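(* Let $\mathbf{s}$ be a seed whose associated quiver $Q$ is acyclic, let $\mathbf{s}'\in\mathbb{T}_n$, and let $c_{i;\mathbf{s}'}$ be the $i$-th column of the $\mathbf{c}$-matrix $C_{\mathbf{s}'}^{-B_Q^T}$. Suppose $c_{i;\mathbf{s}'}$ is a positive $\mathbf{c}$-vector. Let $X$ be the indecomposable rigid $kQ$-module such that $c_{i;\mathbf{s}'}^T=\underline{\dim}\,X$. Then the vector $\sum_{X_j\in\overrightarrow{\mathrm{mesh}}_X}\mathbf{g}_P^{X_j}$ is normal to the hyperplane $c_{i;\mathbf{s}'}^TB_Q\beta_{\mathbf{s}}=0$.
   Context: $k$ is an algebraically closed field of characteristic $0$. $N\cong\mathbb{Z}^n$ is a lattice with a skew-symmetric form $\{\cdot,\cdot\}:N\times N\to\mathbb{Z}$, $M=\mathrm{Hom}(N,\mathbb{Z})$, and $\mathbf{s}=(e_1,\dots,e_n)$ is a seed, i.e. a basis of $N$, with dual basis $(e_i^* )$ of $M$. $B_Q=B_{\mathbf{s}}=(b_{ij})$ with $b_{ij}=\{e_j,e_i\}$, which is skew-symmetric; its quiver $Q$ has vertices $1,\dots,n$ and $b_{ij}=\#\{\text{arrows } i\to j\}-\#\{\text{arrows } j\to i\}$, and is assumed acyclic. For $\beta\in N_{\mathbb{R}}=N\otimes\mathbb{R}$, $\beta_{\mathbf{s}}$ is its column vector of coordinates in the basis $(e_i)$. The hyperplane in question is $\{\beta\in N_{\mathbb{R}}\mid c_{i;\mathbf{s}'}^TB_Q\beta_{\mathbf{s}}=0\}$,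 and a vector $v$ of $M$ (a column vector in the basis $(e_i^* )$) is normal to it if $v^T\beta_{\mathbf{s}}=0$ for all $\beta$ in it. $\mathbb{T}_n$ is the $n$-regular tree with edges labelled by $1,\dots,n$ (distinct labels at each vertex), with root $\mathbf{s}$; its vertices are identified with the seeds obtained from $\mathbf{s}$ by iterated mutation. The $\mathbf{c}$-matrix $C_{\mathbf{s}'}^{-B_Q^T}$ is the lower $n\times n$ block of the matrix obtained from the $2n\times n$ matrix $\binom{-B_Q^T}{\mathrm{Id}_n}$ by Fomin–Zelevinsky matrix mutations along the path from $\mathbf{s}$ to $\mathbf{s}'$ (note $-B_Q^T=B_Q$). Its columns are the $\mathbf{c}$-vectors; each is non-zero with all entries non-negative (positive) or all entries non-positive (negative). It is known that the positive $\mathbf{c}$-vectors are exactly the transposes of dimension vectors of indecomposable rigid $kQ$-modules (rigid: $\mathrm{Ext}^1_{kQ}(X,X)=0$), the module being determined up to isomorphism by its dimension vector. $\mathrm{mod}\,kQ$ is the category of finite-dimensional right $kQ$-modules, with conventions such that $\dim_k\mathrm{Ext}^1_{kQ}(S_i,S_j)$ equals the number of arrows from $j$ to $i$ in $Q$ (paths composed like functions). $S_i$, $P_i$ are the simple and indecomposable projective modules at $i$. $D^b_{kQ}$ is the bounded derived category, modules being stalk complexes in degree $0$. If $[X]=\sum_i d_i[S_i]$ in $K_0(D^b_{kQ})$ then $\underline{\dim}\,X=(d_1,\dots,d_n)$ (row vector). If the image of $X$ under the canonical equivalence $D^b_{kQ}\to\mathsf{K}^{\mathrm b}(\mathrm{proj}\,kQ)$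 (homotopy category of bounded complexes of finitely generated projectives) has class $\sum_i g_i[P_i]$ in $K_0(\mathsf{K}^{\mathrm b}(\mathrm{proj}\,kQ))$, then $\mathbf{g}_P^X=(g_1,\dots,g_n)^T\in M$ (here $P=P_1\oplus\dots\oplus P_n$). For an indecomposable $X$ in $D^b_{kQ}$ there is an Auslander–Reiten triangle $X\to X_1\oplus\dots\oplus X_r\to\tau^{-1}X\to X[1]$ in $D^b_{kQ}$ with $X_j$ indecomposable and $\tau$ the Auslander–Reiten translation; $X_j\in\overrightarrow{\mathrm{mesh}}_X$ means $X_j$ is one of these indecomposable summands of the middle term, and sums count them with multiplicity. *)

theory Defs
  imports
    "HOL-Analysis.Analysis"
    "HOL-Algebra.Free_Abelian_Groups"
    "HOL-Computational_Algebra.Polynomial"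
    "Jordan_Normal_Form.Matrix"
begin

(* Keep the vector index and inner product notation of HOL-Analysis unambiguous. *)
no_notation Matrix.vec_index (infixl "$" 100)
no_notation Matrix.scalar_prod (infix "\<bullet>" 70)

section \<open>Seeds, matrix mutation and c-vectors\<close>

text \<open>
  The index set of a seed is a finite type \<open>'n\<close>.  The lattice is \<open>N = int ^ 'n\<close> inside
  \<open>N\<^sub>R = real ^ 'n\<close>; a seed is an arbitrary basis of it.
\<close>

definition skew_form :: "(int ^ 'n \<Rightarrow> int ^ 'n \<Rightarrow> int) \<Rightarrow> bool" where
  "skew_form \<omega> \<longleftrightarrow>
     (\<forall>x y z. \<omega> (x + y) z = \<omega> x z + \<omega> y z) \<and>
     (\<forall>x y z. \<omega> x (y + z) = \<omega> x y + \<omega> x z) \<and>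
     (\<forall>x y. \<omega> x y = - \<omega> y x)"

definition is_seed :: "('n::finite \<Rightarrow> int ^ 'n) \<Rightarrow> bool" where
  "is_seed e \<longleftrightarrow> (\<forall>x. \<exists>!c :: int ^ 'n. x = (\<Sum>i\<in>UNIV. (c $ i) *s e i))"

definition exchange_matrix ::
  "(int ^ 'n \<Rightarrow> int ^ 'n \<Rightarrow> int) \<Rightarrow> ('n::finite \<Rightarrow> int ^ 'n) \<Rightarrow> int ^ 'n ^ 'n" where
  "exchange_matrix \<omega> e = (\<chi> i j. \<omega> (e j) (e i))"

text \<open>
  Fomin-Zelevinsky mutation in direction \<open>k\<close> of a \<open>2n \<times> n\<close> matrix; the rows \<open>Inl i\<close> form the
  upper (exchange) block and the rows \<open>Inr i\<close> the lower (coefficient) block.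
\<close>

definition mutate ::
  "'n \<Rightarrow> int ^ ('n::finite) ^ ('n + 'n) \<Rightarrow> int ^ 'n ^ ('n + 'n)" where
  "mutate k A = (\<chi> r j.
     if r = Inl k \<or> j = k then - (A $ r $ j)
     else A $ r $ j + sgn (A $ r $ k) * max 0 (A $ r $ k * A $ Inl k $ j))"

text \<open>
  A vertex of the \<open>n\<close>-regular tree is given by the sequence of labels on the unique path
  without backtracking from the root to it.
\<close>

definition tree_vertices :: "'n list set" where
  "tree_vertices = {w. distinct_adj w}"

definition extended_matrix :: "int ^ 'n ^ 'n \<Rightarrow> int ^ ('n::finite) ^ ('n + 'n)" where
  "extended_matrix B =
     (\<chi> r j. case r of Inl i \<Rightarrow> B $ i $ j | Inr i \<Rightarrow> if i = j then 1 else 0)"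

definition c_matrix :: "int ^ 'n ^ 'n \<Rightarrow> ('n::finite) list \<Rightarrow> int ^ 'n ^ 'n" where
  "c_matrix B w =
     (let A = foldl (\<lambda>A k. mutate k A) (extended_matrix B) w in \<chi> i j. A $ Inr i $ j)"

definition c_vector :: "int ^ 'n ^ 'n \<Rightarrow> ('n::finite) list \<Rightarrow> 'n \<Rightarrow> int ^ 'n" where
  "c_vector B w i = column i (c_matrix B w)"

definition positive_vector :: "int ^ 'n \<Rightarrow> bool" where
  "positive_vector c \<longleftrightarrow> c \<noteq> 0 \<and> (\<forall>j. 0 \<le> c $ j)"

definition real_vec :: "int ^ 'n \<Rightarrow> real ^ 'n" where
  "real_vec c = (\<chi> j. real_of_int (c $ j))"

definition coords :: "('n::finite \<Rightarrow> int ^ 'n) \<Rightarrow> real ^ 'n \<Rightarrow> real ^ 'n" where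
  "coords e \<beta> = (THE x. \<beta> = (\<Sum>i\<in>UNIV. (x $ i) *\<^sub>R real_vec (e i)))"

definition c_hyperplane ::
  "('n::finite \<Rightarrow> int ^ 'n) \<Rightarrow> int ^ 'n ^ 'n \<Rightarrow> int ^ 'n \<Rightarrow> (real ^ 'n) set" where
  "c_hyperplane e B c = {\<beta>. real_vec (c v* B) \<bullet> coords e \<beta> = 0}"

text \<open>The vector \<open>v\<close> of the dual lattice is given by its coordinates in the dual basis.\<close>

definition normal_to :: "('n::finite \<Rightarrow> int ^ 'n) \<Rightarrow> int ^ 'n \<Rightarrow> (real ^ 'n) set \<Rightarrow> bool" where
  "normal_to e v H \<longleftrightarrow> (\<forall>\<beta>\<in>H. real_vec v \<bullet> coords e \<beta> = 0)"


section \<open>Quivers and path algebras\<close>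

text \<open>
  A quiver is given by its numbers of arrows; the arrows from \<open>i\<close> to \<open>j\<close> are the triples
  \<open>(i, j, m)\<close> with \<open>m < Q i j\<close>.
\<close>

type_synonym 'n quiver = "'n \<Rightarrow> 'n \<Rightarrow> nat"
type_synonym 'n arrow = "'n \<times> 'n \<times> nat"

definition quiver_of :: "int ^ 'n ^ 'n \<Rightarrow> 'n::finite quiver" where
  "quiver_of B = (\<lambda>i j. nat (B $ i $ j))"

definition acyclic_quiver :: "'n quiver \<Rightarrow> bool" where
  "acyclic_quiver Q \<longleftrightarrow> acyclic {(i, j). 0 < Q i j}"

definition is_arrow :: "'n quiver \<Rightarrow> 'n arrow \<Rightarrow> bool" where
  "is_arrow Q a = (case a of (i, j, m) \<Rightarrow> m < Q i j)"

definition source :: "'n arrow \<Rightarrow> 'n" where "source a = fst a"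
definition target :: "'n arrow \<Rightarrow> 'n" where "target a = fst (snd a)"

text \<open>
  A path is its starting vertex together with its arrows in the order of traversal.  Paths
  compose like functions: \<open>path_comp p q\<close> is first \<open>q\<close>, then \<open>p\<close>.
\<close>

type_synonym 'n path = "'n \<times> 'n arrow list"

fun is_walk :: "'n quiver \<Rightarrow> 'n \<Rightarrow> 'n arrow list \<Rightarrow> bool" where
  "is_walk Q i [] = True"
| "is_walk Q i (a # as) = (is_arrow Q a \<and> source a = i \<and> is_walk Q (target a) as)"

definition paths :: "'n quiver \<Rightarrow> 'n path set" where
  "paths Q = {p. is_walk Q (fst p) (snd p)}"

definition path_source :: "'n path \<Rightarrow> 'n" where "path_source p = fst p"
definition path_target :: "'n path \<Rightarrow> 'n" where
  "path_target p = (if snd p = [] then fst p else target (last (snd p)))"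

definition path_comp :: "'n path \<Rightarrow> 'n path \<Rightarrow> 'n path" where
  "path_comp p q = (fst q, snd q @ snd p)"

type_synonym ('n, 'k) path_alg = "'n path \<Rightarrow>\<^sub>0 'k"

definition kQ :: "'n quiver \<Rightarrow> ('n, 'k::field) path_alg set" where
  "kQ Q = {x. Poly_Mapping.keys x \<subseteq> paths Q}"

definition kQ_one :: "('n::finite, 'k::field) path_alg" where
  "kQ_one = (\<Sum>i\<in>UNIV. Poly_Mapping.single (i, []) 1)"

definition kQ_smult :: "'k::field \<Rightarrow> ('n, 'k) path_alg \<Rightarrow> ('n, 'k) path_alg" where
  "kQ_smult c x = Poly_Mapping.map ((*) c) x"

definition kQ_mult ::
  "('n, 'k::field) path_alg \<Rightarrow> ('n, 'k) path_alg \<Rightarrow> ('n, 'k) path_alg" where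
  "kQ_mult x y =
     (\<Sum>p\<in>Poly_Mapping.keys x. \<Sum>q\<in>Poly_Mapping.keys y.
        if path_target q = path_source p
        then Poly_Mapping.single (path_comp p q)
               (Poly_Mapping.lookup x p * Poly_Mapping.lookup y q)
        else 0)"


section \<open>Finite-dimensional right modules\<close>

text \<open>
  A finite-dimensional right module is a right module structure on some \<open>k\<^sup>m\<close> (column vectors),
  with \<open>act M a\<close> the matrix of \<open>v \<mapsto> v \<cdot> a\<close>; hence \<open>act M\<close> reverses products.  Every
  finite-dimensional right module is isomorphic to one of these.
\<close>

record (overloaded) ('n, 'k) rmod =
  mdim :: nat
  act :: "('n, 'k) path_alg \<Rightarrow> 'k Matrix.mat"

definition is_mod :: "'n quiver \<Rightarrow> ('n::finite, 'k::field) rmod \<Rightarrow> bool" where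
  "is_mod Q M \<longleftrightarrow>
     (\<forall>x\<in>kQ Q. act M x \<in> carrier_mat (mdim M) (mdim M)) \<and>
     (\<forall>x\<in>kQ Q. \<forall>y\<in>kQ Q. act M (x + y) = act M x + act M y) \<and>
     (\<forall>c. \<forall>x\<in>kQ Q. act M (kQ_smult c x) = c \<cdot>\<^sub>m act M x) \<and>
     (\<forall>x\<in>kQ Q. \<forall>y\<in>kQ Q. act M (kQ_mult x y) = act M y * act M x) \<and>
     act M kQ_one = 1\<^sub>m (mdim M)"

definition mod_hom ::
  "'n quiver \<Rightarrow> ('n::finite, 'k::field) rmod \<Rightarrow> ('n, 'k) rmod \<Rightarrow> 'k Matrix.mat set" where
  "mod_hom Q M N =
     {F \<in> carrier_mat (mdim N) (mdim M). \<forall>x\<in>kQ Q. F * act M x = act N x * F}"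

definition zero_mod :: "('n, 'k::field) rmod" where
  "zero_mod = \<lparr>mdim = 0, act = (\<lambda>x. 0\<^sub>m 0 0)\<rparr>"

definition sum_mod :: "('n, 'k::field) rmod \<Rightarrow> ('n, 'k) rmod \<Rightarrow> ('n, 'k) rmod" where
  "sum_mod M N =
     \<lparr>mdim = mdim M + mdim N,
      act = (\<lambda>x. four_block_mat (act M x) (0\<^sub>m (mdim M) (mdim N))
                                 (0\<^sub>m (mdim N) (mdim M)) (act N x))\<rparr>"

definition mod_iso :: "'n quiver \<Rightarrow> ('n::finite, 'k::field) rmod \<Rightarrow> ('n, 'k) rmod \<Rightarrow> bool" where
  "mod_iso Q M N \<longleftrightarrow>
     (\<exists>F\<in>mod_hom Q M N. \<exists>G\<in>mod_hom Q N M. G * F = 1\<^sub>m (mdim M) \<and> F * G = 1\<^sub>m (mdim N))"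

definition indecomposable_mod :: "'n quiver \<Rightarrow> ('n::finite, 'k::field) rmod \<Rightarrow> bool" where
  "indecomposable_mod Q M \<longleftrightarrow>
     is_mod Q M \<and> mdim M \<noteq> 0 \<and>
     (\<forall>A B. is_mod Q A \<and> is_mod Q B \<and> mod_iso Q M (sum_mod A B) \<longrightarrow> mdim A = 0 \<or> mdim B = 0)"

definition short_exact ::
  "'n quiver \<Rightarrow> ('n::finite, 'k::field) rmod \<Rightarrow> 'k Matrix.mat \<Rightarrow> ('n, 'k) rmod \<Rightarrow>
   'k Matrix.mat \<Rightarrow> ('n, 'k) rmod \<Rightarrow> bool" where
  "short_exact Q M F E G N \<longleftrightarrow>
     is_mod Q M \<and> is_mod Q E \<and> is_mod Q N \<and> F \<in> mod_hom Q M E \<and> G \<in> mod_hom Q E N \<and>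
     inj_on (\<lambda>v. F *\<^sub>v v) (carrier_vec (mdim M)) \<and>
     (\<lambda>v. F *\<^sub>v v) ` carrier_vec (mdim M) =
       {v \<in> carrier_vec (mdim E). G *\<^sub>v v = 0\<^sub>v (mdim N)} \<and>
     (\<lambda>v. G *\<^sub>v v) ` carrier_vec (mdim E) = carrier_vec (mdim N)"

text \<open>Vanishing of the Yoneda extension group of \<open>N\<close> by \<open>M\<close>.\<close>

definition Ext1_zero :: "'n quiver \<Rightarrow> ('n::finite, 'k::field) rmod \<Rightarrow> ('n, 'k) rmod \<Rightarrow> bool" where
  "Ext1_zero Q N M \<longleftrightarrow>
     (\<forall>F E G. short_exact Q M F E G N \<longrightarrow> (\<exists>H\<in>mod_hom Q N E. G * H = 1\<^sub>m (mdim N)))"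

definition rigid_mod :: "'n quiver \<Rightarrow> ('n::finite, 'k::field) rmod \<Rightarrow> bool" where
  "rigid_mod Q M \<longleftrightarrow> is_mod Q M \<and> Ext1_zero Q M M"

definition projective_mod :: "'n quiver \<Rightarrow> ('n::finite, 'k::field) rmod \<Rightarrow> bool" where
  "projective_mod Q P \<longleftrightarrow>
     is_mod Q P \<and>
     (\<forall>M N. \<forall>G\<in>mod_hom Q M N. \<forall>H\<in>mod_hom Q P N.
        is_mod Q M \<and> is_mod Q N \<and>
        (\<lambda>v. G *\<^sub>v v) ` carrier_vec (mdim M) = carrier_vec (mdim N) \<longrightarrow>
        (\<exists>H'\<in>mod_hom Q P M. G * H' = H))"

definition simple_mod :: "'n \<Rightarrow> ('n, 'k::field) rmod" where
  "simple_mod i =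
     \<lparr>mdim = 1, act = (\<lambda>x. Matrix.mat 1 1 (\<lambda>_. Poly_Mapping.lookup x (i, [])))\<rparr>"

text \<open>
  The right ideal \<open>e\<^sub>i kQ\<close>, whose basis consists of the paths ending in \<open>i\<close>; there are finitely
  many of them if the quiver is acyclic, and we choose an enumeration.
\<close>

definition path_list :: "'n quiver \<Rightarrow> 'n \<Rightarrow> 'n path list" where
  "path_list Q i = (SOME ps. distinct ps \<and> set ps = {p \<in> paths Q. path_target p = i})"

definition proj_mod :: "'n quiver \<Rightarrow> 'n \<Rightarrow> ('n, 'k::field) rmod" where
  "proj_mod Q i =
     (let ps = path_list Q i in
      \<lparr>mdim = length ps,
       act = (\<lambda>x. Matrix.mat (length ps) (length ps) (\<lambda>(r, c).
         Poly_Mapping.lookup (kQ_mult (Poly_Mapping.single (ps ! c) 1) x) (ps ! r)))\<rparr>)"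


section \<open>Complexes\<close>

record (overloaded) ('n, 'k) cpx =
  ob :: "int \<Rightarrow> ('n, 'k) rmod"
  diff :: "int \<Rightarrow> 'k Matrix.mat"

abbreviation cdim :: "('n, 'k) cpx \<Rightarrow> int \<Rightarrow> nat" where
  "cdim X n \<equiv> mdim (ob X n)"

definition bounded_cpx :: "'n quiver \<Rightarrow> ('n::finite, 'k::field) cpx \<Rightarrow> bool" where
  "bounded_cpx Q X \<longleftrightarrow>
     (\<forall>n. is_mod Q (ob X n)) \<and>
     (\<forall>n. diff X n \<in> mod_hom Q (ob X n) (ob X (n + 1))) \<and>
     (\<forall>n. diff X (n + 1) * diff X n = 0\<^sub>m (cdim X (n + 2)) (cdim X n)) \<and>
     finite {n. cdim X n \<noteq> 0}"

definition chain_map ::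
  "'n quiver \<Rightarrow> ('n::finite, 'k::field) cpx \<Rightarrow> ('n, 'k) cpx \<Rightarrow> (int \<Rightarrow> 'k Matrix.mat) set" where
  "chain_map Q X Y =
     {f. \<forall>n. f n \<in> mod_hom Q (ob X n) (ob Y n) \<and> diff Y n * f n = f (n + 1) * diff X n}"

definition chain_comp ::
  "(int \<Rightarrow> 'k::field Matrix.mat) \<Rightarrow> (int \<Rightarrow> 'k Matrix.mat) \<Rightarrow> int \<Rightarrow> 'k Matrix.mat" where
  "chain_comp g f = (\<lambda>n. g n * f n)"

definition chain_id :: "('n, 'k::field) cpx \<Rightarrow> int \<Rightarrow> 'k Matrix.mat" where
  "chain_id X = (\<lambda>n. 1\<^sub>m (cdim X n))"

definition chain_zero :: "('n, 'k::field) cpx \<Rightarrow> ('n, 'k) cpx \<Rightarrow> int \<Rightarrow> 'k Matrix.mat" where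
  "chain_zero X Y = (\<lambda>n. 0\<^sub>m (cdim Y n) (cdim X n))"

definition homotopy_rel ::
  "'n quiver \<Rightarrow> ('n::finite, 'k::field) cpx \<Rightarrow> ('n, 'k) cpx \<Rightarrow>
   ((int \<Rightarrow> 'k Matrix.mat) \<times> (int \<Rightarrow> 'k Matrix.mat)) set" where
  "homotopy_rel Q X Y =
     {(f, g). f \<in> chain_map Q X Y \<and> g \<in> chain_map Q X Y \<and>
        (\<exists>h. \<forall>n. h n \<in> mod_hom Q (ob X n) (ob Y (n - 1)) \<and>
                 f n - g n = diff Y (n - 1) * h n + h (n + 1) * diff X n)}"

definition cocycles :: "('n, 'k::field) cpx \<Rightarrow> int \<Rightarrow> 'k Matrix.vec set" where
  "cocycles X n = {v \<in> carrier_vec (cdim X n). diff X n *\<^sub>v v = 0\<^sub>v (cdim X (n + 1))}"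

definition coboundaries :: "('n, 'k::field) cpx \<Rightarrow> int \<Rightarrow> 'k Matrix.vec set" where
  "coboundaries X n = (\<lambda>v. diff X (n - 1) *\<^sub>v v) ` carrier_vec (cdim X (n - 1))"

text \<open>
  The two clauses say that the induced map on \<open>n\<close>-th cohomology, cocycles modulo coboundaries,
  is injective and surjective, respectively.
\<close>

definition quasi_iso ::
  "'n quiver \<Rightarrow> ('n::finite, 'k::field) cpx \<Rightarrow> ('n, 'k) cpx \<Rightarrow> (int \<Rightarrow> 'k Matrix.mat) \<Rightarrow> bool" where
  "quasi_iso Q X Y f \<longleftrightarrow>
     f \<in> chain_map Q X Y \<and>
     (\<forall>n. \<forall>v\<in>cocycles X n. f n *\<^sub>v v \<in> coboundaries Y n \<longrightarrow> v \<in> coboundaries X n) \<and>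
     (\<forall>n. \<forall>w\<in>cocycles Y n. \<exists>v\<in>cocycles X n. \<exists>u\<in>coboundaries Y n. w = f n *\<^sub>v v + u)"

definition zero_cpx :: "('n, 'k::field) cpx" where
  "zero_cpx = \<lparr>ob = (\<lambda>n. zero_mod), diff = (\<lambda>n. 0\<^sub>m 0 0)\<rparr>"

definition sum_cpx :: "('n, 'k::field) cpx \<Rightarrow> ('n, 'k) cpx \<Rightarrow> ('n, 'k) cpx" where
  "sum_cpx X Y =
     \<lparr>ob = (\<lambda>n. sum_mod (ob X n) (ob Y n)),
      diff = (\<lambda>n. four_block_mat (diff X n) (0\<^sub>m (cdim X (n + 1)) (cdim Y n))
                                  (0\<^sub>m (cdim Y (n + 1)) (cdim X n)) (diff Y n))\<rparr>"

definition stalk :: "('n, 'k::field) rmod \<Rightarrow> ('n, 'k) cpx" where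
  "stalk M =
     \<lparr>ob = (\<lambda>n. if n = 0 then M else zero_mod),
      diff = (\<lambda>n. 0\<^sub>m (if n = - 1 then mdim M else 0) (if n = 0 then mdim M else 0))\<rparr>"

definition shift :: "('n, 'k::field) cpx \<Rightarrow> ('n, 'k) cpx" where
  "shift X = \<lparr>ob = (\<lambda>n. ob X (n + 1)), diff = (\<lambda>n. - diff X (n + 1))\<rparr>"

definition chain_shift :: "(int \<Rightarrow> 'k Matrix.mat) \<Rightarrow> int \<Rightarrow> 'k Matrix.mat" where
  "chain_shift f = (\<lambda>n. f (n + 1))"

definition cone ::
  "('n, 'k::field) cpx \<Rightarrow> ('n, 'k) cpx \<Rightarrow> (int \<Rightarrow> 'k Matrix.mat) \<Rightarrow> ('n, 'k) cpx" where
  "cone X Y f =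
     \<lparr>ob = (\<lambda>n. sum_mod (ob X (n + 1)) (ob Y n)),
      diff = (\<lambda>n. four_block_mat (- diff X (n + 1)) (0\<^sub>m (cdim X (n + 2)) (cdim Y n))
                                  (f (n + 1)) (diff Y n))\<rparr>"

definition cone_in :: "('n, 'k::field) cpx \<Rightarrow> ('n, 'k) cpx \<Rightarrow> int \<Rightarrow> 'k Matrix.mat" where
  "cone_in X Y = (\<lambda>n. 0\<^sub>m (cdim X (n + 1)) (cdim Y n) @\<^sub>r 1\<^sub>m (cdim Y n))"

definition cone_out :: "('n, 'k::field) cpx \<Rightarrow> ('n, 'k) cpx \<Rightarrow> int \<Rightarrow> 'k Matrix.mat" where
  "cone_out X Y = (\<lambda>n. four_block_mat (1\<^sub>m (cdim X (n + 1))) (0\<^sub>m (cdim X (n + 1)) (cdim Y n))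
                                       (0\<^sub>m 0 (cdim X (n + 1))) (0\<^sub>m 0 (cdim Y n)))"


section \<open>Categories with shift and triangles\<close>

text \<open>
  The data of a triangulated category: objects, morphism sets, composition
  (\<open>Cmp T X Y Z g f\<close> is \<open>g\<close> after \<open>f\<close> for \<open>f : X \<rightarrow> Y\<close>, \<open>g : Y \<rightarrow> Z\<close>), identities, zero morphisms,
  binary direct sums, the zero object, shift on objects and morphisms, and the set of standard
  triangles \<open>X \<rightarrow> Y \<rightarrow> Z \<rightarrow> X[1]\<close>.
\<close>

record ('o, 'm) tricat =
  Obj :: "'o set"
  Mor :: "'o \<Rightarrow> 'o \<Rightarrow> 'm set"
  Cmp :: "'o \<Rightarrow> 'o \<Rightarrow> 'o \<Rightarrow> 'm \<Rightarrow> 'm \<Rightarrow> 'm"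
  Ide :: "'o \<Rightarrow> 'm"
  Zer :: "'o \<Rightarrow> 'o \<Rightarrow> 'm"
  Dsum :: "'o \<Rightarrow> 'o \<Rightarrow> 'o"
  Null :: 'o
  Sh :: "'o \<Rightarrow> 'o"
  ShM :: "'o \<Rightarrow> 'o \<Rightarrow> 'm \<Rightarrow> 'm"
  Std :: "('o \<times> 'o \<times> 'o \<times> 'm \<times> 'm \<times> 'm) set"

definition is_iso :: "('o, 'm) tricat \<Rightarrow> 'o \<Rightarrow> 'o \<Rightarrow> 'm \<Rightarrow> bool" where
  "is_iso T X Y f \<longleftrightarrow>
     f \<in> Mor T X Y \<and>
     (\<exists>g\<in>Mor T Y X. Cmp T X Y X g f = Ide T X \<and> Cmp T Y X Y f g = Ide T Y)"

definition isomorphic :: "('o, 'm) tricat \<Rightarrow> 'o \<Rightarrow> 'o \<Rightarrow> bool" where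
  "isomorphic T X Y \<longleftrightarrow> X \<in> Obj T \<and> Y \<in> Obj T \<and> (\<exists>f. is_iso T X Y f)"

definition indecomposable :: "('o, 'm) tricat \<Rightarrow> 'o \<Rightarrow> bool" where
  "indecomposable T X \<longleftrightarrow>
     X \<in> Obj T \<and> \<not> isomorphic T X (Null T) \<and>
     (\<forall>A\<in>Obj T. \<forall>B\<in>Obj T. isomorphic T X (Dsum T A B) \<longrightarrow>
        isomorphic T A (Null T) \<or> isomorphic T B (Null T))"

definition retraction :: "('o, 'm) tricat \<Rightarrow> 'o \<Rightarrow> 'o \<Rightarrow> 'm \<Rightarrow> bool" where
  "retraction T X Y f \<longleftrightarrow>
     f \<in> Mor T X Y \<and> (\<exists>s\<in>Mor T Y X. Cmp T Y X Y f s = Ide T Y)"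

definition sum_objs :: "('o, 'm) tricat \<Rightarrow> 'o list \<Rightarrow> 'o" where
  "sum_objs T Xs = foldr (Dsum T) Xs (Null T)"

text \<open>The distinguished triangles are those isomorphic to a standard triangle.\<close>

definition distinguished ::
  "('o, 'm) tricat \<Rightarrow> 'o \<Rightarrow> 'o \<Rightarrow> 'o \<Rightarrow> 'm \<Rightarrow> 'm \<Rightarrow> 'm \<Rightarrow> bool" where
  "distinguished T X Y Z u v w \<longleftrightarrow>
     X \<in> Obj T \<and> Y \<in> Obj T \<and> Z \<in> Obj T \<and>
     u \<in> Mor T X Y \<and> v \<in> Mor T Y Z \<and> w \<in> Mor T Z (Sh T X) \<and>
     (\<exists>X' Y' Z' u' v' w' a b c.
        (X', Y', Z', u', v', w') \<in> Std T \<and>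
        is_iso T X X' a \<and> is_iso T Y Y' b \<and> is_iso T Z Z' c \<and>
        Cmp T X Y Y' b u = Cmp T X X' Y' u' a \<and>
        Cmp T Y Z Z' c v = Cmp T Y Y' Z' v' b \<and>
        Cmp T Z (Sh T X) (Sh T X') (ShM T X X' a) w = Cmp T Z Z' (Sh T X') w' c)"

text \<open>
  Auslander-Reiten triangles in the sense of Happel.  The third object is the inverse
  Auslander-Reiten translate of \<open>X\<close>.
\<close>

definition AR_triangle ::
  "('o, 'm) tricat \<Rightarrow> 'o \<Rightarrow> 'o \<Rightarrow> 'o \<Rightarrow> 'm \<Rightarrow> 'm \<Rightarrow> 'm \<Rightarrow> bool" where
  "AR_triangle T X Y Z u v w \<longleftrightarrow>
     distinguished T X Y Z u v w \<and> indecomposable T X \<and> indecomposable T Z \<and>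
     w \<noteq> Zer T Z (Sh T X) \<and>
     (\<forall>W\<in>Obj T. \<forall>f\<in>Mor T W Z. \<not> retraction T W Z f \<longrightarrow>
        (\<exists>f'\<in>Mor T W Y. Cmp T W Y Z v f' = f))"

text \<open>
  \<open>Xs\<close> lists, with multiplicity, the indecomposable summands of the middle term of the
  Auslander-Reiten triangle starting in \<open>X\<close>.
\<close>

definition is_mesh :: "('o, 'm) tricat \<Rightarrow> 'o \<Rightarrow> 'o list \<Rightarrow> bool" where
  "is_mesh T X Xs \<longleftrightarrow>
     (\<forall>Y\<in>set Xs. indecomposable T Y) \<and>
     (\<exists>Z u v w. AR_triangle T X (sum_objs T Xs) Z u v w)"

definition K0_relations :: "('o, 'm) tricat \<Rightarrow> ('o \<Rightarrow>\<^sub>0 int) set" where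
  "K0_relations T =
     generate (free_Abelian_group (Obj T))
       {frag_of Y - frag_of X - frag_of Z | X Y Z. \<exists>u v w. distinguished T X Y Z u v w}"

definition K0 :: "('o, 'm) tricat \<Rightarrow> ('o \<Rightarrow>\<^sub>0 int) set monoid" where
  "K0 T = free_Abelian_group (Obj T) Mod K0_relations T"

text \<open>The element of \<open>K0 T\<close> represented by a formal integer combination of objects.\<close>

definition K0_class :: "('o, 'm) tricat \<Rightarrow> ('o \<Rightarrow>\<^sub>0 int) \<Rightarrow> ('o \<Rightarrow>\<^sub>0 int) set" where
  "K0_class T a = K0_relations T #>\<^bsub>free_Abelian_group (Obj T)\<^esub> a"


section \<open>The homotopy category of projectives and the bounded derived category\<close>

definition Kb_map ::
  "'n quiver \<Rightarrow> ('n::finite, 'k::field) cpx \<Rightarrow> ('n, 'k) cpx \<Rightarrow> (int \<Rightarrow> 'k Matrix.mat) \<Rightarrow>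
   (int \<Rightarrow> 'k Matrix.mat) set" where
  "Kb_map Q X Y f = homotopy_rel Q X Y `` {f}"

definition Kb_proj ::
  "'n quiver \<Rightarrow> (('n::finite, 'k::field) cpx, (int \<Rightarrow> 'k Matrix.mat) set) tricat" where
  "Kb_proj Q =
     (let Os = {X. bounded_cpx Q X \<and> (\<forall>n. projective_mod Q (ob X n))} in
     \<lparr>Obj = Os,
      Mor = (\<lambda>X Y. chain_map Q X Y // homotopy_rel Q X Y),
      Cmp = (\<lambda>X Y Z G F. \<Union>g\<in>G. \<Union>f\<in>F. Kb_map Q X Z (chain_comp g f)),
      Ide = (\<lambda>X. Kb_map Q X X (chain_id X)),
      Zer = (\<lambda>X Y. Kb_map Q X Y (chain_zero X Y)),
      Dsum = sum_cpx,
      Null = zero_cpx,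
      Sh = shift,
      ShM = (\<lambda>X Y F. \<Union>f\<in>F. Kb_map Q (shift X) (shift Y) (chain_shift f)),
      Std = {(X, Y, cone X Y f, Kb_map Q X Y f, Kb_map Q Y (cone X Y f) (cone_in X Y),
              Kb_map Q (cone X Y f) (shift X) (cone_out X Y)) | X Y f.
              X \<in> Os \<and> Y \<in> Os \<and> f \<in> chain_map Q X Y}\<rparr>)"

text \<open>
  A morphism \<open>X \<rightarrow> Y\<close> of the derived category is an equivalence class of roofs \<open>(W, s, f)\<close>,
  \<open>X \<leftarrow>s\<midarrow> W \<midarrow>f\<rightarrow> Y\<close> with \<open>s\<close> a quasi-isomorphism.
\<close>

type_synonym ('n, 'k) roof =
  "('n, 'k) cpx \<times> (int \<Rightarrow> 'k Matrix.mat) \<times> (int \<Rightarrow> 'k Matrix.mat)"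

definition roofs ::
  "'n quiver \<Rightarrow> ('n::finite, 'k::field) cpx \<Rightarrow> ('n, 'k) cpx \<Rightarrow> ('n, 'k) roof set" where
  "roofs Q X Y = {(W, s, f). bounded_cpx Q W \<and> quasi_iso Q W X s \<and> f \<in> chain_map Q W Y}"

definition roof_rel ::
  "'n quiver \<Rightarrow> ('n::finite, 'k::field) cpx \<Rightarrow> ('n, 'k) cpx \<Rightarrow>
   (('n, 'k) roof \<times> ('n, 'k) roof) set" where
  "roof_rel Q X Y =
     {((W, s, f), (V, t, g)). (W, s, f) \<in> roofs Q X Y \<and> (V, t, g) \<in> roofs Q X Y \<and>
        (\<exists>U a b. bounded_cpx Q U \<and> a \<in> chain_map Q U W \<and> b \<in> chain_map Q U V \<and>
           quasi_iso Q U X (chain_comp s a) \<and>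
           (chain_comp s a, chain_comp t b) \<in> homotopy_rel Q U X \<and>
           (chain_comp f a, chain_comp g b) \<in> homotopy_rel Q U Y)}"

definition roof_comp ::
  "'n quiver \<Rightarrow> ('n::finite, 'k::field) cpx \<Rightarrow> ('n, 'k) roof \<Rightarrow> ('n, 'k) roof \<Rightarrow>
   ('n, 'k) roof set" where
  "roof_comp Q Y \<psi> \<phi> =
     (case \<phi> of (W, s, f) \<Rightarrow> case \<psi> of (V, t, g) \<Rightarrow>
        {(U, chain_comp s a, chain_comp g b) | U a b.
           bounded_cpx Q U \<and> quasi_iso Q U W a \<and> b \<in> chain_map Q U V \<and>
           (chain_comp f a, chain_comp t b) \<in> homotopy_rel Q U Y})"

definition Db_map ::
  "'n quiver \<Rightarrow> ('n::finite, 'k::field) cpx \<Rightarrow> ('n, 'k) cpx \<Rightarrow> (int \<Rightarrow> 'k Matrix.mat) \<Rightarrow>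
   ('n, 'k) roof set" where
  "Db_map Q X Y f = roof_rel Q X Y `` {(X, chain_id X, f)}"

definition Db ::
  "'n quiver \<Rightarrow> (('n::finite, 'k::field) cpx, ('n, 'k) roof set) tricat" where
  "Db Q =
     \<lparr>Obj = {X. bounded_cpx Q X},
      Mor = (\<lambda>X Y. roofs Q X Y // roof_rel Q X Y),
      Cmp = (\<lambda>X Y Z G F. \<Union>g\<in>G. \<Union>f\<in>F. roof_rel Q X Z `` roof_comp Q Y g f),
      Ide = (\<lambda>X. Db_map Q X X (chain_id X)),
      Zer = (\<lambda>X Y. Db_map Q X Y (chain_zero X Y)),
      Dsum = sum_cpx,
      Null = zero_cpx,
      Sh = shift,
      ShM = (\<lambda>X Y F. roof_rel Q (shift X) (shift Y) ``
               {(shift W, chain_shift s, chain_shift f) | W s f. (W, s, f) \<in> F}),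
      Std = {(X, Y, cone X Y f, Db_map Q X Y f, Db_map Q Y (cone X Y f) (cone_in X Y),
              Db_map Q (cone X Y f) (shift X) (cone_out X Y)) | X Y f.
              bounded_cpx Q X \<and> bounded_cpx Q Y \<and> f \<in> chain_map Q X Y}\<rparr>"


section \<open>Dimension vectors and g-vectors\<close>

definition dim_vector :: "'n quiver \<Rightarrow> ('n::finite, 'k::field) cpx \<Rightarrow> int ^ 'n" where
  "dim_vector Q X =
     (THE d. K0_class (Db Q) (frag_of X) =
             K0_class (Db Q) (\<Sum>i\<in>UNIV. frag_cmul (d $ i) (frag_of (stalk (simple_mod i)))))"

text \<open>
  The canonical equivalence sends \<open>X\<close> to a bounded complex of projectives \<open>P\<close> which is
  isomorphic to \<open>X\<close> in the derived category; \<open>P\<close> is unique up to homotopy equivalence.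
\<close>

definition g_vector :: "'n quiver \<Rightarrow> ('n::finite, 'k::field) cpx \<Rightarrow> int ^ 'n" where
  "g_vector Q X =
     (THE g. \<exists>P. P \<in> Obj (Kb_proj Q) \<and> isomorphic (Db Q) P X \<and>
        K0_class (Kb_proj Q) (frag_of P) =
        K0_class (Kb_proj Q) (\<Sum>i\<in>UNIV. frag_cmul (g $ i) (frag_of (stalk (proj_mod Q i)))))"

end

theory Submission imports Defs begin

text \<open>
  The vector in question is \<open>c v* B\<close>, the coefficient vector of the hyperplane
  itself. Write \<open>x\<close> for the dimension vector of \<open>X\<close> and \<open>Z =
  \<tau>\<^sup>-\<^sup>1 X\<close> for the third object of the Auslander-Reiten triangle.
  Classes in a Grothendieck group are additive on triangles and on direct sums, so the sum over
  the mesh is the sum of the g-vectors of \<open>X\<close> and of \<open>Z\<close>, and both are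
  to be expressed by \<open>x\<close>.

  For \<open>X\<close>: comparing dimensions at a vertex \<open>l\<close> in a projective
  resolution gives \<open>\<Sum>i. g\<^sub>i(X) * #paths(l,i) = x\<^sub>l\<close>. The path
  matrix has the inverse \<open>1 - (number of arrows)\<close>, because a nontrivial path has a
  first arrow; so \<open>g\<^sub>s(X) = x\<^sub>s - (\<Sum>t. #(s \<rightarrow> t) *
  x\<^sub>t)\<close>.

  For \<open>Z\<close> the classical argument uses \<open>\<tau>\<^sup>-\<^sup>1 =
  \<nu>\<^sup>-\<^sup>1[1]\<close> with the Nakayama functor. Here the duality behind it is read
  off from the Auslander-Reiten triangle. Let \<open>S\<close> be a projective resolution of
  \<open>Z[-1]\<close> and \<open>w : S \<rightarrow> X\<close> the connecting morphism; it is
  not zero, and \<open>w p = 0\<close> for every \<open>p\<close> into \<open>S\<close> that is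
  not a retraction. Composition followed by a linear functional that does not vanish on
  \<open>w\<close> is then a nondegenerate pairing between \<open>Hom(S, P\<^sub>j)\<close> and
  \<open>Hom(P\<^sub>j, X)\<close>: a nonzero map out of \<open>S\<close> factors
  \<open>w\<close> because the map from its homotopy fibre is not a retraction
  (\<open>factors\<close>), and \<open>w\<close> factors through each nonzero map
  \<open>P\<^sub>j \<rightarrow> X\<close> because \<open>X\<close> has a local endomorphism
  ring (\<open>factors_from\<close>). The first fact also kills \<open>Hom(S,
  P\<^sub>j[n])\<close> for \<open>n \<noteq> 0\<close>, so the Euler characteristic of the
  complex \<open>Hom(S, P\<^sub>j)\<close> is \<open>dim Hom(P\<^sub>j, X) = x\<^sub>j\<close>,
  whereas it can also be computed from the class of \<open>S\<close> and \<open>dim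
  Hom(P\<^sub>i, P\<^sub>j) = #paths(i,j)\<close>. This gives \<open>\<Sum>i. g\<^sub>i(Z) *
  #paths(i,j) = - x\<^sub>j\<close>, hence \<open>g\<^sub>s(Z) = - x\<^sub>s + (\<Sum>t. #(t
  \<rightarrow> s) * x\<^sub>t)\<close> (\<open>AR_g_vector\<close>,
  \<open>paths_inverse_last\<close>). Adding the two, \<open>x\<^sub>s\<close> cancels and
  \<open>\<Sum>t. (#(t \<rightarrow> s) - #(s \<rightarrow> t)) * x\<^sub>t = \<Sum>t.
  b\<^sub>t\<^sub>s * x\<^sub>t\<close> remains (\<open>mesh_g_vectors\<close>).

  Three devices carry the foundations. Matrices are embedded in one ring of operators, so that
  homological algebra needs no bookkeeping of sizes. A morphism \<open>X \<rightarrow> Y\<close>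
  of the derived category is handled through its action on homotopy classes of maps from
  complexes of projectives to \<open>X\<close>, which determines it (\<open>Mor_eqI\<close>) and
  turns composition of roofs into composition of functions (\<open>Cmp_Db\<close>). The
  Grothendieck groups are evaluated by the Euler characteristic of traces of the vertex
  idempotents, which is invariant under homotopy because traces are cyclic
  (\<open>euler_homotopy_equivalence\<close>); in characteristic \<open>0\<close> such traces
  recover dimensions.
\<close>

section \<open>Matrices as linear operators\<close>

text \<open>
  Matrices of all sizes act on sequences, the entries beyond the size being cut off. Products of
  operators need no size conditions, so that diagram chasing becomes computation in a ring; the
  sizes survive only as the idempotents \<open>en n\<close>.
\<close>

typedef (overloaded) 'k lin_op = "{f :: (nat \<Rightarrow> 'k::field) \<Rightarrow> nat \<Rightarrow> 'k.
    (\<forall>x y. f (\<lambda>i. x i + y i) = (\<lambda>i. f x i + f y i)) \<and>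
    (\<forall>c x. f (\<lambda>i. c * x i) = (\<lambda>i. c * f x i))}"
  morphisms ap Lin_op
  by (rule exI[of _ "\<lambda>x. x"]) simp

setup_lifting type_definition_lin_op

lemma ap_add: "ap f (\<lambda>i. x i + y i) = (\<lambda>i. ap f x i + ap f y i)"
  and ap_scale: "ap f (\<lambda>i. c * x i) = (\<lambda>i. c * ap f x i)"
  using ap[of f] by auto

lemma ap_zero [simp]: "ap f (\<lambda>i. 0) = (\<lambda>i. 0)"
  using ap_scale[of f 0 "\<lambda>i. 0"] by simp

lemma ap_sum: "ap f (\<lambda>i. \<Sum>a\<in>A. x a i) = (\<lambda>i. \<Sum>a\<in>A. ap f (x a) i)"
  by (induction A rule: infinite_finite_induct) (auto simp: ap_add)

lemma lin_op_eqI: "(\<And>x i. ap f x i = ap g x i) \<Longrightarrow> f = g"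
  by (metis ap_inject ext)

instantiation lin_op :: (field) ring_1
begin
lift_definition zero_lin_op :: "'a lin_op" is "\<lambda>x i. 0" by simp
lift_definition one_lin_op :: "'a lin_op" is "\<lambda>x. x" by simp
lift_definition plus_lin_op :: "'a lin_op \<Rightarrow> 'a lin_op \<Rightarrow> 'a lin_op" is "\<lambda>f g x i. f x i + g x i"
  by (auto simp: algebra_simps)
lift_definition minus_lin_op :: "'a lin_op \<Rightarrow> 'a lin_op \<Rightarrow> 'a lin_op" is "\<lambda>f g x i. f x i - g x i"
  by (auto simp: algebra_simps)
lift_definition uminus_lin_op :: "'a lin_op \<Rightarrow> 'a lin_op" is "\<lambda>f x i. - f x i"
  by (auto simp: algebra_simps)
lift_definition times_lin_op :: "'a lin_op \<Rightarrow> 'a lin_op \<Rightarrow> 'a lin_op" is "\<lambda>f g x. f (g x)"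
  by auto
instance
proof
  fix a b c :: "'a lin_op"
  show "a + b + c = a + (b + c)" by transfer (simp add: add.assoc)
  show "a + b = b + a" by transfer (simp add: add.commute)
  show "0 + a = a" by transfer simp
  show "- a + a = 0" by transfer simp
  show "a - b = a + - b" by transfer simp
  show "a * b * c = a * (b * c)" by transfer simp
  show "1 * a = a" by transfer simp
  show "a * 1 = a" by transfer simp
  show "(a + b) * c = a * c + b * c" by transfer simp
  show "a * (b + c) = a * b + a * c" by transfer simp
  show "(0::'a lin_op) \<noteq> 1" by transfer (metis zero_neq_one)
qed
end

lemma ap_simps [simp]:
  "ap 0 x = (\<lambda>i. 0)" "ap 1 x = x" "ap (f + g) x = (\<lambda>i. ap f x i + ap g x i)"
  "ap (f - g) x = (\<lambda>i. ap f x i - ap g x i)" "ap (- f) x = (\<lambda>i. - ap f x i)"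
  "ap (f * g) x = ap f (ap g x)"
  by (transfer; simp)+

lemma ap_sum_op: "ap (\<Sum>a\<in>A. f a) x = (\<lambda>i. \<Sum>a\<in>A. ap (f a) x i)"
  by (induction A rule: infinite_finite_induct) auto

lift_definition scl :: "'k::field \<Rightarrow> 'k lin_op \<Rightarrow> 'k lin_op" is "\<lambda>c f x i. c * f x i"
  by (auto simp: algebra_simps)

lemma ap_scl [simp]: "ap (scl c f) x = (\<lambda>i. c * ap f x i)"
  by transfer simp

lemma scl_vector_space: "vector_space (scl :: 'k::field \<Rightarrow> _)"
  by unfold_locales (auto intro!: lin_op_eqI simp: algebra_simps)

interpretation scl: vector_space "scl :: 'k::field \<Rightarrow> 'k lin_op \<Rightarrow> 'k lin_op"
  by (rule scl_vector_space)

lemma scl_mult_left: "scl c f * g = scl c (f * g)"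
  by (rule lin_op_eqI) simp

lemma scl_mult_right: "f * scl c g = scl c (f * g)"
proof (rule lin_op_eqI)
  fix x i
  show "ap (f * scl c g) x i = ap (scl c (f * g)) x i"
    using ap_scale[of f c "ap g x"] by simp
qed

lift_definition emb :: "'k::field Matrix.mat \<Rightarrow> 'k lin_op" is
  "\<lambda>A x i. if i < dim_row A then \<Sum>j<dim_col A. A $$ (i, j) * x j else 0"
  by (auto simp: algebra_simps sum.distrib sum_distrib_left)

lemma ap_emb: "ap (emb A) x = (\<lambda>i. if i < dim_row A then \<Sum>j<dim_col A. A $$ (i, j) * x j else 0)"
  by (simp add: emb.rep_eq)

definition uv :: "nat \<Rightarrow> nat \<Rightarrow> 'k::field" where "uv j = (\<lambda>i. if i = j then 1 else 0)"

definition vsp :: "nat \<Rightarrow> (nat \<Rightarrow> 'k::field) set" where "vsp n = {x. \<forall>i\<ge>n. x i = 0}"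

definition en :: "nat \<Rightarrow> 'k::field lin_op" where "en n = emb (1\<^sub>m n)"

lemma ap_en: "ap (en n) x = (\<lambda>i. if i < n then x i else 0)"
  by (auto simp: en_def ap_emb one_mat_def if_distrib[of "\<lambda>c. c * _"] cong: if_cong)

lemma vsp_iff: "x \<in> vsp n \<longleftrightarrow> ap (en n) x = x"
  by (auto simp: vsp_def ap_en fun_eq_iff)

lemma vsp_expand: "x \<in> vsp n \<Longrightarrow> x = (\<lambda>i. \<Sum>j<n. x j * uv j i)"
  by (auto simp: vsp_def uv_def fun_eq_iff if_distrib[of "\<lambda>c. _ * c"] cong: if_cong)

lemma ap_expand: "x \<in> vsp n \<Longrightarrow> ap f x i = (\<Sum>j<n. x j * ap f (uv j) i)"
  by (subst vsp_expand) (auto simp: ap_sum ap_scale)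

lemma uv_vsp [simp]: "j < n \<Longrightarrow> uv j \<in> vsp n"
  by (auto simp: uv_def vsp_def)

lemma vsp_closed [simp]: "(\<lambda>i. 0) \<in> vsp n"
  "x \<in> vsp n \<Longrightarrow> y \<in> vsp n \<Longrightarrow> (\<lambda>i. x i + y i) \<in> vsp n"
  "x \<in> vsp n \<Longrightarrow> y \<in> vsp n \<Longrightarrow> (\<lambda>i. x i - y i) \<in> vsp n"
  "x \<in> vsp n \<Longrightarrow> (\<lambda>i. - x i) \<in> vsp n"
  "x \<in> vsp n \<Longrightarrow> (\<lambda>i. c * x i) \<in> vsp n"
  by (auto simp: vsp_def)

lemma en_en [simp]: "en n * en n = en n"
  by (rule lin_op_eqI) (simp add: ap_en)

lemma emb_en: "emb A * en (dim_col A) = emb A" "en (dim_row A) * emb A = emb A"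
  by (auto intro!: lin_op_eqI simp: ap_en ap_emb)

text \<open>
  The Peirce component of the ring that consists of the images of the \<open>n \<times>
  m\<close> matrices; here \<open>mt\<close> inverts \<open>emb\<close>.
\<close>

definition bd :: "nat \<Rightarrow> nat \<Rightarrow> 'k::field lin_op set" where
  "bd n m = {f. en n * f = f \<and> f * en m = f}"

lemma bdD: "f \<in> bd n m \<Longrightarrow> en n * f = f" "f \<in> bd n m \<Longrightarrow> f * en m = f"
  by (auto simp: bd_def)

lemma emb_bd: "A \<in> carrier_mat n m \<Longrightarrow> emb A \<in> bd n m"
  using emb_en[of A] by (auto simp: bd_def)

lemma ap_emb_uv: "A \<in> carrier_mat n m \<Longrightarrow> i < n \<Longrightarrow> j < m \<Longrightarrow> ap (emb A) (uv j) i = A $$ (i, j)"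
  by (auto simp: ap_emb uv_def if_distrib[of "\<lambda>c. _ * c"] cong: if_cong)

lemma emb_inj: "A \<in> carrier_mat n m \<Longrightarrow> C \<in> carrier_mat n m \<Longrightarrow> emb A = emb C \<Longrightarrow> A = C"
  by (rule eq_matI) (auto simp flip: ap_emb_uv)

lemma bd_eqI:
  fixes f g :: "'k::field lin_op"
  assumes "f \<in> bd n m" "g \<in> bd n m" "\<And>i j. i < n \<Longrightarrow> j < m \<Longrightarrow> ap f (uv j) i = ap g (uv j) i"
  shows "f = g"
proof (rule lin_op_eqI)
  fix x :: "nat \<Rightarrow> 'k" and i
  have "ap h x i = (if i < n then \<Sum>j<m. ap (en m) x j * ap h (uv j) i else 0)" if "h \<in> bd n m" for h
  proof -
    have "ap h x i = ap (en n) (ap h (ap (en m) x)) i"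
      using bdD[OF that] by (metis ap_simps(6))
    moreover have "ap (en m) x \<in> vsp m" by (simp add: vsp_def ap_en)
    ultimately show ?thesis using ap_expand[of "ap (en m) x" m h i] by (simp add: ap_en)
  qed
  then show "ap f x i = ap g x i" using assms by simp
qed

definition mt :: "nat \<Rightarrow> nat \<Rightarrow> 'k::field lin_op \<Rightarrow> 'k Matrix.mat" where
  "mt n m f = Matrix.mat n m (\<lambda>(i, j). ap f (uv j) i)"

lemma mt_carrier [simp]: "mt n m f \<in> carrier_mat n m" by (simp add: mt_def)

lemma emb_mt: "f \<in> bd n m \<Longrightarrow> emb (mt n m f) = f"
  by (rule bd_eqI[of _ n m]) (auto simp: emb_bd ap_emb_uv[OF mt_carrier], simp add: mt_def)

lemma emb_mult: "dim_col A = dim_row C \<Longrightarrow> emb (A * C) = emb A * emb C"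
proof (rule bd_eqI[of _ "dim_row A" "dim_col C"])
  assume eq: "dim_col A = dim_row C"
  show "emb A * emb C \<in> bd (dim_row A) (dim_col C)"
    using emb_en[of A] emb_en[of C] by (simp add: bd_def flip: mult.assoc) (simp add: mult.assoc)
  fix i j assume i: "i < dim_row A" and j: "j < dim_col C"
  have "ap (emb C) (uv j) = (\<lambda>i. if i < dim_row C then C $$ (i, j) else 0)"
    using j by (auto simp: ap_emb uv_def if_distrib[of "\<lambda>c. _ * c"] cong: if_cong)
  then show "ap (emb (A * C)) (uv j) i = ap (emb A * emb C) (uv j) i"
    using i j eq by (subst ap_emb_uv[of _ "dim_row A" "dim_col C"])
      (auto simp: ap_emb[of A] scalar_prod_def lessThan_atLeast0)
qed (auto intro!: emb_bd)

lemma emb_plus: "A \<in> carrier_mat n m \<Longrightarrow> C \<in> carrier_mat n m \<Longrightarrow> emb (A + C) = emb A + emb C"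
  and emb_minus: "A \<in> carrier_mat n m \<Longrightarrow> C \<in> carrier_mat n m \<Longrightarrow> emb (A - C) = emb A - emb C"
  by (rule lin_op_eqI, force simp: ap_emb algebra_simps simp flip: sum.distrib sum_subtractf)+

lemma emb_uminus: "emb (- A) = - emb A"
  by (rule lin_op_eqI) (auto simp: ap_emb simp flip: sum_negf)

lemma emb_smult: "emb (c \<cdot>\<^sub>m A) = scl c (emb A)"
  by (rule lin_op_eqI) (auto simp: ap_emb sum_distrib_left algebra_simps)

lemma emb_zero [simp]: "emb (0\<^sub>m n m) = 0"
  by (rule lin_op_eqI) (simp add: ap_emb)

lemma en_0 [simp]: "en 0 = 0"
  by (rule lin_op_eqI) (simp add: ap_en)

lemma bd_0 [simp]: "bd 0 m = {0}" "bd n 0 = {0}"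
  by (auto simp: bd_def)

lemma bd_closed:
  "0 \<in> bd n m" "f \<in> bd n m \<Longrightarrow> g \<in> bd n m \<Longrightarrow> f + g \<in> bd n m"
  "f \<in> bd n m \<Longrightarrow> g \<in> bd n m \<Longrightarrow> f - g \<in> bd n m" "f \<in> bd n m \<Longrightarrow> - f \<in> bd n m"
  "f \<in> bd n m \<Longrightarrow> scl c f \<in> bd n m"
  "h \<in> bd l n \<Longrightarrow> f \<in> bd n m \<Longrightarrow> h * f \<in> bd l m"
  by (auto simp: bd_def algebra_simps scl_mult_left scl_mult_right)
     (metis mult.assoc)+

lemma en_bd: "en n \<in> bd n n" by (simp add: bd_def)

lemma bd_vsp: "f \<in> bd n m \<Longrightarrow> ap f x \<in> vsp n"
  unfolding vsp_iff by (metis ap_simps(6) bdD(1))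

text \<open>Column vectors as sequences.\<close>

definition vf :: "'k::field Matrix.vec \<Rightarrow> nat \<Rightarrow> 'k" where
  "vf v = (\<lambda>i. if i < dim_vec v then vec_index v i else 0)"

lemma vf_vsp: "v \<in> carrier_vec n \<Longrightarrow> vf v \<in> vsp n"
  by (auto simp: vf_def vsp_def)

lemma vf_inj: "v \<in> carrier_vec n \<Longrightarrow> w \<in> carrier_vec n \<Longrightarrow> vf v = vf w \<Longrightarrow> v = w"
  by (rule eq_vecI) (auto simp: vf_def fun_eq_iff split: if_splits)

lemma vf_surj: "x \<in> vsp n \<Longrightarrow> \<exists>v\<in>carrier_vec n. vf v = x"
  by (rule bexI[of _ "Matrix.vec n x"]) (auto simp: vf_def vsp_def)

lemma vf_zero [simp]: "vf (0\<^sub>v n) = (\<lambda>i. 0)"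
  by (auto simp: vf_def)

lemma vf_add: "v \<in> carrier_vec n \<Longrightarrow> w \<in> carrier_vec n \<Longrightarrow> vf (v + w) = (\<lambda>i. vf v i + vf w i)"
  by (auto simp: vf_def)

lemma vf_mult: "v \<in> carrier_vec (dim_col A) \<Longrightarrow> vf (A *\<^sub>v v) = ap (emb A) (vf v)"
  by (auto simp: vf_def ap_emb scalar_prod_def lessThan_atLeast0 intro!: sum.cong)

subsection \<open>Blocks\<close>

text \<open>
  Injections and projections of the direct sum of coordinate spaces that underlies block
  matrices. The formulas for \<open>in1\<close> and \<open>pr1\<close> coincide; the two names
  record the direction.
\<close>

definition in1 :: "nat \<Rightarrow> nat \<Rightarrow> 'k::field lin_op" where "in1 a b = en a"
definition pr1 :: "nat \<Rightarrow> nat \<Rightarrow> 'k::field lin_op" where "pr1 a b = en a"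
lift_definition in2 :: "nat \<Rightarrow> nat \<Rightarrow> 'k::field lin_op" is
  "\<lambda>a b x i. if a \<le> i \<and> i < a + b then x (i - a) else 0" by (auto simp: fun_eq_iff)
lift_definition pr2 :: "nat \<Rightarrow> nat \<Rightarrow> 'k::field lin_op" is
  "\<lambda>a b x i. if i < b then x (i + a) else 0" by (auto simp: fun_eq_iff)

lemma ap_in2: "ap (in2 a b) x = (\<lambda>i. if a \<le> i \<and> i < a + b then x (i - a) else 0)"
  and ap_pr2: "ap (pr2 a b) x = (\<lambda>i. if i < b then x (i + a) else 0)"
  by (transfer; simp)+

lemma blocks_bd:
  "in1 a b \<in> bd (a + b) a" "in2 a b \<in> bd (a + b) b" "pr1 a b \<in> bd a (a + b)" "pr2 a b \<in> bd b (a + b)"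
  by (auto simp: bd_def in1_def pr1_def ap_en ap_in2 ap_pr2 intro!: lin_op_eqI)

lemma pr_in:
  "pr1 a b * in1 a b = en a" "pr2 a b * in2 a b = en b" "pr1 a b * in2 a b = 0" "pr2 a b * in1 a b = 0"
  "in1 a b * pr1 a b + in2 a b * pr2 a b = en (a + b)"
  by (auto simp: in1_def pr1_def ap_en ap_in2 ap_pr2 fun_eq_iff intro!: lin_op_eqI)

lemma pr_in_assoc:
  "pr1 a b * (in1 a b * f) = en a * f" "pr2 a b * (in2 a b * f) = en b * f"
  "pr1 a b * (in2 a b * f) = 0" "pr2 a b * (in1 a b * f) = 0"
  by (simp_all flip: mult.assoc add: pr_in)

lemma sum_lt_split: "(\<Sum>j<a + b. f j) = (\<Sum>j<a. f j) + (\<Sum>j<b. f (j + a) :: 'k::comm_monoid_add)" for a b :: nat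
  by (induction b) (auto simp: ac_simps)

lemma emb_four_block:
  assumes "A \<in> carrier_mat r1 c1" "B \<in> carrier_mat r1 c2" "C \<in> carrier_mat r2 c1" "D \<in> carrier_mat r2 c2"
  shows "emb (four_block_mat A B C D) =
    in1 r1 r2 * emb A * pr1 c1 c2 + in1 r1 r2 * emb B * pr2 c1 c2 +
    in2 r1 r2 * emb C * pr1 c1 c2 + in2 r1 r2 * emb D * pr2 c1 c2"
proof (rule lin_op_eqI)
  fix x i
  consider "i < r1" | "r1 \<le> i" "i < r1 + r2" | "r1 + r2 \<le> i" by linarith
  then show "ap (emb (four_block_mat A B C D)) x i = ap (in1 r1 r2 * emb A * pr1 c1 c2 +
    in1 r1 r2 * emb B * pr2 c1 c2 + in2 r1 r2 * emb C * pr1 c1 c2 + in2 r1 r2 * emb D * pr2 c1 c2) x i"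
    using assms
    by cases (auto simp: in1_def pr1_def ap_en ap_in2 ap_pr2 ap_emb sum_lt_split)
qed

definition trc :: "nat \<Rightarrow> 'k::field lin_op \<Rightarrow> 'k" where "trc n f = (\<Sum>i<n. ap f (uv i) i)"

lemma trc_simps: "trc n (f + g) = trc n f + trc n g" "trc n (f - g) = trc n f - trc n g"
  "trc n (- f) = - trc n f" "trc n 0 = 0" "trc n (en n) = of_nat n"
  by (auto simp: trc_def sum.distrib sum_subtractf sum_negf ap_en uv_def)

text \<open>
  Cyclicity holds between spaces of different sizes; it is the source of all invariance
  statements about Euler characteristics.
\<close>

lemma trc_cyclic:
  assumes "f \<in> bd n m" "g \<in> bd m n"
  shows "trc n (f * g) = trc m (g * f)"
proof -
  have "trc n (f * g) = (\<Sum>i<n. \<Sum>j<m. ap g (uv i) j * ap f (uv j) i)"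
    unfolding trc_def using ap_expand[OF bd_vsp[OF assms(2)], of f] by simp
  also have "\<dots> = (\<Sum>j<m. \<Sum>i<n. ap f (uv j) i * ap g (uv i) j)"
    by (subst sum.swap) (simp add: mult.commute)
  also have "\<dots> = trc m (g * f)"
    unfolding trc_def using ap_expand[OF bd_vsp[OF assms(1)], of g] by simp
  finally show ?thesis .
qed

section \<open>The path algebra\<close>

lemma lookup_smult [simp]: "Poly_Mapping.lookup (kQ_smult c x) p = c * Poly_Mapping.lookup x p"
  by (simp add: kQ_smult_def Poly_Mapping.map.rep_eq when_def)

lemma kQ_mult_eq:
  assumes "finite A" "Poly_Mapping.keys x \<subseteq> A" "finite C" "Poly_Mapping.keys y \<subseteq> C"
  shows "kQ_mult x y = (\<Sum>p\<in>A. \<Sum>q\<in>C. if path_target q = path_source p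
           then Poly_Mapping.single (path_comp p q) (Poly_Mapping.lookup x p * Poly_Mapping.lookup y q) else 0)"
proof -
  have "(\<Sum>q\<in>Poly_Mapping.keys y. if path_target q = path_source p
           then Poly_Mapping.single (path_comp p q) (Poly_Mapping.lookup x p * Poly_Mapping.lookup y q) else 0)
      = (\<Sum>q\<in>C. if path_target q = path_source p
           then Poly_Mapping.single (path_comp p q) (Poly_Mapping.lookup x p * Poly_Mapping.lookup y q) else 0)" for p
    by (rule sum.mono_neutral_left) (use assms in \<open>auto simp: in_keys_iff\<close>)
  then show ?thesis
    unfolding kQ_mult_def
    by simp (rule sum.mono_neutral_left, use assms in \<open>auto simp: in_keys_iff intro!: sum.neutral\<close>)
qed

lemma kQ_mult_add_left: "kQ_mult (x + y) z = kQ_mult x z + kQ_mult y z"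
proof -
  let ?A = "Poly_Mapping.keys x \<union> Poly_Mapping.keys y" and ?C = "Poly_Mapping.keys z"
  have "Poly_Mapping.keys (x + y) \<subseteq> ?A" by (rule keys_add)
  then show ?thesis
    by (subst (1 2 3) kQ_mult_eq[of ?A _ ?C])
       (auto simp: sum.distrib[symmetric] lookup_add distrib_right single_add intro!: sum.cong)
qed

lemma kQ_mult_add_right: "kQ_mult z (x + y) = kQ_mult z x + kQ_mult z y"
proof -
  let ?A = "Poly_Mapping.keys x \<union> Poly_Mapping.keys y" and ?C = "Poly_Mapping.keys z"
  have "Poly_Mapping.keys (x + y) \<subseteq> ?A" by (rule keys_add)
  then show ?thesis
    by (subst (1 2 3) kQ_mult_eq[of ?C _ ?A])
       (auto simp: sum.distrib[symmetric] lookup_add distrib_left single_add intro!: sum.cong)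
qed

lemma kQ_mult_zero [simp]: "kQ_mult 0 x = 0" "kQ_mult x 0 = 0"
  by (simp_all add: kQ_mult_def)

lemma kQ_mult_sum_left: "kQ_mult (\<Sum>a\<in>A. f a) z = (\<Sum>a\<in>A. kQ_mult (f a) z)"
  by (induction A rule: infinite_finite_induct) (auto simp: kQ_mult_add_left)

lemma kQ_mult_sum_right: "kQ_mult z (\<Sum>a\<in>A. f a) = (\<Sum>a\<in>A. kQ_mult z (f a))"
  by (induction A rule: infinite_finite_induct) (auto simp: kQ_mult_add_right)

lemma kQ_mult_single:
  "kQ_mult (Poly_Mapping.single p a) (Poly_Mapping.single q b) =
     (if path_target q = path_source p then Poly_Mapping.single (path_comp p q) (a * b) else 0)"
  by (subst kQ_mult_eq[of "{p}" _ "{q}"]) auto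

lemma path_comp_ends:
  "path_target q = path_source p \<Longrightarrow> path_target (path_comp p q) = path_target p"
  "path_source (path_comp p q) = path_source q"
  by (auto simp: path_comp_def path_target_def path_source_def)

lemma path_comp_assoc: "path_comp (path_comp p q) r = path_comp p (path_comp q r)"
  by (simp add: path_comp_def)

lemma poly_expand: "x = (\<Sum>p\<in>Poly_Mapping.keys x. Poly_Mapping.single p (Poly_Mapping.lookup x p))"
  by (rule poly_mapping_eqI) (simp add: lookup_sum lookup_single when_def in_keys_iff)

lemma kQ_mult_assoc_single:
  "kQ_mult (kQ_mult (Poly_Mapping.single p a) (Poly_Mapping.single q b)) (Poly_Mapping.single r c)
   = kQ_mult (Poly_Mapping.single p a) (kQ_mult (Poly_Mapping.single q b) (Poly_Mapping.single r c))"
  by (auto simp: kQ_mult_single path_comp_ends path_comp_assoc mult.assoc)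

lemma kQ_mult_assoc: "kQ_mult (kQ_mult x y) z = kQ_mult x (kQ_mult y z)"
  by (subst (1 2) poly_expand[of x], subst (1 2) poly_expand[of y], subst (1 2) poly_expand[of z])
     (simp only: kQ_mult_sum_left kQ_mult_sum_right kQ_mult_assoc_single)

lemma kQ_closed:
  "x \<in> kQ Q \<Longrightarrow> y \<in> kQ Q \<Longrightarrow> x + y \<in> kQ Q"
  "x \<in> kQ Q \<Longrightarrow> kQ_smult c x \<in> kQ Q" "0 \<in> kQ Q"
  "p \<in> paths Q \<Longrightarrow> Poly_Mapping.single p a \<in> kQ Q"
  using keys_add[of x y] by (auto simp: kQ_def in_keys_iff)

lemma kQ_sum: "(\<And>a. a \<in> A \<Longrightarrow> f a \<in> kQ Q) \<Longrightarrow> (\<Sum>a\<in>A. f a) \<in> kQ Q"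
  by (induction A rule: infinite_finite_induct) (auto simp: kQ_closed)

lemma trivial_path [simp]: "(i, []) \<in> paths Q" by (simp add: paths_def)

lemma is_walk_append: "is_walk Q i (as @ bs) \<longleftrightarrow> is_walk Q i as \<and> is_walk Q (path_target (i, as)) bs"
  by (induction as arbitrary: i) (auto simp: path_target_def)

lemma path_comp_paths: "p \<in> paths Q \<Longrightarrow> q \<in> paths Q \<Longrightarrow> path_target q = path_source p \<Longrightarrow> path_comp p q \<in> paths Q"
  by (auto simp: paths_def path_comp_def is_walk_append path_source_def)

lemma kQ_mult_closed: "x \<in> kQ Q \<Longrightarrow> y \<in> kQ Q \<Longrightarrow> kQ_mult x y \<in> kQ Q"
  unfolding kQ_mult_def by (intro kQ_sum) (force simp: kQ_def intro!: path_comp_paths)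

lemma kQ_one_closed: "kQ_one \<in> kQ Q"
  unfolding kQ_one_def by (intro kQ_sum kQ_closed) simp

abbreviation vtx :: "'n \<Rightarrow> ('n, 'k::field) path_alg" where "vtx i \<equiv> Poly_Mapping.single (i, []) 1"

lemma vtx_closed [simp]: "vtx i \<in> kQ Q" by (simp add: kQ_closed)

lemma vtx_mult:
  "kQ_mult (Poly_Mapping.single p a) (vtx i) = (if path_source p = i then Poly_Mapping.single p a else 0)"
  "kQ_mult (vtx i) (Poly_Mapping.single p a) = (if path_target p = i then Poly_Mapping.single p a else 0)"
  by (auto simp: kQ_mult_single path_comp_def path_target_def path_source_def)

lemma kQ_mult_one: "kQ_mult x kQ_one = x"
proof -
  have "kQ_mult (Poly_Mapping.single p a) kQ_one = Poly_Mapping.single p a" for p :: "'a path" and a :: 'b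
    by (simp add: kQ_one_def kQ_mult_sum_right vtx_mult)
  then show ?thesis
    by (subst (1 2) poly_expand[of x]) (simp only: kQ_mult_sum_left)
qed

section \<open>Modules as representations by operators\<close>

text \<open>
  A right module becomes an anti-representation by operators; its identity \<open>idm M\<close>
  is an idempotent that remembers the dimension.
\<close>

abbreviation rho :: "('n, 'k::field) rmod \<Rightarrow> ('n, 'k) path_alg \<Rightarrow> 'k lin_op" where
  "rho M x \<equiv> emb (act M x)"

abbreviation idm :: "('n, 'k::field) rmod \<Rightarrow> 'k lin_op" where "idm M \<equiv> en (mdim M)"

abbreviation vs :: "('n, 'k::field) rmod \<Rightarrow> (nat \<Rightarrow> 'k) set" where "vs M \<equiv> vsp (mdim M)"

definition Hm :: "'n quiver \<Rightarrow> ('n::finite, 'k::field) rmod \<Rightarrow> ('n, 'k) rmod \<Rightarrow> 'k lin_op set" where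
  "Hm Q M N = {f \<in> bd (mdim N) (mdim M). \<forall>x\<in>kQ Q. f * rho M x = rho N x * f}"

lemma is_mod_act: "is_mod Q M \<Longrightarrow> x \<in> kQ Q \<Longrightarrow> act M x \<in> carrier_mat (mdim M) (mdim M)"
  by (simp add: is_mod_def)

lemma rho_bd: "is_mod Q M \<Longrightarrow> x \<in> kQ Q \<Longrightarrow> rho M x \<in> bd (mdim M) (mdim M)"
  by (simp add: is_mod_act emb_bd)

lemma rho_simps:
  assumes "is_mod Q M"
  shows "x \<in> kQ Q \<Longrightarrow> y \<in> kQ Q \<Longrightarrow> rho M (x + y) = rho M x + rho M y"
    "x \<in> kQ Q \<Longrightarrow> rho M (kQ_smult c x) = scl c (rho M x)"
    "x \<in> kQ Q \<Longrightarrow> y \<in> kQ Q \<Longrightarrow> rho M (kQ_mult x y) = rho M y * rho M x"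
    "rho M kQ_one = idm M"
proof -
  have c: "act M x \<in> carrier_mat (mdim M) (mdim M)" if "x \<in> kQ Q" for x
    using assms that by (rule is_mod_act)
  show "x \<in> kQ Q \<Longrightarrow> y \<in> kQ Q \<Longrightarrow> rho M (x + y) = rho M x + rho M y"
    using assms emb_plus[OF c c, of x y] by (simp add: is_mod_def)
  show "x \<in> kQ Q \<Longrightarrow> rho M (kQ_smult c x) = scl c (rho M x)"
    using assms by (simp add: is_mod_def emb_smult)
  show "x \<in> kQ Q \<Longrightarrow> y \<in> kQ Q \<Longrightarrow> rho M (kQ_mult x y) = rho M y * rho M x"
  proof -
    assume "x \<in> kQ Q" "y \<in> kQ Q"
    then have "dim_col (act M y) = dim_row (act M x)" using c by (metis carrier_matD)
    then show ?thesis using assms \<open>x \<in> kQ Q\<close> \<open>y \<in> kQ Q\<close> by (simp add: is_mod_def emb_mult)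
  qed
  show "rho M kQ_one = idm M" using assms by (simp add: is_mod_def en_def)
qed

lemma rho_zero: "is_mod Q M \<Longrightarrow> rho M 0 = 0"
  using rho_simps(1)[of Q M 0 0] by (simp add: kQ_closed)

lemma rho_sum: "is_mod Q M \<Longrightarrow> (\<And>a. a \<in> A \<Longrightarrow> f a \<in> kQ Q) \<Longrightarrow> rho M (\<Sum>a\<in>A. f a) = (\<Sum>a\<in>A. rho M (f a))"
  by (induction A rule: infinite_finite_induct) (auto simp: rho_zero rho_simps kQ_sum)

lemma single_smult: "Poly_Mapping.single p c = kQ_smult c (Poly_Mapping.single p 1)"
  by (rule poly_mapping_eqI) (simp add: lookup_single when_def)

lemma rho_expand:
  assumes "is_mod Q M" "x \<in> kQ Q"
  shows "rho M x = (\<Sum>p\<in>Poly_Mapping.keys x. scl (Poly_Mapping.lookup x p) (rho M (Poly_Mapping.single p 1)))"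
proof -
  have p: "p \<in> paths Q" if "p \<in> Poly_Mapping.keys x" for p using assms that by (auto simp: kQ_def)
  have "rho M x = (\<Sum>p\<in>Poly_Mapping.keys x. rho M (Poly_Mapping.single p (Poly_Mapping.lookup x p)))"
    by (subst poly_expand[of x], subst rho_sum[OF assms(1)]) (use p in \<open>auto intro: kQ_closed\<close>)
  also have "\<dots> = (\<Sum>p\<in>Poly_Mapping.keys x. scl (Poly_Mapping.lookup x p) (rho M (Poly_Mapping.single p 1)))"
    by (intro sum.cong refl, subst single_smult) (use p assms(1) in \<open>auto intro!: rho_simps kQ_closed\<close>)
  finally show ?thesis .
qed

lemma is_modI:
  assumes c: "\<And>x. x \<in> kQ Q \<Longrightarrow> act M x \<in> carrier_mat (mdim M) (mdim M)"
    and "\<And>x y. x \<in> kQ Q \<Longrightarrow> y \<in> kQ Q \<Longrightarrow> rho M (x + y) = rho M x + rho M y"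
    and "\<And>c x. x \<in> kQ Q \<Longrightarrow> rho M (kQ_smult c x) = scl c (rho M x)"
    and "\<And>x y. x \<in> kQ Q \<Longrightarrow> y \<in> kQ Q \<Longrightarrow> rho M (kQ_mult x y) = rho M y * rho M x"
    and "rho M kQ_one = idm M"
  shows "is_mod Q M"
proof -
  note inj = emb_inj[of _ "mdim M" "mdim M"]
  note pl = emb_plus[OF c c]
  have dims: "dim_col (act M y) = dim_row (act M x)" if "x \<in> kQ Q" "y \<in> kQ Q" for x y
    using c that by (metis carrier_matD)
  show ?thesis
    unfolding is_mod_def
    by (intro conjI ballI allI inj)
       (use assms dims in \<open>auto simp: kQ_closed kQ_mult_closed kQ_one_closed pl emb_smult emb_mult en_def
         intro!: mult_carrier_mat\<close>)
qed

lemma emb_mod_hom: "is_mod Q M \<Longrightarrow> is_mod Q N \<Longrightarrow> F \<in> mod_hom Q M N \<Longrightarrow> emb F \<in> Hm Q M N"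
proof -
  assume M: "is_mod Q M" "is_mod Q N" and F: "F \<in> mod_hom Q M N"
  have "emb F * rho M x = rho N x * emb F" if "x \<in> kQ Q" for x
  proof -
    have "emb (F * act M x) = emb (act N x * F)" using F that by (simp add: mod_hom_def)
    then show ?thesis
      using F that is_mod_act[OF M(1) that] is_mod_act[OF M(2) that]
      by (subst (asm) (1 2) emb_mult) (auto simp: mod_hom_def)
  qed
  then show ?thesis using F by (auto simp: Hm_def mod_hom_def emb_bd)
qed

lemma Hm_mod_hom:
  assumes M: "is_mod Q M" "is_mod Q N" and f: "f \<in> Hm Q M N"
  shows "mt (mdim N) (mdim M) f \<in> mod_hom Q M N" "emb (mt (mdim N) (mdim M) f) = f"
proof -
  have b: "f \<in> bd (mdim N) (mdim M)" using f by (simp add: Hm_def)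
  show e: "emb (mt (mdim N) (mdim M) f) = f" using b by (rule emb_mt)
  have "mt (mdim N) (mdim M) f * act M x = act N x * mt (mdim N) (mdim M) f" if "x \<in> kQ Q" for x
  proof (rule emb_inj[of _ "mdim N" "mdim M"])
    note c = is_mod_act[OF M(1) that] is_mod_act[OF M(2) that] mt_carrier[of "mdim N" "mdim M" f]
    show "mt (mdim N) (mdim M) f * act M x \<in> carrier_mat (mdim N) (mdim M)"
      "act N x * mt (mdim N) (mdim M) f \<in> carrier_mat (mdim N) (mdim M)"
      using mult_carrier_mat[OF c(3) c(1)] mult_carrier_mat[OF c(2) c(3)] by blast+
    show "emb (mt (mdim N) (mdim M) f * act M x) = emb (act N x * mt (mdim N) (mdim M) f)"
      using f that c by (subst (1 2) emb_mult) (auto simp: e Hm_def carrier_matD[OF mt_carrier])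
  qed
  then show "mt (mdim N) (mdim M) f \<in> mod_hom Q M N" by (simp add: mod_hom_def)
qed

lemma HmD: "f \<in> Hm Q M N \<Longrightarrow> f \<in> bd (mdim N) (mdim M)"
  "f \<in> Hm Q M N \<Longrightarrow> x \<in> kQ Q \<Longrightarrow> f * rho M x = rho N x * f"
  "f \<in> Hm Q M N \<Longrightarrow> idm N * f = f" "f \<in> Hm Q M N \<Longrightarrow> f * idm M = f"
  by (auto simp: Hm_def bd_def)

lemma Hm_closed:
  "0 \<in> Hm Q M N" "f \<in> Hm Q M N \<Longrightarrow> g \<in> Hm Q M N \<Longrightarrow> f + g \<in> Hm Q M N"
  "f \<in> Hm Q M N \<Longrightarrow> g \<in> Hm Q M N \<Longrightarrow> f - g \<in> Hm Q M N" "f \<in> Hm Q M N \<Longrightarrow> - f \<in> Hm Q M N"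
  "f \<in> Hm Q M N \<Longrightarrow> scl c f \<in> Hm Q M N"
  by (auto simp: Hm_def bd_closed algebra_simps scl_mult_left scl_mult_right)

lemma Hm_sum: "(\<And>a. a \<in> A \<Longrightarrow> f a \<in> Hm Q M N) \<Longrightarrow> (\<Sum>a\<in>A. f a) \<in> Hm Q M N"
  by (induction A rule: infinite_finite_induct) (auto simp: Hm_closed)

lemma Hm_comp: "g \<in> Hm Q N L \<Longrightarrow> f \<in> Hm Q M N \<Longrightarrow> g * f \<in> Hm Q M L"
proof -
  assume g: "g \<in> Hm Q N L" and f: "f \<in> Hm Q M N"
  have "g * f * rho M x = rho L x * (g * f)" if "x \<in> kQ Q" for x
    using HmD(2)[OF g that] HmD(2)[OF f that] by (metis mult.assoc)
  then show ?thesis using HmD(1)[OF g] HmD(1)[OF f] by (simp add: Hm_def bd_closed(6))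
qed

lemma Hm_id: "is_mod Q M \<Longrightarrow> idm M \<in> Hm Q M M"
  using rho_bd[of Q M] by (auto simp: Hm_def en_bd bd_def)

lemma Hm_vs: "f \<in> Hm Q M N \<Longrightarrow> ap f x \<in> vs N"
  using HmD(1) bd_vsp by blast

lemma Hm_rho: "f \<in> Hm Q M N \<Longrightarrow> x \<in> kQ Q \<Longrightarrow> ap f (ap (rho M x) v) = ap (rho N x) (ap f v)"
  by (metis HmD(2) ap_simps(6))

lemma bd_eq_vec: "f \<in> bd n m \<Longrightarrow> g \<in> bd n m \<Longrightarrow> (\<And>v. v \<in> vsp m \<Longrightarrow> ap f v = ap g v) \<Longrightarrow> f = g"
  by (rule bd_eqI[of f n m g]) auto

lemma HmI_vec:
  assumes "is_mod Q M" "is_mod Q N" "f \<in> bd (mdim N) (mdim M)"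
    "\<And>x v. x \<in> kQ Q \<Longrightarrow> v \<in> vs M \<Longrightarrow> ap f (ap (rho M x) v) = ap (rho N x) (ap f v)"
  shows "f \<in> Hm Q M N"
  unfolding Hm_def using assms
  by (auto intro!: bd_eq_vec[of _ "mdim N" "mdim M"] bd_closed(6) rho_bd)

text \<open>
  Modules are built from operators by restricting them to matrices, which is how submodules,
  quotients and summands enter.
\<close>

lemma mk_mod:
  fixes \<phi> :: "('n::finite, 'k::field) path_alg \<Rightarrow> 'k lin_op"
  assumes b: "\<And>x. x \<in> kQ Q \<Longrightarrow> \<phi> x \<in> bd r r"
    and "\<And>x y. x \<in> kQ Q \<Longrightarrow> y \<in> kQ Q \<Longrightarrow> \<phi> (x + y) = \<phi> x + \<phi> y"
    and "\<And>c x. x \<in> kQ Q \<Longrightarrow> \<phi> (kQ_smult c x) = scl c (\<phi> x)"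
    and "\<And>x y. x \<in> kQ Q \<Longrightarrow> y \<in> kQ Q \<Longrightarrow> \<phi> (kQ_mult x y) = \<phi> y * \<phi> x"
    and "\<phi> kQ_one = en r"
  obtains N where "is_mod Q N" "mdim N = r" "\<And>x. x \<in> kQ Q \<Longrightarrow> rho N x = \<phi> x"
proof -
  let ?N = "\<lparr>mdim = r, act = (\<lambda>x. mt r r (\<phi> x))\<rparr>"
  have e: "rho ?N x = \<phi> x" if "x \<in> kQ Q" for x using emb_mt[OF b[OF that]] by simp
  have "is_mod Q ?N"
    by (rule is_modI)
       (simp_all only: e kQ_closed kQ_mult_closed kQ_one_closed assms, auto)
  then show ?thesis using that[of ?N] e by simp
qed

lemma is_mod_zero: "is_mod Q zero_mod"
  by (rule is_modI) (auto simp: zero_mod_def intro!: lin_op_eqI)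

lemma mdim_zero [simp]: "mdim zero_mod = 0" by (simp add: zero_mod_def)

lemma mdim_sum [simp]: "mdim (sum_mod M N) = mdim M + mdim N" by (simp add: sum_mod_def)

abbreviation i1 :: "('n, 'k::field) rmod \<Rightarrow> ('n, 'k) rmod \<Rightarrow> 'k lin_op" where "i1 M N \<equiv> in1 (mdim M) (mdim N)"
abbreviation i2 :: "('n, 'k::field) rmod \<Rightarrow> ('n, 'k) rmod \<Rightarrow> 'k lin_op" where "i2 M N \<equiv> in2 (mdim M) (mdim N)"
abbreviation p1 :: "('n, 'k::field) rmod \<Rightarrow> ('n, 'k) rmod \<Rightarrow> 'k lin_op" where "p1 M N \<equiv> pr1 (mdim M) (mdim N)"
abbreviation p2 :: "('n, 'k::field) rmod \<Rightarrow> ('n, 'k) rmod \<Rightarrow> 'k lin_op" where "p2 M N \<equiv> pr2 (mdim M) (mdim N)"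

lemma rho_sum_mod:
  assumes "is_mod Q M" "is_mod Q N" "x \<in> kQ Q"
  shows "rho (sum_mod M N) x = i1 M N * rho M x * p1 M N + i2 M N * rho N x * p2 M N"
  unfolding sum_mod_def using is_mod_act[OF assms(1,3)] is_mod_act[OF assms(2,3)]
  by (simp add: emb_four_block[of _ "mdim M" "mdim M" _ "mdim N" _ "mdim N"])

lemma en_rho: "is_mod Q M \<Longrightarrow> x \<in> kQ Q \<Longrightarrow> idm M * rho M x = rho M x"
  "is_mod Q M \<Longrightarrow> x \<in> kQ Q \<Longrightarrow> rho M x * idm M = rho M x"
  using rho_bd[of Q M x] by (auto simp: bd_def)

lemma en_rho_assoc: "is_mod Q M \<Longrightarrow> x \<in> kQ Q \<Longrightarrow> idm M * (rho M x * f) = rho M x * f"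
  by (simp flip: mult.assoc add: en_rho)

lemma is_mod_sum:
  fixes M N :: "('n::finite, 'k::field) rmod"
  assumes M: "is_mod Q M" and N: "is_mod Q N"
  shows "is_mod Q (sum_mod M N)"
proof (rule is_modI)
  fix x y :: "('n, 'k) path_alg" and c :: 'k assume x: "x \<in> kQ Q" and y: "y \<in> kQ Q"
  show "act (sum_mod M N) x \<in> carrier_mat (mdim (sum_mod M N)) (mdim (sum_mod M N))"
    using is_mod_act[OF M x] is_mod_act[OF N x] by (auto simp: sum_mod_def)
  show "rho (sum_mod M N) (x + y) = rho (sum_mod M N) x + rho (sum_mod M N) y"
    using x y M N by (simp add: rho_sum_mod[OF M N] kQ_closed rho_simps algebra_simps)
  show "rho (sum_mod M N) (kQ_mult x y) = rho (sum_mod M N) y * rho (sum_mod M N) x"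
    using x y M N by (simp add: rho_sum_mod[OF M N] kQ_mult_closed rho_simps(3) algebra_simps pr_in_assoc en_rho_assoc)
  show "rho (sum_mod M N) (kQ_smult c x) = scl c (rho (sum_mod M N) x)"
    using x M N by (simp add: rho_sum_mod[OF M N] kQ_closed rho_simps(2) algebra_simps scl_mult_left scl_mult_right
        scl.scale_right_distrib)
next
  show "rho (sum_mod M N) kQ_one = idm (sum_mod M N)"
    by (simp add: rho_sum_mod[OF M N] kQ_one_closed rho_simps(4)[OF M] rho_simps(4)[OF N] pr_in
        bdD[OF blocks_bd(1)] bdD[OF blocks_bd(2)])
qed

lemma sum_mod_Hm:
  assumes M: "is_mod Q M" and N: "is_mod Q N"
  shows "i1 M N \<in> Hm Q M (sum_mod M N)" "i2 M N \<in> Hm Q N (sum_mod M N)"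
    "p1 M N \<in> Hm Q (sum_mod M N) M" "p2 M N \<in> Hm Q (sum_mod M N) N"
  using M N
  by (auto simp: Hm_def blocks_bd rho_sum_mod[OF M N] algebra_simps pr_in pr_in_assoc en_rho en_rho_assoc)

lemma lookup_mult_trivial:
  fixes x y :: "('n, 'k::field) path_alg"
  shows "Poly_Mapping.lookup (kQ_mult x y) (i, []) = Poly_Mapping.lookup x (i, []) * Poly_Mapping.lookup y (i, [])"
proof -
  have 1: "Poly_Mapping.lookup (kQ_mult (Poly_Mapping.single p a) (Poly_Mapping.single q b)) (i, []) =
    (if p = (i, []) then a else 0) * (if q = (i, []) then b else 0)" for p q :: "'n path" and a b :: 'k
    by (cases p; cases q)
       (auto simp: kQ_mult_single lookup_single when_def path_comp_def path_target_def path_source_def)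
  have "Poly_Mapping.lookup (kQ_mult x y) (i, []) =
    (\<Sum>p\<in>Poly_Mapping.keys x. \<Sum>q\<in>Poly_Mapping.keys y. (if p = (i, []) then Poly_Mapping.lookup x p else 0) *
       (if q = (i, []) then Poly_Mapping.lookup y q else 0))"
    by (subst poly_expand[of x], subst poly_expand[of y])
       (simp only: kQ_mult_sum_left kQ_mult_sum_right lookup_sum 1, rule sum.swap)
  then show ?thesis
    by (simp flip: sum_product add: in_keys_iff)
qed

lemma mdim_simple [simp]: "mdim (simple_mod i) = 1" by (simp add: simple_mod_def)

lemma rho_simple: "rho (simple_mod i) x = scl (Poly_Mapping.lookup x (i, [])) (en 1)"
  by (rule lin_op_eqI) (auto simp: simple_mod_def ap_emb ap_en)

lemma is_mod_simple: "is_mod Q (simple_mod i)"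
proof (rule is_modI)
  show "rho (simple_mod i) (kQ_one :: ('a, 'b) path_alg) = idm (simple_mod i :: ('a, 'b) rmod)"
    by (simp add: rho_simple kQ_one_def lookup_sum lookup_single when_def)
qed (auto simp: rho_simple lookup_add lookup_mult_trivial scl.scale_left_distrib scl_mult_left scl_mult_right mult.commute,
     simp add: simple_mod_def)

text \<open>
  The dimension of \<open>M e\<^sub>l\<close> as an element of the field: the trace of an
  idempotent is its rank.
\<close>

definition tdim :: "'n \<Rightarrow> ('n, 'k::field) rmod \<Rightarrow> 'k" where "tdim l M = trc (mdim M) (rho M (vtx l))"

lemma tdim_zero [simp]: "tdim l zero_mod = 0" by (simp add: tdim_def trc_def)

lemma tdim_simple: "tdim l (simple_mod i) = (if l = i then 1 else 0)"
  by (simp add: tdim_def rho_simple trc_def lookup_single when_def ap_en uv_def)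

lemma tdim_sum:
  assumes M: "is_mod Q M" and N: "is_mod Q N"
  shows "tdim l (sum_mod M N) = tdim l M + tdim l N"
proof -
  have "trc (mdim M + mdim N) (i1 M N * (rho M (vtx l) * p1 M N)) = tdim l M"
    "trc (mdim M + mdim N) (i2 M N * (rho N (vtx l) * p2 M N)) = tdim l N"
    unfolding tdim_def
    by (subst trc_cyclic[OF blocks_bd(1)] trc_cyclic[OF blocks_bd(2)],
        auto intro!: bd_closed(6) rho_bd[OF M] rho_bd[OF N] blocks_bd simp: mult.assoc pr_in en_rho[OF M] en_rho[OF N])+
  then show ?thesis
    by (simp add: tdim_def[of _ "sum_mod M N"] rho_sum_mod[OF M N] trc_simps mult.assoc)
qed

section \<open>Paths in an acyclic quiver\<close>

abbreviation arr :: "'n quiver \<Rightarrow> ('n \<times> 'n) set" where "arr Q \<equiv> {(i, j). 0 < Q i j}"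

definition paths_between :: "'n quiver \<Rightarrow> 'n \<Rightarrow> 'n \<Rightarrow> 'n path set" where
  "paths_between Q s t = {p \<in> paths Q. path_source p = s \<and> path_target p = t}"

definition npaths :: "'n quiver \<Rightarrow> 'n \<Rightarrow> 'n \<Rightarrow> nat" where
  "npaths Q s t = card (paths_between Q s t)"

lemma walk_reach: "is_walk Q i as \<Longrightarrow> b \<in> set as \<Longrightarrow> (i, source b) \<in> (arr Q)\<^sup>*"
proof (induction as arbitrary: i)
  case (Cons a as)
  have "(i, target a) \<in> arr Q" using Cons.prems(1)
    by (auto simp: is_arrow_def source_def target_def split: prod.splits)
  then show ?case using Cons by (auto intro: converse_rtrancl_into_rtrancl)
qed simp

text \<open>
  A repeated source would close up to an oriented cycle. Hence walks are shorter than the number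
  of vertices, and there are finitely many paths.
\<close>

lemma walk_distinct: "acyclic_quiver Q \<Longrightarrow> is_walk Q i as \<Longrightarrow> distinct (map source as)"
proof (induction as arbitrary: i)
  case (Cons a as)
  have "(source a, target a) \<in> arr Q" using Cons.prems(2)
    by (auto simp: is_arrow_def source_def target_def split: prod.splits)
  then have "(source a, source b) \<in> (arr Q)\<^sup>+" if "b \<in> set as" for b
    using walk_reach[of Q "target a" as b] Cons.prems(2) that by (simp add: rtrancl_into_trancl2)
  then have "source a \<notin> source ` set as"
    using Cons.prems(1) unfolding acyclic_quiver_def acyclic_def by force
  then show ?case using Cons by auto
qed simp

lemma finite_arrows: "finite {a. is_arrow (Q :: 'n::finite quiver) a}"
proof -
  have "{a. is_arrow Q a} \<subseteq> (\<Union>i. \<Union>j. (\<lambda>m. (i, j, m)) ` {..<Q i j})"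
    by (auto simp: is_arrow_def)
  then show ?thesis by (rule finite_subset) auto
qed

lemma finite_paths:
  fixes Q :: "'n::finite quiver"
  assumes "acyclic_quiver Q"
  shows "finite (paths Q)"
proof -
  have "is_walk Q i as \<Longrightarrow> set as \<subseteq> {a. is_arrow Q a}" for i as
    by (induction as arbitrary: i) auto
  moreover have "length as \<le> CARD('n)" if "is_walk Q i as" for i as
    using walk_distinct[OF assms that] by (metis card_mono distinct_card finite_class.finite_UNIV length_map subset_UNIV)
  ultimately have "paths Q \<subseteq> UNIV \<times> {as. set as \<subseteq> {a. is_arrow Q a} \<and> length as \<le> CARD('n)}"
    unfolding paths_def by fastforce
  then show ?thesis
    by (rule finite_subset) (intro finite_SigmaI finite_lists_length_le finite_arrows finite_class.finite_UNIV)
qed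

lemma finite_paths_between: "acyclic_quiver (Q :: 'n::finite quiver) \<Longrightarrow> finite (paths_between Q s t)"
  unfolding paths_between_def by (rule finite_subset[OF _ finite_paths]) auto

lemma arrows_sum:
  fixes Q :: "'n::finite quiver"
  shows "(\<Sum>a\<in>{a. is_arrow Q a \<and> source a = s}. f (target a)) = (\<Sum>t\<in>UNIV. of_nat (Q s t) * (f t :: 'c::semiring_1))"
    "(\<Sum>a\<in>{a. is_arrow Q a \<and> target a = t}. f (source a)) = (\<Sum>s\<in>UNIV. of_nat (Q s t) * (f s :: 'c::semiring_1))"
proof -
  have "(\<Sum>a\<in>{a. is_arrow Q a \<and> source a = s}. f (target a)) =
    (\<Sum>(t, m)\<in>(SIGMA t:UNIV. {..<Q s t}). f t)"
    by (rule sum.reindex_bij_witness[of _ "\<lambda>(t, m). (s, t, m)" "\<lambda>a. snd a"])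
       (auto simp: is_arrow_def source_def target_def)
  then show "(\<Sum>a\<in>{a. is_arrow Q a \<and> source a = s}. f (target a)) = (\<Sum>t\<in>UNIV. of_nat (Q s t) * (f t :: 'c))"
    by (simp flip: sum.Sigma)
  have "(\<Sum>a\<in>{a. is_arrow Q a \<and> target a = t}. f (source a)) =
    (\<Sum>(s, m)\<in>(SIGMA s:UNIV. {..<Q s t}). f s)"
    by (rule sum.reindex_bij_witness[of _ "\<lambda>(s, m). (s, t, m)" "\<lambda>a. (fst a, snd (snd a))"])
       (auto simp: is_arrow_def source_def target_def)
  then show "(\<Sum>a\<in>{a. is_arrow Q a \<and> target a = t}. f (source a)) = (\<Sum>s\<in>UNIV. of_nat (Q s t) * (f s :: 'c))"
    by (simp flip: sum.Sigma)
qed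

text \<open>
  A nontrivial path is uniquely its first arrow followed by a path, and also a path followed by
  its last arrow. These are the two ways of saying that the matrix \<open>1 - Q\<close> inverts
  the path matrix.
\<close>

lemma npaths_first:
  fixes Q :: "'n::finite quiver"
  assumes "acyclic_quiver Q"
  shows "npaths Q s i = (if s = i then 1 else 0) + (\<Sum>t\<in>UNIV. Q s t * npaths Q t i)"
proof -
  let ?A = "{a. is_arrow Q a \<and> source a = s}"
  let ?S = "SIGMA a:?A. paths_between Q (target a) i"
  let ?f = "\<lambda>(a, p). (s, a # snd p)"
  have eq: "paths_between Q s i = (if s = i then {(s, [])} else {}) \<union> ?f ` ?S"
  proof (intro equalityI subsetI)
    fix p assume p: "p \<in> paths_between Q s i"
    show "p \<in> (if s = i then {(s, [])} else {}) \<union> ?f ` ?S"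
    proof (cases "snd p")
      case Nil then show ?thesis using p
        by (cases p) (auto simp: paths_between_def path_target_def path_source_def)
    next
      case (Cons a as)
      then have "p = ?f (a, (target a, as))" "(a, (target a, as)) \<in> ?S" using p
        by (cases p; auto simp: paths_between_def paths_def path_target_def path_source_def)+
      then show ?thesis by blast
    qed
  qed (auto simp: paths_between_def paths_def path_target_def path_source_def split: if_splits)
  have inj: "inj_on ?f ?S"
    by (auto simp: inj_on_def paths_between_def path_source_def)
  have fin: "finite ?S" "finite ?A"
    using finite_arrows[of Q] by (auto intro!: finite_SigmaI finite_paths_between[OF assms] elim: finite_subset[rotated])
  have "card (paths_between Q s i) = (if s = i then 1 else 0) + card (?f ` ?S)"
    unfolding eq by (subst card_Un_disjoint) (use fin in auto)
  also have "card (?f ` ?S) = (\<Sum>a\<in>?A. npaths Q (target a) i)"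
    using card_image[OF inj] fin by (simp add: card_SigmaI finite_paths_between[OF assms] npaths_def)
  finally show ?thesis by (simp add: npaths_def arrows_sum(1)[of "\<lambda>t. npaths Q t i" for i, unfolded npaths_def])
qed

lemma npaths_last:
  fixes Q :: "'n::finite quiver"
  assumes "acyclic_quiver Q"
  shows "npaths Q s i = (if s = i then 1 else 0) + (\<Sum>t\<in>UNIV. Q t i * npaths Q s t)"
proof -
  let ?A = "{a. is_arrow Q a \<and> target a = i}"
  let ?S = "SIGMA a:?A. paths_between Q s (source a)"
  let ?f = "\<lambda>(a, p). (s, snd p @ [a])"
  have eq: "paths_between Q s i = (if s = i then {(s, [])} else {}) \<union> ?f ` ?S"
  proof (intro equalityI subsetI)
    fix p assume p: "p \<in> paths_between Q s i"
    show "p \<in> (if s = i then {(s, [])} else {}) \<union> ?f ` ?S"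
    proof (cases "snd p" rule: rev_cases)
      case Nil then show ?thesis using p
        by (cases p) (auto simp: paths_between_def path_target_def path_source_def)
    next
      case (snoc as a)
      then have "p = ?f (a, (s, as))" "(a, (s, as)) \<in> ?S" using p
        by (cases p; auto simp: paths_between_def paths_def is_walk_append path_target_def path_source_def)+
      then show ?thesis by blast
    qed
  qed (auto simp: paths_between_def paths_def is_walk_append path_target_def path_source_def split: if_splits)
  have inj: "inj_on ?f ?S"
    by (auto simp: inj_on_def paths_between_def path_source_def)
  have fin: "finite ?S" "finite ?A"
    using finite_arrows[of Q] by (auto intro!: finite_SigmaI finite_paths_between[OF assms] elim: finite_subset[rotated])
  have "card (paths_between Q s i) = (if s = i then 1 else 0) + card (?f ` ?S)"
    unfolding eq by (subst card_Un_disjoint) (use fin in auto)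
  also have "card (?f ` ?S) = (\<Sum>a\<in>?A. npaths Q s (source a))"
    using card_image[OF inj] fin by (simp add: card_SigmaI finite_paths_between[OF assms] npaths_def)
  finally show ?thesis by (simp add: npaths_def arrows_sum(2)[of "\<lambda>t. npaths Q s t" for s, unfolded npaths_def])
qed

section \<open>Projective modules\<close>

lemma path_list:
  assumes "acyclic_quiver (Q :: 'n::finite quiver)"
  shows "distinct (path_list Q i)" "set (path_list Q i) = {p \<in> paths Q. path_target p = i}"
proof -
  have "\<exists>ps. distinct ps \<and> set ps = {p \<in> paths Q. path_target p = i}"
    using finite_distinct_list[of "{p \<in> paths Q. path_target p = i}"] finite_paths[OF assms] by auto
  then have "distinct (path_list Q i) \<and> set (path_list Q i) = {p \<in> paths Q. path_target p = i}"
    unfolding path_list_def by (rule someI_ex)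
  then show "distinct (path_list Q i)" "set (path_list Q i) = {p \<in> paths Q. path_target p = i}" by auto
qed

text \<open>
  The projective module at \<open>i\<close> lives on coordinates; \<open>cv\<close> is the
  isomorphism to it from the right ideal spanned by the paths that end in \<open>i\<close>, so
  that module computations are done in the path algebra.
\<close>

definition ideal :: "'n quiver \<Rightarrow> 'n \<Rightarrow> ('n, 'k::field) path_alg set" where
  "ideal Q i = {y. Poly_Mapping.keys y \<subseteq> {p \<in> paths Q. path_target p = i}}"

definition cv :: "'n quiver \<Rightarrow> 'n \<Rightarrow> ('n, 'k::field) path_alg \<Rightarrow> nat \<Rightarrow> 'k" where
  "cv Q i y = (\<lambda>r. if r < length (path_list Q i) then Poly_Mapping.lookup y (path_list Q i ! r) else 0)"

lemma mdim_proj [simp]: "mdim (proj_mod Q i) = length (path_list Q i)"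
  by (simp add: proj_mod_def Let_def)

lemma cv_vs: "cv Q i y \<in> vsp (length (path_list Q i))"
  by (auto simp: cv_def vsp_def)

lemma cv_add: "cv Q i (x + y) = (\<lambda>r. cv Q i x r + cv Q i y r)"
  and cv_smult: "cv Q i (kQ_smult c x) = (\<lambda>r. c * cv Q i x r)"
  by (auto simp: cv_def lookup_add)

lemma ideal_kQ: "y \<in> ideal Q i \<Longrightarrow> y \<in> kQ Q"
  by (auto simp: ideal_def kQ_def)

lemma ideal_closed:
  "0 \<in> ideal Q i" "x \<in> ideal Q i \<Longrightarrow> y \<in> ideal Q i \<Longrightarrow> x + y \<in> ideal Q i"
  "p \<in> paths Q \<Longrightarrow> path_target p = i \<Longrightarrow> Poly_Mapping.single p a \<in> ideal Q i"
  using keys_add[of x y] by (auto simp: ideal_def)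

lemma ideal_sum: "(\<And>a. a \<in> A \<Longrightarrow> f a \<in> ideal Q i) \<Longrightarrow> (\<Sum>a\<in>A. f a) \<in> ideal Q i"
  by (induction A rule: infinite_finite_induct) (auto simp: ideal_closed)

lemma ideal_mult: "y \<in> ideal Q i \<Longrightarrow> x \<in> kQ Q \<Longrightarrow> kQ_mult y x \<in> ideal Q i"
  unfolding kQ_mult_def
  by (intro ideal_sum) (auto simp: ideal_closed(1) path_comp_ends in_keys_iff
      intro!: ideal_closed(3) path_comp_paths, auto simp: ideal_def kQ_def in_keys_iff)

lemma lookup_mult_single:
  "Poly_Mapping.lookup (kQ_mult (Poly_Mapping.single p a) x) r =
     a * Poly_Mapping.lookup (kQ_mult (Poly_Mapping.single p 1) x) r"
  by (subst (1 2) poly_expand[of x])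
     (auto simp: kQ_mult_sum_right kQ_mult_single lookup_sum lookup_single when_def sum_distrib_left intro!: sum.cong)

lemma ideal_expand:
  assumes "acyclic_quiver (Q :: 'n::finite quiver)" "y \<in> ideal Q i"
  shows "y = (\<Sum>c<length (path_list Q i). Poly_Mapping.single (path_list Q i ! c) (Poly_Mapping.lookup y (path_list Q i ! c)))"
proof -
  note pl = path_list[OF assms(1), of i]
  have "y = (\<Sum>p\<in>set (path_list Q i). Poly_Mapping.single p (Poly_Mapping.lookup y p))"
  proof (subst poly_expand, rule sum.mono_neutral_left)
    show "Poly_Mapping.keys y \<subseteq> set (path_list Q i)"
      unfolding pl(2) using assms(2) by (simp add: ideal_def)
  qed (simp_all add: in_keys_iff)
  also have "\<dots> = (\<Sum>c<length (path_list Q i). Poly_Mapping.single (path_list Q i ! c) (Poly_Mapping.lookup y (path_list Q i ! c)))"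
    by (rule sum.reindex_bij_betw[symmetric]) (use pl in \<open>simp add: bij_betw_nth\<close>)
  finally show ?thesis .
qed

lemma cv_surj:
  assumes Q: "acyclic_quiver (Q :: 'n::finite quiver)" and "v \<in> vsp (length (path_list Q i))"
  shows "\<exists>y\<in>ideal Q i. cv Q i y = v"
proof
  let ?y = "\<Sum>c<length (path_list Q i). Poly_Mapping.single (path_list Q i ! c) (v c)"
  note pl = path_list[OF Q, of i]
  have "path_list Q i ! c \<in> set (path_list Q i)" if "c < length (path_list Q i)" for c using that by simp
  then show "?y \<in> ideal Q i" using pl(2) by (auto intro!: ideal_sum ideal_closed(3))
  show "cv Q i ?y = v"
    using assms(2) nth_eq_iff_index_eq[OF pl(1)]
    by (auto simp: cv_def vsp_def lookup_sum lookup_single when_def fun_eq_iff if_distrib cong: if_cong)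
qed

lemma rho_proj:
  assumes Q: "acyclic_quiver (Q :: 'n::finite quiver)" and y: "y \<in> ideal Q i"
  shows "ap (rho (proj_mod Q i) x) (cv Q i y) = cv Q i (kQ_mult y x)"
proof
  fix r
  show "ap (rho (proj_mod Q i) x) (cv Q i y) r = cv Q i (kQ_mult y x) r"
    apply (subst (2) ideal_expand[OF Q y])
    apply (auto simp: proj_mod_def Let_def ap_emb cv_def kQ_mult_sum_left lookup_sum)
    apply (rule sum.cong, simp)
    apply (subst (2) lookup_mult_single, simp)
    done
qed

lemma rho_proj_carrier: "act (proj_mod Q i) x \<in> carrier_mat (length (path_list Q i)) (length (path_list Q i))"
  by (simp add: proj_mod_def Let_def)

lemma is_mod_proj:
  fixes Q :: "'n::finite quiver"
  assumes Q: "acyclic_quiver Q"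
  shows "is_mod Q (proj_mod Q i :: ('n, 'k::field) rmod)"
proof -
  let ?P = "proj_mod Q i :: ('n, 'k) rmod" and ?n = "length (path_list Q i)"
  have bd: "rho ?P x \<in> bd ?n ?n" for x by (rule emb_bd[OF rho_proj_carrier])
  have eqI: "f = g" if "f \<in> bd ?n ?n" "g \<in> bd ?n ?n" "\<And>y. y \<in> ideal Q i \<Longrightarrow> ap f (cv Q i y) = ap g (cv Q i y)"
    for f g :: "'k lin_op"
  proof (rule bd_eq_vec[OF that(1,2)])
    fix v :: "nat \<Rightarrow> 'k" assume "v \<in> vsp ?n"
    then obtain y where "y \<in> ideal Q i" "cv Q i y = v" using cv_surj[OF Q] by blast
    then show "ap f v = ap g v" using that(3) by blast
  qed
  have sm: "kQ_mult y (kQ_smult c x) = kQ_smult c (kQ_mult y x)" for c x and y :: "('n, 'k) path_alg"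
  proof -
    have "Poly_Mapping.keys (kQ_smult c x) \<subseteq> Poly_Mapping.keys x" by (auto simp: in_keys_iff)
    then show ?thesis
      by (intro poly_mapping_eqI)
         (auto simp: kQ_mult_eq[of "Poly_Mapping.keys y" y "Poly_Mapping.keys x"] lookup_sum lookup_single
           when_def sum_distrib_left intro!: sum.cong)
  qed
  show ?thesis
  proof (rule is_modI)
    fix x y :: "('n, 'k) path_alg" and c :: 'k assume x: "x \<in> kQ Q" and y: "y \<in> kQ Q"
    show "act ?P x \<in> carrier_mat (mdim ?P) (mdim ?P)" by (simp add: rho_proj_carrier)
    show "rho ?P (x + y) = rho ?P x + rho ?P y"
      by (rule eqI) (auto simp: bd bd_closed rho_proj[OF Q] kQ_mult_add_right cv_add)
    show "rho ?P (kQ_smult c x) = scl c (rho ?P x)"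
      by (rule eqI) (auto simp: bd bd_closed rho_proj[OF Q] sm cv_smult)
    show "rho ?P (kQ_mult x y) = rho ?P y * rho ?P x"
      using x by (intro eqI) (auto simp: bd bd_closed(6)[OF bd bd] rho_proj[OF Q] ideal_mult kQ_mult_assoc)
  next
    show "rho ?P kQ_one = idm ?P"
      by (rule eqI) (auto simp: bd en_bd rho_proj[OF Q] kQ_mult_one vsp_iff[symmetric] cv_vs
          intro!: vsp_iff[THEN iffD1, symmetric])
  qed
qed

definition gen :: "'n quiver \<Rightarrow> 'n \<Rightarrow> nat \<Rightarrow> 'k::field" where "gen Q i = cv Q i (vtx i)"

lemma vtx_ideal: "vtx i \<in> ideal Q i"
  by (rule ideal_closed) (auto simp: path_target_def)

lemma vtx_mult_ideal: "y \<in> ideal Q i \<Longrightarrow> kQ_mult (vtx i) y = y"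
  apply (subst (1 2) poly_expand[of y])
  apply (simp only: kQ_mult_sum_right)
  apply (rule sum.cong)
   apply (auto simp: vtx_mult ideal_def)
  done

lemma gen_vs: "gen Q i \<in> vsp (length (path_list Q i))"
  by (simp add: gen_def cv_vs)

lemma rho_gen:
  assumes "acyclic_quiver (Q :: 'n::finite quiver)"
  shows "y \<in> ideal Q i \<Longrightarrow> ap (rho (proj_mod Q i) y) (gen Q i) = cv Q i y"
  by (simp add: gen_def rho_proj[OF assms vtx_ideal] vtx_mult_ideal)

lemma vtx_gen:
  assumes "acyclic_quiver (Q :: 'n::finite quiver)"
  shows "ap (rho (proj_mod Q i) (vtx i)) (gen Q i) = gen Q i"
  using rho_gen[OF assms vtx_ideal] by (simp add: gen_def)

lemma proj_hom_eq:
  fixes M :: "('n::finite, 'k::field) rmod"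
  assumes Q: "acyclic_quiver Q"
    and f: "f \<in> Hm Q (proj_mod Q i) M" and g: "g \<in> Hm Q (proj_mod Q i) M" and "ap f (gen Q i) = ap g (gen Q i)"
  shows "f = g"
proof (rule bd_eq_vec)
  show "f \<in> bd (mdim M) (length (path_list Q i))" "g \<in> bd (mdim M) (length (path_list Q i))"
    using HmD(1)[OF f] HmD(1)[OF g] by auto
  fix v :: "nat \<Rightarrow> 'k" assume "v \<in> vsp (length (path_list Q i))"
  then obtain y where y: "y \<in> ideal Q i" "cv Q i y = v" using cv_surj[OF Q] by blast
  show "ap f v = ap g v"
    using Hm_rho[OF f ideal_kQ[OF y(1)], of "gen Q i"] Hm_rho[OF g ideal_kQ[OF y(1)], of "gen Q i"] assms(4)
    by (simp add: rho_gen[OF Q y(1)] y(2))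
qed

text \<open>
  The Yoneda lemma for \<open>e\<^sub>i kQ\<close>: homomorphisms correspond to elements of
  \<open>M e\<^sub>i\<close>, the images of the generator.
\<close>

lemma proj_hom_ex:
  fixes M :: "('n::finite, 'k::field) rmod"
  assumes Q: "acyclic_quiver Q" and M: "is_mod Q M" and u: "u \<in> vs M" "ap (rho M (vtx i)) u = u"
  obtains f where "f \<in> Hm Q (proj_mod Q i) M" "ap f (gen Q i) = u"
    "\<And>y. y \<in> ideal Q i \<Longrightarrow> ap f (cv Q i y) = ap (rho M y) u"
proof -
  let ?L = "path_list Q i"
  define f where "f = emb (Matrix.mat (mdim M) (length ?L) (\<lambda>(r, c). ap (rho M (Poly_Mapping.single (?L ! c) 1)) u r))"
  have fb: "f \<in> bd (mdim M) (length ?L)" unfolding f_def by (rule emb_bd) simp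
  have f: "ap f (cv Q i y) = ap (rho M y) u" if y: "y \<in> ideal Q i" for y
  proof
    fix r
    have p: "?L ! c \<in> paths Q" if "c < length ?L" for c
      using path_list(2)[OF Q, of i] that nth_mem by blast
    have "rho M y = (\<Sum>c<length ?L. rho M (Poly_Mapping.single (?L ! c) (Poly_Mapping.lookup y (?L ! c))))"
      by (subst ideal_expand[OF Q y], subst rho_sum[OF M]) (use p in \<open>auto intro: kQ_closed\<close>)
    also have "\<dots> = (\<Sum>c<length ?L. scl (Poly_Mapping.lookup y (?L ! c)) (rho M (Poly_Mapping.single (?L ! c) 1)))"
      by (intro sum.cong refl, subst single_smult) (use p M in \<open>auto intro!: rho_simps kQ_closed\<close>)
    finally have e: "ap (rho M y) u r = (\<Sum>c<length ?L. Poly_Mapping.lookup y (?L ! c) * ap (rho M (Poly_Mapping.single (?L ! c) 1)) u r)"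
      by (simp add: ap_sum_op)
    have z: "ap (rho M y) u r = 0" if "\<not> r < mdim M"
      using bd_vsp[OF rho_bd[OF M ideal_kQ[OF y]], of u] that by (auto simp: vsp_def)
    show "ap f (cv Q i y) r = ap (rho M y) u r"
      using e z by (auto simp: f_def ap_emb cv_def mult.commute)
  qed
  have "f \<in> Hm Q (proj_mod Q i) M"
  proof (rule HmI_vec[OF is_mod_proj[OF Q] M])
    show "f \<in> bd (mdim M) (mdim (proj_mod Q i))" using fb by simp
    fix x :: "('n, 'k) path_alg" and v :: "nat \<Rightarrow> 'k"
    assume x: "x \<in> kQ Q" and "v \<in> vs (proj_mod Q i :: ('n, 'k) rmod)"
    then obtain y where y: "y \<in> ideal Q i" "cv Q i y = v" using cv_surj[OF Q, of v i] by auto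
    show "ap f (ap (rho (proj_mod Q i) x) v) = ap (rho M x) (ap f v)"
      using y x by (auto simp: rho_proj[OF Q] f ideal_mult rho_simps(3)[OF M] ideal_kQ)
  qed
  moreover have "ap f (gen Q i) = u" using f[OF vtx_ideal] u by (simp add: gen_def)
  ultimately show ?thesis using f that by blast
qed

text \<open>
  Projectivity as lifting along the first map of an exact pair \<open>A \<rightarrow> C
  \<rightarrow> E\<close>. The kernel of the second map takes the place of the target of an
  epimorphism; it lives on a subspace, which is not one of the coordinate spaces on which
  modules are defined.
\<close>

definition exproj :: "'n quiver \<Rightarrow> ('n::finite, 'k::field) rmod \<Rightarrow> bool" where
  "exproj Q P \<longleftrightarrow> is_mod Q P \<and> (\<forall>A C E d d' \<phi>. is_mod Q A \<and> is_mod Q C \<and> is_mod Q E \<and>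
     d \<in> Hm Q A C \<and> d' \<in> Hm Q C E \<and> (\<forall>v\<in>vs C. ap d' v = (\<lambda>i. 0) \<longrightarrow> (\<exists>u\<in>vs A. ap d u = v)) \<and>
     \<phi> \<in> Hm Q P C \<and> d' * \<phi> = 0 \<longrightarrow> (\<exists>\<psi>\<in>Hm Q P A. d * \<psi> = \<phi>))"

lemma exprojD:
  assumes "exproj Q P" "is_mod Q A" "is_mod Q C" "is_mod Q E" "d \<in> Hm Q A C" "d' \<in> Hm Q C E"
    "\<And>v. v \<in> vs C \<Longrightarrow> ap d' v = (\<lambda>i. 0) \<Longrightarrow> \<exists>u\<in>vs A. ap d u = v" "\<phi> \<in> Hm Q P C" "d' * \<phi> = 0"
  obtains \<psi> where "\<psi> \<in> Hm Q P A" "d * \<psi> = \<phi>"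
  using assms unfolding exproj_def by blast

lemma exproj_proj:
  fixes Q :: "'n::finite quiver"
  assumes Q: "acyclic_quiver Q"
  shows "exproj Q (proj_mod Q i :: ('n, 'k::field) rmod)"
  unfolding exproj_def
proof (intro conjI allI impI is_mod_proj[OF Q], elim conjE)
  fix A C E :: "('n, 'k) rmod" and d d' \<phi>
  assume A: "is_mod Q A" and C: "is_mod Q C" "is_mod Q E" and d: "d \<in> Hm Q A C" "d' \<in> Hm Q C E"
    and ex: "\<forall>v\<in>vs C. ap d' v = (\<lambda>i. 0) \<longrightarrow> (\<exists>u\<in>vs A. ap d u = v)"
    and \<phi>: "\<phi> \<in> Hm Q (proj_mod Q i) C" and z: "d' * \<phi> = 0"
  have "ap d' (ap \<phi> (gen Q i)) = (\<lambda>i. 0)" using z by (metis ap_simps(1,6))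
  then obtain u where u: "u \<in> vs A" "ap d u = ap \<phi> (gen Q i)" using ex Hm_vs[OF \<phi>] by blast
  let ?u = "ap (rho A (vtx i)) u"
  have "ap (rho A (vtx i)) ?u = ?u"
    using rho_simps(3)[OF A vtx_closed vtx_closed, of i i]
    by (simp add: vtx_mult path_source_def flip: ap_simps(6))
  then obtain \<psi> where \<psi>: "\<psi> \<in> Hm Q (proj_mod Q i) A" "ap \<psi> (gen Q i) = ?u"
    using proj_hom_ex[OF Q A bd_vsp[OF rho_bd[OF A vtx_closed]]] by blast
  have "ap (d * \<psi>) (gen Q i) = ap \<phi> (gen Q i)"
    using arg_cong[OF vtx_gen[OF Q, of i], of "ap \<phi>"]
    by (simp add: \<psi> u(2) Hm_rho[OF d(1)] Hm_rho[OF \<phi>])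
  then have "d * \<psi> = \<phi>" by (rule proj_hom_eq[OF Q Hm_comp[OF d(1) \<psi>(1)] \<phi>])
  then show "\<exists>\<psi>\<in>Hm Q (proj_mod Q i) A. d * \<psi> = \<phi>" using \<psi> by blast
qed

lemma Hm_zero_left: "f \<in> Hm Q zero_mod M \<longleftrightarrow> f = 0"
  and Hm_zero_right: "f \<in> Hm Q M zero_mod \<longleftrightarrow> f = 0"
  by (auto simp: Hm_def)

lemma exproj_zero: "exproj Q zero_mod"
  by (auto simp: exproj_def is_mod_zero Hm_zero_left)

lemma exproj_sum:
  fixes M N :: "('n::finite, 'k::field) rmod"
  assumes M: "exproj Q M" and N: "exproj Q N"
  shows "exproj Q (sum_mod M N)"
  unfolding exproj_def
proof (intro conjI allI impI, goal_cases)
  case 1 show ?case using M N by (auto simp: exproj_def is_mod_sum)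
next
  case (2 A C E d d' \<phi>)
  have m: "is_mod Q M" "is_mod Q N" using M N by (auto simp: exproj_def)
  have m': "is_mod Q A" "is_mod Q C" "is_mod Q E" and d: "d \<in> Hm Q A C" "d' \<in> Hm Q C E"
    and ex: "\<And>v. v \<in> vs C \<Longrightarrow> ap d' v = (\<lambda>i. 0) \<Longrightarrow> \<exists>u\<in>vs A. ap d u = v"
    and \<phi>: "\<phi> \<in> Hm Q (sum_mod M N) C" "d' * \<phi> = 0" using 2 by auto
  have z: "d' * (\<phi> * f) = 0" for f using \<phi>(2) by (simp flip: mult.assoc)
  obtain \<psi>1 where \<psi>1: "\<psi>1 \<in> Hm Q M A" "d * \<psi>1 = \<phi> * i1 M N"
    by (rule exprojD[OF M m' d ex Hm_comp[OF \<phi>(1) sum_mod_Hm(1)[OF m]] z])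
  obtain \<psi>2 where \<psi>2: "\<psi>2 \<in> Hm Q N A" "d * \<psi>2 = \<phi> * i2 M N"
    by (rule exprojD[OF N m' d ex Hm_comp[OF \<phi>(1) sum_mod_Hm(2)[OF m]] z])
  have "d * (\<psi>1 * p1 M N + \<psi>2 * p2 M N) = \<phi> * (i1 M N * p1 M N + i2 M N * p2 M N)"
    by (simp add: distrib_left \<psi>1 \<psi>2 flip: mult.assoc)
  also have "\<dots> = \<phi>" using HmD(4)[OF \<phi>(1)] by (simp add: pr_in)
  finally show ?case
    using Hm_closed(2)[OF Hm_comp[OF \<psi>1(1) sum_mod_Hm(3)[OF m]] Hm_comp[OF \<psi>2(1) sum_mod_Hm(4)[OF m]]] by blast
qed

lemma exproj_projective:
  assumes P: "exproj Q P"
  shows "projective_mod Q P"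
  unfolding projective_mod_def
proof (intro conjI allI ballI impI)
  show Pm: "is_mod Q P" using P by (simp add: exproj_def)
  fix M N G H assume G: "G \<in> mod_hom Q M N" and H: "H \<in> mod_hom Q P N"
    and *: "is_mod Q M \<and> is_mod Q N \<and> (\<lambda>v. G *\<^sub>v v) ` carrier_vec (mdim M) = carrier_vec (mdim N)"
  then have M: "is_mod Q M" "is_mod Q N" by auto
  have ex: "\<exists>u\<in>vs M. ap (emb G) u = v" if v: "v \<in> vs N" for v
  proof -
    obtain w where w: "w \<in> carrier_vec (mdim N)" "vf w = v" using vf_surj[OF v] by blast
    then obtain u where u: "u \<in> carrier_vec (mdim M)" "w = G *\<^sub>v u" using * by blast
    have "dim_col G = mdim M" using G by (auto simp: mod_hom_def)
    then show ?thesis using u w vf_mult[of u G] vf_vsp by metis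
  qed
  obtain \<psi> where \<psi>: "\<psi> \<in> Hm Q P M" "emb G * \<psi> = emb H"
    by (rule exprojD[OF P M is_mod_zero emb_mod_hom[OF M G], of 0 "emb H"])
       (auto simp: Hm_zero_right ex emb_mod_hom[OF Pm M(2) H])
  note h = Hm_mod_hom[OF Pm M(1) \<psi>(1)]
  have "emb (G * mt (mdim M) (mdim P) \<psi>) = emb H"
    using h \<psi>(2) G by (subst emb_mult) (auto simp: mod_hom_def carrier_matD[OF mt_carrier])
  then have "G * mt (mdim M) (mdim P) \<psi> = H"
    using G H h by (intro emb_inj[of _ "mdim N" "mdim P"]) (auto simp: mod_hom_def)
  then show "\<exists>H'\<in>mod_hom Q P M. G * H' = H" using h by blast
qed

lemma tdim_proj:
  fixes Q :: "'n::finite quiver"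
  assumes Q: "acyclic_quiver Q"
  shows "tdim l (proj_mod Q i :: ('n, 'k::field) rmod) = of_nat (npaths Q l i)"
proof -
  let ?L = "path_list Q i"
  note pl = path_list[OF Q, of i]
  have "ap (rho (proj_mod Q i :: ('n, 'k) rmod) (vtx l)) (uv c) c = (if path_source (?L ! c) = l then 1 else 0)" if c: "c < length ?L" for c
  proof -
    have id: "Poly_Mapping.single (?L ! c) (1 :: 'k) \<in> ideal Q i"
      using pl(2) c nth_mem by (intro ideal_closed(3)) blast+
    have u: "(uv c :: nat \<Rightarrow> 'k) = cv Q i (Poly_Mapping.single (?L ! c) 1)"
      using c nth_eq_iff_index_eq[OF pl(1)] by (auto simp: uv_def cv_def lookup_single when_def fun_eq_iff)
    show ?thesis using c by (simp add: u rho_proj[OF Q id] vtx_mult) (simp add: cv_def lookup_single)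
  qed
  then have "tdim l (proj_mod Q i :: ('n, 'k) rmod) = (\<Sum>c<length ?L. if path_source (?L ! c) = l then 1 else 0)"
    unfolding tdim_def trc_def by (intro sum.cong) auto
  also have "\<dots> = (\<Sum>p\<in>set ?L. if path_source p = l then 1 else 0)"
    by (rule sum.reindex_bij_betw[of "(!) ?L"]) (use pl in \<open>simp add: bij_betw_nth\<close>)
  also have "\<dots> = of_nat (card {p \<in> set ?L. path_source p = l})"
    by (simp flip: sum.inter_filter)
  also have "{p \<in> set ?L. path_source p = l} = paths_between Q l i"
    by (auto simp: pl paths_between_def)
  finally show ?thesis by (simp add: npaths_def)
qed

section \<open>Complexes, chain maps and homotopies\<close>

abbreviation D :: "('n, 'k::field) cpx \<Rightarrow> int \<Rightarrow> 'k lin_op" where "D X n \<equiv> emb (diff X n)"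

text \<open>
  Chain maps and null-homotopic maps as families of operators. The class \<open>null\<close> is
  an ideal, so a homotopy \<open>f \<sim> g\<close> is written \<open>null (f - g)\<close> and
  handled by ring computations.
\<close>

definition CM :: "'n quiver \<Rightarrow> ('n::finite, 'k::field) cpx \<Rightarrow> ('n, 'k) cpx \<Rightarrow> (int \<Rightarrow> 'k lin_op) set" where
  "CM Q X Y = {f. \<forall>n. f n \<in> Hm Q (ob X n) (ob Y n) \<and> D Y n * f n = f (n + 1) * D X n}"

definition null :: "'n quiver \<Rightarrow> ('n::finite, 'k::field) cpx \<Rightarrow> ('n, 'k) cpx \<Rightarrow> (int \<Rightarrow> 'k lin_op) \<Rightarrow> bool" where
  "null Q X Y f \<longleftrightarrow> (\<exists>h. \<forall>n. h n \<in> Hm Q (ob X n) (ob Y (n - 1)) \<and>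
     f n = D Y (n - 1) * h n + h (n + 1) * D X n)"

lemma cpxD:
  assumes "bounded_cpx Q X"
  shows "is_mod Q (ob X n)" "D X n \<in> Hm Q (ob X n) (ob X (n + 1))" "D X (n - 1) \<in> Hm Q (ob X (n - 1)) (ob X n)"
    "D X (n + 1) * D X n = 0" "D X n * D X (n - 1) = 0"
proof -
  have 1: "is_mod Q (ob X n)" "diff X n \<in> mod_hom Q (ob X n) (ob X (n + 1))"
    "diff X (n + 1) * diff X n = 0\<^sub>m (cdim X (n + 2)) (cdim X n)" for n
    using assms by (auto simp: bounded_cpx_def)
  show "is_mod Q (ob X n)" by (rule 1)
  show 2: "D X n \<in> Hm Q (ob X n) (ob X (n + 1))" for n by (intro emb_mod_hom 1)
  show "D X (n - 1) \<in> Hm Q (ob X (n - 1)) (ob X n)" using 2[of "n - 1"] by simp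
  show 3: "D X (n + 1) * D X n = 0" for n
    using 1(2)[of n] 1(2)[of "n + 1"] arg_cong[OF 1(3)[of n], of emb]
    by (subst (asm) emb_mult) (auto simp: mod_hom_def)
  show "D X n * D X (n - 1) = 0" using 3[of "n - 1"] by simp
qed

lemma cpxI:
  assumes "\<And>n. is_mod Q (ob X n)" "\<And>n. diff X n \<in> carrier_mat (cdim X (n + 1)) (cdim X n)"
    "\<And>n. D X n \<in> Hm Q (ob X n) (ob X (n + 1))" "\<And>n. D X (n + 1) * D X n = 0" "finite {n. cdim X n \<noteq> 0}"
  shows "bounded_cpx Q X"
proof -
  have h: "diff X n \<in> mod_hom Q (ob X n) (ob X (n + 1))" for n
    using Hm_mod_hom[OF assms(1) assms(1) assms(3)[of n]] emb_inj[OF assms(2) mt_carrier] by metis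
  have "diff X (n + 1) * diff X n = 0\<^sub>m (cdim X (n + 2)) (cdim X n)" for n
  proof (rule emb_inj[of _ "cdim X (n + 2)" "cdim X n"])
    have c: "diff X (n + 1) \<in> carrier_mat (cdim X (n + 2)) (cdim X (n + 1))"
      using assms(2)[of "n + 1"] by (simp add: add.assoc)
    show "diff X (n + 1) * diff X n \<in> carrier_mat (cdim X (n + 2)) (cdim X n)"
      by (rule mult_carrier_mat[OF c assms(2)])
    show "emb (diff X (n + 1) * diff X n) = emb (0\<^sub>m (cdim X (n + 2)) (cdim X n))"
      using c assms(2)[of n] assms(4)[of n] by (subst emb_mult) auto
  qed simp
  then show ?thesis using assms h by (auto simp: bounded_cpx_def)
qed

lemma CM_D: "f \<in> CM Q X Y \<Longrightarrow> f n \<in> Hm Q (ob X n) (ob Y n)" "f \<in> CM Q X Y \<Longrightarrow> D Y n * f n = f (n + 1) * D X n"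
  by (auto simp: CM_def)

lemma CM_closed:
  "(\<lambda>n. 0) \<in> CM Q X Y" "f \<in> CM Q X Y \<Longrightarrow> g \<in> CM Q X Y \<Longrightarrow> (\<lambda>n. f n + g n) \<in> CM Q X Y"
  "f \<in> CM Q X Y \<Longrightarrow> g \<in> CM Q X Y \<Longrightarrow> (\<lambda>n. f n - g n) \<in> CM Q X Y" "f \<in> CM Q X Y \<Longrightarrow> (\<lambda>n. - f n) \<in> CM Q X Y"
  "f \<in> CM Q X Y \<Longrightarrow> (\<lambda>n. scl c (f n)) \<in> CM Q X Y"
  by (auto simp: CM_def Hm_closed algebra_simps scl_mult_left scl_mult_right)

lemma CM_comp: "g \<in> CM Q Y Z \<Longrightarrow> f \<in> CM Q X Y \<Longrightarrow> (\<lambda>n. g n * f n) \<in> CM Q X Z"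
  unfolding CM_def by (auto intro: Hm_comp) (metis mult.assoc)

lemma CM_id: "bounded_cpx Q X \<Longrightarrow> (\<lambda>n. idm (ob X n)) \<in> CM Q X X"
  by (auto simp: CM_def Hm_id cpxD HmD(3)[OF cpxD(2)] HmD(4)[OF cpxD(2)])

lemma CM_idm: "f \<in> CM Q X Y \<Longrightarrow> idm (ob Y n) * f n = f n" "f \<in> CM Q X Y \<Longrightarrow> f n * idm (ob X n) = f n"
  by (rule HmD(3)[OF CM_D(1)] HmD(4)[OF CM_D(1)], assumption)+

lemma null_zero: "null Q X Y (\<lambda>n. 0)"
  unfolding null_def by (rule exI[of _ "\<lambda>n. 0"]) (simp add: Hm_closed)

lemma null_add: "null Q X Y f \<Longrightarrow> null Q X Y g \<Longrightarrow> null Q X Y (\<lambda>n. f n + g n)"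
  unfolding null_def
  by (elim exE, rule_tac x = "\<lambda>n. h n + ha n" in exI) (auto simp: Hm_closed algebra_simps)

lemma null_minus: "null Q X Y f \<Longrightarrow> null Q X Y (\<lambda>n. - f n)"
  unfolding null_def
  by (elim exE, rule_tac x = "\<lambda>n. - h n" in exI) (auto simp: Hm_closed algebra_simps)

lemma null_diff: "null Q X Y f \<Longrightarrow> null Q X Y g \<Longrightarrow> null Q X Y (\<lambda>n. f n - g n)"
  using null_add[of Q X Y f "\<lambda>n. - g n"] null_minus[of Q X Y g] by simp

lemma null_sym: "null Q X Y (\<lambda>n. f n - g n) \<Longrightarrow> null Q X Y (\<lambda>n. g n - f n)"
  by (drule null_minus) simp

lemma null_trans: "null Q X Y (\<lambda>n. f n - g n) \<Longrightarrow> null Q X Y (\<lambda>n. g n - h n) \<Longrightarrow> null Q X Y (\<lambda>n. f n - h n)"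
  by (drule (1) null_add) simp

lemma null_refl: "null Q X Y (\<lambda>n. f n - f n)"
  using null_zero by simp

lemma null_left: "g \<in> CM Q Y Z \<Longrightarrow> null Q X Y f \<Longrightarrow> null Q X Z (\<lambda>n. g n * f n)"
proof -
  assume g: "g \<in> CM Q Y Z" and "null Q X Y f"
  then obtain h where h: "\<And>n. h n \<in> Hm Q (ob X n) (ob Y (n - 1))"
    "\<And>n. f n = D Y (n - 1) * h n + h (n + 1) * D X n" unfolding null_def by blast
  have "g n * f n = D Z (n - 1) * (g (n - 1) * h n) + (g n * h (n + 1)) * D X n" for n
    using CM_D(2)[OF g, of "n - 1"] by (simp add: h(2) distrib_left flip: mult.assoc)
  then show ?thesis unfolding null_def
    by (intro exI[of _ "\<lambda>n. g (n - 1) * h n"]) (auto intro!: Hm_comp[OF CM_D(1)[OF g] h(1)])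
qed

lemma null_right: "null Q Y Z g \<Longrightarrow> f \<in> CM Q X Y \<Longrightarrow> null Q X Z (\<lambda>n. g n * f n)"
proof -
  assume f: "f \<in> CM Q X Y" and "null Q Y Z g"
  then obtain h where h: "\<And>n. h n \<in> Hm Q (ob Y n) (ob Z (n - 1))"
    "\<And>n. g n = D Z (n - 1) * h n + h (n + 1) * D Y n" unfolding null_def by blast
  have "g n * f n = D Z (n - 1) * (h n * f n) + (h (n + 1) * f (n + 1)) * D X n" for n
    using CM_D(2)[OF f, of n] by (simp add: h(2) distrib_right mult.assoc)
  then show ?thesis unfolding null_def
    by (intro exI[of _ "\<lambda>n. h n * f n"]) (auto intro!: Hm_comp[OF h(1) CM_D(1)[OF f]])
qed

lemma null_comp_cong:
  assumes "null Q X Y (\<lambda>n. f n - f' n)" "null Q Y Z (\<lambda>n. g n - g' n)" "g \<in> CM Q Y Z" "f' \<in> CM Q X Y"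
  shows "null Q X Z (\<lambda>n. g n * f n - g' n * f' n)"
  using null_add[OF null_left[OF assms(3,1)] null_right[OF assms(2,4)]]
  by (simp add: algebra_simps)

text \<open>Passage between families of matrices and families of operators.\<close>

definition mts :: "('n, 'k::field) cpx \<Rightarrow> ('n, 'k) cpx \<Rightarrow> (int \<Rightarrow> 'k lin_op) \<Rightarrow> int \<Rightarrow> 'k Matrix.mat" where
  "mts X Y f = (\<lambda>n. mt (cdim Y n) (cdim X n) (f n))"

lemma chain_map_emb:
  assumes X: "bounded_cpx Q X" and Y: "bounded_cpx Q Y"
  shows "f \<in> chain_map Q X Y \<Longrightarrow> (\<lambda>n. emb (f n)) \<in> CM Q X Y"
proof -
  assume f: "f \<in> chain_map Q X Y"
  have "emb (f n) \<in> Hm Q (ob X n) (ob Y n)" for n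
    using f by (intro emb_mod_hom cpxD(1)[OF X] cpxD(1)[OF Y]) (auto simp: chain_map_def)
  moreover have "D Y n * emb (f n) = emb (f (n + 1)) * D X n" for n
  proof -
    have h: "f n \<in> mod_hom Q (ob X n) (ob Y n)" "f (n + 1) \<in> mod_hom Q (ob X (n + 1)) (ob Y (n + 1))"
      "diff X n \<in> mod_hom Q (ob X n) (ob X (n + 1))" "diff Y n \<in> mod_hom Q (ob Y n) (ob Y (n + 1))"
      using f X Y by (auto simp: chain_map_def bounded_cpx_def)
    have "emb (diff Y n * f n) = emb (f (n + 1) * diff X n)" using f by (simp add: chain_map_def)
    then show ?thesis using h by (subst (asm) (1 2) emb_mult) (auto simp: mod_hom_def)
  qed
  ultimately show ?thesis by (simp add: CM_def)
qed

lemma mts_emb: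
  assumes X: "bounded_cpx Q X" and Y: "bounded_cpx Q Y" and f: "f \<in> CM Q X Y"
  shows "mts X Y f \<in> chain_map Q X Y" "emb (mts X Y f n) = f n"
proof -
  note h = Hm_mod_hom[OF cpxD(1)[OF X] cpxD(1)[OF Y] CM_D(1)[OF f]]
  show e: "emb (mts X Y f n) = f n" for n unfolding mts_def by (rule h)
  have h1: "mts X Y f n \<in> mod_hom Q (ob X n) (ob Y n)" for n unfolding mts_def by (rule h)
  have "diff Y n * mts X Y f n = mts X Y f (n + 1) * diff X n" for n
  proof (rule emb_inj)
    have c: "diff Y n \<in> carrier_mat (cdim Y (n + 1)) (cdim Y n)" "diff X n \<in> carrier_mat (cdim X (n + 1)) (cdim X n)"
      "mts X Y f n \<in> carrier_mat (cdim Y n) (cdim X n)" "mts X Y f (n + 1) \<in> carrier_mat (cdim Y (n + 1)) (cdim X (n + 1))"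
      using X Y h1[of n] h1[of "n + 1"] by (auto simp: bounded_cpx_def mod_hom_def)
    show "diff Y n * mts X Y f n \<in> carrier_mat (cdim Y (n + 1)) (cdim X n)"
      "mts X Y f (n + 1) * diff X n \<in> carrier_mat (cdim Y (n + 1)) (cdim X n)"
      using mult_carrier_mat[OF c(1) c(3)] mult_carrier_mat[OF c(4) c(2)] by blast+
    show "emb (diff Y n * mts X Y f n) = emb (mts X Y f (n + 1) * diff X n)"
      using CM_D(2)[OF f, of n] e carrier_matD[OF c(1)] carrier_matD[OF c(2)] carrier_matD[OF c(3)] carrier_matD[OF c(4)]
      by (subst (1 2) emb_mult) simp_all
  qed
  then show "mts X Y f \<in> chain_map Q X Y" using h1 by (simp add: chain_map_def)
qed

lemma chain_map_carrier: "f \<in> chain_map Q X Y \<Longrightarrow> f n \<in> carrier_mat (cdim Y n) (cdim X n)"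
  by (auto simp: chain_map_def mod_hom_def)

lemma homotopy_rel_iff:
  assumes X: "bounded_cpx Q X" and Y: "bounded_cpx Q Y"
  shows "(f, g) \<in> homotopy_rel Q X Y \<longleftrightarrow> f \<in> chain_map Q X Y \<and> g \<in> chain_map Q X Y \<and>
    null Q X Y (\<lambda>n. emb (f n) - emb (g n))"
proof (cases "f \<in> chain_map Q X Y \<and> g \<in> chain_map Q X Y")
  case True
  then have c: "f n \<in> carrier_mat (cdim Y n) (cdim X n)" "g n \<in> carrier_mat (cdim Y n) (cdim X n)" for n
    using chain_map_carrier by auto
  have dX: "diff X n \<in> carrier_mat (cdim X (n + 1)) (cdim X n)" for n
    using X by (auto simp: bounded_cpx_def mod_hom_def)
  have dY: "diff Y (n - 1) \<in> carrier_mat (cdim Y n) (cdim Y (n - 1))" for n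
    using Y unfolding bounded_cpx_def mod_hom_def by (metis (no_types, lifting) diff_add_cancel mem_Collect_eq)
  have eq: "f n - g n = diff Y (n - 1) * h n + h (n + 1) * diff X n \<longleftrightarrow>
    emb (f n) - emb (g n) = D Y (n - 1) * emb (h n) + emb (h (n + 1)) * D X n"
    if h: "\<And>n. h n \<in> carrier_mat (cdim Y (n - 1)) (cdim X n)" for h n
  proof -
    have h': "h (n + 1) \<in> carrier_mat (cdim Y n) (cdim X (n + 1))" using h[of "n + 1"] by simp
    note m = mult_carrier_mat[OF dY[of n] h[of n]] mult_carrier_mat[OF h' dX[of n]]
    have "emb (diff Y (n - 1) * h n + h (n + 1) * diff X n) = D Y (n - 1) * emb (h n) + emb (h (n + 1)) * D X n"
      using carrier_matD[OF dY[of n]] carrier_matD[OF h[of n]] carrier_matD[OF h'] carrier_matD[OF dX[of n]]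
      by (simp add: emb_plus[OF m] emb_mult)
    moreover have "emb (f n - g n) = emb (f n) - emb (g n)" by (rule emb_minus[OF c])
    moreover have "f n - g n \<in> carrier_mat (cdim Y n) (cdim X n)" using c by (simp add: minus_carrier_mat)
    moreover have "diff Y (n - 1) * h n + h (n + 1) * diff X n \<in> carrier_mat (cdim Y n) (cdim X n)"
      using m by simp
    ultimately show ?thesis using emb_inj by metis
  qed
  show ?thesis
  proof
    assume "(f, g) \<in> homotopy_rel Q X Y"
    then obtain h where h: "\<And>n. h n \<in> mod_hom Q (ob X n) (ob Y (n - 1))"
      "\<And>n. f n - g n = diff Y (n - 1) * h n + h (n + 1) * diff X n" by (auto simp: homotopy_rel_def)
    have "h n \<in> carrier_mat (cdim Y (n - 1)) (cdim X n)" for n using h(1)[of n] by (simp add: mod_hom_def)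
    then have "null Q X Y (\<lambda>n. emb (f n) - emb (g n))"
      unfolding null_def using h(2) eq emb_mod_hom[OF cpxD(1)[OF X] cpxD(1)[OF Y] h(1)]
      by (intro exI[of _ "\<lambda>n. emb (h n)"]) blast
    then show "f \<in> chain_map Q X Y \<and> g \<in> chain_map Q X Y \<and> null Q X Y (\<lambda>n. emb (f n) - emb (g n))"
      using True by blast
  next
    assume "f \<in> chain_map Q X Y \<and> g \<in> chain_map Q X Y \<and> null Q X Y (\<lambda>n. emb (f n) - emb (g n))"
    then obtain h where h: "\<And>n. h n \<in> Hm Q (ob X n) (ob Y (n - 1))"
      "\<And>n. emb (f n) - emb (g n) = D Y (n - 1) * h n + h (n + 1) * D X n" by (auto simp: null_def)
    let ?h = "\<lambda>n. mt (cdim Y (n - 1)) (cdim X n) (h n)"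
    note hm = Hm_mod_hom[OF cpxD(1)[OF X] cpxD(1)[OF Y] h(1)]
    have e: "emb (?h n) = h n" for n by (rule hm)
    have "f n - g n = diff Y (n - 1) * ?h n + ?h (n + 1) * diff X n" for n
      using eq[of ?h n] h(2)[of n] unfolding e by simp
    then show "(f, g) \<in> homotopy_rel Q X Y" using True hm(1)
      unfolding homotopy_rel_def by (intro CollectI case_prodI conjI exI[of _ ?h] allI) auto
  qed
qed (auto simp: homotopy_rel_def)

section \<open>Mapping cones\<close>

text \<open>
  The four structure maps of the mapping cone, as a graded direct sum of \<open>X[1]\<close> and
  \<open>Y\<close>.
\<close>

abbreviation ca :: "('n, 'k::field) cpx \<Rightarrow> ('n, 'k) cpx \<Rightarrow> int \<Rightarrow> 'k lin_op" where "ca X Y n \<equiv> in1 (cdim X (n + 1)) (cdim Y n)"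
abbreviation cb :: "('n, 'k::field) cpx \<Rightarrow> ('n, 'k) cpx \<Rightarrow> int \<Rightarrow> 'k lin_op" where "cb X Y n \<equiv> in2 (cdim X (n + 1)) (cdim Y n)"
abbreviation cp :: "('n, 'k::field) cpx \<Rightarrow> ('n, 'k) cpx \<Rightarrow> int \<Rightarrow> 'k lin_op" where "cp X Y n \<equiv> pr1 (cdim X (n + 1)) (cdim Y n)"
abbreviation cq :: "('n, 'k::field) cpx \<Rightarrow> ('n, 'k) cpx \<Rightarrow> int \<Rightarrow> 'k lin_op" where "cq X Y n \<equiv> pr2 (cdim X (n + 1)) (cdim Y n)"

lemma ob_cone [simp]: "ob (cone X Y f) n = sum_mod (ob X (n + 1)) (ob Y n)"
  by (simp add: cone_def)

lemma cone_Hm: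
  assumes X: "bounded_cpx Q X" and Y: "bounded_cpx Q Y"
  shows "ca X Y n \<in> Hm Q (ob X (n + 1)) (sum_mod (ob X (n + 1)) (ob Y n))"
    "cb X Y n \<in> Hm Q (ob Y n) (sum_mod (ob X (n + 1)) (ob Y n))"
    "cp X Y n \<in> Hm Q (sum_mod (ob X (n + 1)) (ob Y n)) (ob X (n + 1))"
    "cq X Y n \<in> Hm Q (sum_mod (ob X (n + 1)) (ob Y n)) (ob Y n)"
  by (rule sum_mod_Hm[OF cpxD(1)[OF X] cpxD(1)[OF Y]])+

lemma D_cone:
  assumes X: "bounded_cpx Q X" and Y: "bounded_cpx Q Y" and f: "f \<in> chain_map Q X Y"
  shows "D (cone X Y f) n = cb X Y (n + 1) * emb (f (n + 1)) * cp X Y n + cb X Y (n + 1) * D Y n * cq X Y n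
     - ca X Y (n + 1) * D X (n + 1) * cp X Y n"
    "diff (cone X Y f) n \<in> carrier_mat (cdim (cone X Y f) (n + 1)) (cdim (cone X Y f) n)"
proof -
  have c: "- diff X (n + 1) \<in> carrier_mat (cdim X (n + 2)) (cdim X (n + 1))"
    "0\<^sub>m (cdim X (n + 2)) (cdim Y n) \<in> carrier_mat (cdim X (n + 2)) (cdim Y n)"
    "f (n + 1) \<in> carrier_mat (cdim Y (n + 1)) (cdim X (n + 1))"
    "diff Y n \<in> carrier_mat (cdim Y (n + 1)) (cdim Y n)"
    using X Y chain_map_carrier[OF f, of "n + 1"] unfolding bounded_cpx_def mod_hom_def
    by (auto simp: add.assoc dest: spec[of _ "n + 1"])
  show "D (cone X Y f) n = cb X Y (n + 1) * emb (f (n + 1)) * cp X Y n + cb X Y (n + 1) * D Y n * cq X Y n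
     - ca X Y (n + 1) * D X (n + 1) * cp X Y n"
    using emb_four_block[OF c] by (simp add: cone_def emb_uminus add.assoc)
  show "diff (cone X Y f) n \<in> carrier_mat (cdim (cone X Y f) (n + 1)) (cdim (cone X Y f) n)"
    using c by (simp add: cone_def add.assoc)
qed

lemma en_assoc: "f \<in> Hm Q M N \<Longrightarrow> idm N * (f * g) = f * g"
  by (metis HmD(3) mult.assoc)

lemma bounded_cone:
  assumes X: "bounded_cpx Q X" and Y: "bounded_cpx Q Y" and f: "f \<in> chain_map Q X Y"
  shows "bounded_cpx Q (cone X Y f)"
proof (rule cpxI)
  note F = chain_map_emb[OF X Y f]
  note h = cone_Hm[OF X Y]
  show "is_mod Q (ob (cone X Y f) n)" for n by (simp add: is_mod_sum cpxD X Y)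
  show "diff (cone X Y f) n \<in> carrier_mat (cdim (cone X Y f) (n + 1)) (cdim (cone X Y f) n)" for n
    by (rule D_cone[OF X Y f])
  show "D (cone X Y f) n \<in> Hm Q (ob (cone X Y f) n) (ob (cone X Y f) (n + 1))" for n
    unfolding D_cone(1)[OF X Y f] ob_cone
    by (intro Hm_closed(2,3) Hm_comp[OF Hm_comp[OF h(2)] h(3)] Hm_comp[OF Hm_comp[OF h(2)] h(4)] Hm_comp[OF Hm_comp[OF h(1)] h(3)]
        CM_D(1)[OF F] cpxD X Y)
  show "D (cone X Y f) (n + 1) * D (cone X Y f) n = 0" for n
  proof -
    have e: "idm (ob X (n + 2)) * (D X (n + 1) * g) = D X (n + 1) * g" "idm (ob Y (n + 1)) * (D Y n * g) = D Y n * g"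
      "idm (ob Y (n + 1)) * (emb (f (n + 1)) * g) = emb (f (n + 1)) * g" for g
      using en_assoc[OF cpxD(2)[OF X], of "n + 1"] en_assoc[OF cpxD(2)[OF Y], of n] en_assoc[OF CM_D(1)[OF F], of "n + 1"]
      by (simp_all add: add.assoc)
    have z: "D X (n + 2) * (D X (n + 1) * g) = 0" "D Y (n + 1) * (D Y n * g) = 0"
      "D Y (n + 1) * (emb (f (n + 1)) * g) = emb (f (n + 2)) * (D X (n + 1) * g)" for g
      using arg_cong[OF cpxD(4)[OF X, of "n + 1"], of "\<lambda>x. x * g"] arg_cong[OF cpxD(4)[OF Y, of n], of "\<lambda>x. x * g"]
        arg_cong[OF CM_D(2)[OF F, of "n + 1"], of "\<lambda>x. x * g"]
      by (simp_all add: add.assoc mult.assoc)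
    show ?thesis
      unfolding D_cone(1)[OF X Y f]
      by (simp add: distrib_left distrib_right left_diff_distrib right_diff_distrib mult.assoc pr_in_assoc e z add.assoc)
  qed
  have "{n. cdim (cone X Y f) n \<noteq> 0} \<subseteq> (\<lambda>n. n - 1) ` {n. cdim X n \<noteq> 0} \<union> {n. cdim Y n \<noteq> 0}"
    by (auto simp: image_iff) (metis add_diff_cancel_right' less_numeral_extra(3))
  then show "finite {n. cdim (cone X Y f) n \<noteq> 0}"
    by (rule finite_subset) (use X Y in \<open>auto simp: bounded_cpx_def\<close>)
qed

lemma cone_maps:
  assumes X: "bounded_cpx Q X" and Y: "bounded_cpx Q Y" and f: "f \<in> chain_map Q X Y"
  shows "(\<lambda>n. cb X Y n) \<in> CM Q Y (cone X Y f)"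
proof -
  note F = chain_map_emb[OF X Y f]
  show ?thesis
    unfolding CM_def D_cone(1)[OF X Y f]
    using cone_Hm[OF X Y] HmD(4)[OF cpxD(2)[OF Y]]
    by (auto simp: algebra_simps pr_in pr_in_assoc)
qed

section \<open>Lifting along quasi-isomorphisms\<close>

definition acyc :: "('n, 'k::field) cpx \<Rightarrow> bool" where
  "acyc C \<longleftrightarrow> (\<forall>n. \<forall>v\<in>vs (ob C n). ap (D C n) v = (\<lambda>i. 0) \<longrightarrow> (\<exists>u\<in>vs (ob C (n - 1)). ap (D C (n - 1)) u = v))"

text \<open>
  The fundamental lemma of projective resolutions: a contraction is constructed downwards from
  the top degree of \<open>R\<close>, lifting in each degree the part of \<open>f\<close> that
  is not yet accounted for.
\<close>

lemma null_acyclic: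
  fixes R C :: "('n::finite, 'k::field) cpx"
  assumes R: "bounded_cpx Q R" "\<And>n. exproj Q (ob R n)" and C: "bounded_cpx Q C" "acyc C" and f: "f \<in> CM Q R C"
  shows "null Q R C f"
proof -
  have "finite {n. cdim R n \<noteq> 0}" using R(1) by (simp add: bounded_cpx_def)
  then obtain N where N: "\<And>n. n > N \<Longrightarrow> cdim R n = 0"
    using finite_subset[of _ "{..N}" for N] by (metis (mono_tags, lifting) Max_ge linorder_not_less mem_Collect_eq)
  \<comment> \<open>Step \<open>k\<close> treats degree \<open>N - k\<close>; \<open>?P\<close> says that the remainder is a cocycle, \<open>?Q\<close> that the next component of the contraction bounds it.\<close>
  let ?P = "\<lambda>k h. h \<in> Hm Q (ob R (N + 1 - int k)) (ob C (N - int k)) \<and>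
     D C (N - int k) * (f (N - int k) - h * D R (N - int k)) = 0"
  let ?Q = "\<lambda>k h h'. f (N - int k) = D C (N - int k - 1) * h' + h * D R (N - int k)"
  have "\<exists>hs. \<forall>k. ?P k (hs k) \<and> ?Q k (hs k) (hs (Suc k))"
  proof (rule dependent_nat_choice)
    have "f (N + 1) \<in> bd (cdim C (N + 1)) 0" using HmD(1)[OF CM_D(1)[OF f, of "N + 1"]] N[of "N + 1"] by simp
    then have "D C N * f N = 0" using CM_D(2)[OF f, of N] by simp
    then show "\<exists>h. ?P 0 h" by (intro exI[of _ 0]) (simp add: Hm_closed)
  next
    fix h k assume h: "?P k h"
    let ?n = "N - int k"
    have D1: "D R ?n \<in> Hm Q (ob R ?n) (ob R (N + 1 - int k))" using cpxD(2)[OF R(1), of ?n] by (simp add: algebra_simps)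
    have \<psi>: "f ?n - h * D R ?n \<in> Hm Q (ob R ?n) (ob C ?n)"
      using h by (intro Hm_closed CM_D(1)[OF f] Hm_comp[OF _ D1]) auto
    have ex: "\<exists>u\<in>vs (ob C (?n - 1)). ap (D C (?n - 1)) u = v" if "v \<in> vs (ob C ?n)" "ap (D C ?n) v = (\<lambda>i. 0)" for v
      using C(2) that unfolding acyc_def by blast
    obtain h' where h': "h' \<in> Hm Q (ob R ?n) (ob C (?n - 1))" "D C (?n - 1) * h' = f ?n - h * D R ?n"
      by (rule exprojD[OF R(2) cpxD(1)[OF C(1)] cpxD(1)[OF C(1)] cpxD(1)[OF C(1)] cpxD(3)[OF C(1)] cpxD(2)[OF C(1)] ex \<psi>])
         (use h in auto)
    have "D C (?n - 1) * (f (?n - 1) - h' * D R (?n - 1)) = f ?n * D R (?n - 1) - (f ?n - h * D R ?n) * D R (?n - 1)"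
      using CM_D(2)[OF f, of "?n - 1"] h'(2) by (simp add: right_diff_distrib flip: mult.assoc)
    also have "\<dots> = 0" using cpxD(5)[OF R(1), of ?n] by (simp add: left_diff_distrib mult.assoc)
    finally have "?P (Suc k) h' \<and> ?Q k h h'" using h' by (simp add: algebra_simps)
    then show "\<exists>h'. ?P (Suc k) h' \<and> ?Q k h h'" by blast
  qed
  then obtain hs where hs: "\<And>k. ?P k (hs k)" "\<And>k. ?Q k (hs k) (hs (Suc k))" by blast
  define H where "H n = (if n > N then 0 else hs (nat (N + 1 - n)))" for n
  have H: "H n \<in> Hm Q (ob R n) (ob C (n - 1))" for n
    using hs(1)[of "nat (N + 1 - n)"] by (auto simp: H_def Hm_closed)
  have "f n = D C (n - 1) * H n + H (n + 1) * D R n" for n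
  proof (cases "n \<le> N")
    case True
    have "hs 0 = 0" using hs(1)[of 0] HmD(1) N[of "N + 1"] by fastforce
    then have "H (n + 1) = hs (nat (N - n))" using True by (auto simp: H_def)
    moreover have "H n = hs (Suc (nat (N - n)))" using True by (simp add: H_def Suc_nat_eq_nat_zadd1 algebra_simps)
    ultimately show ?thesis using hs(2)[of "nat (N - n)"] True by simp
  next
    case False
    then have "f n \<in> bd (cdim C n) 0" using HmD(1)[OF CM_D(1)[OF f, of n]] N[of n] by simp
    then show ?thesis using False by (simp add: H_def)
  qed
  then show ?thesis unfolding null_def using H by blast
qed

(* Sizes such as n + 1 and the indices of the one-dimensional space would otherwise be rewritten to Suc. *)
declare One_nat_def [simp del]

text \<open>
  An element of a coordinate space is an operator from the one-dimensional space, so that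
  element chases are again computations in the ring.
\<close>

lift_definition colop :: "(nat \<Rightarrow> 'k::field) \<Rightarrow> 'k lin_op" is "\<lambda>v z i. v i * z 0"
  by (auto simp: algebra_simps)

lemma ap_col: "ap (colop v) z = (\<lambda>i. v i * z 0)"
  by transfer simp

lemma mult_col: "f * colop v = colop (ap f v)"
  by (rule lin_op_eqI) (simp add: ap_col mult.commute[of _ "_ 0"] ap_scale)

lemma col_bd: "v \<in> vsp n \<Longrightarrow> colop v \<in> bd n 1"
  by (auto simp: bd_def mult_col vsp_iff[symmetric] intro!: lin_op_eqI) (auto simp: ap_col ap_en vsp_iff)

lemma ap_col_uv: "ap (colop v) (uv 0) = v"
  by (simp add: ap_col uv_def)

lemma col_of_bd: "w \<in> bd n 1 \<Longrightarrow> colop (ap w (uv 0)) = w"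
  by (rule bd_eqI[of _ n 1]) (auto intro: col_bd bd_vsp simp: ap_col_uv)

lemma col_eq_iff: "colop v = colop w \<longleftrightarrow> v = w"
  by (metis ap_col_uv)

lemma col_zero: "colop (\<lambda>i. 0) = 0"
  by (rule lin_op_eqI) (simp add: ap_col)

lemma col_add: "colop (\<lambda>i. v i + w i) = colop v + colop w"
  by (rule lin_op_eqI) (simp add: ap_col distrib_right)

lemma vs_bd_conv:
  "(\<forall>v\<in>vsp n. P (colop v)) \<longleftrightarrow> (\<forall>w\<in>bd n 1. P w)" "(\<exists>v\<in>vsp n. P (colop v)) \<longleftrightarrow> (\<exists>w\<in>bd n 1. P w)"
  by (metis bd_vsp col_bd col_of_bd)+

lemma exact_conv:
  "(\<forall>v\<in>vsp n. ap d' v = (\<lambda>i. 0) \<longrightarrow> (\<exists>u\<in>vsp m. ap d u = v)) \<longleftrightarrow>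
   (\<forall>v\<in>bd n 1. d' * v = 0 \<longrightarrow> (\<exists>u\<in>bd m 1. d * u = v))"
  by (simp flip: vs_bd_conv add: mult_col col_eq_iff col_zero[symmetric])

lemma acyc_iff: "acyc C \<longleftrightarrow> (\<forall>n. \<forall>v\<in>bd (cdim C n) 1. D C n * v = 0 \<longrightarrow> (\<exists>u\<in>bd (cdim C (n - 1)) 1. D C (n - 1) * u = v))"
  unfolding acyc_def exact_conv ..

text \<open>
  Quasi-isomorphism as exactness of the mapping cone, written out on its two components; this
  one condition replaces injectivity and surjectivity on cohomology
  (\<open>quasi_iso_qis\<close>, \<open>qis_quasi_iso\<close>).
\<close>

definition qis :: "'n quiver \<Rightarrow> ('n::finite, 'k::field) cpx \<Rightarrow> ('n, 'k) cpx \<Rightarrow> (int \<Rightarrow> 'k lin_op) \<Rightarrow> bool" where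
  "qis Q W X s \<longleftrightarrow> s \<in> CM Q W X \<and> (\<forall>n. \<forall>x\<in>bd (cdim W (n + 1)) 1. \<forall>y\<in>bd (cdim X n) 1.
     D W (n + 1) * x = 0 \<and> s (n + 1) * x + D X n * y = 0 \<longrightarrow>
     (\<exists>x'\<in>bd (cdim W n) 1. \<exists>y'\<in>bd (cdim X (n - 1)) 1. x = - (D W n * x') \<and> y = s n * x' + D X (n - 1) * y'))"

lemma qis_CM: "qis Q W X s \<Longrightarrow> s \<in> CM Q W X" by (simp add: qis_def)

lemma qisD:
  assumes "qis Q W X s" "x \<in> bd (cdim W (n + 1)) 1" "y \<in> bd (cdim X n) 1"
    "D W (n + 1) * x = 0" "s (n + 1) * x + D X n * y = 0"
  obtains x' y' where "x' \<in> bd (cdim W n) 1" "y' \<in> bd (cdim X (n - 1)) 1"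
    "x = - (D W n * x')" "y = s n * x' + D X (n - 1) * y'"
  using assms unfolding qis_def by blast

lemma bd_comp1: "f \<in> Hm Q M N \<Longrightarrow> x \<in> bd (mdim M) 1 \<Longrightarrow> f * x \<in> bd (mdim N) 1"
  using HmD(1) bd_closed(6) by blast

lemma D_bd1: "bounded_cpx Q X \<Longrightarrow> x \<in> bd (cdim X n) 1 \<Longrightarrow> D X n * x \<in> bd (cdim X (n + 1)) 1"
  by (rule bd_comp1[OF cpxD(2)])

lemma CM_bd1: "f \<in> CM Q X Y \<Longrightarrow> x \<in> bd (cdim X n) 1 \<Longrightarrow> f n * x \<in> bd (cdim Y n) 1"
  by (rule bd_comp1[OF CM_D(1)])

lemma cocycles_iff:
  assumes "bounded_cpx Q X"
  shows "v \<in> cocycles X n \<longleftrightarrow> v \<in> carrier_vec (cdim X n) \<and> D X n * colop (vf v) = 0"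
proof -
  have d: "dim_row (diff X n) = cdim X (n + 1)" "dim_col (diff X n) = cdim X n"
    using assms by (auto simp: bounded_cpx_def mod_hom_def)
  have "diff X n *\<^sub>v v = 0\<^sub>v (cdim X (n + 1)) \<longleftrightarrow> D X n * colop (vf v) = 0" if v: "v \<in> carrier_vec (cdim X n)"
  proof -
    have "diff X n *\<^sub>v v \<in> carrier_vec (cdim X (n + 1))" by (rule carrier_vecI) (simp add: d)
    from vf_inj[OF this zero_carrier_vec]
    have "diff X n *\<^sub>v v = 0\<^sub>v (cdim X (n + 1)) \<longleftrightarrow> vf (diff X n *\<^sub>v v) = (\<lambda>i. 0)"
      unfolding vf_zero by (metis vf_zero)
    then show ?thesis using v d by (simp add: vf_mult mult_col col_eq_iff flip: col_zero)
  qed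
  then show ?thesis by (auto simp: cocycles_def)
qed

lemma coboundaries_iff:
  assumes "bounded_cpx Q X"
  shows "v \<in> coboundaries X n \<longleftrightarrow> v \<in> carrier_vec (cdim X n) \<and> (\<exists>u\<in>bd (cdim X (n - 1)) 1. colop (vf v) = D X (n - 1) * u)"
proof -
  have "diff X (n - 1) \<in> mod_hom Q (ob X (n - 1)) (ob X (n - 1 + 1))" using assms unfolding bounded_cpx_def by blast
  then have d: "dim_row (diff X (n - 1)) = cdim X n" "dim_col (diff X (n - 1)) = cdim X (n - 1)"
    by (auto simp: mod_hom_def)
  have 1: "vf (diff X (n - 1) *\<^sub>v u) = ap (D X (n - 1)) (vf u)" if "u \<in> carrier_vec (cdim X (n - 1))" for u
    using that d by (simp add: vf_mult)
  show ?thesis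
  proof
    assume "v \<in> coboundaries X n"
    then obtain u where u: "u \<in> carrier_vec (cdim X (n - 1))" "v = diff X (n - 1) *\<^sub>v u" by (auto simp: coboundaries_def)
    have "colop (vf v) = D X (n - 1) * colop (vf u)" using u 1[OF u(1)] by (simp add: mult_col)
    moreover have "v \<in> carrier_vec (cdim X n)" unfolding u(2) by (rule carrier_vecI) (simp add: d)
    ultimately show "v \<in> carrier_vec (cdim X n) \<and> (\<exists>u\<in>bd (cdim X (n - 1)) 1. colop (vf v) = D X (n - 1) * u)"
      using col_bd[OF vf_vsp[OF u(1)]] by blast
  next
    assume v: "v \<in> carrier_vec (cdim X n) \<and> (\<exists>u\<in>bd (cdim X (n - 1)) 1. colop (vf v) = D X (n - 1) * u)"
    then obtain u where u: "u \<in> vsp (cdim X (n - 1))" "colop (vf v) = D X (n - 1) * colop u"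
      by (metis bd_vsp col_of_bd)
    then obtain w where w: "w \<in> carrier_vec (cdim X (n - 1))" "vf w = u" using vf_surj by blast
    have "vf v = vf (diff X (n - 1) *\<^sub>v w)" using u w 1[of w] by (simp add: mult_col col_eq_iff)
    moreover have "diff X (n - 1) *\<^sub>v w \<in> carrier_vec (cdim X n)" by (rule carrier_vecI) (simp add: d)
    ultimately have "v = diff X (n - 1) *\<^sub>v w" using v vf_inj by blast
    then show "v \<in> coboundaries X n" using w by (auto simp: coboundaries_def)
  qed
qed

lemma quasi_iso_qis:
  assumes W: "bounded_cpx Q W" and X: "bounded_cpx Q X" and q: "quasi_iso Q W X f"
  shows "qis Q W X (\<lambda>n. emb (f n))"
proof -
  have f: "f \<in> chain_map Q W X" using q by (simp add: quasi_iso_def)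
  note F = chain_map_emb[OF W X f]
  have vec: "\<exists>v\<in>carrier_vec n. colop (vf v) = x" if "x \<in> bd n 1" for x :: "'b lin_op" and n
    using vf_surj[OF bd_vsp[OF that]] col_of_bd[OF that] by metis
  have fv: "colop (vf (f n *\<^sub>v v)) = emb (f n) * colop (vf v)" "f n *\<^sub>v v \<in> carrier_vec (cdim X n)"
    if "v \<in> carrier_vec (cdim W n)" for n v
    using that chain_map_carrier[OF f, of n] by (auto simp: vf_mult mult_col)
  show ?thesis
    unfolding qis_def
  proof (intro conjI F allI ballI impI)
    fix n x y assume x: "x \<in> bd (cdim W (n + 1)) 1" and y: "y \<in> bd (cdim X n) 1"
      and *: "D W (n + 1) * x = 0 \<and> emb (f (n + 1)) * x + D X n * y = 0"
    obtain v where v: "v \<in> carrier_vec (cdim W (n + 1))" "colop (vf v) = x" using vec[OF x] by blast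
    have "emb (f (n + 1)) * x = D X n * (- y)" using * by (simp add: add_eq_0_iff2)
    then have "f (n + 1) *\<^sub>v v \<in> coboundaries X (n + 1)"
      using y v fv[OF v(1)] by (auto simp: coboundaries_iff[OF X] intro!: bexI[of _ "- y"] bd_closed)
    moreover have "v \<in> cocycles W (n + 1)" using * v by (simp add: cocycles_iff[OF W])
    ultimately have "v \<in> coboundaries W (n + 1)" using q by (auto simp: quasi_iso_def)
    then obtain u where u: "u \<in> bd (cdim W n) 1" "x = D W n * u" using v by (auto simp: coboundaries_iff[OF W])
    have "y + emb (f n) * u \<in> bd (cdim X n) 1" by (intro bd_closed y CM_bd1[OF F] u)
    then obtain z where z: "z \<in> carrier_vec (cdim X n)" "colop (vf z) = y + emb (f n) * u" using vec by blast
    have "D X n * (y + emb (f n) * u) = 0"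
      using * CM_D(2)[OF F, of n] u(2) by (simp add: distrib_left add.commute flip: mult.assoc)
    then have "z \<in> cocycles X n" using z by (simp add: cocycles_iff[OF X])
    then obtain v' u' where vu: "v' \<in> cocycles W n" "u' \<in> coboundaries X n" "z = f n *\<^sub>v v' + u'"
      using q unfolding quasi_iso_def by blast
    have v': "v' \<in> carrier_vec (cdim W n)" "D W n * colop (vf v') = 0" using vu(1) by (auto simp: cocycles_iff[OF W])
    obtain y' where y': "y' \<in> bd (cdim X (n - 1)) 1" "u' \<in> carrier_vec (cdim X n)" "colop (vf u') = D X (n - 1) * y'"
      using vu(2) by (auto simp: coboundaries_iff[OF X])
    have "colop (vf z) = colop (vf (f n *\<^sub>v v')) + colop (vf u')"
      unfolding vu(3) vf_add[OF fv(2)[OF v'(1)] y'(2)] by (rule col_add)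
    then have "y + emb (f n) * u = emb (f n) * colop (vf v') + D X (n - 1) * y'" using z fv[OF v'(1)] y' by simp
    then have "y = emb (f n) * (colop (vf v') - u) + D X (n - 1) * y'"
      by (simp add: right_diff_distrib algebra_simps)
    moreover have "x = - (D W n * (colop (vf v') - u))" using u v' by (simp add: right_diff_distrib)
    ultimately show "\<exists>x'\<in>bd (cdim W n) 1. \<exists>y'\<in>bd (cdim X (n - 1)) 1.
        x = - (D W n * x') \<and> y = emb (f n) * x' + D X (n - 1) * y'"
      using y' u col_bd[OF vf_vsp[OF v'(1)]] by (blast intro: bd_closed)
  qed
qed

lemma qis_quasi_iso:
  assumes W: "bounded_cpx Q W" and X: "bounded_cpx Q X" and f: "f \<in> chain_map Q W X"
    and q: "qis Q W X (\<lambda>n. emb (f n))"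
  shows "quasi_iso Q W X f"
  unfolding quasi_iso_def
proof (intro conjI f allI ballI impI)
  note F = chain_map_emb[OF W X f]
  have fv: "colop (vf (f n *\<^sub>v v)) = emb (f n) * colop (vf v)" "f n *\<^sub>v v \<in> carrier_vec (cdim X n)"
    if "v \<in> carrier_vec (cdim W n)" for n v
    using that chain_map_carrier[OF f, of n] by (auto simp: vf_mult mult_col)
  {
    fix n v assume v: "v \<in> cocycles W n" and b: "f n *\<^sub>v v \<in> coboundaries X n"
    have v': "v \<in> carrier_vec (cdim W n)" "D W n * colop (vf v) = 0" using v by (auto simp: cocycles_iff[OF W])
    obtain u where u: "u \<in> bd (cdim X (n - 1)) 1" "emb (f n) * colop (vf v) = D X (n - 1) * u"
      using b fv[OF v'(1)] by (auto simp: coboundaries_iff[OF X])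
    obtain x' where "x' \<in> bd (cdim W (n - 1)) 1" "colop (vf v) = - (D W (n - 1) * x')"
      using qisD[OF q, of "colop (vf v)" "n - 1" "- u"] u v' col_bd[OF vf_vsp[OF v'(1)]] by (auto simp: bd_closed)
    then show "v \<in> coboundaries W n"
      using v' by (auto simp: coboundaries_iff[OF W] intro!: bexI[of _ "- x'"] bd_closed)
  next
    fix n w assume w: "w \<in> cocycles X n"
    then have w': "w \<in> carrier_vec (cdim X n)" "D X n * colop (vf w) = 0" by (auto simp: cocycles_iff[OF X])
    obtain x' y' where x: "x' \<in> bd (cdim W n) 1" "y' \<in> bd (cdim X (n - 1)) 1" "0 = - (D W n * x')"
      "colop (vf w) = emb (f n) * x' + D X (n - 1) * y'"
      using qisD[OF q, of 0 n "colop (vf w)"] w' col_bd[OF vf_vsp[OF w'(1)]] by (auto simp: bd_closed)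
    obtain v where v: "v \<in> carrier_vec (cdim W n)" "colop (vf v) = x'"
      using vf_surj[OF bd_vsp[OF x(1)]] col_of_bd[OF x(1)] by metis
    have b: "D X (n - 1) * y' \<in> bd (cdim X n) 1" using D_bd1[OF X x(2)] by simp
    obtain u where u: "u \<in> carrier_vec (cdim X n)" "colop (vf u) = D X (n - 1) * y'"
      using vf_surj[OF bd_vsp[OF b]] col_of_bd[OF b] by metis
    have "colop (vf w) = colop (vf (f n *\<^sub>v v + u))"
      unfolding vf_add[OF fv(2)[OF v(1)] u(1)] x(4) col_add using fv(1)[OF v(1)] u v by simp
    then have "w = f n *\<^sub>v v + u"
      using w' u fv(2)[OF v(1)] by (intro vf_inj[of w "cdim X n"]) (auto simp: col_eq_iff)
    moreover have "v \<in> cocycles W n" using v x by (simp add: cocycles_iff[OF W])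
    moreover have "u \<in> coboundaries X n" using u x by (auto simp: coboundaries_iff[OF X])
    ultimately show "\<exists>v\<in>cocycles W n. \<exists>u\<in>coboundaries X n. w = f n *\<^sub>v v + u" by blast
  }
qed

abbreviation cn :: "('n, 'k::field) cpx \<Rightarrow> ('n, 'k) cpx \<Rightarrow> (int \<Rightarrow> 'k lin_op) \<Rightarrow> ('n, 'k) cpx" where
  "cn X Y f \<equiv> cone X Y (mts X Y f)"

lemma D_cn:
  assumes X: "bounded_cpx Q X" and Y: "bounded_cpx Q Y" and f: "f \<in> CM Q X Y"
  shows "D (cn X Y f) n = cb X Y (n + 1) * f (n + 1) * cp X Y n + cb X Y (n + 1) * D Y n * cq X Y n
     - ca X Y (n + 1) * D X (n + 1) * cp X Y n"
  by (simp add: D_cone(1)[OF X Y mts_emb(1)[OF X Y f]] mts_emb(2)[OF X Y f])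

lemma bounded_cn: "bounded_cpx Q X \<Longrightarrow> bounded_cpx Q Y \<Longrightarrow> f \<in> CM Q X Y \<Longrightarrow> bounded_cpx Q (cn X Y f)"
  by (rule bounded_cone[OF _ _ mts_emb(1)])

lemma D_cn_in:
  assumes X: "bounded_cpx Q X" and Y: "bounded_cpx Q Y" and f: "f \<in> CM Q X Y"
    and x: "x \<in> bd (cdim X (n + 1)) m" and y: "y \<in> bd (cdim Y n) m"
  shows "D (cn X Y f) n * (ca X Y n * x + cb X Y n * y) =
    ca X Y (n + 1) * (- (D X (n + 1) * x)) + cb X Y (n + 1) * (f (n + 1) * x + D Y n * y)"
  unfolding D_cn[OF X Y f]
  by (simp add: distrib_left left_diff_distrib distrib_right right_diff_distrib mult.assoc pr_in_assoc bdD(1)[OF x] bdD(1)[OF y])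

lemma split_bd:
  assumes "v \<in> bd (a + b) m"
  shows "v = in1 a b * (pr1 a b * v) + in2 a b * (pr2 a b * v)"
    "pr1 a b * v \<in> bd a m" "pr2 a b * v \<in> bd b m"
  using bdD(1)[OF assms, folded pr_in(5)] bd_closed(6)[OF blocks_bd(3) assms] bd_closed(6)[OF blocks_bd(4) assms]
  by (auto simp: mult.assoc distrib_right)

lemma in_eq_iff:
  assumes "x \<in> bd a m" "y \<in> bd b m" "x' \<in> bd a m" "y' \<in> bd b m"
  shows "in1 a b * x + in2 a b * y = in1 a b * x' + in2 a b * y' \<longleftrightarrow> x = x' \<and> y = y'"
proof
  assume e: "in1 a b * x + in2 a b * y = in1 a b * x' + in2 a b * y'"
  have "pr1 a b * (in1 a b * x + in2 a b * y) = x" "pr2 a b * (in1 a b * x + in2 a b * y) = y"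
    "pr1 a b * (in1 a b * x' + in2 a b * y') = x'" "pr2 a b * (in1 a b * x' + in2 a b * y') = y'"
    using assms by (simp_all add: distrib_left pr_in_assoc bdD(1))
  then show "x = x' \<and> y = y'" using e by metis
qed simp

lemma in_bd: "x \<in> bd a m \<Longrightarrow> y \<in> bd b m \<Longrightarrow> in1 a b * x + in2 a b * y \<in> bd (a + b) m"
  by (intro bd_closed(2) bd_closed(6)[OF blocks_bd(1)] bd_closed(6)[OF blocks_bd(2)])

lemma qis_acyc_cone:
  assumes W: "bounded_cpx Q W" and X: "bounded_cpx Q X" and q: "qis Q W X s"
  shows "acyc (cn W X s)"
  unfolding acyc_iff
proof (intro allI ballI impI)
  note s = qis_CM[OF q]
  fix n v assume v: "v \<in> bd (cdim (cn W X s) n) 1" and z: "D (cn W X s) n * v = 0"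
  have v': "v \<in> bd (cdim W (n + 1) + cdim X n) 1" using v by simp
  define x y where "x = cp W X n * v" and "y = cq W X n * v"
  have xy: "v = ca W X n * x + cb W X n * y" "x \<in> bd (cdim W (n + 1)) 1" "y \<in> bd (cdim X n) 1"
    unfolding x_def y_def by (rule split_bd[OF v'])+
  have b: "- (D W (n + 1) * x) \<in> bd (cdim W (n + 1 + 1)) 1" "s (n + 1) * x + D X n * y \<in> bd (cdim X (n + 1)) 1"
    by (intro bd_closed(2,4) D_bd1[OF W] D_bd1[OF X] CM_bd1[OF s] xy)+
  have "- (D W (n + 1) * x) = 0 \<and> s (n + 1) * x + D X n * y = 0"
    using z in_eq_iff[OF b bd_closed(1) bd_closed(1)] by (simp add: xy(1) D_cn_in[OF W X s xy(2,3)])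
  then obtain x' y' where x': "x' \<in> bd (cdim W n) 1" "y' \<in> bd (cdim X (n - 1)) 1"
    "x = - (D W n * x')" "y = s n * x' + D X (n - 1) * y'"
    using qisD[OF q xy(2,3)] by (metis neg_equal_0_iff_equal)
  have x'': "x' \<in> bd (cdim W (n - 1 + 1)) 1" using x' by simp
  show "\<exists>u\<in>bd (cdim (cn W X s) (n - 1)) 1. D (cn W X s) (n - 1) * u = v"
  proof
    show "D (cn W X s) (n - 1) * (ca W X (n - 1) * x' + cb W X (n - 1) * y') = v"
      using D_cn_in[OF W X s x'' x'(2)] by (simp add: xy(1) x'(3,4))
    show "ca W X (n - 1) * x' + cb W X (n - 1) * y' \<in> bd (cdim (cn W X s) (n - 1)) 1"
      using in_bd[OF x'' x'(2)] by simp
  qed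
qed

definition proj_cpx :: "'n quiver \<Rightarrow> ('n::finite, 'k::field) cpx \<Rightarrow> bool" where
  "proj_cpx Q R \<longleftrightarrow> bounded_cpx Q R \<and> (\<forall>n. exproj Q (ob R n))"

lemma proj_cpxD: "proj_cpx Q R \<Longrightarrow> bounded_cpx Q R" "proj_cpx Q R \<Longrightarrow> exproj Q (ob R n)"
  by (auto simp: proj_cpx_def)

lemma cb_CM: "bounded_cpx Q X \<Longrightarrow> bounded_cpx Q Y \<Longrightarrow> f \<in> CM Q X Y \<Longrightarrow> (\<lambda>n. cb X Y n) \<in> CM Q Y (cn X Y f)"
  by (rule cone_maps[OF _ _ mts_emb(1)])

text \<open>
  The component in \<open>X[1]\<close> of a null-homotopy into the cone is the factorisation,
  its component in \<open>Y\<close> the homotopy that makes the triangle commute.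
\<close>

lemma weak_kernel:
  assumes X: "bounded_cpx Q X" and Y: "bounded_cpx Q Y" and R: "bounded_cpx Q R"
    and f: "f \<in> CM Q X Y" and g: "g \<in> CM Q R Y" and z: "null Q R (cn X Y f) (\<lambda>n. cb X Y n * g n)"
  obtains h where "h \<in> CM Q R X" "null Q R Y (\<lambda>n. f n * h n - g n)"
proof -
  obtain H where H: "\<And>n. H n \<in> Hm Q (ob R n) (ob (cn X Y f) (n - 1))"
    "\<And>n. cb X Y n * g n = D (cn X Y f) (n - 1) * H n + H (n + 1) * D R n"
    using z unfolding null_def by blast
  define h k where "h n = cp X Y (n - 1) * H n" and "k n = cq X Y (n - 1) * H n" for n
  have hH: "h n \<in> Hm Q (ob R n) (ob X n)" "k n \<in> Hm Q (ob R n) (ob Y (n - 1))" for n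
    using Hm_comp[OF cone_Hm(3)[OF X Y, of "n - 1"], of "H n" "ob R n"] Hm_comp[OF cone_Hm(4)[OF X Y, of "n - 1"], of "H n" "ob R n"]
      H(1)[of n] by (simp_all add: h_def k_def)
  have Hs: "H n = ca X Y (n - 1) * h n + cb X Y (n - 1) * k n" for n
    unfolding h_def k_def using HmD(1)[OF H(1)[of n]] by (intro split_bd) simp
  have e: "cb X Y n * g n = (ca X Y n * (- (D X n * h n)) + cb X Y n * (f n * h n + D Y (n - 1) * k n))
      + (ca X Y n * (h (n + 1) * D R n) + cb X Y n * (k (n + 1) * D R n))" for n
  proof -
    have "D (cn X Y f) (n - 1) * H n = ca X Y n * (- (D X n * h n)) + cb X Y n * (f n * h n + D Y (n - 1) * k n)"
      unfolding Hs using D_cn_in[OF X Y f, of "h n" "n - 1" "cdim R n" "k n"] HmD(1)[OF hH(1)[of n]] HmD(1)[OF hH(2)[of n]] by simp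
    moreover have "H (n + 1) * D R n = ca X Y n * (h (n + 1) * D R n) + cb X Y n * (k (n + 1) * D R n)"
      using Hs[of "n + 1"] by (simp add: distrib_right mult.assoc)
    ultimately show ?thesis using H(2)[of n] by simp
  qed
  have e': "0 = - (D X n * h n) + h (n + 1) * D R n \<and> g n = f n * h n + D Y (n - 1) * k n + k (n + 1) * D R n" for n
  proof -
    have k1: "k (n + 1) \<in> Hm Q (ob R (n + 1)) (ob Y n)" using hH(2)[of "n + 1"] by simp
    have t: "- (D X n * h n) + h (n + 1) * D R n \<in> Hm Q (ob R n) (ob X (n + 1))"
      "f n * h n + D Y (n - 1) * k n + k (n + 1) * D R n \<in> Hm Q (ob R n) (ob Y n)"
      by (intro Hm_closed Hm_comp[OF cpxD(2)[OF X] hH(1)] Hm_comp[OF hH(1) cpxD(2)[OF R]]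
          Hm_comp[OF CM_D(1)[OF f] hH(1)] Hm_comp[OF cpxD(3)[OF Y] hH(2)] Hm_comp[OF k1 cpxD(2)[OF R]])+
    have "ca X Y n * 0 + cb X Y n * g n = ca X Y n * (- (D X n * h n) + h (n + 1) * D R n)
      + cb X Y n * (f n * h n + D Y (n - 1) * k n + k (n + 1) * D R n)"
      using e[of n] by (simp add: algebra_simps)
    then show ?thesis
      using in_eq_iff[OF bd_closed(1) HmD(1)[OF CM_D(1)[OF g]] HmD(1)[OF t(1)] HmD(1)[OF t(2)]] by blast
  qed
  have "h \<in> CM Q R X" using hH(1) e' by (auto simp: CM_def)
  moreover have "null Q R Y (\<lambda>n. f n * h n - g n)"
    unfolding null_def
  proof (intro exI[of _ "\<lambda>n. - k n"] allI conjI)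
    fix n
    show "- k n \<in> Hm Q (ob R n) (ob Y (n - 1))" by (rule Hm_closed(4)[OF hH(2)])
    have "g n = f n * h n + D Y (n - 1) * k n + k (n + 1) * D R n" using e' by blast
    then show "f n * h n - g n = D Y (n - 1) * - k n + - k (n + 1) * D R n" by simp
  qed
  ultimately show ?thesis using that by blast
qed

text \<open>
  The composite to the cone of a quasi-isomorphism vanishes because that cone is acyclic.
\<close>

lemma lift_ex:
  assumes R: "proj_cpx Q R" and W: "bounded_cpx Q W" and X: "bounded_cpx Q X" and s: "qis Q W X s" and r: "r \<in> CM Q R X"
  obtains r' where "r' \<in> CM Q R W" "null Q R X (\<lambda>n. s n * r' n - r n)"
proof (rule weak_kernel[OF W X proj_cpxD(1)[OF R] qis_CM[OF s] r])
  show "null Q R (cn W X s) (\<lambda>n. cb W X n * r n)"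
    by (rule null_acyclic[OF proj_cpxD[OF R] bounded_cn[OF W X qis_CM[OF s]] qis_acyc_cone[OF W X s]])
       (rule CM_comp[OF cb_CM[OF W X qis_CM[OF s]] r])
qed

text \<open>
  The inverse of the shift; sources of maps into a cone are desuspensions.
\<close>

definition ush :: "('n, 'k::field) cpx \<Rightarrow> ('n, 'k) cpx" where
  "ush X = \<lparr>ob = (\<lambda>n. ob X (n - 1)), diff = (\<lambda>n. - diff X (n - 1))\<rparr>"

lemma ob_ush [simp]: "ob (ush X) n = ob X (n - 1)" by (simp add: ush_def)
lemma D_ush: "D (ush X) n = - D X (n - 1)" by (simp add: ush_def emb_uminus)
lemma ob_shift [simp]: "ob (shift X) n = ob X (n + 1)" by (simp add: shift_def)
lemma D_shift: "D (shift X) n = - D X (n + 1)" by (simp add: shift_def emb_uminus)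

lemma bounded_ush: "bounded_cpx Q X \<Longrightarrow> bounded_cpx Q (ush X)"
proof (rule cpxI)
  assume X: "bounded_cpx Q X"
  show "is_mod Q (ob (ush X) n)" for n by (simp add: cpxD[OF X])
  have "diff X (n - 1) \<in> mod_hom Q (ob X (n - 1)) (ob X (n - 1 + 1))" for n using X unfolding bounded_cpx_def by blast
  then show "diff (ush X) n \<in> carrier_mat (cdim (ush X) (n + 1)) (cdim (ush X) n)" for n
    by (simp add: ush_def mod_hom_def)
  show "D (ush X) n \<in> Hm Q (ob (ush X) n) (ob (ush X) (n + 1))" for n
    using cpxD(3)[OF X, of n] by (simp add: D_ush Hm_closed)
  show "D (ush X) (n + 1) * D (ush X) n = 0" for n using cpxD(5)[OF X, of n] by (simp add: D_ush)
  have "{n. cdim (ush X) n \<noteq> 0} = (\<lambda>n. n + 1) ` {n. cdim X n \<noteq> 0}" by (auto simp: image_iff) (metis diff_add_cancel)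
  then show "finite {n. cdim (ush X) n \<noteq> 0}" using X by (simp add: bounded_cpx_def)
qed

lemma bounded_shift: "bounded_cpx Q X \<Longrightarrow> bounded_cpx Q (shift X)"
proof (rule cpxI)
  assume X: "bounded_cpx Q X"
  show "is_mod Q (ob (shift X) n)" for n by (simp add: cpxD[OF X])
  have "diff X (n + 1) \<in> mod_hom Q (ob X (n + 1)) (ob X (n + 1 + 1))" for n using X unfolding bounded_cpx_def by blast
  then show "diff (shift X) n \<in> carrier_mat (cdim (shift X) (n + 1)) (cdim (shift X) n)" for n
    by (simp add: shift_def mod_hom_def)
  show "D (shift X) n \<in> Hm Q (ob (shift X) n) (ob (shift X) (n + 1))" for n
    using cpxD(2)[OF X, of "n + 1"] by (simp add: D_shift Hm_closed)
  show "D (shift X) (n + 1) * D (shift X) n = 0" for n using cpxD(4)[OF X, of "n + 1"] by (simp add: D_shift)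
  have "{n. cdim (shift X) n \<noteq> 0} = (\<lambda>n. n - 1) ` {n. cdim X n \<noteq> 0}" by (auto simp: image_iff) (metis add_diff_cancel)
  then show "finite {n. cdim (shift X) n \<noteq> 0}" using X by (simp add: bounded_cpx_def)
qed

lemma shift_ush: "shift (ush X) = X" by (simp add: shift_def ush_def)
lemma ush_shift: "ush (shift X) = X" by (simp add: shift_def ush_def)

lemma proj_ush: "proj_cpx Q X \<Longrightarrow> proj_cpx Q (ush X)"
  by (simp add: proj_cpx_def bounded_ush)

lemma proj_shift: "proj_cpx Q X \<Longrightarrow> proj_cpx Q (shift X)"
  by (simp add: proj_cpx_def bounded_shift)

lemma proj_cn: "proj_cpx Q X \<Longrightarrow> proj_cpx Q Y \<Longrightarrow> f \<in> CM Q X Y \<Longrightarrow> proj_cpx Q (cn X Y f)"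
  by (auto simp: proj_cpx_def bounded_cn exproj_sum)

lemma CM_shift: "f \<in> CM Q X Y \<Longrightarrow> (\<lambda>n. f (n + 1)) \<in> CM Q (shift X) (shift Y)"
  by (simp add: CM_def D_shift)

lemma CM_ush: "f \<in> CM Q X Y \<Longrightarrow> (\<lambda>n. f (n - 1)) \<in> CM Q (ush X) (ush Y)"
  by (auto simp: CM_def D_ush dest: spec[of _ "_ - 1"])

lemma null_shift: "null Q X Y f \<Longrightarrow> null Q (shift X) (shift Y) (\<lambda>n. f (n + 1))"
proof -
  assume "null Q X Y f"
  then obtain h where h: "\<And>n. h n \<in> Hm Q (ob X n) (ob Y (n - 1))"
    "\<And>n. f n = D Y (n - 1) * h n + h (n + 1) * D X n" unfolding null_def by blast
  show ?thesis unfolding null_def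
    by (intro exI[of _ "\<lambda>n. - h (n + 1)"] allI conjI)
       (use h(1)[of "n + 1" for n] h(2)[of "n + 1" for n] in \<open>simp_all add: D_shift Hm_closed\<close>)
qed

lemma null_ush: "null Q X Y f \<Longrightarrow> null Q (ush X) (ush Y) (\<lambda>n. f (n - 1))"
proof -
  assume "null Q X Y f"
  then obtain h where h: "\<And>n. h n \<in> Hm Q (ob X n) (ob Y (n - 1))"
    "\<And>n. f n = D Y (n - 1) * h n + h (n + 1) * D X n" unfolding null_def by blast
  show ?thesis unfolding null_def
    by (intro exI[of _ "\<lambda>n. - h (n - 1)"] allI conjI)
       (use h(1)[of "n - 1" for n] h(2)[of "n - 1" for n] in \<open>simp_all add: D_ush Hm_closed\<close>)
qed

lemma lift_unique:
  assumes R: "proj_cpx Q R" and W: "bounded_cpx Q W" and X: "bounded_cpx Q X" and s: "qis Q W X s"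
    and r: "r \<in> CM Q R W" and z: "null Q R X (\<lambda>n. s n * r n)"
  shows "null Q R W r"
proof -
  let ?C = "cn W X s"
  note sC = qis_CM[OF s] and R' = proj_cpxD(1)[OF R]
  obtain k where k: "\<And>n. k n \<in> Hm Q (ob R n) (ob X (n - 1))" "\<And>n. s n * r n = D X (n - 1) * k n + k (n + 1) * D R n"
    using z unfolding null_def by blast
  define F where "F n = ca W X (n - 1) * r n + cb W X (n - 1) * (- k n)" for n
  have rb: "r n \<in> Hm Q (ob R n) (ob W (n - 1 + 1))" for n using CM_D(1)[OF r] by simp
  have FH: "F n \<in> Hm Q (ob R n) (ob (ush ?C) n)" for n
    unfolding F_def using Hm_comp[OF cone_Hm(1)[OF W X, of "n - 1"] rb[of n]] Hm_comp[OF cone_Hm(2)[OF W X, of "n - 1"] k(1)[of n]]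
    by (simp add: Hm_closed(3))
  have "F \<in> CM Q R (ush ?C)"
  proof -
    have "D (ush ?C) n * F n = F (n + 1) * D R n" for n
    proof -
      have "D (ush ?C) n * F n = - (ca W X n * (- (D W n * r n)) + cb W X n * (s n * r n + D X (n - 1) * (- k n)))"
        using D_cn_in[OF W X sC HmD(1)[OF rb] HmD(1)[OF Hm_closed(4)[OF k(1)]], of n] by (simp add: D_ush F_def)
      also have "\<dots> = F (n + 1) * D R n"
        using k(2)[of n] CM_D(2)[OF r, of n] by (simp add: F_def algebra_simps)
      finally show ?thesis .
    qed
    then show ?thesis using FH by (simp add: CM_def)
  qed
  moreover have "acyc (ush ?C)"
  proof -
    have a: "acyc ?C" by (rule qis_acyc_cone[OF W X s])
    show ?thesis unfolding acyc_iff
    proof (intro allI ballI impI)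
      fix n v assume "v \<in> bd (cdim (ush ?C) n) 1" "D (ush ?C) n * v = 0"
      then obtain u where "u \<in> bd (cdim ?C (n - 1 - 1)) 1" "D ?C (n - 1 - 1) * u = v"
        using a[unfolded acyc_iff, rule_format, of v "n - 1"] by (auto simp: D_ush)
      then show "\<exists>u\<in>bd (cdim (ush ?C) (n - 1)) 1. D (ush ?C) (n - 1) * u = v"
        by (intro bexI[of _ "- u"]) (auto simp: D_ush intro: bd_closed(4))
    qed
  qed
  ultimately have "null Q R (ush ?C) F"
    by (rule null_acyclic[OF proj_cpxD[OF R] bounded_ush[OF bounded_cn[OF W X sC]], rotated])
  then obtain H where H: "\<And>n. H n \<in> Hm Q (ob R n) (ob (ush ?C) (n - 1))"
    "\<And>n. F n = D (ush ?C) (n - 1) * H n + H (n + 1) * D R n" unfolding null_def by blast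
  define h where "h n = cp W X (n - 1 - 1) * H n" for n
  have h: "h n \<in> Hm Q (ob R n) (ob W (n - 1))" for n
    using Hm_comp[OF cone_Hm(3)[OF W X, of "n - 1 - 1"], of "H n" "ob R n"] H(1)[of n] by (simp add: h_def)
  have "r n = D W (n - 1) * h n + h (n + 1) * D R n" for n
  proof -
    have eD: "idm (ob W n) * (D W (n - 1) * g) = D W (n - 1) * g" for g
      using en_assoc[OF cpxD(3)[OF W, of n]] by simp
    have "cp W X (n - 1) * F n = r n"
      using CM_idm(1)[OF r, of n] by (simp add: F_def distrib_left pr_in_assoc right_diff_distrib)
    moreover have "cp W X (n - 1) * (D (ush ?C) (n - 1) * H n) = D W (n - 1) * h n"
      unfolding D_ush D_cn[OF W X sC]
      by (simp add: distrib_left left_diff_distrib distrib_right right_diff_distrib mult.assoc pr_in_assoc h_def eD)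
    ultimately show ?thesis using H(2)[of n] by (simp add: distrib_left h_def mult.assoc)
  qed
  then show ?thesis unfolding null_def using h by blast
qed

section \<open>Closure properties of quasi-isomorphisms\<close>

lemma qis_id: "bounded_cpx Q X \<Longrightarrow> qis Q X X (\<lambda>n. idm (ob X n))"
  unfolding qis_def
proof (intro conjI CM_id allI ballI impI)
  fix n x y assume "bounded_cpx Q X" and x: "x \<in> bd (cdim X (n + 1)) 1" "y \<in> bd (cdim X n) 1"
    and "D X (n + 1) * x = 0 \<and> idm (ob X (n + 1)) * x + D X n * y = 0"
  then have "x = - (D X n * y)" by (simp add: bdD(1) add_eq_0_iff2)
  then show "\<exists>x'\<in>bd (cdim X n) 1. \<exists>y'\<in>bd (cdim X (n - 1)) 1. x = - (D X n * x') \<and> y = idm (ob X n) * x' + D X (n - 1) * y'"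
    using x by (intro bexI[of _ y] bexI[of _ 0]) (auto simp: bdD(1) bd_closed)
qed

lemma qis_comp:
  assumes s: "qis Q W X s" and t: "qis Q X Y t"
  shows "qis Q W Y (\<lambda>n. t n * s n)"
  unfolding qis_def
proof (intro conjI CM_comp[OF qis_CM[OF t] qis_CM[OF s]] allI ballI impI)
  note sC = CM_D(2)[OF qis_CM[OF s]] and tC = CM_D(2)[OF qis_CM[OF t]]
  fix n x y assume x: "x \<in> bd (cdim W (n + 1)) 1" and y: "y \<in> bd (cdim Y n) 1"
    and *: "D W (n + 1) * x = 0 \<and> t (n + 1) * s (n + 1) * x + D Y n * y = 0"
  have "D X (n + 1) * (s (n + 1) * x) = 0" using * sC[of "n + 1"] by (simp add: mult.assoc flip: mult.assoc[of "D X (n + 1)"])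
  then obtain a b where a: "a \<in> bd (cdim X n) 1" "b \<in> bd (cdim Y (n - 1)) 1" "s (n + 1) * x = - (D X n * a)"
    "y = t n * a + D Y (n - 1) * b"
    using qisD[OF t CM_bd1[OF qis_CM[OF s] x] y] * by (auto simp: mult.assoc)
  obtain x' y' where x': "x' \<in> bd (cdim W n) 1" "y' \<in> bd (cdim X (n - 1)) 1" "x = - (D W n * x')" "a = s n * x' + D X (n - 1) * y'"
    using qisD[OF s x a(1)] * a(3) by (metis ab_group_add_class.ab_left_minus)
  have "y = t n * s n * x' + D Y (n - 1) * (t (n - 1) * y' + b)"
    unfolding a(4) x'(4) using tC[of "n - 1"] by (simp add: distrib_left add.assoc flip: mult.assoc)
  moreover have "t (n - 1) * y' + b \<in> bd (cdim Y (n - 1)) 1"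
    by (intro bd_closed(2) CM_bd1[OF qis_CM[OF t] x'(2)] a)
  ultimately show "\<exists>x'\<in>bd (cdim W n) 1. \<exists>y'\<in>bd (cdim Y (n - 1)) 1. x = - (D W n * x') \<and> y = t n * s n * x' + D Y (n - 1) * y'"
    using x' by blast
qed

lemma qis_homotopic:
  assumes s: "qis Q W X s" and s': "s' \<in> CM Q W X" and z: "null Q W X (\<lambda>n. s' n - s n)"
  shows "qis Q W X s'"
  unfolding qis_def
proof (intro conjI s' allI ballI impI)
  obtain h where h: "\<And>n. h n \<in> Hm Q (ob W n) (ob X (n - 1))"
    "\<And>n. s' n - s n = D X (n - 1) * h n + h (n + 1) * D W n" using z unfolding null_def by blast
  have e: "s' n = s n + D X (n - 1) * h n + h (n + 1) * D W n" for n using h(2)[of n] by (simp add: algebra_simps)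
  fix n x y assume x: "x \<in> bd (cdim W (n + 1)) 1" and y: "y \<in> bd (cdim X n) 1"
    and *: "D W (n + 1) * x = 0 \<and> s' (n + 1) * x + D X n * y = 0"
  have hx: "h (n + 1) * x \<in> bd (cdim X n) 1" using bd_comp1[OF h(1)[of "n + 1"] x] by simp
  have Dx: "D W (n + 1) * x = 0" using * by blast
  have "s (n + 1) * x + D X n * (h (n + 1) * x + y) = 0"
    using * by (simp add: e distrib_left distrib_right mult.assoc add.assoc Dx)
  then obtain x' y' where x': "x' \<in> bd (cdim W n) 1" "y' \<in> bd (cdim X (n - 1)) 1" "x = - (D W n * x')"
    "h (n + 1) * x + y = s n * x' + D X (n - 1) * y'"
    using qisD[OF s x bd_closed(2)[OF hx y]] * by blast
  have "y = s' n * x' + D X (n - 1) * (y' - h n * x')"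
    using x'(4) by (simp add: e x'(3) distrib_left distrib_right right_diff_distrib mult.assoc algebra_simps)
  moreover have "y' - h n * x' \<in> bd (cdim X (n - 1)) 1"
    by (intro bd_closed(3) x' bd_comp1[OF h(1)])
  ultimately show "\<exists>x'\<in>bd (cdim W n) 1. \<exists>y'\<in>bd (cdim X (n - 1)) 1. x = - (D W n * x') \<and> y = s' n * x' + D X (n - 1) * y'"
    using x' by blast
qed

lemma qis_shift: "qis Q W X s \<Longrightarrow> qis Q (shift W) (shift X) (\<lambda>n. s (n + 1))"
  unfolding qis_def[of Q "shift W"]
proof (intro conjI allI ballI impI, goal_cases)
  case 1 then show ?case by (intro CM_shift qis_CM)
next
  case (2 n x y)
  then have "D W (n + 1 + 1) * x = 0" "s (n + 1 + 1) * x + D X (n + 1) * (- y) = 0"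
    "- y \<in> bd (cdim X (n + 1)) 1" "x \<in> bd (cdim W (n + 1 + 1)) 1"
    by (auto simp: D_shift bd_closed)
  then obtain x' y' where x': "x' \<in> bd (cdim W (n + 1)) 1" "y' \<in> bd (cdim X (n + 1 - 1)) 1"
    "x = - (D W (n + 1) * x')" "- y = s (n + 1) * x' + D X (n + 1 - 1) * y'"
    using qisD[OF 2(1)] by metis
  have "y = s (n + 1) * (- x') - D X n * y'" using arg_cong[OF x'(4), of uminus] by simp
  then show ?case using x' by (intro bexI[of _ "- x'"] bexI[of _ y']) (auto simp: D_shift bd_closed)
qed

lemma qis_ush: "qis Q W X s \<Longrightarrow> qis Q (ush W) (ush X) (\<lambda>n. s (n - 1))"
  unfolding qis_def[of Q "ush W"]
proof (intro conjI allI ballI impI, goal_cases)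
  case 1 then show ?case by (intro CM_ush qis_CM)
next
  case (2 n x y)
  then have "D W (n - 1 + 1) * x = 0" "s (n - 1 + 1) * x + D X (n - 1) * (- y) = 0"
    "- y \<in> bd (cdim X (n - 1)) 1" "x \<in> bd (cdim W (n - 1 + 1)) 1"
    by (auto simp: D_ush bd_closed)
  then obtain x' y' where x': "x' \<in> bd (cdim W (n - 1)) 1" "y' \<in> bd (cdim X (n - 1 - 1)) 1"
    "x = - (D W (n - 1) * x')" "- y = s (n - 1) * x' + D X (n - 1 - 1) * y'"
    using qisD[OF 2(1)] by metis
  have "y = s (n - 1) * (- x') - D X (n - 1 - 1) * y'" using arg_cong[OF x'(4), of uminus] by simp
  then show ?case using x' by (intro bexI[of _ "- x'"] bexI[of _ y']) (auto simp: D_ush bd_closed)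
qed

lemma cone_elem:
  assumes "v \<in> bd (cdim (cn X Y f) n) 1"
  obtains x y where "x \<in> bd (cdim X (n + 1)) 1" "y \<in> bd (cdim Y n) 1" "v = ca X Y n * x + cb X Y n * y"
  using split_bd[of v "cdim X (n + 1)" "cdim Y n" 1] assms by auto

text \<open>
  The comparison map is \<open>e\<close> on \<open>R\<close>, the identity on
  \<open>A[1]\<close>, and the homotopy off the diagonal; exactness is the five lemma.
\<close>

lemma cone_qis:
  assumes A: "bounded_cpx Q A" and R: "bounded_cpx Q R" and X: "bounded_cpx Q X"
    and g: "g \<in> CM Q A R" and f: "f \<in> CM Q A X" and e: "qis Q R X e" and z: "null Q A X (\<lambda>n. e n * g n - f n)"
  shows "\<exists>\<Phi>. qis Q (cn A R g) (cn A X f) \<Phi>"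
proof -
  note eC = qis_CM[OF e]
  obtain h where h: "\<And>n. h n \<in> Hm Q (ob A n) (ob X (n - 1))"
    "\<And>n. e n * g n - f n = D X (n - 1) * h n + h (n + 1) * D A n" using z unfolding null_def by blast
  have h1: "h (n + 1) \<in> Hm Q (ob A (n + 1)) (ob X n)" for n using h(1)[of "n + 1"] by simp
  have hb: "h (n + 1) * x \<in> bd (cdim X n) m" if "x \<in> bd (cdim A (n + 1)) m" for n m x
    using HmD(1)[OF h1] that by (rule bd_closed(6))
  have eb: "e n * y \<in> bd (cdim X n) m" if "y \<in> bd (cdim R n) m" for n m y
    using HmD(1)[OF CM_D(1)[OF eC]] that by (rule bd_closed(6))
  define \<Phi> where "\<Phi> n = ca A X n * cp A R n + cb A X n * (e n * cq A R n + h (n + 1) * cp A R n)" for n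
  have \<Phi>: "\<Phi> n * (ca A R n * x + cb A R n * y) = ca A X n * x + cb A X n * (e n * y + h (n + 1) * x)"
    if "x \<in> bd (cdim A (n + 1)) m" "y \<in> bd (cdim R n) m" for n m x y
    unfolding \<Phi>_def using bdD(1)[OF that(1)] bdD(1)[OF that(2)]
    by (simp add: distrib_left distrib_right mult.assoc pr_in_assoc)
  have \<Phi>H: "\<Phi> n \<in> Hm Q (ob (cn A R g) n) (ob (cn A X f) n)" for n
    unfolding \<Phi>_def ob_cone
    by (intro Hm_closed(2) Hm_comp[OF cone_Hm(1)[OF A X] cone_Hm(3)[OF A R]] Hm_comp[OF cone_Hm(2)[OF A X]]
        Hm_comp[OF CM_D(1)[OF eC] cone_Hm(4)[OF A R]] Hm_comp[OF h1 cone_Hm(3)[OF A R]])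
  have \<Phi>C: "D (cn A X f) n * \<Phi> n = \<Phi> (n + 1) * D (cn A R g) n" for n
  proof -
    let ?a = "cp A R n" and ?b = "cq A R n"
    note b = blocks_bd(3)[of "cdim A (n + 1)" "cdim R n"] blocks_bd(4)[of "cdim A (n + 1)" "cdim R n"]
    have y: "e n * ?b + h (n + 1) * ?a \<in> bd (cdim X n) (cdim A (n + 1) + cdim R n)"
      by (intro bd_closed(2) hb eb b)
    have x2: "- (D A (n + 1) * ?a) \<in> bd (cdim A (n + 1 + 1)) (cdim A (n + 1) + cdim R n)"
      by (intro bd_closed(4) bd_closed(6)[OF HmD(1)[OF cpxD(2)[OF A]] b(1)])
    have y2: "g (n + 1) * ?a + D R n * ?b \<in> bd (cdim R (n + 1)) (cdim A (n + 1) + cdim R n)"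
      by (intro bd_closed(2) bd_closed(6)[OF HmD(1)[OF CM_D(1)[OF g]] b(1)] bd_closed(6)[OF HmD(1)[OF cpxD(2)[OF R]] b(2)])
    have "D (cn A R g) n = D (cn A R g) n * (ca A R n * ?a + cb A R n * ?b)"
      using HmD(4)[OF cpxD(2)[OF bounded_cn[OF A R g]], of n] by (simp add: pr_in)
    then have "\<Phi> (n + 1) * D (cn A R g) n = \<Phi> (n + 1) * (ca A R (n + 1) * (- (D A (n + 1) * ?a)) + cb A R (n + 1) * (g (n + 1) * ?a + D R n * ?b))"
      using D_cn_in[OF A R g b] by simp
    also have "\<dots> = ca A X (n + 1) * (- (D A (n + 1) * ?a)) +
       cb A X (n + 1) * (e (n + 1) * (g (n + 1) * ?a + D R n * ?b) + h (n + 1 + 1) * (- (D A (n + 1) * ?a)))"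
      by (rule \<Phi>[OF x2 y2])
    also have "e (n + 1) * (g (n + 1) * ?a + D R n * ?b) + h (n + 1 + 1) * (- (D A (n + 1) * ?a)) =
      (f (n + 1) * ?a + D X n * (e n * ?b + h (n + 1) * ?a))"
    proof -
      have "e (n + 1) * g (n + 1) = f (n + 1) + D X n * h (n + 1) + h (n + 1 + 1) * D A (n + 1)"
        using h(2)[of "n + 1"] by (simp add: algebra_simps)
      then have "e (n + 1) * (g (n + 1) * ?a) = f (n + 1) * ?a + D X n * (h (n + 1) * ?a) + h (n + 1 + 1) * (D A (n + 1) * ?a)"
        by (simp add: distrib_right flip: mult.assoc)
      moreover have "e (n + 1) * (D R n * ?b) = D X n * (e n * ?b)" using CM_D(2)[OF eC, of n] by (simp flip: mult.assoc)
      ultimately show ?thesis by (simp add: distrib_left algebra_simps)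
    qed
    also have "ca A X (n + 1) * (- (D A (n + 1) * ?a)) + cb A X (n + 1) * (f (n + 1) * ?a + D X n * (e n * ?b + h (n + 1) * ?a)) = D (cn A X f) n * \<Phi> n"
      unfolding \<Phi>_def by (rule D_cn_in[OF A X f b(1) y, symmetric])
    finally show ?thesis ..
  qed
  have "qis Q (cn A R g) (cn A X f) \<Phi>"
    unfolding qis_def
  proof (intro conjI allI ballI impI)
    show "\<Phi> \<in> CM Q (cn A R g) (cn A X f)" using \<Phi>H \<Phi>C by (simp add: CM_def)
    fix n v w assume v: "v \<in> bd (cdim (cn A R g) (n + 1)) 1" and w: "w \<in> bd (cdim (cn A X f) n) 1"
      and *: "D (cn A R g) (n + 1) * v = 0 \<and> \<Phi> (n + 1) * v + D (cn A X f) n * w = 0"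
    obtain x y where x: "x \<in> bd (cdim A (n + 1 + 1)) 1" and y: "y \<in> bd (cdim R (n + 1)) 1"
      and v': "v = ca A R (n + 1) * x + cb A R (n + 1) * y" by (rule cone_elem[OF v])
    obtain x' y' where x': "x' \<in> bd (cdim A (n + 1)) 1" and y': "y' \<in> bd (cdim X n) 1"
      and w': "w = ca A X n * x' + cb A X n * y'" by (rule cone_elem[OF w])
    have t: "- (D A (n + 1 + 1) * x) \<in> bd (cdim A (n + 1 + 1 + 1)) 1" "g (n + 1 + 1) * x + D R (n + 1) * y \<in> bd (cdim R (n + 1 + 1)) 1"
      by (intro bd_closed(2,4) D_bd1[OF A] D_bd1[OF R] CM_bd1[OF g] x y)+
    have 1: "D A (n + 1 + 1) * x = 0 \<and> g (n + 1 + 1) * x + D R (n + 1) * y = 0"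
      using * in_eq_iff[OF t bd_closed(1) bd_closed(1)] unfolding v' D_cn_in[OF A R g x y] by simp
    have t: "x - D A (n + 1) * x' \<in> bd (cdim A (n + 1 + 1)) 1"
      "e (n + 1) * y + h (n + 1 + 1) * x + (f (n + 1) * x' + D X n * y') \<in> bd (cdim X (n + 1)) 1"
      by (intro bd_closed(2,3) D_bd1[OF A] D_bd1[OF X] CM_bd1[OF f] eb hb x y x' y')+
    have "ca A X (n + 1) * (x - D A (n + 1) * x') + cb A X (n + 1) * (e (n + 1) * y + h (n + 1 + 1) * x + (f (n + 1) * x' + D X n * y')) = 0"
      using * unfolding v' w' D_cn_in[OF A X f x' y'] \<Phi>[OF x y] by (simp add: distrib_left right_diff_distrib algebra_simps)
    then have 2: "x = D A (n + 1) * x'" "e (n + 1) * y + h (n + 1 + 1) * x + (f (n + 1) * x' + D X n * y') = 0"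
      using in_eq_iff[OF t bd_closed(1) bd_closed(1)] by auto
    have E: "e (n + 1) * (g (n + 1) * x') = f (n + 1) * x' + D X n * (h (n + 1) * x') + h (n + 1 + 1) * (D A (n + 1) * x')"
      using arg_cong[OF h(2)[of "n + 1"], of "\<lambda>z. z * x'"] by (simp add: algebra_simps)
    have y2: "y + g (n + 1) * x' \<in> bd (cdim R (n + 1)) 1" by (intro bd_closed(2) y CM_bd1[OF g x'])
    have z2: "y' - h (n + 1) * x' \<in> bd (cdim X n) 1" by (intro bd_closed(3) y' hb x')
    have "g (n + 1 + 1) * x = D R (n + 1) * (g (n + 1) * x')" using CM_D(2)[OF g, of "n + 1"] 2(1) by (simp flip: mult.assoc)
    then have "D R (n + 1) * (y + g (n + 1) * x') = 0" using 1 by (simp add: distrib_left add.commute)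
    moreover have "e (n + 1) * (y + g (n + 1) * x') + D X n * (y' - h (n + 1) * x') = 0"
      unfolding distrib_left right_diff_distrib E using 2 by (simp add: algebra_simps)
    ultimately obtain b c where b: "b \<in> bd (cdim R n) 1" "c \<in> bd (cdim X (n - 1)) 1"
      "y + g (n + 1) * x' = - (D R n * b)" "y' - h (n + 1) * x' = e n * b + D X (n - 1) * c"
      using qisD[OF e y2 z2] by blast
    have c0: "0 \<in> bd (cdim A (n - 1 + 1)) 1" by (rule bd_closed)
    have "v = - (D (cn A R g) n * (ca A R n * x' + cb A R n * b))"
      using b(3) 2(1) unfolding v' D_cn_in[OF A R g x' b(1)] by (simp add: eq_neg_iff_add_eq_0 flip: distrib_left) (simp add: algebra_simps)
    moreover have "w = \<Phi> n * (ca A R n * x' + cb A R n * b) + D (cn A X f) (n - 1) * (ca A X (n - 1) * 0 + cb A X (n - 1) * c)"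
    proof -
      have "y' = e n * b + h (n + 1) * x' + D X (n - 1) * c" using b(4) by (simp add: algebra_simps)
      then show ?thesis unfolding w' \<Phi>[OF x' b(1)] D_cn_in[OF A X f c0 b(2)] by (simp add: distrib_left add.assoc)
    qed
    moreover have "ca A R n * x' + cb A R n * b \<in> bd (cdim (cn A R g) n) 1" using in_bd[OF x' b(1)] by simp
    moreover have "ca A X (n - 1) * 0 + cb A X (n - 1) * c \<in> bd (cdim (cn A X f) (n - 1)) 1" using in_bd[OF c0 b(2)] by simp
    ultimately show "\<exists>x'\<in>bd (cdim (cn A R g) n) 1. \<exists>y'\<in>bd (cdim (cn A X f) (n - 1)) 1.
      v = - (D (cn A R g) n * x') \<and> w = \<Phi> n * x' + D (cn A X f) (n - 1) * y'" by blast
  qed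
  then show ?thesis by blast
qed

text \<open>
  Short exact sequences of complexes are given with linear splittings in each degree. These
  always exist over a field, and they turn exactness into equations between operators.
\<close>

definition ses :: "'n quiver \<Rightarrow> ('n::finite, 'k::field) cpx \<Rightarrow> ('n, 'k) cpx \<Rightarrow> ('n, 'k) cpx \<Rightarrow>
    (int \<Rightarrow> 'k lin_op) \<Rightarrow> (int \<Rightarrow> 'k lin_op) \<Rightarrow> bool" where
  "ses Q S M N F G \<longleftrightarrow> F \<in> CM Q S M \<and> G \<in> CM Q M N \<and> (\<forall>n. \<exists>L\<in>bd (cdim S n) (cdim M n). \<exists>H\<in>bd (cdim M n) (cdim N n).
     L * F n = idm (ob S n) \<and> G n * H = idm (ob N n) \<and> F n * L + H * G n = idm (ob M n))"

lemma split_zero: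
  fixes F G H L :: "'a::ring_1"
  assumes "F * L + H * G = e" "e * F = F" "L * F = e1" "G * H = e2" "F * e1 = F" "e2 * G = G"
  shows "G * F = 0"
proof -
  have "F + H * G * F = F" using assms by (metis distrib_right mult.assoc)
  then have "H * (G * F) = 0" by (simp add: mult.assoc)
  then have "G * (H * (G * F)) = 0" by simp
  then show ?thesis using assms by (metis mult.assoc)
qed

lemma sesD:
  assumes "ses Q S M N F G"
  shows "F \<in> CM Q S M" "G \<in> CM Q M N" "G n * F n = 0"
    "s \<in> bd (cdim S n) 1 \<Longrightarrow> s' \<in> bd (cdim S n) 1 \<Longrightarrow> F n * s = F n * s' \<Longrightarrow> s = s'"
    "m \<in> bd (cdim M n) 1 \<Longrightarrow> G n * m = 0 \<Longrightarrow> \<exists>s\<in>bd (cdim S n) 1. m = F n * s"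
    "x \<in> bd (cdim N n) 1 \<Longrightarrow> \<exists>m\<in>bd (cdim M n) 1. G n * m = x"
proof -
  show F: "F \<in> CM Q S M" and G: "G \<in> CM Q M N" using assms by (auto simp: ses_def)
  obtain L H where L: "L \<in> bd (cdim S n) (cdim M n)" "H \<in> bd (cdim M n) (cdim N n)"
    "L * F n = idm (ob S n)" "G n * H = idm (ob N n)" "F n * L + H * G n = idm (ob M n)"
    using assms unfolding ses_def by blast
  show "G n * F n = 0" using split_zero[OF L(5) CM_idm(1)[OF F] L(3,4) CM_idm(2)[OF F] CM_idm(1)[OF G]] .
  show "s = s'" if "s \<in> bd (cdim S n) 1" "s' \<in> bd (cdim S n) 1" "F n * s = F n * s'"
    using that L(3) by (metis bdD(1) mult.assoc)
  show "\<exists>s\<in>bd (cdim S n) 1. m = F n * s" if "m \<in> bd (cdim M n) 1" "G n * m = 0"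
  proof
    show "L * m \<in> bd (cdim S n) 1" by (rule bd_closed(6)[OF L(1) that(1)])
    have "m = (F n * L + H * G n) * m" using L(5) bdD(1)[OF that(1)] by simp
    then show "m = F n * (L * m)" using that(2) by (simp add: distrib_right mult.assoc)
  qed
  show "\<exists>m\<in>bd (cdim M n) 1. G n * m = x" if "x \<in> bd (cdim N n) 1"
    using that L by (intro bexI[of _ "H * x"]) (auto simp: bdD(1) bd_closed(6) simp flip: mult.assoc)
qed

lemma ses_cone:
  assumes S: "bounded_cpx Q S" and M: "bounded_cpx Q M" and N: "bounded_cpx Q N" and ses: "ses Q S M N F G"
  shows "qis Q (cn S M F) N (\<lambda>n. G n * cq S M n)"
  unfolding qis_def
proof (intro conjI allI ballI impI)
  note F = sesD(1)[OF ses] and G = sesD(2)[OF ses]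
  have "D N n * (G n * cq S M n) = G (n + 1) * cq S M (n + 1) * D (cn S M F) n" for n
  proof -
    have "idm (ob M (n + 1)) * (D M n * g) = D M n * g" "idm (ob M (n + 1)) * (F (n + 1) * g) = F (n + 1) * g" for g
      using en_assoc[OF cpxD(2)[OF M], of n] en_assoc[OF CM_D(1)[OF F], of "n + 1"] by simp_all
    then show ?thesis
      unfolding D_cn[OF S M F] using CM_D(2)[OF G, of n] sesD(3)[OF ses, of "n + 1"]
      by (simp add: distrib_left right_diff_distrib mult.assoc pr_in_assoc) (simp flip: mult.assoc)
  qed
  then show "(\<lambda>n. G n * cq S M n) \<in> CM Q (cn S M F) N"
    using Hm_comp[OF CM_D(1)[OF G] cone_Hm(4)[OF S M]] by (simp add: CM_def)
  fix n v y assume v: "v \<in> bd (cdim (cn S M F) (n + 1)) 1" and y: "y \<in> bd (cdim N n) 1"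
    and *: "D (cn S M F) (n + 1) * v = 0 \<and> G (n + 1) * cq S M (n + 1) * v + D N n * y = 0"
  obtain s m where s: "s \<in> bd (cdim S (n + 1 + 1)) 1" and m: "m \<in> bd (cdim M (n + 1)) 1"
    and v': "v = ca S M (n + 1) * s + cb S M (n + 1) * m" by (rule cone_elem[OF v])
  have t: "- (D S (n + 1 + 1) * s) \<in> bd (cdim S (n + 1 + 1 + 1)) 1" "F (n + 1 + 1) * s + D M (n + 1) * m \<in> bd (cdim M (n + 1 + 1)) 1"
    by (intro bd_closed(2,4) D_bd1[OF S] D_bd1[OF M] CM_bd1[OF F] s m)+
  have 1: "F (n + 1 + 1) * s + D M (n + 1) * m = 0"
    using * in_eq_iff[OF t bd_closed(1) bd_closed(1)] unfolding v' D_cn_in[OF S M F s m] by simp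
  have 2: "G (n + 1) * m + D N n * y = 0"
    using * unfolding v' by (simp add: distrib_left mult.assoc pr_in_assoc bdD(1)[OF m])
  obtain m0 where m0: "m0 \<in> bd (cdim M n) 1" "G n * m0 = y" using sesD(6)[OF ses y] by blast
  have mb: "m + D M n * m0 \<in> bd (cdim M (n + 1)) 1" by (intro bd_closed(2) m D_bd1[OF M m0(1)])
  have "G (n + 1) * (m + D M n * m0) = 0"
  proof -
    have "G (n + 1) * (D M n * m0) = D N n * y" using CM_D(2)[OF G, of n] m0(2) by (metis mult.assoc)
    then show ?thesis using 2 by (simp add: distrib_left)
  qed
  then obtain c where c: "c \<in> bd (cdim S (n + 1)) 1" "m + D M n * m0 = F (n + 1) * c" using sesD(5)[OF ses mb] by blast
  have "F (n + 1 + 1) * s = F (n + 1 + 1) * (- (D S (n + 1) * c))"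
  proof -
    have "D M (n + 1) * (m + D M n * m0) = D M (n + 1) * m" using cpxD(4)[OF M, of n] by (simp add: distrib_left flip: mult.assoc)
    then have "D M (n + 1) * m = F (n + 1 + 1) * (D S (n + 1) * c)" using CM_D(2)[OF F, of "n + 1"] by (simp add: c(2) flip: mult.assoc)
    then show ?thesis using 1 by (simp add: eq_neg_iff_add_eq_0)
  qed
  then have s': "s = - (D S (n + 1) * c)" by (rule sesD(4)[OF ses s bd_closed(4)[OF D_bd1[OF S c(1)]]])
  have nc: "- c \<in> bd (cdim S (n + 1)) 1" using c bd_closed(4) by blast
  have "v = - (D (cn S M F) n * (ca S M n * (- c) + cb S M n * m0))"
  proof -
    have "m = F (n + 1) * c - D M n * m0" using c(2) by (simp add: algebra_simps)
    then show ?thesis unfolding v' D_cn_in[OF S M F nc m0(1)] s' by simp (simp add: algebra_simps)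
  qed
  moreover have "y = G n * cq S M n * (ca S M n * (- c) + cb S M n * m0) + D N (n - 1) * 0"
    using m0 by (simp add: distrib_left right_diff_distrib mult.assoc pr_in_assoc bdD(1))
  ultimately show "\<exists>x'\<in>bd (cdim (cn S M F) n) 1. \<exists>y'\<in>bd (cdim N (n - 1)) 1.
     v = - (D (cn S M F) n * x') \<and> y = G n * cq S M n * x' + D N (n - 1) * y'"
    using in_bd[OF nc m0(1)] bd_closed(1) by fastforce
qed

text \<open>
  The horseshoe lemma. Up to quasi-isomorphism \<open>N\<close> is the cone of \<open>S
  \<rightarrow> M\<close>, so \<open>M\<close> is the cone of a connecting map \<open>N[-1]
  \<rightarrow> S\<close>; lifting that map to the resolutions and taking its cone resolves
  \<open>M\<close>.
\<close>

lemma ses_resolution: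
  assumes S: "bounded_cpx Q S" and M: "bounded_cpx Q M" and N: "bounded_cpx Q N" and ses: "ses Q S M N F G"
    and R: "proj_cpx Q R" and e: "qis Q R N e" and R': "proj_cpx Q R'" and e': "qis Q R' S e'"
  shows "\<exists>g\<in>CM Q (ush R) R'. \<exists>\<Psi>. qis Q (cn (ush R) R' g) M \<Psi>"
proof -
  note F = sesD(1)[OF ses] and G = sesD(2)[OF ses]
  note Rb = proj_cpxD(1)[OF R] and R'b = proj_cpxD(1)[OF R']
  let ?C = "cn S M F"
  have Cb: "bounded_cpx Q ?C" by (rule bounded_cn[OF S M F])
  obtain r where r: "r \<in> CM Q R ?C" and "null Q R N (\<lambda>n. (G n * cq S M n) * r n - e n)"
    by (rule lift_ex[OF R Cb N ses_cone[OF S M N ses] qis_CM[OF e]])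
  then have \<epsilon>: "qis Q R N (\<lambda>n. (G n * cq S M n) * r n)"
    by (intro qis_homotopic[OF e] CM_comp[OF qis_CM[OF ses_cone[OF S M N ses]]])
  define r1 r2 where "r1 n = cp S M n * r n" and "r2 n = cq S M n * r n" for n
  have r1H: "r1 n \<in> Hm Q (ob R n) (ob S (n + 1))" and r2H: "r2 n \<in> Hm Q (ob R n) (ob M n)" for n
    using Hm_comp[OF cone_Hm(3)[OF S M, of n], of "r n" "ob R n"] Hm_comp[OF cone_Hm(4)[OF S M, of n], of "r n" "ob R n"]
      CM_D(1)[OF r, of n] by (simp_all add: r1_def r2_def)
  have rs: "r n = ca S M n * r1 n + cb S M n * r2 n" for n
    unfolding r1_def r2_def using HmD(1)[OF CM_D(1)[OF r, of n]] by (intro split_bd) simp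
  have rD: "- (D S (n + 1) * r1 n) = r1 (n + 1) * D R n" "F (n + 1) * r1 n + D M n * r2 n = r2 (n + 1) * D R n" for n
  proof -
    have "ca S M (n + 1) * (- (D S (n + 1) * r1 n)) + cb S M (n + 1) * (F (n + 1) * r1 n + D M n * r2 n) =
      ca S M (n + 1) * (r1 (n + 1) * D R n) + cb S M (n + 1) * (r2 (n + 1) * D R n)"
      using CM_D(2)[OF r, of n] unfolding rs D_cn_in[OF S M F HmD(1)[OF r1H] HmD(1)[OF r2H]]
      by (simp add: distrib_right mult.assoc)
    moreover have "- (D S (n + 1) * r1 n) \<in> Hm Q (ob R n) (ob S (n + 1 + 1))" "F (n + 1) * r1 n + D M n * r2 n \<in> Hm Q (ob R n) (ob M (n + 1))"
      "r1 (n + 1) * D R n \<in> Hm Q (ob R n) (ob S (n + 1 + 1))" "r2 (n + 1) * D R n \<in> Hm Q (ob R n) (ob M (n + 1))"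
      by (intro Hm_closed Hm_comp[OF cpxD(2)[OF S] r1H] Hm_comp[OF CM_D(1)[OF F] r1H] Hm_comp[OF cpxD(2)[OF M] r2H]
          Hm_comp[OF r1H cpxD(2)[OF Rb]] Hm_comp[OF r2H cpxD(2)[OF Rb]])+
    ultimately have "- (D S (n + 1) * r1 n) = r1 (n + 1) * D R n \<and> F (n + 1) * r1 n + D M n * r2 n = r2 (n + 1) * D R n"
      using in_eq_iff[OF HmD(1) HmD(1) HmD(1) HmD(1)] by blast
    then show "- (D S (n + 1) * r1 n) = r1 (n + 1) * D R n" "F (n + 1) * r1 n + D M n * r2 n = r2 (n + 1) * D R n" by auto
  qed
  let ?A = "ush R"
  have Ab: "bounded_cpx Q ?A" by (rule bounded_ush[OF Rb])
  define t where "t n = r1 (n - 1)" for n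
  have t: "t \<in> CM Q ?A S"
  proof -
    have "D S n * t n = t (n + 1) * D ?A n" for n
      using arg_cong[OF rD(1)[of "n - 1"], of uminus] by (simp add: t_def D_ush)
    then show ?thesis using r1H[of "n - 1" for n] by (simp add: CM_def t_def)
  qed
  obtain g where g: "g \<in> CM Q ?A R'" "null Q ?A S (\<lambda>n. e' n * g n - t n)"
    by (rule lift_ex[OF proj_ush[OF R] R'b S e' t])
  obtain \<Phi> where \<Phi>: "qis Q (cn ?A R' g) (cn ?A S t) \<Phi>"
    using cone_qis[OF Ab R'b S g(1) t e' g(2)] by blast
  define \<Psi> where "\<Psi> n = r2 n * cp ?A S n - F n * cq ?A S n" for n
  have \<Psi>: "\<Psi> n * (ca ?A S n * x + cb ?A S n * y) = r2 n * x - F n * y"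
    if "x \<in> bd (cdim R n) m" "y \<in> bd (cdim S n) m" for n m x y
    unfolding \<Psi>_def using bdD(1)[OF that(1)] bdD(1)[OF that(2)]
    by (simp add: distrib_left left_diff_distrib mult.assoc pr_in_assoc)
  have "qis Q (cn ?A S t) M \<Psi>"
    unfolding qis_def
  proof (intro conjI allI ballI impI)
    have "\<Psi> n \<in> Hm Q (ob (cn ?A S t) n) (ob M n)" for n
      using Hm_comp[OF r2H[of n], of "cp ?A S n"] Hm_comp[OF CM_D(1)[OF F, of n] cone_Hm(4)[OF Ab S, of n]] cone_Hm(3)[OF Ab S, of n]
      by (simp add: \<Psi>_def Hm_closed)
    moreover have "D M n * \<Psi> n = \<Psi> (n + 1) * D (cn ?A S t) n" for n
    proof -
      have eR: "idm (ob R (n + 1)) * (D R n * z) = D R n * z" "idm (ob S (n + 1)) * (D S n * z) = D S n * z"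
        "idm (ob S (n + 1)) * (r1 n * z) = r1 n * z" for z
        using en_assoc[OF cpxD(2)[OF Rb], of n] en_assoc[OF cpxD(2)[OF S], of n] en_assoc[OF r1H, of n] by simp_all
      then have eR': "idm (ob R (1 + n)) * (D R n * z) = D R n * z" for z by (simp add: add.commute)
      have eF: "F (n + 1) * (D S n * z) = D M n * (F n * z)" "r2 (n + 1) * (D R n * z) = F (n + 1) * (r1 n * z) + D M n * (r2 n * z)" for z
        using CM_D(2)[OF F, of n] rD(2)[of n] by (simp_all flip: mult.assoc distrib_right)
      show ?thesis
        unfolding D_cn[OF Ab S t] \<Psi>_def
        by (simp add: distrib_left left_diff_distrib distrib_right right_diff_distrib mult.assoc pr_in_assoc eR eR' D_ush t_def eF)
    qed
    ultimately show "\<Psi> \<in> CM Q (cn ?A S t) M" by (simp add: CM_def)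
    fix n v m assume v: "v \<in> bd (cdim (cn ?A S t) (n + 1)) 1" and m: "m \<in> bd (cdim M n) 1"
      and *: "D (cn ?A S t) (n + 1) * v = 0 \<and> \<Psi> (n + 1) * v + D M n * m = 0"
    obtain x y where x0: "x \<in> bd (cdim ?A (n + 1 + 1)) 1" and y: "y \<in> bd (cdim S (n + 1)) 1"
      and v': "v = ca ?A S (n + 1) * x + cb ?A S (n + 1) * y" by (rule cone_elem[OF v])
    have x: "x \<in> bd (cdim R (n + 1)) 1" using x0 by (simp add: add.commute)
    have tb: "- (D ?A (n + 1 + 1) * x) \<in> bd (cdim ?A (n + 1 + 1 + 1)) 1" "t (n + 1 + 1) * x + D S (n + 1) * y \<in> bd (cdim S (n + 1 + 1)) 1"
      by (intro bd_closed(2,4) D_bd1[OF Ab] D_bd1[OF S] CM_bd1[OF t] x0 y)+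
    have "D ?A (n + 1 + 1) * x = 0"
      using * in_eq_iff[OF tb bd_closed(1) bd_closed(1)] unfolding v' D_cn_in[OF Ab S t x0 y] by simp
    then have 1: "D R (n + 1) * x = 0" by (simp add: D_ush add.commute)
    have 2: "r2 (n + 1) * x - F (n + 1) * y + D M n * m = 0" using * unfolding v' \<Psi>[OF x y] by simp
    have Gm: "G n * m \<in> bd (cdim N n) 1" by (rule CM_bd1[OF G m])
    have "G (n + 1) * (r2 (n + 1) * x) + G (n + 1) * (D M n * m) = 0"
      using arg_cong[OF 2, of "\<lambda>z. G (n + 1) * z"] sesD(3)[OF ses, of "n + 1"]
      by (simp add: distrib_left right_diff_distrib mult.assoc flip: mult.assoc[of "G (n + 1)" "F (n + 1)"])
    then have "(G (n + 1) * cq S M (n + 1)) * r (n + 1) * x + D N n * (G n * m) = 0"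
      using CM_D(2)[OF G, of n] by (simp add: r2_def mult.assoc) (simp flip: mult.assoc)
    then obtain a b where a: "a \<in> bd (cdim R n) 1" "b \<in> bd (cdim N (n - 1)) 1" "x = - (D R n * a)"
      "G n * m = (G n * cq S M n) * r n * a + D N (n - 1) * b"
      using qisD[OF \<epsilon> x Gm 1] by blast
    obtain b' where b': "b' \<in> bd (cdim M (n - 1)) 1" "G (n - 1) * b' = b" using sesD(6)[OF ses a(2)] by blast
    let ?m = "m - r2 n * a - D M (n - 1) * b'"
    have Db: "D M (n - 1) * b' \<in> bd (cdim M n) 1" by (rule bd_comp1[OF cpxD(3)[OF M] b'(1)])
    have mb: "?m \<in> bd (cdim M n) 1" by (intro bd_closed(3) m Db bd_comp1[OF r2H a(1)])
    have "G n * (D M (n - 1) * b') = D N (n - 1) * b"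
    proof -
      have "D N (n - 1) * G (n - 1) = G n * D M (n - 1)" using CM_D(2)[OF G, of "n - 1"] by simp
      then have "G n * D M (n - 1) * b' = D N (n - 1) * G (n - 1) * b'" by simp
      then show ?thesis by (simp add: mult.assoc b'(2))
    qed
    then have "G n * ?m = 0" by (simp add: right_diff_distrib a(4) r2_def mult.assoc)
    then obtain c where c: "c \<in> bd (cdim S n) 1" "?m = F n * c" using sesD(5)[OF ses mb] by blast
    have m': "m = r2 n * a - F n * (- c) + D M (n - 1) * b'" using c(2) by (simp add: algebra_simps)
    have "F (n + 1) * y = F (n + 1) * (D S n * c - r1 n * a)"
    proof -
      have dd: "D M n * (D M (n - 1) * b') = 0" using cpxD(5)[OF M, of n] by (simp flip: mult.assoc)
      have "F (n + 1) * y = r2 (n + 1) * x + D M n * m" using 2 by (simp add: algebra_simps)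
      also have "\<dots> = - (r2 (n + 1) * (D R n * a)) + D M n * (r2 n * a) + D M n * (F n * c)"
        using m' by (simp add: a(3) distrib_left right_diff_distrib dd)
      also have "r2 (n + 1) * (D R n * a) = F (n + 1) * (r1 n * a) + D M n * (r2 n * a)"
        using rD(2)[of n] by (simp flip: mult.assoc distrib_right)
      also have "D M n * (F n * c) = F (n + 1) * (D S n * c)" using CM_D(2)[OF F, of n] by (simp flip: mult.assoc)
      finally show ?thesis by (simp add: algebra_simps)
    qed
    then have y': "y = D S n * c - r1 n * a"
      by (rule sesD(4)[OF ses y bd_closed(3)[OF D_bd1[OF S c(1)] bd_comp1[OF r1H a(1)]]])
    have nc: "- c \<in> bd (cdim S n) 1" using c bd_closed(4) by blast
    have a0: "a \<in> bd (cdim ?A (n + 1)) 1" using a by simp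
    have "v = - (D (cn ?A S t) n * (ca ?A S n * a + cb ?A S n * (- c)))"
      unfolding v' D_cn_in[OF Ab S t a0 nc] y' a(3) by (simp add: D_ush t_def algebra_simps)
    moreover have "m = \<Psi> n * (ca ?A S n * a + cb ?A S n * (- c)) + D M (n - 1) * b'"
      unfolding \<Psi>[OF a(1) nc] by (rule m')
    moreover have "ca ?A S n * a + cb ?A S n * (- c) \<in> bd (cdim (cn ?A S t) n) 1" using in_bd[OF a0 nc] by simp
    ultimately show "\<exists>x'\<in>bd (cdim (cn ?A S t) n) 1. \<exists>y'\<in>bd (cdim M (n - 1)) 1.
       v = - (D (cn ?A S t) n * x') \<and> m = \<Psi> n * x' + D M (n - 1) * y'" using b' by blast
  qed
  then have "qis Q (cn ?A R' g) M (\<lambda>n. \<Psi> n * \<Phi> n)" by (rule qis_comp[OF \<Phi>])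
  then show ?thesis using g(1) by blast
qed

section \<open>Euler characteristics and perfect complexes\<close>

text \<open>
  The sign \<open>(-1)\<^sup>n\<close> for integer \<open>n\<close>.
\<close>

definition sgp :: "int \<Rightarrow> 'a::comm_ring_1" where "sgp n = (if even n then 1 else - 1)"

lemma sgp_simps [simp]: "sgp (n + 1) = - sgp n" "sgp (n - 1) = - sgp n" "sgp 0 = 1"
  by (auto simp: sgp_def)

definition euler :: "(('n, 'k::field) rmod \<Rightarrow> 'a::comm_ring_1) \<Rightarrow> ('n, 'k) cpx \<Rightarrow> 'a" where
  "euler \<psi> X = (\<Sum>n | cdim X n \<noteq> 0. sgp n * \<psi> (ob X n))"

definition additive_on :: "'n quiver \<Rightarrow> (('n::finite, 'k::field) rmod \<Rightarrow> 'a::comm_ring_1) \<Rightarrow> bool" where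
  "additive_on Q \<psi> \<longleftrightarrow> (\<forall>M. mdim M = 0 \<longrightarrow> \<psi> M = 0) \<and>
     (\<forall>M N. is_mod Q M \<longrightarrow> is_mod Q N \<longrightarrow> \<psi> (sum_mod M N) = \<psi> M + \<psi> N)"

lemma additive_zero: "additive_on Q \<psi> \<Longrightarrow> mdim M = 0 \<Longrightarrow> \<psi> M = 0"
  by (simp add: additive_on_def)

lemma additive_tdim: "additive_on Q (tdim l)"
  by (auto simp: additive_on_def tdim_sum) (simp add: tdim_def trc_def)

lemma euler_eq:
  assumes "additive_on Q \<psi>" "finite A" "{n. cdim X n \<noteq> 0} \<subseteq> A"
  shows "euler \<psi> X = (\<Sum>n\<in>A. sgp n * \<psi> (ob X n))"
  unfolding euler_def by (rule sum.mono_neutral_left) (use assms in \<open>auto simp: additive_zero\<close>)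

lemma cpx_finite: "bounded_cpx Q X \<Longrightarrow> finite {n. cdim X n \<noteq> 0}" by (simp add: bounded_cpx_def)

lemma euler_shift: "euler \<psi> (shift X) = - euler \<psi> X"
  unfolding euler_def sum_negf[symmetric]
  by (rule sum.reindex_bij_witness[of _ "\<lambda>n. n - 1" "\<lambda>n. n + 1"]) auto

lemma euler_ush: "euler \<psi> (ush X) = - euler \<psi> X"
  unfolding euler_def sum_negf[symmetric]
  by (rule sum.reindex_bij_witness[of _ "\<lambda>n. n + 1" "\<lambda>n. n - 1"]) auto

lemma euler_cone:
  assumes a: "additive_on Q \<psi>" and X: "bounded_cpx Q X" and Y: "bounded_cpx Q Y"
  shows "euler \<psi> (cone X Y f) = euler \<psi> Y - euler \<psi> X"
proof -
  let ?A = "(\<lambda>n. n - 1) ` {n. cdim X n \<noteq> 0} \<union> {n. cdim Y n \<noteq> 0}"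
  have fin: "finite ?A" using cpx_finite[OF X] cpx_finite[OF Y] by blast
  have "{n. cdim (shift X) n \<noteq> 0} \<subseteq> ?A"
    by (auto simp: image_iff) (metis add_diff_cancel_right' less_numeral_extra(3))
  moreover have "{n. cdim (cone X Y f) n \<noteq> 0} \<subseteq> ?A"
    by (auto simp: image_iff) (metis add_diff_cancel_right' less_numeral_extra(3))
  ultimately have "euler \<psi> (cone X Y f) = euler \<psi> (shift X) + euler \<psi> Y"
    using a fin cpxD(1)[OF X] cpxD(1)[OF Y]
    by (subst (1 2 3) euler_eq[OF a fin]) (auto simp: additive_on_def sum.distrib[symmetric] distrib_left)
  then show ?thesis by (simp add: euler_shift)
qed

lemma ob_stalk: "ob (stalk M) n = (if n = 0 then M else zero_mod)" by (simp add: stalk_def)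
lemma D_stalk [simp]: "D (stalk M) n = 0" by (simp add: stalk_def)

lemma euler_stalk: "additive_on Q \<psi> \<Longrightarrow> euler \<psi> (stalk M) = \<psi> M"
  by (subst euler_eq[of Q \<psi> "{0}"]) (auto simp: ob_stalk)

lemma bounded_stalk: "is_mod Q M \<Longrightarrow> bounded_cpx Q (stalk M)"
proof (rule cpxI)
  show "finite {n. cdim (stalk M) n \<noteq> 0}" by (rule finite_subset[of _ "{0}"]) (auto simp: ob_stalk)
qed (auto simp: ob_stalk is_mod_zero Hm_closed, auto simp: stalk_def)

lemma bounded_zero: "bounded_cpx Q zero_cpx"
  by (rule cpxI) (auto simp: zero_cpx_def is_mod_zero Hm_closed)

text \<open>
  The complexes that are built from the indecomposable projectives by cones and shifts, together
  with their class in the Grothendieck group. Carrying the class along makes g-vectors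
  computable by induction.
\<close>

inductive perf :: "'n quiver \<Rightarrow> ('n::finite, 'k::field) cpx \<Rightarrow> ('n \<Rightarrow> int) \<Rightarrow> bool" for Q where
  perf_zero: "perf Q zero_cpx (\<lambda>j. 0)"
| perf_stalk: "perf Q (stalk (proj_mod Q i)) (\<lambda>j. if j = i then 1 else 0)"
| perf_cone: "perf Q X g \<Longrightarrow> perf Q Y h \<Longrightarrow> f \<in> chain_map Q X Y \<Longrightarrow> perf Q (cone X Y f) (\<lambda>j. h j - g j)"
| perf_shift: "perf Q X g \<Longrightarrow> perf Q (shift X) (\<lambda>j. - g j)"
| perf_ush: "perf Q X g \<Longrightarrow> perf Q (ush X) (\<lambda>j. - g j)"

lemma perf_proj: "perf Q R g \<Longrightarrow> acyclic_quiver Q \<Longrightarrow> proj_cpx Q R"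
proof (induction rule: perf.induct)
  case perf_zero show ?case unfolding proj_cpx_def by (intro conjI bounded_zero allI) (simp add: zero_cpx_def exproj_zero)
next
  case (perf_stalk i) then show ?case
    by (auto simp: proj_cpx_def bounded_stalk is_mod_proj ob_stalk exproj_proj exproj_zero)
next
  case (perf_cone X g Y h f) then show ?case by (auto simp: proj_cpx_def bounded_cone exproj_sum)
qed (auto intro: proj_shift proj_ush)

lemma perf_euler: "perf Q R g \<Longrightarrow> acyclic_quiver Q \<Longrightarrow> additive_on Q \<psi> \<Longrightarrow>
    euler \<psi> R = (\<Sum>i\<in>UNIV. of_int (g i) * \<psi> (proj_mod Q i))"
proof (induction rule: perf.induct)
  case perf_zero then show ?case by (simp add: euler_def zero_cpx_def)
next
  case (perf_stalk i) then show ?case by (simp add: euler_stalk if_distrib[of "\<lambda>c. c * _"] if_distrib[of of_int] cong: if_cong)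
next
  case (perf_cone X g Y h f)
  then show ?case using proj_cpxD(1)[OF perf_proj[of Q X g]] proj_cpxD(1)[OF perf_proj[of Q Y h]]
    by (simp add: euler_cone left_diff_distrib sum_subtractf)
qed (auto simp: euler_shift euler_ush sum_negf)

lemma perf_cn: "perf Q X g \<Longrightarrow> perf Q Y h \<Longrightarrow> acyclic_quiver Q \<Longrightarrow> f \<in> CM Q X Y \<Longrightarrow> perf Q (cn X Y f) (\<lambda>j. h j - g j)"
  using perf_cone mts_emb(1) proj_cpxD(1) perf_proj by metis

text \<open>
  Sums of perfect complexes arise as cones of zero maps, so that they stay within
  \<open>perf\<close>.
\<close>

lemma direct_sum:
  assumes Q: "acyclic_quiver (Q :: 'n::finite quiver)" and "finite A" "\<forall>a\<in>A. perf Q (C a :: ('n, 'k::field) cpx) (g a)"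
  shows "\<exists>T \<iota> \<pi>. perf Q T (\<lambda>j. \<Sum>a\<in>A. g a j) \<and> (\<forall>a\<in>A. \<iota> a \<in> CM Q (C a) T \<and> \<pi> a \<in> CM Q T (C a)) \<and>
    (\<forall>a\<in>A. \<forall>b\<in>A. \<forall>n. \<pi> a n * \<iota> b n = (if a = b then idm (ob (C a) n) else 0)) \<and>
    (\<forall>n. (\<Sum>a\<in>A. \<iota> a n * \<pi> a n) = idm (ob T n))"
  using assms(2,3)
proof (induction A rule: finite_induct)
  case empty
  then show ?case using perf_zero[of Q] by (intro exI[of _ zero_cpx]) (auto simp: zero_cpx_def)
next
  case (insert x A)
  have PA: "\<forall>a\<in>A. perf Q (C a) (g a)" using insert.prems by blast
  from insert.IH[OF PA] obtain T \<iota> \<pi> where T: "perf Q T (\<lambda>j. \<Sum>a\<in>A. g a j)"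
    and m': "\<forall>a\<in>A. \<iota> a \<in> CM Q (C a) T \<and> \<pi> a \<in> CM Q T (C a)"
    and \<pi>\<iota>': "\<forall>a\<in>A. \<forall>b\<in>A. \<forall>n. \<pi> a n * \<iota> b n = (if a = b then idm (ob (C a) n) else 0)"
    and \<iota>\<pi>': "\<forall>n. (\<Sum>a\<in>A. \<iota> a n * \<pi> a n) = idm (ob T n)" by (elim exE conjE) (rule that)
  note m = m'[rule_format] and \<pi>\<iota> = \<pi>\<iota>'[rule_format] and \<iota>\<pi> = \<iota>\<pi>'[rule_format]
  let ?X = "ush (C x)" and ?T = "cn (ush (C x)) T (\<lambda>n. 0)"
  have Cx: "perf Q (C x) (g x)" using insert.prems by blast
  note Tb = proj_cpxD(1)[OF perf_proj[OF T Q]] and Cb = proj_cpxD(1)[OF perf_proj[OF Cx Q]]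
  note Xb = bounded_ush[OF Cb]
  have pT: "perf Q ?T (\<lambda>j. (\<Sum>a\<in>A. g a j) - (- g x j))"
    by (rule perf_cn[OF perf_ush[OF Cx] T Q CM_closed(1)])
  note DT = D_cn[OF Xb Tb CM_closed(1)]
  note h = cone_Hm[OF Xb Tb]
  have e: "idm (ob T (n + 1)) * D T n = D T n" "D T n * idm (ob T n) = D T n"
    "idm (ob (C x) (n + 1)) * D (C x) n = D (C x) n" "D (C x) n * idm (ob (C x) n) = D (C x) n"
    "idm (ob T (n + 1)) * (D T n * z) = D T n * z" "idm (ob (C x) (n + 1)) * (D (C x) n * z) = D (C x) n * z" for n z
    using HmD(3,4)[OF cpxD(2)[OF Tb, of n]] HmD(3,4)[OF cpxD(2)[OF Cb, of n]]
      en_assoc[OF cpxD(2)[OF Tb, of n]] en_assoc[OF cpxD(2)[OF Cb, of n]] by simp_all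
  have ia: "(\<lambda>n. ca ?X T n) \<in> CM Q (C x) ?T" "(\<lambda>n. cb ?X T n) \<in> CM Q T ?T"
    "(\<lambda>n. cp ?X T n) \<in> CM Q ?T (C x)" "(\<lambda>n. cq ?X T n) \<in> CM Q ?T T"
    unfolding CM_def DT using h e
    by (auto simp: D_ush distrib_left distrib_right left_diff_distrib right_diff_distrib mult.assoc pr_in pr_in_assoc add.commute[of 1])
  define \<iota>' where "\<iota>' a = (if a = x then (\<lambda>n. ca ?X T n) else (\<lambda>n. cb ?X T n * \<iota> a n))" for a
  define \<pi>' where "\<pi>' a = (if a = x then (\<lambda>n. cp ?X T n) else (\<lambda>n. \<pi> a n * cq ?X T n))" for a
  have "\<forall>a\<in>insert x A. \<iota>' a \<in> CM Q (C a) ?T \<and> \<pi>' a \<in> CM Q ?T (C a)"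
  proof
    fix a assume a: "a \<in> insert x A"
    show "\<iota>' a \<in> CM Q (C a) ?T \<and> \<pi>' a \<in> CM Q ?T (C a)"
    proof (cases "a = x")
      case True then show ?thesis using ia by (simp add: \<iota>'_def \<pi>'_def)
    next
      case False
      with a have "a \<in> A" by simp
      then have "\<iota> a \<in> CM Q (C a) T" "\<pi> a \<in> CM Q T (C a)" using m by blast+
      from CM_comp[OF ia(2) this(1)] CM_comp[OF this(2) ia(4)] False show ?thesis by (simp add: \<iota>'_def \<pi>'_def)
    qed
  qed
  moreover have "\<pi>' a n * \<iota>' b n = (if a = b then idm (ob (C a) n) else 0)"
    if "a \<in> insert x A" "b \<in> insert x A" for a b n
  proof -
    have E: "en (cdim T n) * \<iota> b n = \<iota> b n" if "b \<in> A" using m[OF that] CM_idm(1) by blast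
    show ?thesis
      using that \<pi>\<iota>[of a b n] E
      by (auto simp: \<iota>'_def \<pi>'_def pr_in pr_in_assoc mult.assoc)
  qed
  moreover have "(\<Sum>a\<in>insert x A. \<iota>' a n * \<pi>' a n) = idm (ob ?T n)" for n
  proof -
    have "(\<Sum>a\<in>A. \<iota>' a n * \<pi>' a n) = (\<Sum>a\<in>A. cb ?X T n * (\<iota> a n * \<pi> a n) * cq ?X T n)"
      using insert(2) by (intro sum.cong) (auto simp: \<iota>'_def \<pi>'_def mult.assoc)
    also have "\<dots> = cb ?X T n * (\<Sum>a\<in>A. \<iota> a n * \<pi> a n) * cq ?X T n" by (simp add: sum_distrib_left sum_distrib_right)
    also have "\<dots> = cb ?X T n * cq ?X T n" by (simp add: \<iota>\<pi> bdD(2)[OF blocks_bd(2)])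
    finally show ?thesis using insert(1,2) pr_in(5)[of "cdim ?X (n + 1)" "cdim T n"] by (simp add: \<iota>'_def \<pi>'_def)
  qed
  moreover have "perf Q ?T (\<lambda>j. \<Sum>a\<in>insert x A. g a j)"
    using pT insert(1,2) by (simp add: add.commute)
  ultimately show ?case by blast
qed

section \<open>Resolving simple modules\<close>

definition st :: "'k::field lin_op \<Rightarrow> int \<Rightarrow> 'k lin_op" where "st f n = (if n = 0 then f else 0)"

lemma CM_stalk: "f \<in> Hm Q M N \<Longrightarrow> st f \<in> CM Q (stalk M) (stalk N)"
  by (auto simp: CM_def ob_stalk st_def Hm_closed)

lemma lookup_arrow_mult:
  "Poly_Mapping.lookup (kQ_mult (Poly_Mapping.single (source b, [b]) 1) y) (j, as @ [a]) =
     (if a = b \<and> path_target (j, as) = source b then Poly_Mapping.lookup y (j, as) else 0)"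
  "Poly_Mapping.lookup (kQ_mult (Poly_Mapping.single (source b, [b]) 1) y) (j, []) = 0"
proof -
  have 1: "Poly_Mapping.lookup (kQ_mult (Poly_Mapping.single (source b, [b]) 1) (Poly_Mapping.single q c)) (j, as @ [a]) =
     (if a = b \<and> path_target (j, as) = source b then Poly_Mapping.lookup (Poly_Mapping.single q c) (j, as) else 0)" for q c
    by (cases q) (auto simp: kQ_mult_single lookup_single when_def path_comp_def path_source_def)
  show "Poly_Mapping.lookup (kQ_mult (Poly_Mapping.single (source b, [b]) 1) y) (j, as @ [a]) =
     (if a = b \<and> path_target (j, as) = source b then Poly_Mapping.lookup y (j, as) else 0)"
    by (subst (1 2) poly_expand[of y]) (simp only: kQ_mult_sum_right lookup_sum 1, auto intro!: sum.neutral)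
  have 2: "Poly_Mapping.lookup (kQ_mult (Poly_Mapping.single (source b, [b]) 1) (Poly_Mapping.single q c)) (j, []) = 0" for q c
    by (cases q) (auto simp: kQ_mult_single lookup_single when_def path_comp_def path_source_def)
  show "Poly_Mapping.lookup (kQ_mult (Poly_Mapping.single (source b, [b]) 1) y) (j, []) = 0"
    by (subst poly_expand[of y]) (simp only: kQ_mult_sum_right lookup_sum 2, simp)
qed

lemma bd_sum: "(\<And>a. a \<in> A \<Longrightarrow> f a \<in> bd n m) \<Longrightarrow> (\<Sum>a\<in>A. f a) \<in> bd n m"
  by (induction A rule: infinite_finite_induct) (auto simp: bd_closed)

text \<open>
  Every nontrivial path that ends in \<open>i\<close> has a unique last arrow. Hence the radical
  of the projective at \<open>i\<close> is the direct sum over the arrows \<open>a\<close> into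
  \<open>i\<close> of the projectives at their sources; \<open>\<sigma> a\<close> removes the
  last arrow \<open>a\<close>, and \<open>\<eta>\<close> picks the trivial path.
\<close>

lemma simple_presentation:
  fixes Q :: "'n::finite quiver" and i :: 'n
  assumes Q: "acyclic_quiver Q"
  defines "A \<equiv> {a. is_arrow Q a \<and> target a = i}"
  shows "\<exists>\<delta> \<sigma> \<epsilon> \<eta>. (\<forall>a\<in>A. \<delta> a \<in> Hm Q (proj_mod Q (source a)) (proj_mod Q i :: ('n, 'k::field) rmod) \<and>
      \<sigma> a \<in> bd (length (path_list Q (source a))) (length (path_list Q i))) \<and>
    \<epsilon> \<in> Hm Q (proj_mod Q i) (simple_mod i) \<and> \<eta> \<in> bd (length (path_list Q i)) 1 \<and>
    (\<forall>a\<in>A. \<forall>b\<in>A. \<sigma> a * \<delta> b = (if a = b then en (length (path_list Q (source a))) else 0)) \<and>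
    \<epsilon> * \<eta> = en 1 \<and> (\<Sum>a\<in>A. \<delta> a * \<sigma> a) + \<eta> * \<epsilon> = en (length (path_list Q i))"
proof -
  let ?L = "path_list Q"
  let ?ar = "\<lambda>a. Poly_Mapping.single (source a, [a]) (1 :: 'k)"
  have arI: "?ar a \<in> ideal Q i" if "a \<in> A" for a
    using that by (intro ideal_closed(3)) (auto simp: A_def paths_def path_target_def)
  have "\<exists>d. d \<in> Hm Q (proj_mod Q (source a)) (proj_mod Q i :: ('n, 'k) rmod) \<and>
     (\<forall>y\<in>ideal Q (source a). ap d (cv Q (source a) y) = cv Q i (kQ_mult (?ar a) y))" if a: "a \<in> A" for a
  proof -
    have u: "ap (rho (proj_mod Q i) (vtx (source a))) (cv Q i (?ar a)) = cv Q i (?ar a)"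
      by (simp add: rho_proj[OF Q arI[OF a]] vtx_mult path_source_def)
    have cvs: "cv Q i (?ar a) \<in> vs (proj_mod Q i :: ('n, 'k) rmod)" using cv_vs by simp
    obtain d where "d \<in> Hm Q (proj_mod Q (source a)) (proj_mod Q i :: ('n, 'k) rmod)"
      "ap d (gen Q (source a)) = cv Q i (?ar a)"
      "\<And>y. y \<in> ideal Q (source a) \<Longrightarrow> ap d (cv Q (source a) y) = ap (rho (proj_mod Q i) y) (cv Q i (?ar a))"
      by (rule proj_hom_ex[OF Q is_mod_proj[OF Q] cvs u]) (blast intro: that)
    then show ?thesis using rho_proj[OF Q arI[OF a]] by auto
  qed
  then obtain \<delta> where \<delta>: "\<And>a. a \<in> A \<Longrightarrow> \<delta> a \<in> Hm Q (proj_mod Q (source a)) (proj_mod Q i :: ('n, 'k) rmod)"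
     "\<And>a y. a \<in> A \<Longrightarrow> y \<in> ideal Q (source a) \<Longrightarrow> ap (\<delta> a) (cv Q (source a) y) = cv Q i (kQ_mult (?ar a) y)" by metis
  define \<sigma> :: "'n arrow \<Rightarrow> 'k lin_op" where "\<sigma> a = emb (Matrix.mat (length (?L (source a))) (length (?L i))
      (\<lambda>(r, c). if ?L i ! c = (fst (?L (source a) ! r), snd (?L (source a) ! r) @ [a]) then 1 else 0))" for a
  have \<sigma>b: "\<sigma> a \<in> bd (length (?L (source a))) (length (?L i))" for a unfolding \<sigma>_def by (rule emb_bd) simp
  have \<sigma>: "ap (\<sigma> a) (cv Q i y) r = (if r < length (?L (source a))
      then Poly_Mapping.lookup y (fst (?L (source a) ! r), snd (?L (source a) ! r) @ [a]) else 0)" if a: "a \<in> A" for a y r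
  proof (cases "r < length (?L (source a))")
    case True
    let ?p = "?L (source a) ! r" let ?q = "(fst ?p, snd ?p @ [a])"
    have "?p \<in> paths Q" "path_target ?p = source a" using path_list(2)[OF Q, of "source a"] True nth_mem by blast+
    then have "?q \<in> set (?L i)" using a
      by (auto simp: path_list(2)[OF Q] A_def paths_def is_walk_append path_target_def)
    then obtain c where c: "c < length (?L i)" "?L i ! c = ?q" by (auto simp: in_set_conv_nth)
    have "?L i ! c' = ?q \<longleftrightarrow> c' = c" if "c' < length (?L i)" for c'
      using nth_eq_iff_index_eq[OF path_list(1)[OF Q, of i] that c(1)] c(2) by simp
    then have "ap (\<sigma> a) (cv Q i y) r = (\<Sum>c'<length (?L i). (if c' = c then 1 else 0) * cv Q i y c')"
      using True by (auto simp: \<sigma>_def ap_emb intro!: sum.cong)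
    also have "\<dots> = cv Q i y c" using c by (simp add: if_distrib[of "\<lambda>z. z * _"] cong: if_cong)
    finally show ?thesis using True c by (simp add: cv_def)
  next
    case False then show ?thesis by (simp add: \<sigma>_def ap_emb)
  qed
  have u0: "uv 0 \<in> vs (simple_mod i :: ('n, 'k) rmod)" by simp
  have "ap (rho (simple_mod i) (vtx i)) (uv 0) = (uv 0 :: nat \<Rightarrow> 'k)"
    by (auto simp: rho_simple ap_en uv_def fun_eq_iff)
  from proj_hom_ex[OF Q is_mod_simple u0 this]
  obtain \<epsilon> where \<epsilon>: "\<epsilon> \<in> Hm Q (proj_mod Q i) (simple_mod i :: ('n, 'k) rmod)"
    "\<And>y. y \<in> ideal Q i \<Longrightarrow> ap \<epsilon> (cv Q i y) = ap (rho (simple_mod i) y) (uv 0)" by metis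
  define \<eta> :: "'k lin_op" where "\<eta> = colop (gen Q i)"
  have \<eta>: "\<eta> \<in> bd (length (?L i)) 1" unfolding \<eta>_def by (rule col_bd[OF gen_vs])
  have cveq: "f = g" if "f \<in> bd m (length (?L t))" "g \<in> bd m (length (?L t))"
    "\<And>y. y \<in> ideal Q t \<Longrightarrow> ap f (cv Q t y) = ap g (cv Q t y)" for f g :: "'k lin_op" and m t
  proof (rule bd_eq_vec[OF that(1,2)])
    fix v :: "nat \<Rightarrow> 'k" assume "v \<in> vsp (length (?L t))"
    then obtain y where "y \<in> ideal Q t" "cv Q t y = v" using cv_surj[OF Q] by blast
    then show "ap f v = ap g v" using that(3) by blast
  qed
  have cvz: "ap (en (length (?L t))) (cv Q t y) = (cv Q t y :: nat \<Rightarrow> 'k)" for t y by (rule vsp_iff[THEN iffD1, OF cv_vs])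
  have \<sigma>\<delta>: "\<sigma> a * \<delta> b = (if a = b then en (length (?L (source a))) else 0)" if a: "a \<in> A" and b: "b \<in> A" for a b
  proof (rule cveq[of _ "length (?L (source a))" "source b"])
    show "\<sigma> a * \<delta> b \<in> bd (length (?L (source a))) (length (?L (source b)))"
      using HmD(1)[OF \<delta>(1)[OF b]] by (intro bd_closed(6)[OF \<sigma>b]) simp
    show "(if a = b then en (length (?L (source a))) else 0) \<in> bd (length (?L (source a))) (length (?L (source b)))"
      by (auto simp: en_bd bd_closed)
    fix y :: "('n, 'k) path_alg" assume y: "y \<in> ideal Q (source b)"
    have "ap (\<sigma> a) (cv Q i (kQ_mult (?ar b) y)) r = (if a = b then cv Q (source b) y r else 0)" for r
    proof -
      have "path_target (?L (source a) ! r) = source a" if "r < length (?L (source a))"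
        using path_list(2)[OF Q, of "source a"] that nth_mem by blast
      then show ?thesis unfolding \<sigma>[OF a] lookup_arrow_mult(1) by (auto simp: cv_def)
    qed
    then show "ap (\<sigma> a * \<delta> b) (cv Q (source b) y) = ap (if a = b then en (length (?L (source a))) else 0) (cv Q (source b) y)"
      by (auto simp: \<delta>(2)[OF b y] cvz)
  qed
  have \<epsilon>\<eta>: "\<epsilon> * \<eta> = en 1"
  proof (rule bd_eq_vec[of _ 1 1])
    show "\<epsilon> * \<eta> \<in> bd 1 1" using bd_closed(6)[OF HmD(1)[OF \<epsilon>(1)], of \<eta> 1] \<eta> by simp
    have "ap \<epsilon> (gen Q i) = uv 0" unfolding gen_def using \<epsilon>(2)[OF vtx_ideal]
      by (auto simp: rho_simple ap_en uv_def fun_eq_iff)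
    then show "ap (\<epsilon> * \<eta>) v = ap (en 1) v" if "v \<in> vsp 1" for v :: "nat \<Rightarrow> 'k"
      by (auto simp: \<eta>_def mult_col ap_col uv_def ap_en fun_eq_iff)
  qed (rule en_bd)
  have finA: "finite A" unfolding A_def by (rule finite_subset[OF _ finite_arrows[of Q]]) auto
  have tot: "(\<Sum>a\<in>A. \<delta> a * \<sigma> a) + \<eta> * \<epsilon> = en (length (?L i))"
  proof (rule cveq)
    show "en (length (?L i)) \<in> bd (length (?L i)) (length (?L i))" by (rule en_bd)
    have "\<delta> a * \<sigma> a \<in> bd (length (?L i)) (length (?L i))" if "a \<in> A" for a
      using bd_closed(6)[OF HmD(1)[OF \<delta>(1)[OF that]]] \<sigma>b by simp
    then have "(\<Sum>a\<in>A. \<delta> a * \<sigma> a) \<in> bd (length (?L i)) (length (?L i))"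
      by (rule bd_sum)
    then show "(\<Sum>a\<in>A. \<delta> a * \<sigma> a) + \<eta> * \<epsilon> \<in> bd (length (?L i)) (length (?L i))"
      using HmD(1)[OF \<epsilon>(1)] by (intro bd_closed(2) bd_closed(6)[OF \<eta>]) simp_all
    fix y :: "('n, 'k) path_alg" assume y: "y \<in> ideal Q i"
    have "\<exists>z. z \<in> ideal Q (source a) \<and> cv Q (source a) z = ap (\<sigma> a) (cv Q i y)" for a
      using cv_surj[OF Q bd_vsp[OF \<sigma>b]] by metis
    then obtain z where z: "\<And>a. z a \<in> ideal Q (source a)" "\<And>a. cv Q (source a) (z a) = ap (\<sigma> a) (cv Q i y)" by metis
    have zl: "Poly_Mapping.lookup (z a) p = Poly_Mapping.lookup y (fst p, snd p @ [a])"
      if a: "a \<in> A" and p: "p \<in> paths Q" "path_target p = source a" for a p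
    proof -
      obtain r where "r < length (?L (source a))" "?L (source a) ! r = p"
        using p path_list(2)[OF Q, of "source a"] by (metis (mono_tags, lifting) in_set_conv_nth mem_Collect_eq)
      then show ?thesis using fun_cong[OF z(2)[of a], of r] unfolding \<sigma>[OF a] by (auto simp: cv_def)
    qed
    have 1: "ap (\<delta> a) (ap (\<sigma> a) (cv Q i y)) = cv Q i (kQ_mult (?ar a) (z a))" if "a \<in> A" for a
      using \<delta>(2)[OF that z(1)] z(2) by metis
    have 2: "ap \<eta> (ap \<epsilon> (cv Q i y)) = (\<lambda>r. Poly_Mapping.lookup y (i, []) * gen Q i r)"
      by (simp add: \<epsilon>(2)[OF y] \<eta>_def ap_col rho_simple ap_en uv_def mult.commute)
    have "(\<Sum>a\<in>A. cv Q i (kQ_mult (?ar a) (z a)) r) + Poly_Mapping.lookup y (i, []) * gen Q i r = cv Q i y r" for r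
    proof (cases "r < length (?L i)")
      case True
      obtain j as where q: "?L i ! r = (j, as)" by force
      have q': "(j, as) \<in> paths Q" "path_target (j, as) = i" using path_list(2)[OF Q, of i] True nth_mem q by force+
      show ?thesis
      proof (cases as rule: rev_cases)
        case Nil
        then have "j = i" using q' by (simp add: path_target_def)
        then show ?thesis using True q Nil by (simp add: cv_def lookup_arrow_mult gen_def)
      next
        case (snoc bs b)
        have b: "b \<in> A" "(j, bs) \<in> paths Q" "path_target (j, bs) = source b"
          using q' snoc by (auto simp: A_def paths_def is_walk_append path_target_def)
        have "(\<Sum>a\<in>A. cv Q i (kQ_mult (?ar a) (z a)) r) = (\<Sum>a\<in>A. if a = b then Poly_Mapping.lookup (z b) (j, bs) else 0)"
          using True q snoc b by (intro sum.cong) (auto simp: cv_def lookup_arrow_mult)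
        also have "\<dots> = Poly_Mapping.lookup y (j, as)" using finA b zl[OF b] snoc by simp
        finally show ?thesis using True q snoc by (simp add: cv_def gen_def lookup_single when_def)
      qed
    next
      case False then show ?thesis by (simp add: cv_def gen_def)
    qed
    then show "ap ((\<Sum>a\<in>A. \<delta> a * \<sigma> a) + \<eta> * \<epsilon>) (cv Q i y) = ap (en (length (?L i))) (cv Q i y)"
      by (simp add: ap_sum_op 1 2 cvz cong: sum.cong)
  qed
  show ?thesis
    by (rule exI[of _ \<delta>], rule exI[of _ \<sigma>], rule exI[of _ \<epsilon>], rule exI[of _ \<eta>])
       (use \<delta>(1) \<sigma>b \<epsilon>(1) \<eta> \<sigma>\<delta> \<epsilon>\<eta> tot in blast)
qed

text \<open>
  The Euler characteristics are kept as part of the notion, since the glued resolutions are not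
  compared with the resolved complex in any other way.
\<close>

definition resolvable :: "'n quiver \<Rightarrow> ('n::finite, 'k::field) cpx \<Rightarrow> bool" where
  "resolvable Q X \<longleftrightarrow> (\<exists>R g e. perf Q R g \<and> qis Q R X e \<and> (\<forall>l. euler (tdim l) R = (euler (tdim l) X :: 'k)))"

text \<open>
  Resolutions of modules are concentrated in nonpositive degrees; this identifies the module
  with the cokernel of their last differential.
\<close>

definition nonpos :: "('n, 'k::field) cpx \<Rightarrow> bool" where "nonpos R \<longleftrightarrow> (\<forall>n>0. cdim R n = 0)"

definition mod_resolution :: "'n quiver \<Rightarrow> ('n::finite, 'k::field) rmod \<Rightarrow> bool" where
  "mod_resolution Q M \<longleftrightarrow> (\<exists>R g e. perf Q R g \<and> qis Q R (stalk M) e \<and> nonpos R \<and>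
     (\<forall>l. euler (tdim l) R = (tdim l M :: 'k)))"

lemma trc_split:
  assumes "F \<in> bd m s" "L \<in> bd s m" "G \<in> bd n m" "H \<in> bd m n" "L * F = en s" "G * H = en n" "F * L + H * G = en m"
    "f \<in> bd m m" "fs \<in> bd s s" "fn \<in> bd n n" "f * F = F * fs" "G * f = fn * G"
  shows "trc m f = trc s fs + trc n fn"
proof -
  have "trc m f = trc m (F * (L * f) + H * (G * f))"
    using assms(7) bdD(1)[OF assms(8)] by (simp flip: mult.assoc distrib_right)
  also have "\<dots> = trc s (L * f * F) + trc n (G * f * H)"
    unfolding trc_simps using assms
    by (subst trc_cyclic[of F m s] trc_cyclic[of H m n], auto intro: bd_closed(6))+
  also have "L * f * F = fs" using assms(5,9,11) bdD(1) by (metis mult.assoc)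
  also have "G * f * H = fn" using assms(6,10,12) bdD(2) by (metis mult.assoc)
  finally show ?thesis .
qed

lemma ses_tdim:
  assumes "ses Q S M N F G" "bounded_cpx Q S" "bounded_cpx Q M" "bounded_cpx Q N"
  shows "tdim l (ob M n) = tdim l (ob S n) + tdim l (ob N n)"
proof -
  obtain L H where L: "L \<in> bd (cdim S n) (cdim M n)" "H \<in> bd (cdim M n) (cdim N n)"
    "L * F n = idm (ob S n)" "G n * H = idm (ob N n)" "F n * L + H * G n = idm (ob M n)"
    using assms(1) unfolding ses_def by blast
  note F = CM_D(1)[OF sesD(1)[OF assms(1)], of n] and G = CM_D(1)[OF sesD(2)[OF assms(1)], of n]
  show ?thesis
    unfolding tdim_def
    by (rule trc_split[OF HmD(1)[OF F] L(1) HmD(1)[OF G] L(2-5)])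
       (simp_all add: rho_bd[OF cpxD(1)[OF assms(2)]] rho_bd[OF cpxD(1)[OF assms(3)]]
         rho_bd[OF cpxD(1)[OF assms(4)]] HmD(2)[OF F] HmD(2)[OF G])
qed

lemma ses_euler:
  assumes "ses Q S M N F G" "bounded_cpx Q S" "bounded_cpx Q M" "bounded_cpx Q N"
  shows "euler (tdim l) M = euler (tdim l) S + euler (tdim l) N"
proof -
  let ?A = "{n. cdim S n \<noteq> 0} \<union> {n. cdim M n \<noteq> 0} \<union> {n. cdim N n \<noteq> 0}"
  have "finite ?A" by (intro finite_UnI cpx_finite[OF assms(2)] cpx_finite[OF assms(3)] cpx_finite[OF assms(4)])
  then show ?thesis
    by (subst (1 2 3) euler_eq[OF additive_tdim[of Q l], of ?A])
       (auto simp: ses_tdim[OF assms] distrib_left sum.distrib)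
qed

lemma resolution_ses:
  assumes Q: "acyclic_quiver (Q :: 'n::finite quiver)"
    and b: "bounded_cpx Q (S :: ('n, 'k::field) cpx)" "bounded_cpx Q M" "bounded_cpx Q N" and ses: "ses Q S M N F G"
    and R: "perf Q R g" "qis Q R N e" "\<forall>l. euler (tdim l) R = (euler (tdim l) N :: 'k)"
    and R': "perf Q R' g'" "qis Q R' S e'" "\<forall>l. euler (tdim l) R' = (euler (tdim l) S :: 'k)"
  shows "\<exists>R'' g'' e''. perf Q R'' g'' \<and> qis Q R'' M e'' \<and> (\<forall>l. euler (tdim l) R'' = (euler (tdim l) M :: 'k)) \<and>
    (nonpos R \<longrightarrow> nonpos R' \<longrightarrow> nonpos R'')"
proof -
  note p = perf_proj[OF R(1) Q] perf_proj[OF R'(1) Q]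
  obtain f \<Psi> where f: "f \<in> CM Q (ush R) R'" "qis Q (cn (ush R) R' f) M \<Psi>"
    using ses_resolution[OF b ses p(1) R(2) p(2) R'(2)] by blast
  note ub = bounded_ush[OF proj_cpxD(1)[OF p(1)]]
  have "perf Q (cn (ush R) R' f) (\<lambda>j. g' j - (- g j))" by (rule perf_cn[OF perf_ush[OF R(1)] R'(1) Q f(1)])
  moreover have "euler (tdim l) (cn (ush R) R' f) = (euler (tdim l) M :: 'k)" for l
    using R(3) R'(3) by (simp add: euler_cone[OF additive_tdim ub proj_cpxD(1)[OF p(2)]] euler_ush ses_euler[OF ses b])
  moreover have "nonpos R \<longrightarrow> nonpos R' \<longrightarrow> nonpos (cn (ush R) R' f)" by (simp add: nonpos_def)
  ultimately show ?thesis using f(2) by blast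
qed

lemma ses_stalk:
  assumes "F \<in> Hm Q S M" "G \<in> Hm Q M N" "L \<in> bd (mdim S) (mdim M)" "H \<in> bd (mdim M) (mdim N)"
    "L * F = idm S" "G * H = idm N" "F * L + H * G = idm M"
  shows "ses Q (stalk S) (stalk M) (stalk N) (st F) (st G)"
  unfolding ses_def
proof (intro conjI CM_stalk assms allI)
  fix n :: int
  show "\<exists>L\<in>bd (cdim (stalk S) n) (cdim (stalk M) n). \<exists>H\<in>bd (cdim (stalk M) n) (cdim (stalk N) n).
    L * st F n = idm (ob (stalk S) n) \<and> st G n * H = idm (ob (stalk N) n) \<and> st F n * L + H * st G n = idm (ob (stalk M) n)"
    using assms by (intro bexI[of _ "st L n"] bexI[of _ "st H n"]) (auto simp: ob_stalk st_def)
qed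

lemma en_zeroD: "en n = (0 :: 'k::field lin_op) \<Longrightarrow> n = 0"
proof (rule ccontr)
  assume "en n = (0 :: 'k lin_op)" "n \<noteq> 0"
  then have "ap (en n) (uv 0) 0 = (0 :: 'k)" by simp
  then show False using \<open>n \<noteq> 0\<close> by (simp add: ap_en uv_def)
qed

lemma simple_resolution:
  fixes Q :: "'n::finite quiver"
  assumes Q: "acyclic_quiver Q"
  shows "mod_resolution Q (simple_mod i :: ('n, 'k::field) rmod)"
proof -
  let ?A = "{a. is_arrow Q a \<and> target a = i}"
  let ?P = "\<lambda>i. proj_mod Q i :: ('n, 'k) rmod"
  obtain \<delta> \<sigma> \<epsilon> \<eta> where \<delta>: "\<forall>a\<in>?A. \<delta> a \<in> Hm Q (?P (source a)) (?P i) \<and>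
      \<sigma> a \<in> bd (length (path_list Q (source a))) (length (path_list Q i))"
    and \<epsilon>: "\<epsilon> \<in> Hm Q (?P i) (simple_mod i)" and \<eta>: "\<eta> \<in> bd (length (path_list Q i)) 1"
    and \<sigma>\<delta>: "\<forall>a\<in>?A. \<forall>b\<in>?A. \<sigma> a * \<delta> b = (if a = b then en (length (path_list Q (source a))) else 0)"
    and \<epsilon>\<eta>: "\<epsilon> * \<eta> = en 1" and tot: "(\<Sum>a\<in>?A. \<delta> a * \<sigma> a) + \<eta> * \<epsilon> = en (length (path_list Q i))"
    using simple_presentation[OF Q, of i, where 'k = 'k] by blast
  have fin: "finite ?A" by (rule finite_subset[OF _ finite_arrows[of Q]]) auto
  have "\<forall>a\<in>?A. perf Q (stalk (?P (source a))) (\<lambda>j. if j = source a then 1 else 0)" by (simp add: perf_stalk)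
  from direct_sum[OF Q fin this] obtain T \<iota> \<pi> where T: "perf Q T (\<lambda>j. \<Sum>a\<in>?A. if j = source a then 1 else 0)"
    and \<iota>: "\<forall>a\<in>?A. \<iota> a \<in> CM Q (stalk (?P (source a))) T \<and> \<pi> a \<in> CM Q T (stalk (?P (source a)))"
    and \<pi>\<iota>: "\<forall>a\<in>?A. \<forall>b\<in>?A. \<forall>n. \<pi> a n * \<iota> b n = (if a = b then idm (ob (stalk (?P (source a))) n) else 0)"
    and \<iota>\<pi>: "\<forall>n. (\<Sum>a\<in>?A. \<iota> a n * \<pi> a n) = idm (ob T n)" by (elim exE conjE) (rule that)
  note Tp = perf_proj[OF T Q]
  have Pb: "bounded_cpx Q (stalk (?P j))" for j by (rule bounded_stalk[OF is_mod_proj[OF Q]])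
  have z: "\<iota> a n = 0 \<and> \<pi> a n = 0" if "a \<in> ?A" "n \<noteq> 0" for a n
    using HmD(1)[OF CM_D(1)[OF conjunct1[OF \<iota>[rule_format, OF that(1)]]], of n]
      HmD(1)[OF CM_D(1)[OF conjunct2[OF \<iota>[rule_format, OF that(1)]]], of n] that(2) by (simp add: ob_stalk)
  have Tz: "cdim T n = 0" if "n \<noteq> 0" for n
  proof -
    have "idm (ob T n) = (\<Sum>a\<in>?A. \<iota> a n * \<pi> a n)" using \<iota>\<pi> by simp
    also have "\<dots> = 0" by (rule sum.neutral) (use z that in auto)
    finally show ?thesis by (rule en_zeroD)
  qed
  define F where "F n = (\<Sum>a\<in>?A. st (\<delta> a) n * \<pi> a n)" for n
  define L where "L n = (\<Sum>a\<in>?A. \<iota> a n * st (\<sigma> a) n)" for n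
  have FC: "F \<in> CM Q T (stalk (?P i))"
  proof -
    have "(\<lambda>n. st (\<delta> a) n * \<pi> a n) \<in> CM Q T (stalk (?P i))" if "a \<in> ?A" for a
      by (rule CM_comp[OF CM_stalk[OF conjunct1[OF \<delta>[rule_format, OF that]]] conjunct2[OF \<iota>[rule_format, OF that]]])
    then show ?thesis
      unfolding F_def CM_def by (auto intro!: Hm_sum sum.cong simp: sum_distrib_left sum_distrib_right)
  qed
  have Lb: "L n \<in> bd (cdim T n) (cdim (stalk (?P i)) n)" for n
    unfolding L_def
  proof (rule bd_sum)
    fix a assume a: "a \<in> ?A"
    have "st (\<sigma> a) n \<in> bd (cdim (stalk (?P (source a))) n) (cdim (stalk (?P i)) n)"
      using conjunct2[OF \<delta>[rule_format, OF a]] by (simp add: st_def ob_stalk bd_closed)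
    then show "\<iota> a n * st (\<sigma> a) n \<in> bd (cdim T n) (cdim (stalk (?P i)) n)"
      using HmD(1)[OF CM_D(1)[OF conjunct1[OF \<iota>[rule_format, OF a]]]] bd_closed(6) by blast
  qed
  have LF: "L n * F n = idm (ob T n)" for n
  proof (cases "n = 0")
    case True
    have "L n * F n = (\<Sum>a\<in>?A. \<Sum>b\<in>?A. \<iota> a n * (\<sigma> a * \<delta> b) * \<pi> b n)"
      by (simp add: L_def F_def sum_product st_def True mult.assoc)
    also have "\<dots> = (\<Sum>a\<in>?A. \<Sum>b\<in>?A. if a = b then \<iota> a n * \<pi> a n else 0)"
    proof (intro sum.cong refl)
      fix a b assume a: "a \<in> ?A" and b: "b \<in> ?A"
      have "en (length (path_list Q (source b))) * \<pi> b n = \<pi> b n"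
        using CM_idm(1)[OF conjunct2[OF \<iota>[rule_format, OF b]], of n] by (simp add: ob_stalk True)
      then show "\<iota> a n * (\<sigma> a * \<delta> b) * \<pi> b n = (if a = b then \<iota> a n * \<pi> a n else 0)"
        using \<sigma>\<delta>[rule_format, OF a b] by (simp add: mult.assoc)
    qed
    also have "\<dots> = (\<Sum>a\<in>?A. \<iota> a n * \<pi> a n)" using fin by simp
    finally show ?thesis using \<iota>\<pi> by simp
  next
    case False then show ?thesis using Tz[OF False] Lb[of n] by simp
  qed
  have FL: "F n * L n + st \<eta> n * st \<epsilon> n = idm (ob (stalk (?P i)) n)" for n
  proof (cases "n = 0")
    case True
    have "F n * L n = (\<Sum>a\<in>?A. \<Sum>b\<in>?A. \<delta> a * (\<pi> a n * \<iota> b n) * \<sigma> b)"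
      by (simp add: L_def F_def sum_product st_def True mult.assoc)
    also have "\<dots> = (\<Sum>a\<in>?A. \<Sum>b\<in>?A. if a = b then \<delta> a * \<sigma> a else 0)"
    proof (intro sum.cong refl)
      fix a b assume a: "a \<in> ?A" and b: "b \<in> ?A"
      have "en (length (path_list Q (source b))) * \<sigma> b = \<sigma> b"
        by (rule bdD(1)[OF conjunct2[OF \<delta>[rule_format, OF b]]])
      then show "\<delta> a * (\<pi> a n * \<iota> b n) * \<sigma> b = (if a = b then \<delta> a * \<sigma> a else 0)"
        using \<pi>\<iota>[rule_format, OF a b, of n] by (simp add: mult.assoc ob_stalk True)
    qed
    also have "\<dots> = (\<Sum>a\<in>?A. \<delta> a * \<sigma> a)" using fin by simp
    finally show ?thesis using tot by (simp add: st_def ob_stalk True)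
  next
    case False then show ?thesis using Lb[of n] Tz[OF False] by (simp add: st_def ob_stalk)
  qed
  have ses: "ses Q T (stalk (?P i)) (stalk (simple_mod i)) F (st \<epsilon>)"
    unfolding ses_def
  proof (intro conjI FC CM_stalk \<epsilon> allI)
    fix n
    have "st \<epsilon> n * st \<eta> n = idm (ob (stalk (simple_mod i)) n)"
      "st \<eta> n \<in> bd (cdim (stalk (?P i)) n) (cdim (stalk (simple_mod i :: ('n, 'k) rmod)) n)"
      using \<epsilon>\<eta> \<eta> by (auto simp: st_def ob_stalk)
    then show "\<exists>L\<in>bd (cdim T n) (cdim (stalk (?P i)) n).
       \<exists>H\<in>bd (cdim (stalk (?P i)) n) (cdim (stalk (simple_mod i :: ('n, 'k) rmod)) n).
       L * F n = idm (ob T n) \<and> st \<epsilon> n * H = idm (ob (stalk (simple_mod i)) n) \<and>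
       F n * L + H * st \<epsilon> n = idm (ob (stalk (?P i)) n)"
      using LF[of n] FL[of n] Lb[of n] by blast
  qed
  have sb: "bounded_cpx Q (stalk (simple_mod i :: ('n, 'k) rmod))" by (rule bounded_stalk[OF is_mod_simple])
  have p: "perf Q (cn T (stalk (?P i)) F) (\<lambda>j. (if j = i then 1 else 0) - (\<Sum>a\<in>?A. if j = source a then 1 else 0))"
    by (rule perf_cn[OF T perf_stalk Q FC])
  have "euler (tdim l) (cn T (stalk (?P i)) F) = (tdim l (simple_mod i :: ('n, 'k) rmod) :: 'k)" for l
    using ses_euler[OF ses proj_cpxD(1)[OF Tp] Pb sb, of l]
    by (simp add: euler_cone[OF additive_tdim proj_cpxD(1)[OF Tp] Pb] euler_stalk[OF additive_tdim])
  moreover have "nonpos (cn T (stalk (?P i)) F)" by (simp add: nonpos_def Tz ob_stalk)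
  ultimately show ?thesis
    unfolding mod_resolution_def using p ses_cone[OF proj_cpxD(1)[OF Tp] Pb sb ses] by blast
qed

section \<open>Resolving arbitrary complexes\<close>

lift_definition drop_at :: "nat \<Rightarrow> nat \<Rightarrow> 'k::field lin_op" is
  "\<lambda>r m x i. if i < m then x (if i < r then i else i + 1) else 0" by (auto simp: fun_eq_iff)
lift_definition ins_at :: "nat \<Rightarrow> nat \<Rightarrow> 'k::field lin_op" is
  "\<lambda>r m x i. if i < r \<and> i < m then x i else if r < i \<and> i \<le> m then x (i - 1) else 0" by (auto simp: fun_eq_iff)

lemma ap_drop_at: "ap (drop_at r m) x = (\<lambda>i. if i < m then x (if i < r then i else i + 1) else 0)"
  by (simp add: drop_at.rep_eq)
lemma ap_ins_at: "ap (ins_at r m) x = (\<lambda>i. if i < r \<and> i < m then x i else if r < i \<and> i \<le> m then x (i - 1) else 0)"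
  by (simp add: ins_at.rep_eq)

text \<open>
  Splitting off the line of a nonzero vector: \<open>L\<close> reads off a coordinate
  \<open>r\<close> in which \<open>u\<close> does not vanish, and the quotient is the space of
  the other coordinates.
\<close>

lemma quotient_by_vector:
  fixes u :: "nat \<Rightarrow> 'k::field"
  assumes u: "u \<in> vsp (Suc m)" "u \<noteq> (\<lambda>i. 0)"
  obtains G H L where "G \<in> bd m (Suc m)" "H \<in> bd (Suc m) m" "L \<in> bd 1 (Suc m)" "L * colop u = en 1"
    "G * H = en m" "colop u * L + H * G = en (Suc m)" "G * colop u = 0"
proof -
  obtain r where r: "r < Suc m" "u r \<noteq> 0"
    using u unfolding vsp_def fun_eq_iff mem_Collect_eq by (metis not_less)
  define L :: "'k lin_op" where "L = emb (Matrix.mat 1 (Suc m) (\<lambda>(i, j). if j = r then inverse (u r) else 0))"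
  \<comment> \<open>Subtract the multiple of \<open>u\<close> that clears coordinate \<open>r\<close>, then delete this coordinate.\<close>
  define G where "G = drop_at r m * (en (Suc m) - colop u * L)"
  have aL: "ap L x = (\<lambda>i. if i < 1 then inverse (u r) * x r else 0)" for x
    using r by (auto simp: L_def ap_emb if_distrib[of "\<lambda>c. c * _"] cong: if_cong)
  have L: "L \<in> bd 1 (Suc m)" unfolding L_def by (rule emb_bd) simp
  have H: "(ins_at r m :: 'k lin_op) \<in> bd (Suc m) m"
    by (auto simp: bd_def ap_ins_at ap_en fun_eq_iff intro!: lin_op_eqI)
  have dr: "(drop_at r m :: 'k lin_op) \<in> bd m (Suc m)"
    by (auto simp: bd_def ap_drop_at ap_en fun_eq_iff intro!: lin_op_eqI)
  have uL: "colop u * L \<in> bd (Suc m) (Suc m)" by (rule bd_closed(6)[OF col_bd[OF u(1)] L])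
  have G: "G \<in> bd m (Suc m)" unfolding G_def by (intro bd_closed(6)[OF dr] bd_closed(3) en_bd uL)
  have Lu: "L * colop u = en 1"
    by (rule lin_op_eqI) (use r in \<open>auto simp: aL ap_col ap_en fun_eq_iff\<close>)
  have LH: "L * ins_at r m = 0" by (rule lin_op_eqI) (simp add: aL ap_ins_at)
  have dH: "drop_at r m * ins_at r m = (en m :: 'k lin_op)"
    by (rule lin_op_eqI) (use r in \<open>auto simp: ap_drop_at ap_ins_at ap_en\<close>)
  have GH: "G * ins_at r m = en m"
    using dH bdD(1)[OF H] by (simp add: G_def mult.assoc left_diff_distrib LH)
  have Hd: "ap (ins_at r m) (ap (drop_at r m) x) = x" if "x \<in> vsp (Suc m)" "x r = 0" for x
    using that r by (auto simp: ap_drop_at ap_ins_at vsp_def fun_eq_iff)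
  have "ins_at r m * G = en (Suc m) - colop u * L"
  proof (rule lin_op_eqI)
    fix x i
    let ?w = "ap (en (Suc m) - colop u * L) x"
    have "?w \<in> vsp (Suc m)" by (rule bd_vsp[OF bd_closed(3)[OF en_bd uL]])
    moreover have "?w r = 0" using r by (simp add: ap_en aL ap_col)
    ultimately show "ap (ins_at r m * G) x i = ap (en (Suc m) - colop u * L) x i"
      using Hd[of ?w] by (simp add: G_def)
  qed
  then have tot: "colop u * L + ins_at r m * G = en (Suc m)" by simp
  have "(en (Suc m) - colop u * L) * colop u = 0"
    using bdD(1)[OF col_bd[OF u(1)]] bdD(2)[OF col_bd[OF u(1)]] Lu by (simp add: left_diff_distrib mult.assoc)
  then have Gu: "G * colop u = 0" by (simp add: G_def mult.assoc)
  show ?thesis by (rule that[OF G H L Lu GH tot Gu])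
qed

text \<open>
  Among the vertices at which \<open>M\<close> does not vanish choose a source-minimal one
  \<open>j\<close>. Arrows act from their target to their source, so every arrow kills \<open>M
  e\<^sub>j\<close>, and any nonzero vector there spans a simple submodule.
\<close>

lemma simple_submodule:
  fixes M :: "('n::finite, 'k::field) rmod"
  assumes Q: "acyclic_quiver Q" and M: "is_mod Q M" and nz: "mdim M \<noteq> 0"
  shows "\<exists>j u. u \<in> vs M \<and> u \<noteq> (\<lambda>i. 0) \<and> (\<forall>x\<in>kQ Q. ap (rho M x) u = (\<lambda>i. Poly_Mapping.lookup x (j, []) * u i))"
proof -
  let ?S = "{j. rho M (vtx j) \<noteq> 0}"
  have "?S \<noteq> {}"
  proof
    assume "?S = {}"
    then have "rho M kQ_one = 0" unfolding kQ_one_def by (subst rho_sum[OF M]) auto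
    then have z: "idm M = 0" using rho_simps(4)[OF M] by simp
    show False using en_zeroD[OF z] nz by simp
  qed
  then obtain j0 where j0: "j0 \<in> ?S" by blast
  have "wf (arr Q)"
    using finite_acyclic_wf[OF finite] Q by (simp add: acyclic_quiver_def)
  from wfE_min[OF this j0] obtain j where j: "j \<in> ?S" "\<And>s. (s, j) \<in> arr Q \<Longrightarrow> s \<notin> ?S" by blast
  then obtain v where v: "ap (rho M (vtx j)) v \<noteq> (\<lambda>i. 0)" using lin_op_eqI[of "rho M (vtx j)" 0] by (auto simp: fun_eq_iff)
  define u where "u = ap (rho M (vtx j)) v"
  have uj: "ap (rho M (vtx i)) u = (if i = j then u else (\<lambda>i. 0))" for i
  proof -
    have "rho M (kQ_mult (vtx j) (vtx i)) = rho M (vtx i) * rho M (vtx j)" by (rule rho_simps(3)[OF M]) simp_all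
    then show ?thesis unfolding u_def
      by (auto simp: vtx_mult path_source_def rho_zero[OF M] simp flip: ap_simps(6))
  qed
  have arr0: "ap (rho M (Poly_Mapping.single (source a, [a]) 1)) u = (\<lambda>i. 0)" if a: "is_arrow Q a" for a
  proof -
    let ?s = "Poly_Mapping.single (source a, [a]) (1 :: 'k)"
    have p: "(source a, [a]) \<in> paths Q" using a by (simp add: paths_def)
    have k: "?s \<in> kQ Q" by (rule kQ_closed(4)[OF p])
    show ?thesis
    proof (cases "target a = j")
      case True
      then have "0 < Q (source a) j" using a by (auto simp: is_arrow_def source_def target_def split: prod.splits)
      then have "rho M (vtx (source a)) = 0" using j(2) by blast
      moreover have "rho M (kQ_mult ?s (vtx (source a))) = rho M (vtx (source a)) * rho M ?s"
        by (rule rho_simps(3)[OF M k]) simp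
      ultimately show ?thesis by (simp add: vtx_mult path_source_def)
    next
      case False
      have "rho M (kQ_mult (vtx (target a)) ?s) = rho M ?s * rho M (vtx (target a))"
        by (rule rho_simps(3)[OF M _ k]) simp
      then have "ap (rho M ?s) u = ap (rho M ?s) (ap (rho M (vtx (target a))) u)"
        by (simp add: vtx_mult path_target_def flip: ap_simps(6))
      then show ?thesis using uj[of "target a"] False by simp
    qed
  qed
  have path0: "ap (rho M (Poly_Mapping.single p 1)) u = (if p = (j, []) then u else (\<lambda>i. 0))" if p: "p \<in> paths Q" for p
  proof -
    obtain i as where ia: "p = (i, as)" by force
    show ?thesis
    proof (cases as rule: rev_cases)
      case Nil then show ?thesis using uj[of i] ia by simp
    next
      case (snoc bs a)
      then have a: "is_arrow Q a" "(i, bs) \<in> paths Q" "path_target (i, bs) = source a"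
        using p ia by (auto simp: paths_def is_walk_append)
      let ?s = "Poly_Mapping.single (source a, [a]) (1 :: 'k)" and ?b = "Poly_Mapping.single (i, bs) (1 :: 'k)"
      have k: "?s \<in> kQ Q" "?b \<in> kQ Q" using a by (auto intro!: kQ_closed(4) simp: paths_def)
      have "kQ_mult ?s ?b = Poly_Mapping.single p 1"
        using a ia snoc by (simp add: kQ_mult_single path_source_def path_comp_def)
      then have "rho M (Poly_Mapping.single p 1) = rho M ?b * rho M ?s" using rho_simps(3)[OF M k] by simp
      then show ?thesis using arr0[OF a(1)] ia snoc by simp
    qed
  qed
  have "ap (rho M x) u = (\<lambda>i. Poly_Mapping.lookup x (j, []) * u i)" if x: "x \<in> kQ Q" for x
  proof
    fix i
    have "ap (rho M x) u i = (\<Sum>p\<in>Poly_Mapping.keys x. Poly_Mapping.lookup x p * ap (rho M (Poly_Mapping.single p 1)) u i)"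
      by (simp add: rho_expand[OF M x] ap_sum_op)
    also have "\<dots> = (\<Sum>p\<in>Poly_Mapping.keys x. if p = (j, []) then Poly_Mapping.lookup x p * u i else 0)"
      using x by (intro sum.cong) (auto simp: path0 kQ_def subset_iff split: if_splits)
    also have "\<dots> = Poly_Mapping.lookup x (j, []) * u i" by (simp add: in_keys_iff)
    finally show "ap (rho M x) u i = Poly_Mapping.lookup x (j, []) * u i" .
  qed
  moreover have "u \<in> vs M" unfolding u_def by (rule bd_vsp[OF rho_bd[OF M vtx_closed]])
  ultimately show ?thesis using v unfolding u_def by blast
qed

lemma module_filtration_step:
  fixes M :: "('n::finite, 'k::field) rmod"
  assumes Q: "acyclic_quiver Q" and M: "is_mod Q M" and nz: "mdim M \<noteq> 0"
  obtains j N F G where "is_mod Q N" "mdim N < mdim M" "ses Q (stalk (simple_mod j)) (stalk M) (stalk N) F G"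
proof -
  obtain j u where u: "u \<in> vs M" "u \<noteq> (\<lambda>i. 0)" "\<And>x. x \<in> kQ Q \<Longrightarrow> ap (rho M x) u = (\<lambda>i. Poly_Mapping.lookup x (j, []) * u i)"
    using simple_submodule[OF assms] by blast
  obtain m where m: "mdim M = Suc m" using nz not0_implies_Suc by blast
  obtain G H L where G: "G \<in> bd m (Suc m)" "H \<in> bd (Suc m) m" "L \<in> bd 1 (Suc m)" "L * colop u = en 1"
    "G * H = en m" "colop u * L + H * G = en (Suc m)" "G * colop u = 0"
    by (rule quotient_by_vector[OF u(1)[unfolded m] u(2)])
  have ru: "rho M x * colop u = scl (Poly_Mapping.lookup x (j, [])) (colop u)" if "x \<in> kQ Q" for x
    by (rule lin_op_eqI) (simp add: mult_col u(3)[OF that] ap_col)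
  have rb: "rho M x \<in> bd (Suc m) (Suc m)" if "x \<in> kQ Q" for x using rho_bd[OF M that] m by simp
  have Gx: "G * rho M x * H * G = G * rho M x" if x: "x \<in> kQ Q" for x
  proof -
    have "H * G = en (Suc m) - colop u * L" using G(6) by (simp add: algebra_simps)
    then have "G * rho M x * (H * G) = G * rho M x - G * (rho M x * colop u) * L"
      using bdD(2)[OF rb[OF x]] by (simp add: right_diff_distrib mult.assoc)
    then show ?thesis by (simp add: ru[OF x] scl_mult_right G(7) scl_mult_left mult.assoc)
  qed
  have Gx': "G * rho M x * H * (G * z) = G * rho M x * z" if x: "x \<in> kQ Q" for x z
    using Gx[OF x] by (metis mult.assoc)
  obtain N where N: "is_mod Q N" "mdim N = m" "\<And>x. x \<in> kQ Q \<Longrightarrow> rho N x = G * rho M x * H"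
  proof (rule mk_mod[of Q "\<lambda>x. G * rho M x * H" m])
    show "G * rho M x * H \<in> bd m m" if "x \<in> kQ Q" for x
      by (intro bd_closed(6)[OF bd_closed(6)[OF G(1) rb[OF that]] G(2)])
    show "G * rho M kQ_one * H = en m" using rho_simps(4)[OF M] bdD(2)[OF G(1)] G(5) m by simp
    show "G * rho M (kQ_mult x y) * H = G * rho M y * H * (G * rho M x * H)" if "x \<in> kQ Q" "y \<in> kQ Q" for x y
      using Gx'[OF that(2), of "rho M x * H"] by (simp add: rho_simps(3)[OF M that] mult.assoc)
  qed (auto simp: rho_simps[OF M] distrib_left distrib_right scl_mult_left scl_mult_right)
  have F: "colop u \<in> Hm Q (simple_mod j) M"
    using col_bd[OF u(1)] bdD(2)[OF col_bd[OF u(1)]] by (simp add: Hm_def ru rho_simple scl_mult_right)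
  have GH: "G \<in> Hm Q M N" using G(1) m N Gx by (simp add: Hm_def)
  have "ses Q (stalk (simple_mod j)) (stalk M) (stalk N) (st (colop u)) (st G)"
    using G m N(2) by (intro ses_stalk[OF F GH, of L H]) auto
  then show ?thesis using that[OF N(1)] N(2) m by simp
qed

lemma qis_zero:
  assumes "bounded_cpx Q X" "\<And>n. cdim X n = 0"
  shows "qis Q zero_cpx X (\<lambda>n. 0)"
  unfolding qis_def using assms(2) by (auto simp: CM_closed zero_cpx_def)

text \<open>
  Induction on the dimension: split off a simple submodule and apply the horseshoe lemma.
\<close>

theorem module_resolution:
  fixes M :: "('n::finite, 'k::field) rmod"
  assumes Q: "acyclic_quiver Q" and M: "is_mod Q M"
  shows "mod_resolution Q M"
  using M
proof (induction "mdim M" arbitrary: M rule: less_induct)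
  case less
  show ?case
  proof (cases "mdim M = 0")
    case True
    then have "qis Q zero_cpx (stalk M) (\<lambda>n. 0)"
      by (intro qis_zero bounded_stalk less.prems) (simp add: ob_stalk)
    then show ?thesis unfolding mod_resolution_def using perf_zero True
      by (intro exI[of _ zero_cpx] exI[of _ "\<lambda>j. 0"] exI[of _ "\<lambda>n. 0"])
         (auto simp: nonpos_def zero_cpx_def euler_def additive_zero[OF additive_tdim[of Q]])
  next
    case False
    obtain j N F G where N: "is_mod Q N" "mdim N < mdim M" and ses: "ses Q (stalk (simple_mod j)) (stalk M) (stalk N) F G"
      by (rule module_filtration_step[OF Q less.prems False])
    obtain R g e where R: "perf Q R g" "qis Q R (stalk N) e" "nonpos R" "\<forall>l. euler (tdim l) R = (euler (tdim l) (stalk N) :: 'k)"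
      using less.hyps[OF N(2,1)] unfolding mod_resolution_def euler_stalk[OF additive_tdim[of Q]] by blast
    obtain R' g' e' where R': "perf Q R' g'" "qis Q R' (stalk (simple_mod j)) e'" "nonpos R'"
      "\<forall>l. euler (tdim l) R' = (euler (tdim l) (stalk (simple_mod j)) :: 'k)"
      using simple_resolution[OF Q, of j] unfolding mod_resolution_def euler_stalk[OF additive_tdim[of Q]] by blast
    show ?thesis
      using resolution_ses[OF Q bounded_stalk[OF is_mod_simple] bounded_stalk[OF less.prems] bounded_stalk[OF N(1)] ses R(1,2,4) R'(1,2,4)] R(3) R'(3)
      unfolding mod_resolution_def euler_stalk[OF additive_tdim[of Q]] by blast
  qed
qed

definition stalk_at :: "int \<Rightarrow> ('n, 'k::field) rmod \<Rightarrow> ('n, 'k) cpx" where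
  "stalk_at a M = \<lparr>ob = (\<lambda>n. if n = a then M else zero_mod),
     diff = (\<lambda>n. 0\<^sub>m (if n + 1 = a then mdim M else 0) (if n = a then mdim M else 0))\<rparr>"

lemma at_zero: "stalk_at 0 M = stalk M"
  by (auto simp: stalk_at_def stalk_def fun_eq_iff)

lemma at_shift: "shift (stalk_at (a + 1) M) = stalk_at a M" and at_ush: "ush (stalk_at a M) = stalk_at (a + 1) M"
  by (auto simp: stalk_at_def shift_def ush_def fun_eq_iff intro!: eq_matI)

lemma resolvable_shift: "resolvable Q X \<Longrightarrow> resolvable Q (shift X)"
  unfolding resolvable_def using perf_shift qis_shift by (metis euler_shift)

lemma resolvable_ush: "resolvable Q X \<Longrightarrow> resolvable Q (ush X)"
  unfolding resolvable_def using perf_ush qis_ush by (metis euler_ush)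

lemma resolvable_at:
  assumes Q: "acyclic_quiver Q" and M: "is_mod Q M"
  shows "resolvable Q (stalk_at a M)"
proof (induction a rule: int_induct[of _ 0])
  case base
  show ?case using module_resolution[OF assms]
    unfolding at_zero resolvable_def mod_resolution_def euler_stalk[OF additive_tdim[of Q]] by blast
next
  case (step1 i) then show ?case using resolvable_ush[of Q "stalk_at i M"] by (simp add: at_ush)
next
  case (step2 i) then show ?case using resolvable_shift[of Q "stalk_at i M"] at_shift[of "i - 1" M] by simp
qed

text \<open>
  Induction on the number of nonzero terms: the terms above the lowest one form a subcomplex,
  and the quotient is a module in a single degree.
\<close>

theorem resolution_exists:
  fixes X :: "('n::finite, 'k::field) cpx"
  assumes Q: "acyclic_quiver Q" and X: "bounded_cpx Q X"
  shows "resolvable Q X"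
  using X
proof (induction "card {n. cdim X n \<noteq> 0}" arbitrary: X rule: less_induct)
  case less
  note fin = cpx_finite[OF less.prems] and Xb = less.prems
  show ?case
  proof (cases "{n. cdim X n \<noteq> 0} = {}")
    case True
    then have "qis Q zero_cpx X (\<lambda>n. 0)" by (intro qis_zero Xb) auto
    then show ?thesis unfolding resolvable_def using perf_zero True
      by (intro exI[of _ zero_cpx] exI[of _ "\<lambda>j. 0"] exI[of _ "\<lambda>n. 0"]) (auto simp: euler_def zero_cpx_def)
  next
    case False
    define a where "a = Min {n. cdim X n \<noteq> 0}"
    have a: "cdim X a \<noteq> 0" using Min_in[OF fin False] by (simp add: a_def)
    have lt: "cdim X n = 0" if "n < a" for n using Min_le[OF fin, of n] that by (auto simp: a_def)
    define X' where "X' = \<lparr>ob = (\<lambda>n. if n = a then zero_mod else ob X n),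
      diff = (\<lambda>n. if n = a then 0\<^sub>m (cdim X (n + 1)) 0 else if n + 1 = a then 0\<^sub>m 0 (cdim X n) else diff X n)\<rparr>"
    have obX': "ob X' n = (if n = a then zero_mod else ob X n)" for n by (simp add: X'_def)
    have DX': "D X' n = (if n = a \<or> n + 1 = a then 0 else D X n)" for n by (simp add: X'_def)
    have Da: "D X (a - 1) = 0" using HmD(1)[OF cpxD(3)[OF Xb, of a]] lt[of "a - 1"] by simp
    have "diff X n \<in> carrier_mat (cdim X (n + 1)) (cdim X n)" for n using Xb by (auto simp: bounded_cpx_def mod_hom_def)
    then have X'b: "bounded_cpx Q X'"
      using cpxD[OF Xb] fin
      by (intro cpxI) (auto simp: obX' DX' is_mod_zero Hm_closed X'_def elim: finite_subset[rotated])
    have atb: "bounded_cpx Q (stalk_at a (ob X a))"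
    proof (rule cpxI)
      show "finite {n. cdim (stalk_at a (ob X a)) n \<noteq> 0}" by (rule finite_subset[of _ "{a}"]) (auto simp: stalk_at_def)
    qed (auto simp: stalk_at_def is_mod_zero cpxD(1)[OF Xb] Hm_closed)
    define F where "F n = (if n = a then 0 else idm (ob X n) :: 'k lin_op)" for n
    define G where "G n = (if n = a then idm (ob X n) else 0 :: 'k lin_op)" for n
    have obat: "ob (stalk_at a (ob X a)) n = (if n = a then ob X a else zero_mod)" "D (stalk_at a (ob X a)) n = 0" for n
      by (simp_all add: stalk_at_def)
    have e: "D X n * idm (ob X n) = D X n" "idm (ob X (n + 1)) * D X n = D X n" for n
      using HmD(3,4)[OF cpxD(2)[OF Xb, of n]] by auto
    have "D X n * F n = F (n + 1) * D X' n" for n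
      using Da e by (cases "n + 1 = a") (auto simp: F_def DX')
    then have FC: "F \<in> CM Q X' X"
      using Hm_id[OF cpxD(1)[OF Xb]] by (auto simp: CM_def obX' F_def Hm_closed)
    have "D X n = 0" if "n + 1 = a" for n using Da that by auto
    then have GC: "G \<in> CM Q X (stalk_at a (ob X a))"
      using Hm_id[OF cpxD(1)[OF Xb]] by (auto simp: CM_def obat G_def Hm_closed)
    have ses: "ses Q X' X (stalk_at a (ob X a)) F G"
      unfolding ses_def
    proof (intro conjI FC GC allI)
      fix n
      show "\<exists>L\<in>bd (cdim X' n) (cdim X n). \<exists>H\<in>bd (cdim X n) (cdim (stalk_at a (ob X a)) n).
          L * F n = idm (ob X' n) \<and> G n * H = idm (ob (stalk_at a (ob X a)) n) \<and> F n * L + H * G n = idm (ob X n)"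
        by (rule bexI[of _ "F n"], rule bexI[of _ "G n"]) (auto simp: F_def G_def obX' obat bd_closed en_bd)
    qed
    have "{n. cdim X' n \<noteq> 0} = {n. cdim X n \<noteq> 0} - {a}" by (auto simp: obX')
    then have "card {n. cdim X' n \<noteq> 0} < card {n. cdim X n \<noteq> 0}"
      using card_Diff1_less[OF fin, of a] a by simp
    then have "resolvable Q X'" by (rule less.hyps[OF _ X'b])
    moreover have "resolvable Q (stalk_at a (ob X a))" by (rule resolvable_at[OF Q cpxD(1)[OF Xb]])
    ultimately show ?thesis
      using resolution_ses[OF Q X'b Xb atb ses] unfolding resolvable_def by blast
  qed
qed

section \<open>Homotopy invariance of the Euler characteristic\<close>

text \<open>
  The trace of \<open>d h + h d\<close> cancels in neighbouring degrees by cyclicity.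
\<close>

lemma trc_null:
  fixes R :: "('n::finite, 'k::field) cpx"
  assumes R: "bounded_cpx Q R" and z: "null Q R R k"
  shows "(\<Sum>n | cdim R n \<noteq> 0. sgp n * trc (cdim R n) (rho (ob R n) (vtx l) * k n)) = (0 :: 'k)"
proof -
  obtain h where h: "\<And>n. h n \<in> Hm Q (ob R n) (ob R (n - 1))" "\<And>n. k n = D R (n - 1) * h n + h (n + 1) * D R n"
    using z unfolding null_def by blast
  let ?S = "{n. cdim R n \<noteq> 0}"
  let ?A = "?S \<union> (\<lambda>n. n - 1) ` ?S" and ?r = "\<lambda>n. rho (ob R n) (vtx l)"
  define t where "t n = trc (cdim R n) (?r n * (D R (n - 1) * h n))" for n
  have fin: "finite ?S" by (rule cpx_finite[OF R])
  have rb: "?r n \<in> bd (cdim R n) (cdim R n)" for n by (rule rho_bd[OF cpxD(1)[OF R] vtx_closed])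
  have h1: "h (n + 1) \<in> bd (cdim R n) (cdim R (n + 1))" for n using HmD(1)[OF h(1)[of "n + 1"]] by simp
  have "trc (cdim R n) (?r n * (h (n + 1) * D R n)) = t (n + 1)" for n
  proof -
    have "?r n * h (n + 1) = h (n + 1) * ?r (n + 1)" using HmD(2)[OF h(1)[of "n + 1"], of "vtx l"] by simp
    then have "trc (cdim R n) (?r n * (h (n + 1) * D R n)) = trc (cdim R n) (h (n + 1) * (?r (n + 1) * D R n))"
      by (simp flip: mult.assoc)
    also have "\<dots> = trc (cdim R (n + 1)) (?r (n + 1) * D R n * h (n + 1))"
      by (rule trc_cyclic[OF h1 bd_closed(6)[OF rb HmD(1)[OF cpxD(2)[OF R]]]])
    finally show ?thesis by (simp add: t_def mult.assoc)
  qed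
  then have e: "trc (cdim R n) (?r n * k n) = t n + t (n + 1)" for n
    by (simp add: h(2) t_def distrib_left trc_simps)
  have t0: "t n = 0" if "cdim R n = 0" for n using that by (simp add: t_def trc_def)
  have "(\<Sum>n\<in>?S. sgp n * trc (cdim R n) (?r n * k n)) = (\<Sum>n\<in>?A. sgp n * (t n + t (n + 1)))"
    unfolding e[symmetric] using fin by (intro sum.mono_neutral_left) (auto simp: trc_def)
  also have "\<dots> = (\<Sum>n\<in>?A. sgp n * t n) + (\<Sum>n\<in>?A. sgp n * t (n + 1))" by (simp add: distrib_left sum.distrib)
  also have "(\<Sum>n\<in>?A. sgp n * t n) = (\<Sum>n\<in>?S. sgp n * t n)"
    using fin t0 by (intro sum.mono_neutral_right) auto
  also have "(\<Sum>n\<in>?A. sgp n * t (n + 1)) = (\<Sum>n\<in>(\<lambda>n. n - 1) ` ?S. sgp n * t (n + 1))"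
    using fin t0 by (intro sum.mono_neutral_right) (auto simp: image_iff, metis add_diff_cancel_right')
  also have "\<dots> = (\<Sum>n\<in>?S. - (sgp n * t n))"
    by (subst sum.reindex) (auto simp: inj_on_def)
  finally show ?thesis by (simp add: sum_negf)
qed

lemma euler_homotopy_equivalence:
  fixes R R' :: "('n::finite, 'k::field) cpx"
  assumes R: "bounded_cpx Q R" and R': "bounded_cpx Q R'" and f: "f \<in> CM Q R R'" and g: "g \<in> CM Q R' R"
    and "null Q R R (\<lambda>n. g n * f n - idm (ob R n))" "null Q R' R' (\<lambda>n. f n * g n - idm (ob R' n))"
  shows "euler (tdim l) R = (euler (tdim l) R' :: 'k)"
proof -
  have 1: "euler (tdim l) R = (\<Sum>n | cdim R n \<noteq> 0. sgp n * trc (cdim R n) (rho (ob R n) (vtx l) * (g n * f n)))"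
    if R: "bounded_cpx Q R" and "null Q R R (\<lambda>n. g n * f n - idm (ob R n))" for R R' :: "('n, 'k) cpx" and f g
    using trc_null[OF that, of l]
    by (simp add: euler_def tdim_def right_diff_distrib trc_simps sum_subtractf en_rho[OF cpxD(1)[OF R]])
  let ?A = "{n. cdim R n \<noteq> 0} \<union> {n. cdim R' n \<noteq> 0}"
  have fin: "finite ?A" using cpx_finite[OF R] cpx_finite[OF R'] by blast
  have "euler (tdim l) R = (\<Sum>n\<in>?A. sgp n * trc (cdim R n) (rho (ob R n) (vtx l) * (g n * f n)))"
    unfolding 1[OF R assms(5)] using fin by (intro sum.mono_neutral_left) (auto simp: trc_def)
  also have "\<dots> = (\<Sum>n\<in>?A. sgp n * trc (cdim R' n) (rho (ob R' n) (vtx l) * (f n * g n)))"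
  proof (intro sum.cong refl arg_cong2[of _ _ _ _ "(*)"])
    fix n
    have b: "rho (ob R n) (vtx l) * g n \<in> bd (cdim R n) (cdim R' n)"
      by (rule bd_closed(6)[OF rho_bd[OF cpxD(1)[OF R] vtx_closed] HmD(1)[OF CM_D(1)[OF g]]])
    have "trc (cdim R n) (rho (ob R n) (vtx l) * (g n * f n)) = trc (cdim R' n) (f n * (rho (ob R n) (vtx l) * g n))"
      using trc_cyclic[OF b HmD(1)[OF CM_D(1)[OF f]]] by (simp add: mult.assoc)
    then show "trc (cdim R n) (rho (ob R n) (vtx l) * (g n * f n)) = trc (cdim R' n) (rho (ob R' n) (vtx l) * (f n * g n))"
      using HmD(2)[OF CM_D(1)[OF f, of n] vtx_closed, of l] by (simp flip: mult.assoc)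
  qed
  also have "\<dots> = euler (tdim l) R'"
    unfolding 1[OF R' assms(6)] using fin by (intro sum.mono_neutral_right) (auto simp: trc_def)
  finally show ?thesis .
qed

lemma emb_chain_comp:
  assumes "u \<in> chain_map Q A B" "v \<in> chain_map Q C A"
  shows "emb (chain_comp u v n) = emb (u n) * emb (v n)"
  using chain_map_carrier[OF assms(1), of n] chain_map_carrier[OF assms(2), of n]
  by (simp add: chain_comp_def emb_mult)

lemma chain_comp_map:
  assumes b: "bounded_cpx Q A" "bounded_cpx Q B" "bounded_cpx Q C" and u: "u \<in> chain_map Q A B" and v: "v \<in> chain_map Q C A"
  shows "chain_comp u v \<in> chain_map Q C B" "chain_comp u v = mts C B (\<lambda>n. emb (u n) * emb (v n))"
proof -
  let ?w = "\<lambda>n. emb (u n) * emb (v n)"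
  have w: "?w \<in> CM Q C B" by (rule CM_comp[OF chain_map_emb[OF b(1,2) u] chain_map_emb[OF b(3,1) v]])
  show e: "chain_comp u v = mts C B ?w"
  proof
    fix n
    show "chain_comp u v n = mts C B ?w n"
    proof (rule emb_inj[of _ "cdim B n" "cdim C n"])
      show "chain_comp u v n \<in> carrier_mat (cdim B n) (cdim C n)"
        unfolding chain_comp_def by (rule mult_carrier_mat[OF chain_map_carrier[OF u] chain_map_carrier[OF v]])
      show "mts C B ?w n \<in> carrier_mat (cdim B n) (cdim C n)" by (simp add: mts_def)
      show "emb (chain_comp u v n) = emb (mts C B ?w n)" by (simp add: emb_chain_comp[OF u v] mts_emb(2)[OF b(3,2) w])
    qed
  qed
  show "chain_comp u v \<in> chain_map Q C B" unfolding e by (rule mts_emb(1)[OF b(3,2) w])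
qed

section \<open>The action of roofs on maps from projective complexes\<close>

text \<open>
  The roof \<open>X \<leftarrow> W \<rightarrow> Y\<close> carries the map \<open>r : R
  \<rightarrow> X\<close> to \<open>y : R \<rightarrow> Y\<close> if \<open>r\<close> lifts to
  \<open>W\<close> up to homotopy with image \<open>y\<close>. For a bounded complex
  \<open>R\<close> of projectives this is a function on homotopy classes.
\<close>

definition tracks :: "'n quiver \<Rightarrow> ('n::finite, 'k::field) cpx \<Rightarrow> ('n, 'k) cpx \<Rightarrow> ('n, 'k) roof \<Rightarrow> ('n, 'k) cpx \<Rightarrow>
    (int \<Rightarrow> 'k lin_op) \<Rightarrow> (int \<Rightarrow> 'k lin_op) \<Rightarrow> bool" where
  "tracks Q X Y \<phi> R r y = (case \<phi> of (W, s, f) \<Rightarrow> y \<in> CM Q R Y \<and>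
     (\<exists>r'\<in>CM Q R W. null Q R X (\<lambda>n. emb (s n) * r' n - r n) \<and> null Q R Y (\<lambda>n. emb (f n) * r' n - y n)))"

lemma roofsD:
  assumes "(W, s, f) \<in> roofs Q X Y" "bounded_cpx Q X" "bounded_cpx Q Y"
  shows "bounded_cpx Q W" "qis Q W X (\<lambda>n. emb (s n))" "(\<lambda>n. emb (s n)) \<in> CM Q W X" "(\<lambda>n. emb (f n)) \<in> CM Q W Y"
proof -
  show W: "bounded_cpx Q W" using assms by (simp add: roofs_def)
  show q: "qis Q W X (\<lambda>n. emb (s n))" using assms by (intro quasi_iso_qis W) (auto simp: roofs_def)
  then show "(\<lambda>n. emb (s n)) \<in> CM Q W X" by (rule qis_CM)
  show "(\<lambda>n. emb (f n)) \<in> CM Q W Y" using assms by (intro chain_map_emb W) (auto simp: roofs_def)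
qed

locale acyclic =
  fixes Q :: "'n::finite quiver"
  assumes Q: "acyclic_quiver Q"
begin

lemma resolve:
  assumes "bounded_cpx Q (X :: ('n, 'k::field) cpx)"
  obtains R g e where "perf Q R g" "proj_cpx Q R" "qis Q R X e" "\<And>l. euler (tdim l) R = (euler (tdim l) X :: 'k)"
  using resolution_exists[OF Q assms] perf_proj[OF _ Q] unfolding resolvable_def by blast

lemma tracks_ex:
  assumes "\<phi> \<in> roofs Q X Y" "bounded_cpx Q X" "bounded_cpx Q Y" "proj_cpx Q R" "r \<in> CM Q R X"
  shows "\<exists>y\<in>CM Q R Y. tracks Q X Y \<phi> R r y"
proof -
  obtain W s f where \<phi>: "\<phi> = (W, s, f)" by (cases \<phi>) auto
  note d = roofsD[OF assms(1)[unfolded \<phi>] assms(2,3)]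
  obtain r' where r': "r' \<in> CM Q R W" "null Q R X (\<lambda>n. emb (s n) * r' n - r n)"
    by (rule lift_ex[OF assms(4) d(1) assms(2) d(2) assms(5)])
  show ?thesis unfolding tracks_def \<phi>
    by (rule bexI[of _ "\<lambda>n. emb (f n) * r' n"])
       (use r' CM_comp[OF d(4) r'(1)] null_refl[of Q R Y "\<lambda>n. emb (f n) * r' n"] in auto)
qed

lemma tracks_unique:
  assumes "\<phi> \<in> roofs Q X Y" "bounded_cpx Q X" "bounded_cpx Q Y" "proj_cpx Q R"
    "tracks Q X Y \<phi> R r y" "tracks Q X Y \<phi> R r2 y2" "null Q R X (\<lambda>n. r n - r2 n)"
  shows "null Q R Y (\<lambda>n. y n - y2 n)"
proof -
  obtain W s f where \<phi>: "\<phi> = (W, s, f)" by (cases \<phi>) auto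
  note d = roofsD[OF assms(1)[unfolded \<phi>] assms(2,3)]
  obtain a where a: "a \<in> CM Q R W" "null Q R X (\<lambda>n. emb (s n) * a n - r n)" "null Q R Y (\<lambda>n. emb (f n) * a n - y n)"
    using assms(5) by (auto simp: tracks_def \<phi>)
  obtain b where b: "b \<in> CM Q R W" "null Q R X (\<lambda>n. emb (s n) * b n - r2 n)" "null Q R Y (\<lambda>n. emb (f n) * b n - y2 n)"
    using assms(6) by (auto simp: tracks_def \<phi>)
  have "null Q R X (\<lambda>n. emb (s n) * a n - emb (s n) * b n)"
    by (rule null_trans[OF a(2) null_trans[OF assms(7) null_sym[OF b(2)]]])
  then have "null Q R X (\<lambda>n. emb (s n) * (a n - b n))" by (simp add: right_diff_distrib)
  then have "null Q R W (\<lambda>n. a n - b n)" by (rule lift_unique[OF assms(4) d(1) assms(2) d(2) CM_closed(3)[OF a(1) b(1)]])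
  then have "null Q R Y (\<lambda>n. emb (f n) * (a n - b n))" by (rule null_left[OF d(4)])
  then have "null Q R Y (\<lambda>n. emb (f n) * a n - emb (f n) * b n)" by (simp add: right_diff_distrib)
  from null_trans[OF null_sym[OF a(3)] null_trans[OF this b(3)]] show ?thesis .
qed

lemma tracks_cong:
  assumes "tracks Q X Y \<phi> R r y" "null Q R X (\<lambda>n. r n - r2 n)" "null Q R Y (\<lambda>n. y n - y2 n)" "y2 \<in> CM Q R Y"
  shows "tracks Q X Y \<phi> R r2 y2"
proof -
  obtain W s f where \<phi>: "\<phi> = (W, s, f)" by (cases \<phi>) auto
  obtain a where a: "a \<in> CM Q R W" "null Q R X (\<lambda>n. emb (s n) * a n - r n)" "null Q R Y (\<lambda>n. emb (f n) * a n - y n)"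
    using assms(1) by (auto simp: tracks_def \<phi>)
  show ?thesis unfolding tracks_def \<phi> using a(1) assms(4) null_trans[OF a(2) assms(2)] null_trans[OF a(3) assms(3)] by auto
qed

lemma tracks_rel:
  assumes rel: "(\<phi>, \<psi>) \<in> roof_rel Q X Y" and X: "bounded_cpx Q X" and Y: "bounded_cpx Q Y" and R: "proj_cpx Q R"
    and r: "r \<in> CM Q R X" and t: "tracks Q X Y \<phi> R r y"
  shows "tracks Q X Y \<psi> R r y"
proof -
  obtain W s f V t' g where \<phi>: "\<phi> = (W, s, f)" "\<psi> = (V, t', g)" by (cases \<phi>, cases \<psi>) auto
  have rf: "(W, s, f) \<in> roofs Q X Y" "(V, t', g) \<in> roofs Q X Y" using rel by (auto simp: roof_rel_def \<phi>)
  note d = roofsD[OF rf(1) X Y] and d' = roofsD[OF rf(2) X Y]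
  obtain U a b where U: "bounded_cpx Q U" "a \<in> chain_map Q U W" "b \<in> chain_map Q U V" "quasi_iso Q U X (chain_comp s a)"
    "(chain_comp s a, chain_comp t' b) \<in> homotopy_rel Q U X" "(chain_comp f a, chain_comp g b) \<in> homotopy_rel Q U Y"
    using rel by (auto simp: roof_rel_def \<phi>)
  note aC = chain_map_emb[OF U(1) d(1) U(2)] and bC = chain_map_emb[OF U(1) d'(1) U(3)]
  have ch: "s \<in> chain_map Q W X" "f \<in> chain_map Q W Y" "t' \<in> chain_map Q V X" "g \<in> chain_map Q V Y"
    using rf by (auto simp: roofs_def quasi_iso_def)
  note es = emb_chain_comp[OF ch(1) U(2)] emb_chain_comp[OF ch(2) U(2)] emb_chain_comp[OF ch(3) U(3)] emb_chain_comp[OF ch(4) U(3)]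
  have q: "qis Q U X (\<lambda>n. emb (s n) * emb (a n))" using quasi_iso_qis[OF U(1) X U(4)] by (simp add: es)
  have n1: "null Q U X (\<lambda>n. emb (s n) * emb (a n) - emb (t' n) * emb (b n))"
    and n2: "null Q U Y (\<lambda>n. emb (f n) * emb (a n) - emb (g n) * emb (b n))"
    using U(5,6) by (auto simp: homotopy_rel_iff[OF U(1) X] homotopy_rel_iff[OF U(1) Y] es)
  obtain r' where r': "r' \<in> CM Q R U" "null Q R X (\<lambda>n. emb (s n) * emb (a n) * r' n - r n)"
    by (rule lift_ex[OF R U(1) X q r])
  have "tracks Q X Y \<phi> R r (\<lambda>n. emb (f n) * (emb (a n) * r' n))"
    unfolding tracks_def \<phi> using CM_comp[OF d(4) CM_comp[OF aC r'(1)]] CM_comp[OF aC r'(1)] r'(2) null_refl[of Q R Y "\<lambda>n. emb (f n) * (emb (a n) * r' n)"]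
    by (auto intro!: bexI[of _ "\<lambda>n. emb (a n) * r' n"] simp: mult.assoc)
  from tracks_unique[OF rf(1)[folded \<phi>(1)] X Y R this t null_refl]
  have z: "null Q R Y (\<lambda>n. emb (f n) * (emb (a n) * r' n) - y n)" .
  have "null Q R X (\<lambda>n. emb (t' n) * emb (b n) * r' n - emb (s n) * emb (a n) * r' n)"
    using null_right[OF null_sym[OF n1] r'(1)] by (simp add: left_diff_distrib)
  from null_trans[OF this r'(2)] have z1: "null Q R X (\<lambda>n. emb (t' n) * (emb (b n) * r' n) - r n)" by (simp add: mult.assoc)
  have "null Q R Y (\<lambda>n. emb (g n) * emb (b n) * r' n - emb (f n) * emb (a n) * r' n)"
    using null_right[OF null_sym[OF n2] r'(1)] by (simp add: left_diff_distrib)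
  from null_trans[OF this] z have "null Q R Y (\<lambda>n. emb (g n) * (emb (b n) * r' n) - y n)" by (simp add: mult.assoc)
  then show ?thesis unfolding tracks_def \<phi> using z1 CM_comp[OF bC r'(1)] t by (auto simp: tracks_def \<phi>)
qed

text \<open>
  A resolution \<open>P\<close> of \<open>X\<close> is itself a common refinement of two roofs
  that act on it in the same way.
\<close>

lemma rel_tracks:
  assumes rf: "\<phi> \<in> roofs Q X Y" "\<psi> \<in> roofs Q X Y" and X: "bounded_cpx Q X" and Y: "bounded_cpx Q Y"
    and P: "proj_cpx Q P" and p: "qis Q P X p" and t: "tracks Q X Y \<phi> P p y" "tracks Q X Y \<psi> P p y"
  shows "(\<phi>, \<psi>) \<in> roof_rel Q X Y"
proof -
  obtain W s f V t' g where \<phi>: "\<phi> = (W, s, f)" "\<psi> = (V, t', g)" by (cases \<phi>, cases \<psi>) auto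
  note d = roofsD[OF rf(1)[unfolded \<phi>(1)] X Y] and d' = roofsD[OF rf(2)[unfolded \<phi>(2)] X Y]
  note Pb = proj_cpxD(1)[OF P]
  have ch: "s \<in> chain_map Q W X" "f \<in> chain_map Q W Y" "t' \<in> chain_map Q V X" "g \<in> chain_map Q V Y"
    using rf by (auto simp: roofs_def quasi_iso_def \<phi>)
  obtain a where a: "a \<in> CM Q P W" "null Q P X (\<lambda>n. emb (s n) * a n - p n)" "null Q P Y (\<lambda>n. emb (f n) * a n - y n)"
    using t(1) by (auto simp: tracks_def \<phi>)
  obtain b where b: "b \<in> CM Q P V" "null Q P X (\<lambda>n. emb (t' n) * b n - p n)" "null Q P Y (\<lambda>n. emb (g n) * b n - y n)"
    using t(2) by (auto simp: tracks_def \<phi>)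
  let ?a = "mts P W a" and ?b = "mts P V b"
  note am = mts_emb[OF Pb d(1) a(1)] and bm = mts_emb[OF Pb d'(1) b(1)]
  note es = emb_chain_comp[OF ch(1) am(1)] emb_chain_comp[OF ch(2) am(1)] emb_chain_comp[OF ch(3) bm(1)] emb_chain_comp[OF ch(4) bm(1)]
    chain_comp_map(1)[OF d(1) X Pb ch(1) am(1)] chain_comp_map(1)[OF d(1) Y Pb ch(2) am(1)]
    chain_comp_map(1)[OF d'(1) X Pb ch(3) bm(1)] chain_comp_map(1)[OF d'(1) Y Pb ch(4) bm(1)]
  have q: "qis Q P X (\<lambda>n. emb (s n) * a n)"
    by (rule qis_homotopic[OF p CM_comp[OF d(3) a(1)] a(2)])
  have "quasi_iso Q P X (chain_comp s ?a)"
    by (rule qis_quasi_iso[OF Pb X es(5)]) (simp add: es am q)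
  moreover have "(chain_comp s ?a, chain_comp t' ?b) \<in> homotopy_rel Q P X"
    using null_trans[OF a(2) null_sym[OF b(2)]] by (simp add: homotopy_rel_iff[OF Pb X] es am bm)
  moreover have "(chain_comp f ?a, chain_comp g ?b) \<in> homotopy_rel Q P Y"
    using null_trans[OF a(3) null_sym[OF b(3)]] by (simp add: homotopy_rel_iff[OF Pb Y] es am bm)
  ultimately show ?thesis
    unfolding roof_rel_def \<phi> using rf Pb am(1) bm(1) by (auto simp: \<phi>)
qed

definition acts :: "('n, 'k::field) cpx \<Rightarrow> ('n, 'k) cpx \<Rightarrow> ('n, 'k) roof set \<Rightarrow> ('n, 'k) cpx \<Rightarrow>
    (int \<Rightarrow> 'k lin_op) \<Rightarrow> (int \<Rightarrow> 'k lin_op) \<Rightarrow> bool" where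
  "acts X Y F R r y \<longleftrightarrow> (\<exists>\<phi>\<in>F. tracks Q X Y \<phi> R r y)"

abbreviation roof_class :: "('n, 'k::field) cpx \<Rightarrow> ('n, 'k) cpx \<Rightarrow> ('n, 'k) roof \<Rightarrow> ('n, 'k) roof set" where
  "roof_class X Y \<phi> \<equiv> roof_rel Q X Y `` {\<phi>}"

lemma Mor_Db: "F \<in> Mor (Db Q) X Y \<longleftrightarrow> (\<exists>\<phi>\<in>roofs Q X Y. F = roof_class X Y \<phi>)"
  by (auto simp: Db_def quotient_def)

lemma class_iff:
  assumes "\<phi> \<in> roofs Q X Y" and X: "bounded_cpx Q X" and Y: "bounded_cpx Q Y"
    and P: "proj_cpx Q P" and p: "qis Q P X p" and t: "tracks Q X Y \<phi> P p y"
  shows "\<psi> \<in> roof_class X Y \<phi> \<longleftrightarrow> \<psi> \<in> roofs Q X Y \<and> tracks Q X Y \<psi> P p y"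
proof
  assume "\<psi> \<in> roof_class X Y \<phi>"
  then have "(\<phi>, \<psi>) \<in> roof_rel Q X Y" by simp
  then show "\<psi> \<in> roofs Q X Y \<and> tracks Q X Y \<psi> P p y"
    using tracks_rel[OF _ X Y P qis_CM[OF p] t] by (auto simp: roof_rel_def)
next
  assume "\<psi> \<in> roofs Q X Y \<and> tracks Q X Y \<psi> P p y"
  then show "\<psi> \<in> roof_class X Y \<phi>" using rel_tracks[OF assms(1) _ X Y P p t] by simp
qed

lemma class_self:
  assumes "\<phi> \<in> roofs Q X Y" and X: "bounded_cpx Q X" and Y: "bounded_cpx Q Y"
  shows "\<phi> \<in> roof_class X Y \<phi>"
proof -
  obtain P g p where P: "perf Q P g" "proj_cpx Q P" "qis Q P X p" using resolve[OF X] by metis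
  obtain y where "tracks Q X Y \<phi> P p y" using tracks_ex[OF assms P(2) qis_CM[OF P(3)]] by blast
  then show ?thesis using class_iff[OF assms P(2,3)] assms(1) by blast
qed

lemma acts_class:
  assumes "\<phi> \<in> roofs Q X Y" and X: "bounded_cpx Q X" and Y: "bounded_cpx Q Y" and R: "proj_cpx Q R" and r: "r \<in> CM Q R X"
  shows "acts X Y (roof_class X Y \<phi>) R r y \<longleftrightarrow> tracks Q X Y \<phi> R r y"
proof
  assume "acts X Y (roof_class X Y \<phi>) R r y"
  then obtain \<psi> where \<psi>: "(\<phi>, \<psi>) \<in> roof_rel Q X Y" "tracks Q X Y \<psi> R r y" by (auto simp: acts_def)
  have rf: "\<psi> \<in> roofs Q X Y" using \<psi>(1) by (auto simp: roof_rel_def)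
  obtain y' where y': "y' \<in> CM Q R Y" "tracks Q X Y \<phi> R r y'" using tracks_ex[OF assms] by blast
  have "null Q R Y (\<lambda>n. y' n - y n)"
    by (rule tracks_unique[OF rf X Y R tracks_rel[OF \<psi>(1) X Y R r y'(2)] \<psi>(2) null_refl])
  moreover have "y \<in> CM Q R Y" using \<psi>(2) by (auto simp: tracks_def)
  ultimately show "tracks Q X Y \<phi> R r y" using tracks_cong[OF y'(2) null_refl] by blast
next
  assume "tracks Q X Y \<phi> R r y"
  then show "acts X Y (roof_class X Y \<phi>) R r y" using class_self[OF assms(1-3)] by (auto simp: acts_def)
qed

lemma acts_ex:
  assumes "F \<in> Mor (Db Q) X Y" "bounded_cpx Q X" "bounded_cpx Q Y" "proj_cpx Q R" "r \<in> CM Q R X"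
  shows "\<exists>y\<in>CM Q R Y. acts X Y F R r y"
  using assms tracks_ex acts_class unfolding Mor_Db by metis

lemma acts_unique:
  assumes "F \<in> Mor (Db Q) X Y" "bounded_cpx Q X" "bounded_cpx Q Y" "proj_cpx Q R" "r \<in> CM Q R X" "r2 \<in> CM Q R X"
    "acts X Y F R r y" "acts X Y F R r2 y2" "null Q R X (\<lambda>n. r n - r2 n)"
  shows "null Q R Y (\<lambda>n. y n - y2 n)"
proof -
  obtain \<phi> where \<phi>: "\<phi> \<in> roofs Q X Y" "F = roof_class X Y \<phi>" using assms(1) unfolding Mor_Db by blast
  show ?thesis
    using assms(7,8) acts_class[OF \<phi>(1) assms(2-5)] acts_class[OF \<phi>(1) assms(2-4,6)]
      tracks_unique[OF \<phi>(1) assms(2-4) _ _ assms(9)] unfolding \<phi>(2) by blast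
qed

lemma acts_cong:
  assumes "acts X Y F R r y" "null Q R X (\<lambda>n. r n - r2 n)" "null Q R Y (\<lambda>n. y n - y2 n)" "y2 \<in> CM Q R Y"
  shows "acts X Y F R r2 y2"
  using assms tracks_cong unfolding acts_def by blast

lemma acts_CM: "acts X Y F R r y \<Longrightarrow> y \<in> CM Q R Y"
  by (auto simp: acts_def tracks_def)

text \<open>
  The Yoneda principle for the derived category: a resolution represents maps out of
  \<open>X\<close>, so the value on it determines the morphism.
\<close>

lemma Mor_eqI:
  assumes F: "F \<in> Mor (Db Q) X Y" and G: "G \<in> Mor (Db Q) X Y" and X: "bounded_cpx Q X" and Y: "bounded_cpx Q Y"
    and P: "proj_cpx Q P" "qis Q P X p" and a: "acts X Y F P p y" "acts X Y G P p y"
  shows "F = G"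
proof -
  obtain \<phi> where \<phi>: "\<phi> \<in> roofs Q X Y" "F = roof_class X Y \<phi>" using F unfolding Mor_Db by blast
  obtain \<psi> where \<psi>: "\<psi> \<in> roofs Q X Y" "G = roof_class X Y \<psi>" using G unfolding Mor_Db by blast
  have "tracks Q X Y \<phi> P p y" "tracks Q X Y \<psi> P p y"
    using a acts_class[OF \<phi>(1) X Y P(1) qis_CM[OF P(2)]] acts_class[OF \<psi>(1) X Y P(1) qis_CM[OF P(2)]] by (simp_all add: \<phi> \<psi>)
  then show ?thesis using class_iff[OF \<phi>(1) X Y P] class_iff[OF \<psi>(1) X Y P] unfolding \<phi>(2) \<psi>(2) by blast
qed

text \<open>
  Whatever common refinement is used to compose two roofs, the composite acts by composing the
  actions; hence composition is well defined on classes.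
\<close>

lemma Cmp_Db:
  assumes F: "F \<in> Mor (Db Q) X Y" and G: "G \<in> Mor (Db Q) Y Z" and X: "bounded_cpx Q X" and Y: "bounded_cpx Q Y" and Z: "bounded_cpx Q Z"
  shows "Cmp (Db Q) X Y Z G F \<in> Mor (Db Q) X Z"
    "proj_cpx Q R \<Longrightarrow> r \<in> CM Q R X \<Longrightarrow> acts X Y F R r y \<Longrightarrow> acts Y Z G R y z \<Longrightarrow> acts X Z (Cmp (Db Q) X Y Z G F) R r z"
proof -
  obtain \<phi> where \<phi>: "\<phi> \<in> roofs Q X Y" "F = roof_class X Y \<phi>" using F unfolding Mor_Db by blast
  obtain \<psi> where \<psi>: "\<psi> \<in> roofs Q Y Z" "G = roof_class Y Z \<psi>" using G unfolding Mor_Db by blast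
  have comp: "\<theta> \<in> roofs Q X Z \<and> (\<forall>R r y z. proj_cpx Q R \<longrightarrow> r \<in> CM Q R X \<longrightarrow> acts X Y F R r y \<longrightarrow> acts Y Z G R y z \<longrightarrow> tracks Q X Z \<theta> R r z)"
    if f: "f \<in> F" and g: "g \<in> G" and \<theta>: "\<theta> \<in> roof_comp Q Y g f" for f g \<theta>
  proof -
    have fr: "f \<in> roofs Q X Y" "g \<in> roofs Q Y Z" using f g by (auto simp: \<phi> \<psi> roof_rel_def)
    obtain W s u V t v where fg: "f = (W, s, u)" "g = (V, t, v)" by (cases f, cases g) auto
    note d = roofsD[OF fr(1)[unfolded fg] X Y] and d' = roofsD[OF fr(2)[unfolded fg] Y Z]
    obtain U a b where U: "bounded_cpx Q U" "quasi_iso Q U W a" "b \<in> chain_map Q U V"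
      "(chain_comp u a, chain_comp t b) \<in> homotopy_rel Q U Y" and \<theta>': "\<theta> = (U, chain_comp s a, chain_comp v b)"
      using \<theta> by (auto simp: roof_comp_def fg)
    have aq: "qis Q U W (\<lambda>n. emb (a n))" by (rule quasi_iso_qis[OF U(1) d(1) U(2)])
    note aC = qis_CM[OF aq] and bC = chain_map_emb[OF U(1) d'(1) U(3)]
    have ch: "s \<in> chain_map Q W X" "u \<in> chain_map Q W Y" "t \<in> chain_map Q V Y" "v \<in> chain_map Q V Z" "a \<in> chain_map Q U W"
      using fr U(2) by (auto simp: roofs_def quasi_iso_def fg)
    note es = emb_chain_comp[OF ch(1) ch(5)] emb_chain_comp[OF ch(2) ch(5)] emb_chain_comp[OF ch(3) U(3)] emb_chain_comp[OF ch(4) U(3)]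
    have sq: "qis Q U X (\<lambda>n. emb (s n) * emb (a n))" by (rule qis_comp[OF aq d(2)])
    have n1: "null Q U Y (\<lambda>n. emb (u n) * emb (a n) - emb (t n) * emb (b n))"
      using U(4) by (auto simp: homotopy_rel_iff[OF U(1) Y] es)
    have rf: "\<theta> \<in> roofs Q X Z"
      unfolding \<theta>' roofs_def
      using U(1) qis_quasi_iso[OF U(1) X chain_comp_map(1)[OF d(1) X U(1) ch(1) ch(5)]] sq chain_comp_map(1)[OF d'(1) Z U(1) ch(4) U(3)] by (simp add: es)
    have "tracks Q X Z \<theta> R r z" if R: "proj_cpx Q R" and r: "r \<in> CM Q R X" and y: "acts X Y F R r y" and z: "acts Y Z G R y z" for R r y z
    proof -
      note yC = acts_CM[OF y]
      obtain r' where r': "r' \<in> CM Q R U" "null Q R X (\<lambda>n. emb (s n) * emb (a n) * r' n - r n)"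
        by (rule lift_ex[OF R U(1) X sq r])
      have tf: "acts X Y F R r (\<lambda>n. emb (u n) * emb (a n) * r' n)"
        unfolding acts_def
        by (rule bexI[OF _ f], unfold tracks_def fg)
           (use CM_comp[OF d(4) CM_comp[OF aC r'(1)]] CM_comp[OF aC r'(1)] r'(2) null_refl[of Q R Y "\<lambda>n. emb (u n) * (emb (a n) * r' n)"]
             in \<open>auto intro!: bexI[of _ "\<lambda>n. emb (a n) * r' n"] simp: mult.assoc\<close>)
      have e1: "null Q R Y (\<lambda>n. emb (u n) * emb (a n) * r' n - y n)" by (rule acts_unique[OF F X Y R r r tf y null_refl])
      have "null Q R Y (\<lambda>n. emb (t n) * emb (b n) * r' n - emb (u n) * emb (a n) * r' n)"
        using null_right[OF null_sym[OF n1] r'(1)] by (simp add: left_diff_distrib)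
      from null_trans[OF this e1] have e2: "null Q R Y (\<lambda>n. emb (t n) * (emb (b n) * r' n) - y n)" by (simp add: mult.assoc)
      have tg: "acts Y Z G R y (\<lambda>n. emb (v n) * (emb (b n) * r' n))"
        unfolding acts_def
        by (rule bexI[OF _ g], unfold tracks_def fg)
           (use CM_comp[OF d'(4) CM_comp[OF bC r'(1)]] CM_comp[OF bC r'(1)] e2 null_refl[of Q R Z "\<lambda>n. emb (v n) * (emb (b n) * r' n)"]
             in \<open>auto intro!: bexI[of _ "\<lambda>n. emb (b n) * r' n"] simp: mult.assoc\<close>)
      have "null Q R Z (\<lambda>n. emb (v n) * (emb (b n) * r' n) - z n)"
        by (rule acts_unique[OF G Y Z R yC yC tg z null_refl])
      then show ?thesis unfolding tracks_def \<theta>' using r' acts_CM[OF z] by (auto simp: es mult.assoc)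
    qed
    then show ?thesis using rf by blast
  qed
  have ex: "\<exists>\<theta>. \<theta> \<in> roof_comp Q Y \<psi> \<phi>"
  proof -
    obtain W s u V t v where fg: "\<phi> = (W, s, u)" "\<psi> = (V, t, v)" by (cases \<phi>, cases \<psi>) auto
    note d = roofsD[OF \<phi>(1)[unfolded fg] X Y] and d' = roofsD[OF \<psi>(1)[unfolded fg] Y Z]
    obtain U g a where U: "perf Q U g" "proj_cpx Q U" "qis Q U W a" using resolve[OF d(1)] by metis
    note Ub = proj_cpxD(1)[OF U(2)]
    obtain b where b: "b \<in> CM Q U V" "null Q U Y (\<lambda>n. emb (t n) * b n - emb (u n) * a n)"
      by (rule lift_ex[OF U(2) d'(1) Y d'(2) CM_comp[OF d(4) qis_CM[OF U(3)]]])
    note am = mts_emb[OF Ub d(1) qis_CM[OF U(3)]] and bm = mts_emb[OF Ub d'(1) b(1)]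
    have ch: "u \<in> chain_map Q W Y" "t \<in> chain_map Q V Y"
      using \<phi>(1) \<psi>(1) by (auto simp: roofs_def quasi_iso_def fg)
    have m: "chain_comp u (mts U W a) = mts U Y (\<lambda>n. emb (u n) * a n)" "chain_comp t (mts U V b) = mts U Y (\<lambda>n. emb (t n) * b n)"
      using chain_comp_map(2)[OF d(1) Y Ub ch(1) am(1)] chain_comp_map(2)[OF d'(1) Y Ub ch(2) bm(1)] by (simp_all add: am bm)
    have "(chain_comp u (mts U W a), chain_comp t (mts U V b)) \<in> homotopy_rel Q U Y"
      unfolding m homotopy_rel_iff[OF Ub Y]
      using mts_emb[OF Ub Y CM_comp[OF d(4) qis_CM[OF U(3)]]] mts_emb[OF Ub Y CM_comp[OF d'(3) b(1)]] null_sym[OF b(2)] by simp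
    moreover have "quasi_iso Q U W (mts U W a)" by (rule qis_quasi_iso[OF Ub d(1) am(1)]) (simp add: am U(3))
    ultimately show ?thesis unfolding roof_comp_def fg using Ub bm(1) by auto
  qed
  then obtain \<theta> where \<theta>: "\<theta> \<in> roof_comp Q Y \<psi> \<phi>" by blast
  have self: "\<phi> \<in> F" "\<psi> \<in> G" using class_self[OF \<phi>(1) X Y] class_self[OF \<psi>(1) Y Z] by (simp_all add: \<phi> \<psi>)
  note c\<theta> = comp[OF self \<theta>]
  obtain P k p where P: "perf Q P k" "proj_cpx Q P" "qis Q P X p" using resolve[OF X] by metis
  note pC = qis_CM[OF P(3)]
  obtain y0 where y0: "y0 \<in> CM Q P Y" "acts X Y F P p y0" using acts_ex[OF F X Y P(2) pC] by blast
  obtain z0 where z0: "z0 \<in> CM Q P Z" "acts Y Z G P y0 z0" using acts_ex[OF G Y Z P(2) y0(1)] by blast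
  have same: "roof_class X Z \<theta>' = roof_class X Z \<theta>" if "f \<in> F" "g \<in> G" "\<theta>' \<in> roof_comp Q Y g f" for f g \<theta>'
  proof -
    have c: "\<theta>' \<in> roofs Q X Z" "tracks Q X Z \<theta>' P p z0" "\<theta> \<in> roofs Q X Z" "tracks Q X Z \<theta> P p z0"
      using comp[OF that] c\<theta> P(2) pC y0(2) z0(2) by blast+
    show ?thesis using class_iff[OF c(1) X Z P(2,3) c(2)] class_iff[OF c(3) X Z P(2,3) c(4)] by blast
  qed
  have eq: "Cmp (Db Q) X Y Z G F = roof_class X Z \<theta>"
  proof -
    have "Cmp (Db Q) X Y Z G F = (\<Union>g\<in>G. \<Union>f\<in>F. \<Union>\<theta>'\<in>roof_comp Q Y g f. roof_class X Z \<theta>')"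
      by (auto simp: Db_def)
    also have "\<dots> = roof_class X Z \<theta>" using same self \<theta> by blast
    finally show ?thesis .
  qed
  show "Cmp (Db Q) X Y Z G F \<in> Mor (Db Q) X Z" unfolding eq Mor_Db using c\<theta> by blast
  show "acts X Z (Cmp (Db Q) X Y Z G F) R r z"
    if "proj_cpx Q R" "r \<in> CM Q R X" "acts X Y F R r y" "acts Y Z G R y z"
    unfolding eq using c\<theta> that acts_class[OF _ X Z that(1,2)] by blast
qed

end

section \<open>Chain maps as matrices\<close>

lemma chain_mapI_emb:
  assumes X: "bounded_cpx Q X" and Y: "bounded_cpx Q Y" and c: "\<And>n. f n \<in> carrier_mat (cdim Y n) (cdim X n)"
    and m: "(\<lambda>n. emb (f n)) \<in> CM Q X Y"
  shows "f \<in> chain_map Q X Y"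
proof -
  have "mts X Y (\<lambda>n. emb (f n)) = f"
    by (rule ext, rule emb_inj[OF _ c]) (simp_all add: mts_def mts_emb(2)[OF X Y m, unfolded mts_def])
  then show ?thesis using mts_emb(1)[OF X Y m] by simp
qed

lemma emb_chain_id: "emb (chain_id X n) = idm (ob X n)"
  and emb_chain_zero: "emb (chain_zero X Y n) = 0"
  by (simp_all add: chain_id_def chain_zero_def en_def)

lemma chain_id_map: "bounded_cpx Q X \<Longrightarrow> chain_id X \<in> chain_map Q X X"
  by (rule chain_mapI_emb) (auto simp: emb_chain_id CM_id, simp add: chain_id_def)

lemma chain_zero_map: "bounded_cpx Q X \<Longrightarrow> bounded_cpx Q Y \<Longrightarrow> chain_zero X Y \<in> chain_map Q X Y"
  by (rule chain_mapI_emb) (auto simp: emb_chain_zero CM_closed, simp add: chain_zero_def)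

lemma chain_shift_map: "bounded_cpx Q X \<Longrightarrow> bounded_cpx Q Y \<Longrightarrow> f \<in> chain_map Q X Y \<Longrightarrow> chain_shift f \<in> chain_map Q (shift X) (shift Y)"
  using CM_shift[OF chain_map_emb[of Q X Y f]] chain_map_carrier[of f Q X Y]
  by (intro chain_mapI_emb bounded_shift) (auto simp: chain_shift_def)

lemma emb_cone_in: "emb (cone_in X Y n) = cb X Y n"
proof -
  have "emb (cone_in X Y n) = in2 (cdim X (n + 1)) (cdim Y n) * en (cdim Y n) * pr1 (cdim Y n) 0"
    unfolding cone_in_def append_rows_def
    by (subst emb_four_block[of _ "cdim X (n + 1)" "cdim Y n" _ 0 _ "cdim Y n"]) (auto simp: en_def)
  then show ?thesis by (simp add: pr1_def bdD(2)[OF blocks_bd(2)])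
qed

lemma emb_cone_out: "emb (cone_out X Y n) = cp X Y n"
proof -
  have "emb (cone_out X Y n) = in1 (cdim X (n + 1)) 0 * en (cdim X (n + 1)) * cp X Y n"
    unfolding cone_out_def
    by (subst emb_four_block[of _ "cdim X (n + 1)" "cdim X (n + 1)" _ "cdim Y n" _ 0]) (auto simp: en_def)
  then show ?thesis by (simp add: in1_def bdD(1)[OF blocks_bd(3)] mult.assoc)
qed

lemma cp_CM:
  assumes X: "bounded_cpx Q X" and Y: "bounded_cpx Q Y" and f: "f \<in> chain_map Q X Y"
  shows "(\<lambda>n. cp X Y n) \<in> CM Q (cone X Y f) (shift X)"
proof -
  have "idm (ob X (n + 1 + 1)) * (D X (n + 1) * g) = D X (n + 1) * g" for n g
    using en_assoc[OF cpxD(2)[OF X], of "n + 1"] by simp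
  then show ?thesis
    unfolding CM_def D_cone(1)[OF X Y f]
    using cone_Hm[OF X Y] by (auto simp: D_shift algebra_simps pr_in_assoc)
qed

lemma cone_in_map:
  assumes X: "bounded_cpx Q X" and Y: "bounded_cpx Q Y" and f: "f \<in> chain_map Q X Y"
  shows "cone_in X Y \<in> chain_map Q Y (cone X Y f)"
  using cone_maps[OF X Y f]
  by (intro chain_mapI_emb[OF Y bounded_cone[OF X Y f]]) (auto simp: emb_cone_in intro!: carrier_matI, simp_all add: cone_in_def append_rows_def)

lemma cone_out_map:
  assumes X: "bounded_cpx Q X" and Y: "bounded_cpx Q Y" and f: "f \<in> chain_map Q X Y"
  shows "cone_out X Y \<in> chain_map Q (cone X Y f) (shift X)"
  using cp_CM[OF X Y f]
  by (intro chain_mapI_emb[OF bounded_cone[OF X Y f] bounded_shift[OF X]])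
     (auto simp: emb_cone_out intro!: carrier_matI, simp_all add: cone_out_def)

text \<open>
  The contraction moves the copy of \<open>X\<close> into \<open>X[1]\<close> by the identity.
\<close>

lemma null_cone_id:
  assumes X: "bounded_cpx Q X"
  shows "null Q (cone X X (chain_id X)) (cone X X (chain_id X)) (\<lambda>n. idm (ob (cone X X (chain_id X)) n))"
proof -
  let ?C = "cone X X (chain_id X)"
  note idc = chain_id_map[OF X]
  define h where "h n = ca X X (n - 1) * cq X X n" for n
  have "h n \<in> Hm Q (ob ?C n) (ob ?C (n - 1))" for n
    using Hm_comp[OF cone_Hm(1)[OF X X, of "n - 1"], of "cq X X n"] cone_Hm(4)[OF X X, of n] by (simp add: h_def)
  moreover have "idm (ob ?C n) = D ?C (n - 1) * h n + h (n + 1) * D ?C n" for n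
  proof -
    have e: "idm (ob X n) * cq X X n = cq X X n" "idm (ob X (n + 1)) * cp X X n = cp X X n"
      "idm (ob X (n + 1)) * (D X n * g) = D X n * g" for g
      using bdD(1)[OF blocks_bd(4)] bdD(1)[OF blocks_bd(3)] en_assoc[OF cpxD(2)[OF X], of n g] by simp_all
    have "D ?C (n - 1) * h n = cb X X n * cq X X n - ca X X n * (D X n * cq X X n)"
      unfolding D_cone(1)[OF X X idc] h_def
      by (simp add: distrib_right left_diff_distrib mult.assoc pr_in_assoc emb_chain_id e)
    moreover have "h (n + 1) * D ?C n = ca X X n * cp X X n + ca X X n * (D X n * cq X X n)"
      unfolding D_cone(1)[OF X X idc] h_def
      by (simp add: distrib_left right_diff_distrib mult.assoc pr_in_assoc emb_chain_id e)
    ultimately have "D ?C (n - 1) * h n + h (n + 1) * D ?C n = ca X X n * cp X X n + cb X X n * cq X X n"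
      by (simp add: algebra_simps)
    then show ?thesis by (simp add: pr_in(5))
  qed
  ultimately show ?thesis unfolding null_def by blast
qed

section \<open>Grothendieck groups\<close>

lemma K0_relations_closed:
  assumes "x \<in> K0_relations T" "y \<in> K0_relations T"
  shows "x + y \<in> K0_relations T" "- x \<in> K0_relations T" "x - y \<in> K0_relations T" "0 \<in> K0_relations T"
proof -
  let ?S = "{frag_of Y - frag_of X - frag_of Z | X Y Z. \<exists>u v w. distinguished T X Y Z u v w}"
  let ?G = "free_Abelian_group (Obj T)"
  have "?S \<subseteq> carrier ?G"
  proof
    fix a assume "a \<in> ?S"
    then obtain X Y Z u v w where a: "a = frag_of Y - frag_of X - frag_of Z" and "distinguished T X Y Z u v w" by blast
    then have "X \<in> Obj T" "Y \<in> Obj T" "Z \<in> Obj T" by (auto simp: distinguished_def)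
    then show "a \<in> carrier ?G"
      using keys_diff[of "frag_of Y - frag_of X" "frag_of Z"] keys_diff[of "frag_of Y" "frag_of X"] by (auto simp: a)
  qed
  then have sub: "subgroup (K0_relations T) ?G"
    unfolding K0_relations_def by (rule group.generate_is_subgroup[OF group_free_Abelian_group])
  have k: "Poly_Mapping.keys x \<subseteq> Obj T" if "x \<in> K0_relations T" for x using subgroup.mem_carrier[OF sub that] by simp
  have neg: "- x \<in> K0_relations T" if "x \<in> K0_relations T" for x
    using subgroup.m_inv_closed[OF sub that] k[OF that] by simp
  show add: "x + y \<in> K0_relations T" using subgroup.m_closed[OF sub assms] by simp
  show "- x \<in> K0_relations T" by (rule neg[OF assms(1)])
  show "x - y \<in> K0_relations T" using subgroup.m_closed[OF sub assms(1) neg[OF assms(2)]] by simp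
  show "0 \<in> K0_relations T" using subgroup.one_closed[OF sub] by simp
qed

lemma K0_relations_zero: "0 \<in> K0_relations T"
  unfolding K0_relations_def using generate.one[of "free_Abelian_group (Obj T)"] by simp

lemma K0_class_eq_iff: "K0_class T a = K0_class T b \<longleftrightarrow> a - b \<in> K0_relations T"
proof
  have mem: "x \<in> K0_class T b \<longleftrightarrow> x - b \<in> K0_relations T" for x b
    by (auto simp: K0_class_def r_coset_def) (metis diff_add_cancel)
  {
    assume "K0_class T a = K0_class T b"
    moreover have "a \<in> K0_class T a" by (simp add: mem K0_relations_zero)
    ultimately show "a - b \<in> K0_relations T" using mem by blast
  next
    assume ab: "a - b \<in> K0_relations T"
    have "x - a \<in> K0_relations T \<longleftrightarrow> x - b \<in> K0_relations T" for x
    proof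
      assume "x - a \<in> K0_relations T"
      from K0_relations_closed(1)[OF this ab] show "x - b \<in> K0_relations T" by simp
    next
      assume "x - b \<in> K0_relations T"
      from K0_relations_closed(3)[OF this ab] show "x - a \<in> K0_relations T" by simp
    qed
    then show "K0_class T a = K0_class T b" using mem by blast
  }
qed

lemma K0_relations_triangle: "distinguished T X Y Z u v w \<Longrightarrow> frag_of Y - frag_of X - frag_of Z \<in> K0_relations T"
  unfolding K0_relations_def by (rule generate.incl) blast

text \<open>
  What the homotopy category and the derived category have in common: \<open>tm\<close> is the
  functor from chain maps. The last assumption is what makes the Euler characteristic descend to
  the Grothendieck group.
\<close>

locale chain_triangles =
  fixes Q :: "'n::finite quiver" and T :: "(('n, 'k::field_char_0) cpx, 'm) tricat"
    and tm :: "('n, 'k) cpx \<Rightarrow> ('n, 'k) cpx \<Rightarrow> (int \<Rightarrow> 'k Matrix.mat) \<Rightarrow> 'm"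
  assumes Obj_bounded: "X \<in> Obj T \<Longrightarrow> bounded_cpx Q X"
    and zero_Obj: "zero_cpx \<in> Obj T"
    and tm_Mor: "bounded_cpx Q X \<Longrightarrow> bounded_cpx Q Y \<Longrightarrow> f \<in> chain_map Q X Y \<Longrightarrow> tm X Y f \<in> Mor T X Y"
    and tm_comp: "bounded_cpx Q X \<Longrightarrow> bounded_cpx Q Y \<Longrightarrow> bounded_cpx Q Z \<Longrightarrow> f \<in> chain_map Q X Y \<Longrightarrow> g \<in> chain_map Q Y Z \<Longrightarrow>
      Cmp T X Y Z (tm Y Z g) (tm X Y f) = tm X Z (chain_comp g f)"
    and tm_id: "Ide T X = tm X X (chain_id X)"
    and tm_homotopic: "bounded_cpx Q X \<Longrightarrow> bounded_cpx Q Y \<Longrightarrow> (f, g) \<in> homotopy_rel Q X Y \<Longrightarrow> tm X Y f = tm X Y g"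
    and tm_shift: "bounded_cpx Q X \<Longrightarrow> bounded_cpx Q Y \<Longrightarrow> f \<in> chain_map Q X Y \<Longrightarrow>
      ShM T X Y (tm X Y f) = tm (shift X) (shift Y) (chain_shift f)"
    and Sh_T: "Sh T = shift"
    and Std_T: "Std T = {(X, Y, cone X Y f, tm X Y f, tm Y (cone X Y f) (cone_in X Y), tm (cone X Y f) (shift X) (cone_out X Y)) | X Y f.
              X \<in> Obj T \<and> Y \<in> Obj T \<and> f \<in> chain_map Q X Y}"
    and iso_euler: "bounded_cpx Q X \<Longrightarrow> bounded_cpx Q Y \<Longrightarrow> is_iso T X Y F \<Longrightarrow> euler (tdim l) X = (euler (tdim l) Y :: 'k)"
begin

lemma tm_eqI:
  assumes "bounded_cpx Q X" "bounded_cpx Q Y" "f \<in> chain_map Q X Y" "g \<in> chain_map Q X Y" "null Q X Y (\<lambda>n. emb (f n) - emb (g n))"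
  shows "tm X Y f = tm X Y g"
  using assms by (intro tm_homotopic) (auto simp: homotopy_rel_iff)

lemma homotopy_iso:
  assumes X: "bounded_cpx Q X" and Y: "bounded_cpx Q Y" and f: "f \<in> chain_map Q X Y" and g: "g \<in> chain_map Q Y X"
    and "null Q X X (\<lambda>n. emb (g n) * emb (f n) - idm (ob X n))" "null Q Y Y (\<lambda>n. emb (f n) * emb (g n) - idm (ob Y n))"
  shows "is_iso T X Y (tm X Y f)"
proof -
  have "tm X X (chain_comp g f) = tm X X (chain_id X)" "tm Y Y (chain_comp f g) = tm Y Y (chain_id Y)"
    using assms chain_comp_map(1)[OF Y X X g f] chain_comp_map(1)[OF X Y Y f g]
    by (auto intro!: tm_eqI chain_id_map simp: emb_chain_comp[OF g f] emb_chain_comp[OF f g] emb_chain_id)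
  then show ?thesis unfolding is_iso_def using assms tm_Mor
    by (auto simp: tm_comp tm_id intro!: bexI[of _ "tm Y X g"])
qed

lemma Ide_iso: "bounded_cpx Q X \<Longrightarrow> is_iso T X X (Ide T X)"
  unfolding tm_id
  by (rule homotopy_iso[of X X "chain_id X" "chain_id X"]) (auto simp: chain_id_map emb_chain_id null_zero)

lemma std_distinguished:
  assumes X: "X \<in> Obj T" and Y: "Y \<in> Obj T" and C: "cone X Y f \<in> Obj T" and f: "f \<in> chain_map Q X Y"
  shows "distinguished T X Y (cone X Y f) (tm X Y f) (tm Y (cone X Y f) (cone_in X Y)) (tm (cone X Y f) (shift X) (cone_out X Y))"
proof -
  let ?C = "cone X Y f"
  note b = Obj_bounded[OF X] Obj_bounded[OF Y] Obj_bounded[OF C] bounded_shift[OF Obj_bounded[OF X]]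
  note m = f cone_in_map[OF b(1,2) f] cone_out_map[OF b(1,2) f]
  have l: "chain_comp (chain_id B) h = h" "chain_comp h (chain_id A) = h"
    if "h \<in> chain_map Q A B" for A B :: "('n, 'k) cpx" and h
    unfolding chain_comp_def chain_id_def
    using left_mult_one_mat[OF chain_map_carrier[OF that]] right_mult_one_mat[OF chain_map_carrier[OF that]] by auto
  have s: "chain_shift (chain_id X) = chain_id (shift X)" by (simp add: chain_shift_def chain_id_def fun_eq_iff)
  have "Cmp T X Y Y (Ide T Y) (tm X Y f) = Cmp T X X Y (tm X Y f) (Ide T X)"
    "Cmp T Y ?C ?C (Ide T ?C) (tm Y ?C (cone_in X Y)) = Cmp T Y Y ?C (tm Y ?C (cone_in X Y)) (Ide T Y)"
    "Cmp T ?C (shift X) (shift X) (ShM T X X (Ide T X)) (tm ?C (shift X) (cone_out X Y)) = Cmp T ?C ?C (shift X) (tm ?C (shift X) (cone_out X Y)) (Ide T ?C)"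
    using b m l by (auto simp: tm_id tm_comp chain_id_map tm_shift s)
  moreover have "(X, Y, ?C, tm X Y f, tm Y ?C (cone_in X Y), tm ?C (shift X) (cone_out X Y)) \<in> Std T"
    unfolding Std_T using X Y f by blast
  ultimately show ?thesis
    unfolding distinguished_def Sh_T using X Y C tm_Mor b m Ide_iso[OF b(1)] Ide_iso[OF b(2)] Ide_iso[OF b(3)] by blast
qed

text \<open>
  The cone of the identity is contractible, so the standard triangle of the identity of
  \<open>Y\<close> is isomorphic to \<open>X \<rightarrow> Y \<rightarrow> 0\<close>.
\<close>

lemma iso_distinguished:
  assumes X: "X \<in> Obj T" and Y: "Y \<in> Obj T" and f: "f \<in> chain_map Q X Y" and iso: "is_iso T X Y (tm X Y f)"
  shows "\<exists>u v w. distinguished T X Y zero_cpx u v w"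
proof -
  let ?C = "cone Y Y (chain_id Y)" and ?N = "zero_cpx :: ('n, 'k) cpx"
  note b = Obj_bounded[OF X] Obj_bounded[OF Y] bounded_zero[of Q]
  note idY = chain_id_map[OF b(2)]
  note Cb = bounded_cone[OF b(2,2) idY]
  note sX = bounded_shift[OF b(1)] and sY = bounded_shift[OF b(2)]
  note z = chain_zero_map[OF b(2,3)] chain_zero_map[OF b(3) sX] chain_zero_map[OF b(3) Cb] chain_zero_map[OF Cb b(3)]
  note ci = cone_in_map[OF b(2,2) idY] and co = cone_out_map[OF b(2,2) idY]
  have N0: "idm (ob ?N n) = 0" for n by (simp add: zero_cpx_def)
  have nC: "null Q ?C ?C (\<lambda>n. idm (ob ?C n))" by (rule null_cone_id[OF b(2)])
  have iN: "is_iso T ?N ?C (tm ?N ?C (chain_zero ?N ?C))"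
    using null_minus[OF nC] null_zero by (intro homotopy_iso[OF b(3) Cb z(3,4)]) (simp_all add: emb_chain_zero N0 del: ob_cone)
  have "null Q Y ?C (\<lambda>n. idm (ob ?C n) * cb Y Y n)"
    by (rule null_right[OF nC cone_maps[OF b(2,2) idY]])
  moreover have "idm (ob ?C n) * cb Y Y n = cb Y Y n" for n using CM_idm(1)[OF cone_maps[OF b(2,2) idY], of n] .
  ultimately have nci: "null Q Y ?C (\<lambda>n. cb Y Y n)" by simp
  have sq1: "Cmp T X Y Y (Ide T Y) (tm X Y f) = Cmp T X Y Y (tm Y Y (chain_id Y)) (tm X Y f)" by (simp add: tm_id)
  have sq2: "Cmp T Y ?N ?C (tm ?N ?C (chain_zero ?N ?C)) (tm Y ?N (chain_zero Y ?N)) = Cmp T Y Y ?C (tm Y ?C (cone_in Y Y)) (Ide T Y)"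
    unfolding tm_id tm_comp[OF b(2) b(3) Cb z(1,3)] tm_comp[OF b(2,2) Cb idY ci]
  proof (rule tm_eqI[OF b(2) Cb chain_comp_map(1)[OF b(3) Cb b(2) z(3) z(1)] chain_comp_map(1)[OF b(2) Cb b(2) ci idY]])
    show "null Q Y ?C (\<lambda>n. emb (chain_comp (chain_zero ?N ?C) (chain_zero Y ?N) n) - emb (chain_comp (cone_in Y Y) (chain_id Y) n))"
      using null_minus[OF nci] by (simp add: emb_chain_comp[OF z(3,1)] emb_chain_comp[OF ci idY] emb_chain_zero emb_cone_in emb_chain_id
          bdD(2)[OF blocks_bd(2)])
  qed
  have sf: "chain_shift f \<in> chain_map Q (shift X) (shift Y)" by (rule chain_shift_map[OF b(1,2) f])
  have sq3: "Cmp T ?N (shift X) (shift Y) (ShM T X Y (tm X Y f)) (tm ?N (shift X) (chain_zero ?N (shift X))) =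
     Cmp T ?N ?C (shift Y) (tm ?C (shift Y) (cone_out Y Y)) (tm ?N ?C (chain_zero ?N ?C))"
    unfolding tm_shift[OF b(1,2) f] tm_comp[OF b(3) sX sY z(2) sf] tm_comp[OF b(3) Cb sY z(3) co]
    by (rule tm_eqI[OF b(3) sY chain_comp_map(1)[OF sX sY b(3) sf z(2)] chain_comp_map(1)[OF Cb sY b(3) co z(3)]])
       (simp add: emb_chain_comp[OF sf z(2)] emb_chain_comp[OF co z(3)] emb_chain_zero null_zero)
  have std: "(Y, Y, ?C, tm Y Y (chain_id Y), tm Y ?C (cone_in Y Y), tm ?C (shift Y) (cone_out Y Y)) \<in> Std T"
    unfolding Std_T using Y idY by blast
  have "distinguished T X Y ?N (tm X Y f) (tm Y ?N (chain_zero Y ?N)) (tm ?N (shift X) (chain_zero ?N (shift X)))"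
    unfolding distinguished_def Sh_T
    using X Y zero_Obj tm_Mor[OF b(1,2) f] tm_Mor[OF b(2,3) z(1)] tm_Mor[OF b(3) sX z(2)] std iso Ide_iso[OF b(2)] iN sq1 sq2 sq3
    by blast
  then show ?thesis by blast
qed

lemma zero_relation: "frag_of zero_cpx \<in> K0_relations T"
proof -
  note b = bounded_zero[of Q]
  have "\<exists>u v w. distinguished T zero_cpx zero_cpx zero_cpx u v w"
    using iso_distinguished[OF zero_Obj zero_Obj chain_id_map[OF b]] Ide_iso[OF b] by (simp add: tm_id)
  then have "frag_of zero_cpx - frag_of zero_cpx - frag_of zero_cpx \<in> K0_relations T"
    by (elim exE) (rule K0_relations_triangle)
  then show ?thesis using K0_relations_closed(2) by fastforce
qed

lemma iso_relation:
  assumes "X \<in> Obj T" "Y \<in> Obj T" "f \<in> chain_map Q X Y" "is_iso T X Y (tm X Y f)"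
  shows "frag_of Y - frag_of X \<in> K0_relations T"
proof -
  have "frag_of Y - frag_of X - frag_of zero_cpx \<in> K0_relations T"
    using iso_distinguished[OF assms] by (elim exE) (rule K0_relations_triangle)
  from K0_relations_closed(1)[OF this zero_relation] show ?thesis by simp
qed

lemma cone_relation:
  assumes "X \<in> Obj T" "Y \<in> Obj T" "cone X Y f \<in> Obj T" "f \<in> chain_map Q X Y"
  shows "frag_of Y - frag_of X - frag_of (cone X Y f) \<in> K0_relations T"
  by (rule K0_relations_triangle[OF std_distinguished[OF assms]])

text \<open>
  The shift is the cone of the map to zero.
\<close>

lemma shift_relation:
  assumes X: "X \<in> Obj T" and S: "shift X \<in> Obj T" and C: "cone X zero_cpx (chain_zero X zero_cpx) \<in> Obj T"
  shows "frag_of (shift X) + frag_of X \<in> K0_relations T"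
proof -
  let ?N = "zero_cpx :: ('n, 'k) cpx" let ?z = "chain_zero X ?N" let ?C = "cone X ?N ?z"
  note b = Obj_bounded[OF X] bounded_zero[of Q] Obj_bounded[OF S] Obj_bounded[OF C]
  note z = chain_zero_map[OF b(1,2)]
  note co = cone_out_map[OF b(1,2) z]
  have N0: "cdim ?N n = 0" "D ?N n = 0" for n by (simp_all add: zero_cpx_def)
  have ca: "(\<lambda>n. ca X ?N n) \<in> CM Q (shift X) ?C"
  proof -
    have "D ?C n * ca X ?N n = ca X ?N (n + 1) * D (shift X) n" for n
    proof -
      have "D X (n + 1) * en (cdim X (n + 1)) = D X (n + 1)" using HmD(4)[OF cpxD(2)[OF b(1)], of "n + 1"] .
      then show ?thesis
        unfolding D_cone(1)[OF b(1,2) z]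
        by (simp add: distrib_right left_diff_distrib mult.assoc pr_in D_shift emb_chain_zero N0)
    qed
    then show ?thesis using cone_Hm(1)[OF b(1,2)] by (simp add: CM_def)
  qed
  note m = mts_emb[OF b(3,4) ca]
  have q0: "pr2 a 0 = (0 :: 'k lin_op)" for a by (rule lin_op_eqI) (simp add: ap_pr2)
  have "in1 a 0 * pr1 a 0 + in2 a 0 * pr2 a 0 = (en (a + 0) :: 'k lin_op)" for a by (rule pr_in(5))
  then have "in1 a 0 * pr1 a 0 = (en a :: 'k lin_op)" for a by (simp add: q0)
  then have "ca X ?N n * cp X ?N n = idm (ob ?C n)" for n by (simp add: N0)
  then have "is_iso T ?C (shift X) (tm ?C (shift X) (cone_out X ?N))"
    by (intro homotopy_iso[OF b(4,3) co m(1)]) (simp_all add: m emb_cone_out pr_in null_zero)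
  then have 1: "frag_of (shift X) - frag_of ?C \<in> K0_relations T" by (rule iso_relation[OF C S co])
  have "frag_of ?N - frag_of X - frag_of ?C \<in> K0_relations T" by (rule cone_relation[OF X zero_Obj C z])
  from K0_relations_closed(3)[OF 1 this] have "frag_of (shift X) + frag_of X - frag_of ?N \<in> K0_relations T" by (simp add: algebra_simps)
  from K0_relations_closed(1)[OF this zero_relation] show ?thesis by simp
qed

text \<open>
  The recorded class is the class in the Grothendieck group: each rule of \<open>perf\<close> is
  a triangle.
\<close>

lemma perf_relation:
  assumes Q: "acyclic_quiver Q" and Ob: "\<And>R g. perf Q R g \<Longrightarrow> R \<in> Obj T"
  shows "perf Q R g \<Longrightarrow> frag_of R - (\<Sum>i\<in>UNIV. frag_cmul (g i) (frag_of (stalk (proj_mod Q i)))) \<in> K0_relations T"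
proof (induction rule: perf.induct)
  case perf_zero show ?case using zero_relation by simp
next
  case (perf_stalk i)
  have "(\<Sum>j\<in>UNIV. frag_cmul (if j = i then 1 else 0) (frag_of (stalk (proj_mod Q j)))) = frag_of (stalk (proj_mod Q i) :: ('n, 'k) cpx)"
    by (simp add: if_distrib[of "\<lambda>c. frag_cmul c _"] cong: if_cong)
  then show ?case by (simp add: K0_relations_zero)
next
  case (perf_cone X g Y h f)
  have "frag_of Y - frag_of X - frag_of (cone X Y f) \<in> K0_relations T"
    by (intro cone_relation Ob[OF perf_cone(1)] Ob[OF perf_cone(2)] perf_cone Ob[OF perf.perf_cone[OF perf_cone(1-3)]])
  from K0_relations_closed(3)[OF K0_relations_closed(3)[OF perf_cone.IH(2) perf_cone.IH(1)] this]
  show ?case by (simp add: frag_cmul_diff_distrib sum_subtractf algebra_simps)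
next
  case (perf_shift X g)
  have c: "cone X zero_cpx (chain_zero X zero_cpx) \<in> Obj T"
    using Ob[OF perf.perf_cone[OF perf_shift(1) perf_zero]] chain_zero_map[OF Obj_bounded[OF Ob[OF perf_shift(1)]] bounded_zero] by blast
  have "frag_of (shift X) + frag_of X \<in> K0_relations T"
    by (rule shift_relation[OF Ob[OF perf_shift(1)] Ob[OF perf.perf_shift[OF perf_shift(1)]] c])
  from K0_relations_closed(3)[OF this perf_shift.IH] show ?case by (simp add: sum_negf algebra_simps flip: minus_frag_cmul)
next
  case (perf_ush X g)
  have pu: "perf Q (ush X) (\<lambda>j. - g j)" by (rule perf.perf_ush[OF perf_ush(1)])
  have c: "cone (ush X) zero_cpx (chain_zero (ush X) zero_cpx) \<in> Obj T"
    using Ob[OF perf.perf_cone[OF pu perf_zero]] chain_zero_map[OF Obj_bounded[OF Ob[OF pu]] bounded_zero] by blast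
  have "frag_of X + frag_of (ush X) \<in> K0_relations T"
    using shift_relation[OF Ob[OF pu] _ c] Ob[OF perf_ush(1)] by (simp add: shift_ush)
  from K0_relations_closed(3)[OF this perf_ush.IH] show ?case by (simp add: sum_negf algebra_simps flip: minus_frag_cmul)
qed

definition frag_euler :: "'n \<Rightarrow> (('n, 'k) cpx \<Rightarrow>\<^sub>0 int) \<Rightarrow> 'k" where
  "frag_euler l a = (\<Sum>X\<in>Poly_Mapping.keys a. of_int (Poly_Mapping.lookup a X) * euler (tdim l) X)"

lemma frag_euler_eq: "finite A \<Longrightarrow> Poly_Mapping.keys a \<subseteq> A \<Longrightarrow>
    frag_euler l a = (\<Sum>X\<in>A. of_int (Poly_Mapping.lookup a X) * euler (tdim l) X)"
  unfolding frag_euler_def by (rule sum.mono_neutral_left) (auto simp: in_keys_iff)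

lemma frag_euler_add: "frag_euler l (a + b) = frag_euler l a + frag_euler l b"
proof -
  let ?A = "Poly_Mapping.keys a \<union> Poly_Mapping.keys b"
  have "finite ?A" "Poly_Mapping.keys (a + b) \<subseteq> ?A" using keys_add[of a b] by auto
  then show ?thesis
    by (subst (1 2 3) frag_euler_eq[of ?A]) (auto simp: lookup_add distrib_right sum.distrib)
qed

lemma frag_euler_minus: "frag_euler l (- a) = - frag_euler l a"
  by (simp add: frag_euler_def sum_negf)

lemma frag_euler_of: "frag_euler l (frag_of X) = euler (tdim l) X"
  by (simp add: frag_euler_def)

lemma frag_euler_diff: "frag_euler l (a - b) = frag_euler l a - frag_euler l b"
  using frag_euler_add[of l a "- b"] by (simp add: frag_euler_minus)

lemma frag_euler_cmul: "frag_euler l (frag_cmul c a) = of_int c * frag_euler l a"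
  by (subst (1 2) frag_euler_eq[of "Poly_Mapping.keys a"]) (auto simp: sum_distrib_left mult.assoc)

lemma frag_euler_sum: "frag_euler l (\<Sum>a\<in>A. f a) = (\<Sum>a\<in>A. frag_euler l (f a))"
  by (induction A rule: infinite_finite_induct) (auto simp: frag_euler_add, simp_all add: frag_euler_def)

lemma distinguished_euler:
  assumes "distinguished T X Y Z u v w"
  shows "euler (tdim l) Y = euler (tdim l) X + (euler (tdim l) Z :: 'k)"
proof -
  obtain X' Y' Z' u' v' w' a b c where X: "X \<in> Obj T" "Y \<in> Obj T" "Z \<in> Obj T"
    and std: "(X', Y', Z', u', v', w') \<in> Std T" and iso: "is_iso T X X' a" "is_iso T Y Y' b" "is_iso T Z Z' c"
    using assms unfolding distinguished_def by blast
  obtain f where f: "X' \<in> Obj T" "Y' \<in> Obj T" "f \<in> chain_map Q X' Y'" and Z': "Z' = cone X' Y' f"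
    using std unfolding Std_T by blast
  note b' = Obj_bounded[OF f(1)] Obj_bounded[OF f(2)]
  show ?thesis
    using iso_euler[OF Obj_bounded[OF X(1)] b'(1) iso(1)] iso_euler[OF Obj_bounded[OF X(2)] b'(2) iso(2)]
      iso_euler[OF Obj_bounded[OF X(3)] bounded_cone[OF b' f(3)] iso(3)[unfolded Z']] euler_cone[OF additive_tdim b', of l f]
    by simp
qed

lemma relation_euler: "a \<in> K0_relations T \<Longrightarrow> frag_euler l a = 0"
  unfolding K0_relations_def
proof (induction rule: generate.induct)
  case one then show ?case by (simp add: frag_euler_def)
next
  case (incl h) then show ?case using distinguished_euler by (auto simp: frag_euler_diff frag_euler_of)
next
  case (inv h)
  then obtain X Y Z u v w where h: "h = frag_of Y - frag_of X - frag_of Z" and d: "distinguished T X Y Z u v w" by blast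
  then have "X \<in> Obj T" "Y \<in> Obj T" "Z \<in> Obj T" by (auto simp: distinguished_def)
  then have "Poly_Mapping.keys h \<subseteq> Obj T"
    using keys_diff[of "frag_of Y - frag_of X" "frag_of Z"] keys_diff[of "frag_of Y" "frag_of X"] by (auto simp: h)
  then show ?case using distinguished_euler[OF d, of l] by (simp add: frag_euler_minus h frag_euler_diff frag_euler_of)
next
  case (eng h1 h2) then show ?case by (simp add: frag_euler_add)
qed

end

section \<open>The derived category and the homotopy category\<close>

context acyclic
begin

lemma Db_simps: "Obj (Db Q) = {X. bounded_cpx Q X}" "Ide (Db Q) X = Db_map Q X X (chain_id X)"
  "Zer (Db Q) X Y = Db_map Q X Y (chain_zero X Y)" "Dsum (Db Q) = sum_cpx" "Null (Db Q) = zero_cpx" "Sh (Db Q) = shift"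
  by (simp_all add: Db_def)

lemma acts_natural:
  assumes "acts X Y F R r y" "t \<in> CM Q R' R"
  shows "acts X Y F R' (\<lambda>n. r n * t n) (\<lambda>n. y n * t n)"
proof -
  obtain W s f r' where \<phi>: "(W, s, f) \<in> F" "y \<in> CM Q R Y" "r' \<in> CM Q R W" "null Q R X (\<lambda>n. emb (s n) * r' n - r n)"
    "null Q R Y (\<lambda>n. emb (f n) * r' n - y n)" using assms(1) by (auto simp: acts_def tracks_def)
  have "tracks Q X Y (W, s, f) R' (\<lambda>n. r n * t n) (\<lambda>n. y n * t n)"
    unfolding tracks_def using null_right[OF \<phi>(4) assms(2)] null_right[OF \<phi>(5) assms(2)] CM_comp[OF \<phi>(3) assms(2)] CM_comp[OF \<phi>(2) assms(2)]
    by (auto intro!: bexI[of _ "\<lambda>n. r' n * t n"] simp: left_diff_distrib mult.assoc)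
  then show ?thesis using \<phi>(1) by (auto simp: acts_def)
qed

lemma roof_chain:
  assumes "bounded_cpx Q X" "bounded_cpx Q Y" "f \<in> chain_map Q X Y"
  shows "(X, chain_id X, f) \<in> roofs Q X Y"
  using assms qis_id[OF assms(1)]
  by (auto simp: roofs_def intro!: qis_quasi_iso chain_id_map simp: emb_chain_id)

lemma Db_map_Mor:
  assumes "bounded_cpx Q X" "bounded_cpx Q Y" "f \<in> chain_map Q X Y"
  shows "Db_map Q X Y f \<in> Mor (Db Q) X Y"
  unfolding Mor_Db Db_map_def using roof_chain[OF assms] by blast

lemma Db_map_acts:
  assumes X: "bounded_cpx Q X" and Y: "bounded_cpx Q Y" and f: "f \<in> chain_map Q X Y" and R: "proj_cpx Q R" and r: "r \<in> CM Q R X"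
  shows "acts X Y (Db_map Q X Y f) R r (\<lambda>n. emb (f n) * r n)"
  unfolding Db_map_def acts_class[OF roof_chain[OF X Y f] X Y R r] tracks_def
  using r null_zero CM_comp[OF chain_map_emb[OF X Y f] r] by (auto simp: emb_chain_id CM_idm(1)[OF r] intro!: bexI[of _ r])

lemma Ide_acts:
  assumes "bounded_cpx Q X" "proj_cpx Q R" "r \<in> CM Q R X"
  shows "acts X X (Ide (Db Q) X) R r r"
  using Db_map_acts[OF assms(1,1) chain_id_map[OF assms(1)] assms(2,3)] by (simp add: Db_simps emb_chain_id CM_idm(1)[OF assms(3)])

lemma Ide_Mor: "bounded_cpx Q X \<Longrightarrow> Ide (Db Q) X \<in> Mor (Db Q) X X"
  by (simp add: Db_simps Db_map_Mor chain_id_map)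

lemma Db_map_comp:
  assumes X: "bounded_cpx Q X" and Y: "bounded_cpx Q Y" and Z: "bounded_cpx Q Z" and f: "f \<in> chain_map Q X Y" and g: "g \<in> chain_map Q Y Z"
  shows "Cmp (Db Q) X Y Z (Db_map Q Y Z g) (Db_map Q X Y f) = Db_map Q X Z (chain_comp g f)"
proof -
  obtain P k p where P: "perf Q P k" "proj_cpx Q P" "qis Q P X p" using resolve[OF X] by metis
  note pC = qis_CM[OF P(3)] and F = Db_map_Mor[OF X Y f] and G = Db_map_Mor[OF Y Z g] and gf = chain_comp_map(1)[OF Y Z X g f]
  have 1: "acts X Z (Cmp (Db Q) X Y Z (Db_map Q Y Z g) (Db_map Q X Y f)) P p (\<lambda>n. emb (g n) * (emb (f n) * p n))"
    by (rule Cmp_Db(2)[OF F G X Y Z P(2) pC Db_map_acts[OF X Y f P(2) pC] Db_map_acts[OF Y Z g P(2) CM_comp[OF chain_map_emb[OF X Y f] pC]]])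
  have 2: "acts X Z (Db_map Q X Z (chain_comp g f)) P p (\<lambda>n. emb (g n) * (emb (f n) * p n))"
    using Db_map_acts[OF X Z gf P(2) pC] by (simp add: emb_chain_comp[OF g f] mult.assoc)
  show ?thesis by (rule Mor_eqI[OF Cmp_Db(1)[OF F G X Y Z] Db_map_Mor[OF X Z gf] X Z P(2,3) 1 2])
qed

lemma Db_map_homotopic:
  assumes X: "bounded_cpx Q X" and Y: "bounded_cpx Q Y" and h: "(f, g) \<in> homotopy_rel Q X Y"
  shows "Db_map Q X Y f = Db_map Q X Y g"
proof -
  obtain P k p where P: "perf Q P k" "proj_cpx Q P" "qis Q P X p" using resolve[OF X] by metis
  note pC = qis_CM[OF P(3)]
  have fg: "f \<in> chain_map Q X Y" "g \<in> chain_map Q X Y" "null Q X Y (\<lambda>n. emb (f n) - emb (g n))"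
    using h by (auto simp: homotopy_rel_iff[OF X Y])
  have "null Q P Y (\<lambda>n. emb (f n) * p n - emb (g n) * p n)" using null_right[OF fg(3) pC] by (simp add: left_diff_distrib)
  then have "acts X Y (Db_map Q X Y f) P p (\<lambda>n. emb (g n) * p n)"
    by (rule acts_cong[OF Db_map_acts[OF X Y fg(1) P(2) pC] null_refl _ CM_comp[OF chain_map_emb[OF X Y fg(2)] pC]])
  then show ?thesis
    by (rule Mor_eqI[OF Db_map_Mor[OF X Y fg(1)] Db_map_Mor[OF X Y fg(2)] X Y P(2,3) _ Db_map_acts[OF X Y fg(2) P(2) pC]])
qed

text \<open>
  The definition shifts all roofs of a class at once; they remain equivalent because shifting
  commutes with the action.
\<close>

lemma ShM_Db:
  assumes F: "F \<in> Mor (Db Q) X Y" and X: "bounded_cpx Q X" and Y: "bounded_cpx Q Y"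
  shows "ShM (Db Q) X Y F \<in> Mor (Db Q) (shift X) (shift Y)"
    "proj_cpx Q R \<Longrightarrow> r \<in> CM Q R X \<Longrightarrow> acts X Y F R r y \<Longrightarrow>
       acts (shift X) (shift Y) (ShM (Db Q) X Y F) (shift R) (\<lambda>n. r (n + 1)) (\<lambda>n. y (n + 1))"
proof -
  note sX = bounded_shift[OF X] and sY = bounded_shift[OF Y]
  obtain \<phi> where \<phi>: "\<phi> \<in> roofs Q X Y" "F = roof_class X Y \<phi>" using F unfolding Mor_Db by blast
  let ?sh = "\<lambda>(W, s, f). (shift W, chain_shift s, chain_shift f)"
  have sr: "?sh \<psi> \<in> roofs Q (shift X) (shift Y)" if "\<psi> \<in> roofs Q X Y" for \<psi>
  proof -
    obtain W s f where w: "\<psi> = (W, s, f)" by (cases \<psi>) auto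
    note d = roofsD[OF that[unfolded w] X Y]
    have c: "s \<in> chain_map Q W X" "f \<in> chain_map Q W Y" using that by (auto simp: roofs_def w quasi_iso_def)
    have "quasi_iso Q (shift W) (shift X) (chain_shift s)"
      by (rule qis_quasi_iso[OF bounded_shift[OF d(1)] sX chain_shift_map[OF d(1) X c(1)]])
         (use qis_shift[OF d(2)] in \<open>simp add: chain_shift_def\<close>)
    then show ?thesis using bounded_shift[OF d(1)] chain_shift_map[OF d(1) Y c(2)] by (simp add: roofs_def w)
  qed
  have st: "tracks Q (shift X) (shift Y) (?sh \<psi>) (shift R) (\<lambda>n. r (n + 1)) (\<lambda>n. y (n + 1))" if tr: "tracks Q X Y \<psi> R r y" for \<psi> R r y
  proof -
    obtain W s f where w: "\<psi> = (W, s, f)" by (cases \<psi>) auto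
    obtain r' where r': "y \<in> CM Q R Y" "r' \<in> CM Q R W" "null Q R X (\<lambda>n. emb (s n) * r' n - r n)" "null Q R Y (\<lambda>n. emb (f n) * r' n - y n)"
      using tr by (auto simp: tracks_def w)
    show ?thesis
      using CM_shift[OF r'(1)] CM_shift[OF r'(2)] null_shift[OF r'(3)] null_shift[OF r'(4)]
      by (auto simp: tracks_def w chain_shift_def intro!: bexI[of _ "\<lambda>n. r' (n + 1)"])
  qed
  obtain P k p where P: "perf Q P k" "proj_cpx Q P" "qis Q P X p" using resolve[OF X] by metis
  note pC = qis_CM[OF P(3)] and sP = proj_shift[OF P(2)] and sp = qis_shift[OF P(3)]
  obtain z where z: "z \<in> CM Q P Y" "acts X Y F P p z" using acts_ex[OF F X Y P(2) pC] by blast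
  have t: "\<psi> \<in> roofs Q X Y \<and> (\<forall>R r y. proj_cpx Q R \<longrightarrow> r \<in> CM Q R X \<longrightarrow> acts X Y F R r y \<longrightarrow> tracks Q X Y \<psi> R r y)" if \<psi>: "\<psi> \<in> F" for \<psi>
  proof -
    have rf: "\<psi> \<in> roofs Q X Y" using \<psi> by (auto simp: \<phi> roof_rel_def)
    have "roof_class X Y \<psi> = F"
    proof (rule Mor_eqI[OF _ F X Y P(2,3) _ z(2)])
      show "roof_class X Y \<psi> \<in> Mor (Db Q) X Y" using rf by (auto simp: Mor_Db)
      have "tracks Q X Y \<phi> P p z" using z(2) acts_class[OF \<phi>(1) X Y P(2) pC] by (simp add: \<phi>(2))
      then show "acts X Y (roof_class X Y \<psi>) P p z"
        using tracks_rel[OF _ X Y P(2) pC] \<psi> acts_class[OF rf X Y P(2) pC] by (simp add: \<phi>(2))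
    qed
    then show ?thesis using rf acts_class[OF rf X Y] by auto
  qed
  have self: "\<phi> \<in> F" using class_self[OF \<phi>(1) X Y] by (simp add: \<phi>)
  \<comment> \<open>All shifted representatives lie in the class of one of them.\<close>
  let ?\<theta> = "?sh \<phi>"
  have ty: "tracks Q X Y \<psi> P p z" if "\<psi> \<in> F" for \<psi> using t[OF that] P(2) pC z(2) by blast
  have same: "roof_class (shift X) (shift Y) (?sh \<psi>) = roof_class (shift X) (shift Y) ?\<theta>" if "\<psi> \<in> F" for \<psi>
    using class_iff[OF sr[OF conjunct1[OF t[OF that]]] sX sY sP sp st[OF ty[OF that]]]
      class_iff[OF sr[OF \<phi>(1)] sX sY sP sp st[OF ty[OF self]]] by blast
  have "ShM (Db Q) X Y F = (\<Union>\<psi>\<in>F. roof_class (shift X) (shift Y) (?sh \<psi>))"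
    by (force simp: Db_def Image_def)
  also have "\<dots> = roof_class (shift X) (shift Y) ?\<theta>" using same self by blast
  finally have eq: "ShM (Db Q) X Y F = roof_class (shift X) (shift Y) ?\<theta>" .
  show "ShM (Db Q) X Y F \<in> Mor (Db Q) (shift X) (shift Y)" unfolding eq Mor_Db using sr[OF \<phi>(1)] by blast
  show "acts (shift X) (shift Y) (ShM (Db Q) X Y F) (shift R) (\<lambda>n. r (n + 1)) (\<lambda>n. y (n + 1))"
    if "proj_cpx Q R" "r \<in> CM Q R X" "acts X Y F R r y"
    unfolding eq acts_class[OF sr[OF \<phi>(1)] sX sY proj_shift[OF that(1)] CM_shift[OF that(2)]]
    using st t[OF self] that by blast
qed

text \<open>
  An isomorphism in the derived category lifts to a homotopy equivalence between resolutions,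
  and resolutions have the Euler characteristics of the complexes that they resolve.
\<close>

lemma Db_iso_euler:
  fixes X Y :: "('n, 'k::field) cpx"
  assumes X: "bounded_cpx Q X" and Y: "bounded_cpx Q Y" and iso: "is_iso (Db Q) X Y F"
  shows "euler (tdim l) X = (euler (tdim l) Y :: 'k)"
proof -
  obtain G where F: "F \<in> Mor (Db Q) X Y" and G: "G \<in> Mor (Db Q) Y X"
    and GF: "Cmp (Db Q) X Y X G F = Ide (Db Q) X" and FG: "Cmp (Db Q) Y X Y F G = Ide (Db Q) Y"
    using iso by (auto simp: is_iso_def)
  have half: "\<exists>a\<in>CM Q P P'. \<forall>b x. acts Y X G P' q x \<longrightarrow> b \<in> CM Q P' P \<longrightarrow> null Q P' X (\<lambda>n. p n * b n - x n) \<longrightarrow>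
       null Q P P (\<lambda>n. b n * a n - idm (ob P n)) \<and> (\<exists>y. acts X Y F P p y \<and> null Q P Y (\<lambda>n. q n * a n - y n))"
    if X: "bounded_cpx Q X" and Y: "bounded_cpx Q Y" and F: "F \<in> Mor (Db Q) X Y" and G: "G \<in> Mor (Db Q) Y X"
      and GF: "Cmp (Db Q) X Y X G F = Ide (Db Q) X"
      and P: "proj_cpx Q P" "qis Q P X p" and P': "proj_cpx Q P'" "qis Q P' Y q" for X Y :: "('n, 'k) cpx" and F G P p P' q
  proof -
    note pC = qis_CM[OF P(2)] and qC = qis_CM[OF P'(2)] and Pb = proj_cpxD(1)[OF P(1)] and P'b = proj_cpxD(1)[OF P'(1)]
    obtain y where y: "y \<in> CM Q P Y" "acts X Y F P p y" using acts_ex[OF F X Y P(1) pC] by blast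
    obtain a where a: "a \<in> CM Q P P'" "null Q P Y (\<lambda>n. q n * a n - y n)" by (rule lift_ex[OF P(1) P'b Y P'(2) y(1)])
    have "null Q P P (\<lambda>n. b n * a n - idm (ob P n))"
      if x: "acts Y X G P' q x" and b: "b \<in> CM Q P' P" "null Q P' X (\<lambda>n. p n * b n - x n)" for b x
    proof -
      note xC = acts_CM[OF x]
      have "acts Y X G P y (\<lambda>n. x n * a n)"
        by (rule acts_cong[OF acts_natural[OF x a(1)] a(2) null_refl CM_comp[OF xC a(1)]])
      then have 1: "acts X X (Ide (Db Q) X) P p (\<lambda>n. x n * a n)"
        using Cmp_Db(2)[OF F G X Y X P(1) pC y(2)] GF by simp
      have "null Q P X (\<lambda>n. x n * a n - p n)"
        by (rule acts_unique[OF Ide_Mor[OF X] X X P(1) pC pC 1 Ide_acts[OF X P(1) pC] null_refl])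
      moreover have "null Q P X (\<lambda>n. p n * b n * a n - x n * a n)"
        using null_right[OF b(2) a(1)] by (simp add: left_diff_distrib)
      ultimately have "null Q P X (\<lambda>n. p n * b n * a n - p n)" by (rule null_trans[rotated])
      then have "null Q P X (\<lambda>n. p n * (b n * a n - idm (ob P n)))"
        by (simp add: right_diff_distrib mult.assoc CM_idm(2)[OF pC])
      then show ?thesis by (rule lift_unique[OF P(1) Pb X P(2) CM_closed(3)[OF CM_comp[OF b(1) a(1)] CM_id[OF Pb]]])
    qed
    then show ?thesis using a y by blast
  qed
  obtain P k p where P: "perf Q P k" "proj_cpx Q P" "qis Q P X p" "\<And>l. euler (tdim l) P = (euler (tdim l) X :: 'k)" using resolve[OF X] by metis
  obtain P' k' q where P': "perf Q P' k'" "proj_cpx Q P'" "qis Q P' Y q" "\<And>l. euler (tdim l) P' = (euler (tdim l) Y :: 'k)" using resolve[OF Y] by metis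
  note pC = qis_CM[OF P(3)] and qC = qis_CM[OF P'(3)] and Pb = proj_cpxD(1)[OF P(2)] and P'b = proj_cpxD(1)[OF P'(2)]
  obtain y where y: "y \<in> CM Q P Y" "acts X Y F P p y" using acts_ex[OF F X Y P(2) pC] by blast
  obtain x where x: "x \<in> CM Q P' X" "acts Y X G P' q x" using acts_ex[OF G Y X P'(2) qC] by blast
  obtain a where a: "a \<in> CM Q P P'" and a1: "\<forall>b x. acts Y X G P' q x \<longrightarrow> b \<in> CM Q P' P \<longrightarrow> null Q P' X (\<lambda>n. p n * b n - x n) \<longrightarrow>
       null Q P P (\<lambda>n. b n * a n - idm (ob P n)) \<and> (\<exists>y. acts X Y F P p y \<and> null Q P Y (\<lambda>n. q n * a n - y n))"
    using half[OF X Y F G GF P(2,3) P'(2,3)] by blast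
  obtain b where b: "b \<in> CM Q P' P" and b1: "\<forall>a y. acts X Y F P p y \<longrightarrow> a \<in> CM Q P P' \<longrightarrow> null Q P Y (\<lambda>n. q n * a n - y n) \<longrightarrow>
       null Q P' P' (\<lambda>n. a n * b n - idm (ob P' n)) \<and> (\<exists>x. acts Y X G P' q x \<and> null Q P' X (\<lambda>n. p n * b n - x n))"
    using half[OF Y X G F FG P'(2,3) P(2,3)] by blast
  obtain b0 where b0: "b0 \<in> CM Q P' P" "null Q P' X (\<lambda>n. p n * b0 n - x n)" by (rule lift_ex[OF P'(2) Pb X P(3) x(1)])
  obtain y' where y': "acts X Y F P p y'" "null Q P Y (\<lambda>n. q n * a n - y' n)" using a1 x(2) b0 by blast
  have 1: "null Q P' P' (\<lambda>n. a n * b n - idm (ob P' n))" "\<exists>x. acts Y X G P' q x \<and> null Q P' X (\<lambda>n. p n * b n - x n)"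
    using b1 y' a by blast+
  then have "null Q P P (\<lambda>n. b n * a n - idm (ob P n))" using a1 b by blast
  then have "euler (tdim l) P = (euler (tdim l) P' :: 'k)" by (rule euler_homotopy_equivalence[OF Pb P'b a b _ 1(1)])
  then show ?thesis using P(4) P'(4) by simp
qed

lemma Db_qis_iso:
  assumes X: "bounded_cpx Q X" and Y: "bounded_cpx Q Y" and s: "s \<in> chain_map Q X Y" and q: "qis Q X Y (\<lambda>n. emb (s n))"
  shows "is_iso (Db Q) X Y (Db_map Q X Y s)"
proof -
  let ?S = "Db_map Q X Y s"
  have rf: "(X, s, chain_id X) \<in> roofs Q Y X"
    using X qis_quasi_iso[OF X Y s q] chain_id_map[OF X] by (simp add: roofs_def)
  define G where "G = roof_class Y X (X, s, chain_id X)"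
  have G: "G \<in> Mor (Db Q) Y X" unfolding G_def Mor_Db using rf by blast
  have S: "?S \<in> Mor (Db Q) X Y" by (rule Db_map_Mor[OF X Y s])
  have Ga: "acts Y X G R r r'" if "proj_cpx Q R" "r \<in> CM Q R Y" "r' \<in> CM Q R X" "null Q R Y (\<lambda>n. emb (s n) * r' n - r n)" for R r r'
    unfolding G_def acts_class[OF rf Y X that(1,2)] tracks_def using that null_zero
    by (auto simp: emb_chain_id CM_idm(1)[OF that(3)] intro!: bexI[of _ r'])
  have sC: "(\<lambda>n. emb (s n)) \<in> CM Q X Y" by (rule qis_CM[OF q])
  have "Cmp (Db Q) X Y X G ?S = Ide (Db Q) X"
  proof -
    obtain P k p where P: "perf Q P k" "proj_cpx Q P" "qis Q P X p" using resolve[OF X] by metis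
    note pC = qis_CM[OF P(3)]
    have "acts X X (Cmp (Db Q) X Y X G ?S) P p p"
      by (rule Cmp_Db(2)[OF S G X Y X P(2) pC Db_map_acts[OF X Y s P(2) pC] Ga[OF P(2) CM_comp[OF sC pC] pC null_refl]])
    then show ?thesis by (rule Mor_eqI[OF Cmp_Db(1)[OF S G X Y X] Ide_Mor[OF X] X X P(2,3) _ Ide_acts[OF X P(2) pC]])
  qed
  moreover have "Cmp (Db Q) Y X Y ?S G = Ide (Db Q) Y"
  proof -
    obtain P k p where P: "perf Q P k" "proj_cpx Q P" "qis Q P Y p" using resolve[OF Y] by metis
    note pC = qis_CM[OF P(3)]
    obtain r where r: "r \<in> CM Q P X" "null Q P Y (\<lambda>n. emb (s n) * r n - p n)" by (rule lift_ex[OF P(2) X Y q pC])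
    have "acts Y Y (Cmp (Db Q) Y X Y ?S G) P p (\<lambda>n. emb (s n) * r n)"
      by (rule Cmp_Db(2)[OF G S Y X Y P(2) pC Ga[OF P(2) pC r] Db_map_acts[OF X Y s P(2) r(1)]])
    then have "acts Y Y (Cmp (Db Q) Y X Y ?S G) P p p" by (rule acts_cong[OF _ null_refl r(2) pC])
    then show ?thesis by (rule Mor_eqI[OF Cmp_Db(1)[OF G S Y X Y] Ide_Mor[OF Y] Y Y P(2,3) _ Ide_acts[OF Y P(2) pC]])
  qed
  ultimately show ?thesis unfolding is_iso_def using S G by blast
qed

lemma Db_triangles: "chain_triangles Q (Db Q :: (('n, 'k::field_char_0) cpx, _) tricat) (Db_map Q)"
proof (unfold_locales, goal_cases)
  case (7 X Y f)
  note sX = bounded_shift[OF 7(1)] and sY = bounded_shift[OF 7(2)] and sf = chain_shift_map[OF 7]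
  note F = Db_map_Mor[OF 7]
  obtain P k p where P: "perf Q P k" "proj_cpx Q P" "qis Q P X p" using resolve[OF 7(1)] by metis
  note pC = qis_CM[OF P(3)]
  have "acts (shift X) (shift Y) (ShM (Db Q) X Y (Db_map Q X Y f)) (shift P) (\<lambda>n. p (n + 1)) (\<lambda>n. emb (f (n + 1)) * p (n + 1))"
    by (rule ShM_Db(2)[OF F 7(1,2) P(2) pC Db_map_acts[OF 7 P(2) pC]])
  moreover have "acts (shift X) (shift Y) (Db_map Q (shift X) (shift Y) (chain_shift f)) (shift P) (\<lambda>n. p (n + 1)) (\<lambda>n. emb (f (n + 1)) * p (n + 1))"
    using Db_map_acts[OF sX sY sf proj_shift[OF P(2)] CM_shift[OF pC]] by (simp add: chain_shift_def)
  ultimately show ?case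
    by (rule Mor_eqI[OF ShM_Db(1)[OF F 7(1,2)] Db_map_Mor[OF sX sY sf] sX sY proj_shift[OF P(2)] qis_shift[OF P(3)]])
qed (simp_all add: Db_simps bounded_zero Db_map_Mor Db_map_comp Db_map_homotopic Db_iso_euler, simp add: Db_def)

lemma homotopy_rel_trans:
  assumes "bounded_cpx Q X" "bounded_cpx Q Y"
  shows "(f, g) \<in> homotopy_rel Q X Y \<Longrightarrow> (g, h) \<in> homotopy_rel Q X Y \<Longrightarrow> (f, h) \<in> homotopy_rel Q X Y"
    "(f, g) \<in> homotopy_rel Q X Y \<Longrightarrow> (g, f) \<in> homotopy_rel Q X Y"
    "f \<in> chain_map Q X Y \<Longrightarrow> (f, f) \<in> homotopy_rel Q X Y"
proof -
  assume "(f, g) \<in> homotopy_rel Q X Y" "(g, h) \<in> homotopy_rel Q X Y"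
  then show "(f, h) \<in> homotopy_rel Q X Y"
    by (auto simp: homotopy_rel_iff[OF assms] intro: null_trans[of Q X Y "\<lambda>n. emb (f n)" "\<lambda>n. emb (g n)"])
next
  assume "(f, g) \<in> homotopy_rel Q X Y"
  then show "(g, f) \<in> homotopy_rel Q X Y"
    by (auto simp: homotopy_rel_iff[OF assms] intro: null_sym)
next
  assume "f \<in> chain_map Q X Y"
  then show "(f, f) \<in> homotopy_rel Q X Y"
    by (auto simp: homotopy_rel_iff[OF assms] intro: null_zero)
qed

lemma Kb_map_eq:
  assumes "bounded_cpx Q X" "bounded_cpx Q Y" "(f, g) \<in> homotopy_rel Q X Y"
  shows "Kb_map Q X Y f = Kb_map Q X Y g"
  unfolding Kb_map_def using homotopy_rel_trans[OF assms(1,2)] assms(3) by blast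

lemma Kb_simps: "Obj (Kb_proj Q) = {X. bounded_cpx Q X \<and> (\<forall>n. projective_mod Q (ob X n))}"
  "Ide (Kb_proj Q) X = Kb_map Q X X (chain_id X)" "Sh (Kb_proj Q) = shift"
  "Mor (Kb_proj Q) X Y = chain_map Q X Y // homotopy_rel Q X Y"
  "Cmp (Kb_proj Q) X Y Z G F = (\<Union>g\<in>G. \<Union>f\<in>F. Kb_map Q X Z (chain_comp g f))"
  "ShM (Kb_proj Q) X Y F = (\<Union>f\<in>F. Kb_map Q (shift X) (shift Y) (chain_shift f))"
  by (simp_all add: Kb_proj_def Let_def)

lemma Kb_comp:
  assumes X: "bounded_cpx Q X" and Y: "bounded_cpx Q Y" and Z: "bounded_cpx Q Z" and f: "f \<in> chain_map Q X Y" and g: "g \<in> chain_map Q Y Z"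
  shows "Cmp (Kb_proj Q) X Y Z (Kb_map Q Y Z g) (Kb_map Q X Y f) = Kb_map Q X Z (chain_comp g f)"
proof -
  have "Kb_map Q X Z (chain_comp g' f') = Kb_map Q X Z (chain_comp g f)"
    if "g' \<in> Kb_map Q Y Z g" "f' \<in> Kb_map Q X Y f" for g' f'
  proof -
    have h: "(g, g') \<in> homotopy_rel Q Y Z" "(f, f') \<in> homotopy_rel Q X Y" using that by (simp_all add: Kb_map_def)
    then have c: "g' \<in> chain_map Q Y Z" "f' \<in> chain_map Q X Y" and n: "null Q Y Z (\<lambda>n. emb (g n) - emb (g' n))" "null Q X Y (\<lambda>n. emb (f n) - emb (f' n))"
      by (auto simp: homotopy_rel_iff[OF Y Z] homotopy_rel_iff[OF X Y])
    have "null Q X Z (\<lambda>n. emb (g n) * emb (f n) - emb (g' n) * emb (f' n))"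
      by (rule null_comp_cong[OF n(2,1) chain_map_emb[OF Y Z g] chain_map_emb[OF X Y c(2)]])
    then have "(chain_comp g f, chain_comp g' f') \<in> homotopy_rel Q X Z"
      by (simp add: homotopy_rel_iff[OF X Z] chain_comp_map(1)[OF Y Z X] c f g emb_chain_comp[OF g f] emb_chain_comp[OF c])
    then show ?thesis using Kb_map_eq[OF X Z] by blast
  qed
  moreover have "g \<in> Kb_map Q Y Z g" "f \<in> Kb_map Q X Y f"
    using homotopy_rel_trans(3)[OF Y Z g] homotopy_rel_trans(3)[OF X Y f] by (simp_all add: Kb_map_def)
  ultimately show ?thesis unfolding Kb_simps by blast
qed

lemma Kb_shift:
  assumes X: "bounded_cpx Q X" and Y: "bounded_cpx Q Y" and f: "f \<in> chain_map Q X Y"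
  shows "ShM (Kb_proj Q) X Y (Kb_map Q X Y f) = Kb_map Q (shift X) (shift Y) (chain_shift f)"
proof -
  have "Kb_map Q (shift X) (shift Y) (chain_shift f') = Kb_map Q (shift X) (shift Y) (chain_shift f)" if "f' \<in> Kb_map Q X Y f" for f'
  proof -
    have h: "(f, f') \<in> homotopy_rel Q X Y" using that by (simp add: Kb_map_def)
    then have c: "f' \<in> chain_map Q X Y" and n: "null Q X Y (\<lambda>n. emb (f n) - emb (f' n))" by (auto simp: homotopy_rel_iff[OF X Y])
    have "(chain_shift f, chain_shift f') \<in> homotopy_rel Q (shift X) (shift Y)"
      using null_shift[OF n] by (simp add: homotopy_rel_iff[OF bounded_shift[OF X] bounded_shift[OF Y]] chain_shift_map[OF X Y] f c)
        (simp add: chain_shift_def)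
    then show ?thesis using Kb_map_eq[OF bounded_shift[OF X] bounded_shift[OF Y]] by blast
  qed
  moreover have "f \<in> Kb_map Q X Y f" using homotopy_rel_trans(3)[OF X Y f] by (simp add: Kb_map_def)
  ultimately show ?thesis unfolding Kb_simps by blast
qed

lemma Kb_iso_euler:
  fixes X Y :: "('n, 'k::field) cpx"
  assumes X: "bounded_cpx Q X" and Y: "bounded_cpx Q Y" and iso: "is_iso (Kb_proj Q) X Y F"
  shows "euler (tdim l) X = (euler (tdim l) Y :: 'k)"
proof -
  obtain G where "F \<in> Mor (Kb_proj Q) X Y" "G \<in> Mor (Kb_proj Q) Y X"
    and GF: "Cmp (Kb_proj Q) X Y X G F = Ide (Kb_proj Q) X" and FG: "Cmp (Kb_proj Q) Y X Y F G = Ide (Kb_proj Q) Y"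
    using iso by (auto simp: is_iso_def)
  then obtain f g where f: "f \<in> chain_map Q X Y" "F = Kb_map Q X Y f" and g: "g \<in> chain_map Q Y X" "G = Kb_map Q Y X g"
    by (auto simp: Kb_simps quotient_def Kb_map_def)
  have n: "null Q X X (\<lambda>n. emb (g n) * emb (f n) - idm (ob X n))"
    if X: "bounded_cpx Q X" and Y: "bounded_cpx Q Y" and f: "f \<in> chain_map Q X Y" and g: "g \<in> chain_map Q Y X"
      and e: "Cmp (Kb_proj Q) X Y X (Kb_map Q Y X g) (Kb_map Q X Y f) = Ide (Kb_proj Q) X" for X Y :: "('n, 'k) cpx" and f g
  proof -
    have "Kb_map Q X X (chain_comp g f) = Kb_map Q X X (chain_id X)" using e by (simp add: Kb_comp[OF X Y X f g]) (simp add: Kb_simps)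
    moreover have "chain_id X \<in> Kb_map Q X X (chain_id X)"
      using homotopy_rel_trans(3)[OF X X chain_id_map[OF X]] by (simp add: Kb_map_def)
    ultimately have "chain_id X \<in> Kb_map Q X X (chain_comp g f)" by simp
    then have "(chain_comp g f, chain_id X) \<in> homotopy_rel Q X X" by (simp add: Kb_map_def)
    then show ?thesis by (simp add: homotopy_rel_iff[OF X X] emb_chain_comp[OF g f] emb_chain_id)
  qed
  show ?thesis
    by (rule euler_homotopy_equivalence[OF X Y chain_map_emb[OF X Y f(1)] chain_map_emb[OF Y X g(1)]
          n[OF X Y f(1) g(1) GF[unfolded f g]] n[OF Y X g(1) f(1) FG[unfolded f g]]])
qed

lemma Kb_triangles: "chain_triangles Q (Kb_proj Q :: (('n, 'k::field_char_0) cpx, _) tricat) (Kb_map Q)"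
proof (unfold_locales, goal_cases)
  case 2 show ?case using exproj_projective[OF exproj_zero] by (simp add: Kb_simps bounded_zero) (simp add: zero_cpx_def)
next
  case (3 X Y f) then show ?case by (auto simp: Kb_simps Kb_map_def intro: quotientI)
next
  case (9) show ?case by (simp add: Kb_proj_def Let_def)
qed (simp_all add: Kb_simps(1-3) Kb_comp Kb_map_eq Kb_shift Kb_iso_euler)

section \<open>Dimension vectors and g-vectors\<close>

lemma ses_relation:
  fixes S M N :: "('n, 'k::field_char_0) cpx"
  assumes b: "bounded_cpx Q S" "bounded_cpx Q M" "bounded_cpx Q N" and ses: "ses Q S M N F G"
  shows "frag_of M - frag_of S - frag_of N \<in> K0_relations (Db Q)"
proof -
  note T = Db_triangles[where 'k = 'k]
  let ?f = "mts S M F"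
  note f = mts_emb(1)[OF b(1,2) sesD(1)[OF ses]]
  have Cb: "bounded_cpx Q (cone S M ?f)" by (rule bounded_cone[OF b(1,2) f])
  note q = ses_cone[OF b ses]
  note qm = mts_emb[OF Cb b(3) qis_CM[OF q]]
  have "frag_of N - frag_of (cone S M ?f) \<in> K0_relations (Db Q)"
    by (rule chain_triangles.iso_relation[OF T _ _ qm(1)])
       (use Cb b Db_qis_iso[OF Cb b(3) qm(1)] q in \<open>auto simp: Db_simps qm\<close>)
  moreover have "frag_of M - frag_of S - frag_of (cone S M ?f) \<in> K0_relations (Db Q)"
    by (rule chain_triangles.cone_relation[OF T _ _ _ f]) (use b Cb in \<open>auto simp: Db_simps\<close>)
  ultimately show ?thesis using K0_relations_closed(3) by fastforce
qed

text \<open>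
  Split off simple submodules until nothing is left.
\<close>

lemma simple_expansion:
  fixes M :: "('n, 'k::field_char_0) rmod"
  assumes "is_mod Q M"
  shows "\<exists>d :: int ^ 'n. frag_of (stalk M) - (\<Sum>i\<in>UNIV. frag_cmul (d $ i) (frag_of (stalk (simple_mod i)))) \<in> K0_relations (Db Q)"
  using assms
proof (induction "mdim M" arbitrary: M rule: less_induct)
  case less
  note T = Db_triangles[where 'k = 'k]
  note b = bounded_stalk[OF less.prems]
  show ?case
  proof (cases "mdim M = 0")
    case True
    let ?z = "chain_zero zero_cpx (stalk M)"
    note z = chain_zero_map[OF bounded_zero b]
    have "qis Q zero_cpx (stalk M) (\<lambda>n. emb (?z n))"
      using qis_zero[OF b] True by (simp add: ob_stalk emb_chain_zero)
    then have "frag_of (stalk M) - frag_of zero_cpx \<in> K0_relations (Db Q)"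
      by (intro chain_triangles.iso_relation[OF T _ _ z] Db_qis_iso bounded_zero b z) (simp_all add: Db_simps bounded_zero b)
    from K0_relations_closed(1)[OF this chain_triangles.zero_relation[OF T]] show ?thesis
      by (intro exI[of _ 0]) simp
  next
    case False
    obtain j N F G where N: "is_mod Q N" "mdim N < mdim M" and ses: "ses Q (stalk (simple_mod j)) (stalk M) (stalk N) F G"
      by (rule module_filtration_step[OF Q less.prems False])
    obtain d :: "int ^ 'n" where d: "frag_of (stalk N) - (\<Sum>i\<in>UNIV. frag_cmul (d $ i) (frag_of (stalk (simple_mod i)))) \<in> K0_relations (Db Q)"
      using less.hyps[OF N(2,1)] by blast
    let ?S = "\<lambda>i. frag_of (stalk (simple_mod i) :: ('n, 'k) cpx)"
    have "frag_of (stalk M) - ?S j - frag_of (stalk N) \<in> K0_relations (Db Q)"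
      by (rule ses_relation[OF bounded_stalk[OF is_mod_simple] b bounded_stalk[OF N(1)] ses])
    from K0_relations_closed(1)[OF this d]
    have "frag_of (stalk M) - (?S j + (\<Sum>i\<in>UNIV. frag_cmul (d $ i) (?S i))) \<in> K0_relations (Db Q)" by (simp add: algebra_simps)
    also have "?S j + (\<Sum>i\<in>UNIV. frag_cmul (d $ i) (?S i)) = (\<Sum>i\<in>UNIV. frag_cmul ((d + axis j 1) $ i) (?S i))"
      by (simp add: frag_cmul_distrib sum.distrib axis_def if_distrib[of "\<lambda>c. frag_cmul c _"] cong: if_cong)
    finally show ?thesis by blast
  qed
qed

text \<open>
  An expansion into simple modules exists, and its coefficients are read off by Euler
  characteristics, so the description that defines the dimension vector is met by exactly one
  vector.
\<close>

lemma dim_vector_stalk: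
  fixes M :: "('n, 'k::field_char_0) rmod"
  assumes M: "is_mod Q M"
  shows "of_int (dim_vector Q (stalk M) $ l) = (tdim l M :: 'k)"
proof -
  note T = Db_triangles[where 'k = 'k]
  let ?S = "\<lambda>d. (\<Sum>i\<in>UNIV. frag_cmul (d $ i) (frag_of (stalk (simple_mod i) :: ('n, 'k) cpx)))"
  have e: "of_int (d $ l) = (tdim l M :: 'k)" if "frag_of (stalk M) - ?S d \<in> K0_relations (Db Q)" for d :: "int ^ 'n" and l
  proof -
    have "chain_triangles.frag_euler l (frag_of (stalk M) - ?S d) = (0 :: 'k)" by (rule chain_triangles.relation_euler[OF T that])
    then show ?thesis
      by (simp add: chain_triangles.frag_euler_diff[OF T] chain_triangles.frag_euler_of[OF T] chain_triangles.frag_euler_sum[OF T]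
          chain_triangles.frag_euler_cmul[OF T] euler_stalk[OF additive_tdim[of Q]] tdim_simple if_distrib[of "\<lambda>c. _ * c"] cong: if_cong)
  qed
  obtain d :: "int ^ 'n" where d: "frag_of (stalk M) - ?S d \<in> K0_relations (Db Q)" using simple_expansion[OF M] by blast
  have "dim_vector Q (stalk M) = d"
    unfolding dim_vector_def K0_class_eq_iff
  proof (rule the_equality)
    show "frag_of (stalk M) - ?S d \<in> K0_relations (Db Q)" by (rule d)
    fix d' assume "frag_of (stalk M) - ?S d' \<in> K0_relations (Db Q)"
    then have "of_int (d' $ l) = (of_int (d $ l) :: 'k)" for l using e[OF d] e by simp
    then have "\<forall>l. d' $ l = d $ l" by simp
    then show "d' = d" by (simp add: Finite_Cartesian_Product.vec_eq_iff)
  qed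
  then show ?thesis using e[OF d] by simp
qed

text \<open>
  Multiplication by the inverse \<open>1 - Q\<close> of the path matrix, in the form given by
  \<open>npaths_first\<close>.
\<close>

lemma paths_inverse:
  fixes h x :: "'n \<Rightarrow> int"
  assumes "\<And>l. (\<Sum>i\<in>UNIV. h i * int (npaths Q l i)) = x l"
  shows "h s = x s - (\<Sum>t\<in>UNIV. int (Q s t) * x t)"
proof -
  have "(\<Sum>t\<in>UNIV. int (Q s t) * x t) = (\<Sum>i\<in>UNIV. h i * (\<Sum>t\<in>UNIV. int (Q s t) * int (npaths Q t i)))"
    unfolding assms[symmetric] sum_distrib_left by (subst sum.swap) (simp add: ac_simps)
  moreover have "x s = (\<Sum>i\<in>UNIV. h i * int (npaths Q s i))" by (simp add: assms)
  moreover have "int (npaths Q s i) = (if s = i then 1 else 0) + (\<Sum>t\<in>UNIV. int (Q s t) * int (npaths Q t i))" for i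
    by (subst npaths_first[OF Q]) simp
  ultimately show ?thesis by (simp add: distrib_left sum.distrib if_distrib[of "\<lambda>c. _ * c"] cong: if_cong)
qed

lemma perf_euler_paths:
  fixes R :: "('n, 'k::field) cpx"
  shows "perf Q R g \<Longrightarrow> euler (tdim l) R = (of_int (\<Sum>i\<in>UNIV. g i * int (npaths Q l i)) :: 'k)"
  using perf_euler[OF _ Q additive_tdim[of Q l]] by (simp add: tdim_proj[OF Q])

lemma perf_Obj: "perf Q R g \<Longrightarrow> R \<in> Obj (Kb_proj Q)"
  using perf_proj[OF _ Q] by (auto simp: Kb_simps proj_cpx_def exproj_projective)

text \<open>
  Any two representatives have the same Euler characteristics at all vertices, and these
  determine the class because the path matrix is invertible.
\<close>

lemma g_vector_eq:
  fixes Y :: "('n, 'k::field_char_0) cpx"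
  assumes Y: "bounded_cpx Q Y" and R: "perf Q R g" and q: "qis Q R Y e" and eu: "\<And>l. euler (tdim l) R = (euler (tdim l) Y :: 'k)"
  shows "g_vector Q Y = (\<chi> i. g i)"
proof -
  note T = Kb_triangles[where 'k = 'k]
  note Rb = proj_cpxD(1)[OF perf_proj[OF R Q]]
  let ?S = "\<lambda>g. (\<Sum>i\<in>UNIV. frag_cmul (g $ i) (frag_of (stalk (proj_mod Q i) :: ('n, 'k) cpx)))"
  show ?thesis
    unfolding g_vector_def K0_class_eq_iff
  proof (rule the_equality)
    note qm = mts_emb[OF Rb Y qis_CM[OF q]]
    have "isomorphic (Db Q) R Y"
      using Db_qis_iso[OF Rb Y qm(1)] q Rb Y by (auto simp: isomorphic_def Db_simps qm)
    moreover have "frag_of R - ?S (\<chi> i. g i) \<in> K0_relations (Kb_proj Q)"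
      using chain_triangles.perf_relation[OF T Q perf_Obj R] by simp
    ultimately show "\<exists>P. P \<in> Obj (Kb_proj Q) \<and> isomorphic (Db Q) P Y \<and> frag_of P - ?S (\<chi> i. g i) \<in> K0_relations (Kb_proj Q)"
      using perf_Obj[OF R] by blast
    fix g' assume "\<exists>P. P \<in> Obj (Kb_proj Q) \<and> isomorphic (Db Q) P Y \<and> frag_of P - ?S g' \<in> K0_relations (Kb_proj Q)"
    then obtain P where P: "P \<in> Obj (Kb_proj Q)" "isomorphic (Db Q) P Y" "frag_of P - ?S g' \<in> K0_relations (Kb_proj Q)" by blast
    have Pb: "bounded_cpx Q P" using P(1) by (simp add: Kb_simps)
    have "of_int (\<Sum>i\<in>UNIV. g' $ i * int (npaths Q l i)) = (of_int (\<Sum>i\<in>UNIV. g i * int (npaths Q l i)) :: 'k)" for l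
    proof -
      have "chain_triangles.frag_euler l (frag_of P - ?S g') = (0 :: 'k)" by (rule chain_triangles.relation_euler[OF T P(3)])
      then have "euler (tdim l) P = (of_int (\<Sum>i\<in>UNIV. g' $ i * int (npaths Q l i)) :: 'k)"
        by (simp add: chain_triangles.frag_euler_diff[OF T] chain_triangles.frag_euler_of[OF T] chain_triangles.frag_euler_sum[OF T]
          chain_triangles.frag_euler_cmul[OF T] euler_stalk[OF additive_tdim[of Q]] tdim_proj[OF Q])
      moreover have "euler (tdim l) P = (euler (tdim l) Y :: 'k)"
        using P(2) Db_iso_euler[OF Pb Y] by (auto simp: isomorphic_def)
      ultimately show ?thesis using eu perf_euler_paths[OF R, of l] by simp
    qed
    then have *: "(\<Sum>i\<in>UNIV. g' $ i * int (npaths Q l i)) = (\<Sum>i\<in>UNIV. g i * int (npaths Q l i))" for l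
      by (metis of_int_eq_iff)
    have "g' $ s = g s" for s
      using paths_inverse[of "\<lambda>i. g' $ i" _ s, OF *] paths_inverse[of g _ s, OF refl] by simp
    then show "g' = (\<chi> i. g i)" by (simp add: Finite_Cartesian_Product.vec_eq_iff)
  qed
qed

lemma g_vector_euler:
  fixes Y :: "('n, 'k::field_char_0) cpx"
  assumes Y: "bounded_cpx Q Y"
  shows "of_int (\<Sum>i\<in>UNIV. g_vector Q Y $ i * int (npaths Q l i)) = (euler (tdim l) Y :: 'k)"
proof -
  obtain R g e where R: "perf Q R g" "proj_cpx Q R" "qis Q R Y e" "\<And>l. euler (tdim l) R = (euler (tdim l) Y :: 'k)"
    by (rule resolve[OF Y]) (blast intro: that)
  show ?thesis using perf_euler_paths[OF R(1), of l] R(4)[of l] by (simp add: g_vector_eq[OF Y R(1,3,4)])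
qed

end

section \<open>Linear algebra of operator spaces\<close>

text \<open>
  Spaces of homomorphisms are subspaces of the ring of operators, which has infinite dimension;
  each of them lies in some \<open>bd n m\<close>, and this is where finiteness comes from.
\<close>

abbreviation lin :: "('k::field lin_op \<Rightarrow> 'k lin_op) \<Rightarrow> bool" where "lin \<equiv> Vector_Spaces.linear scl scl"

lemma linI: "(\<And>x y. T (x + y) = T x + T y) \<Longrightarrow> (\<And>c x. T (scl c x) = scl c (T x)) \<Longrightarrow> lin T"
  by (auto simp: Vector_Spaces.linear_iff scl_vector_space)

lemma lin_simps:
  assumes "lin T"
  shows "T (x + y) = T x + T y" "T (scl c x) = scl c (T x)" "T 0 = 0"
proof -
  show a: "T (x + y) = T x + T y" and "T (scl c x) = scl c (T x)" for x y c using assms by (auto simp: Vector_Spaces.linear_iff)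
  show "T 0 = 0" using a[of 0 0] by simp
qed

lemma lin_left: "lin (\<lambda>x. a * x)" and lin_right: "lin (\<lambda>x. x * a)"
  by (rule linI; simp add: distrib_left distrib_right scl_mult_left scl_mult_right)+

lemma subspaceI: "0 \<in> V \<Longrightarrow> (\<And>x y. x \<in> V \<Longrightarrow> y \<in> V \<Longrightarrow> x + y \<in> V) \<Longrightarrow> (\<And>c x. x \<in> V \<Longrightarrow> scl c x \<in> V) \<Longrightarrow> scl.subspace V"
  by (simp add: scl.subspace_def)

lemma subspaceD:
  assumes "scl.subspace V"
  shows "0 \<in> V" "x \<in> V \<Longrightarrow> y \<in> V \<Longrightarrow> x + y \<in> V" "x \<in> V \<Longrightarrow> y \<in> V \<Longrightarrow> x - y \<in> V" "x \<in> V \<Longrightarrow> scl c x \<in> V"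
  using assms scl.subspace_diff by (auto simp: scl.subspace_def)

lemma subspace_Hm: "scl.subspace (Hm Q M N)" by (rule subspaceI) (auto simp: Hm_closed)

lemma subspace_bd: "scl.subspace (bd n m)" by (rule subspaceI) (auto simp: bd_closed)

lemma subspace_kernel: "scl.subspace V \<Longrightarrow> lin T \<Longrightarrow> scl.subspace {v \<in> V. T v = 0}"
  by (rule subspaceI) (auto simp: subspaceD lin_simps)

lemma subspace_image: "scl.subspace V \<Longrightarrow> lin T \<Longrightarrow> scl.subspace (T ` V)"
  by (rule module_hom.subspace_image[OF Vector_Spaces.linear.axioms(3)])

lemma bd_span: "(bd n m :: 'k::field lin_op set) \<subseteq> scl.span ((\<lambda>(i, j). colop (uv i) * emb (Matrix.mat 1 m (\<lambda>(a, b). if b = j then 1 else 0))) ` ({..<n} \<times> {..<m}))"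
  (is "_ \<subseteq> scl.span (?u ` ?I)")
proof
  fix f :: "'k lin_op" assume f: "f \<in> bd n m"
  have u: "?u (i, j) \<in> bd n m" if "i < n" for i j
    by (auto intro!: bd_closed(6)[of _ n 1 _ m] col_bd emb_bd simp: that)
  have "f = (\<Sum>p\<in>?I. scl (ap f (uv (snd p)) (fst p)) (?u p))"
  proof (rule bd_eqI[OF f])
    show "(\<Sum>p\<in>?I. scl (ap f (uv (snd p)) (fst p)) (?u p)) \<in> bd n m" by (rule bd_sum) (auto intro!: bd_closed(5) u[simplified])
    fix i j assume ij: "i < n" "j < m"
    have "ap (?u p) (uv j) i = (if p = (i, j) then 1 else 0)" if "p \<in> ?I" for p
      using ij that by (auto simp: ap_col ap_emb uv_def if_distrib[of "\<lambda>x. _ * x"] if_distrib[of "\<lambda>x. x * _"] sum.delta cong: if_cong split: prod.splits)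
    then have "(\<Sum>p\<in>?I. ap f (uv (snd p)) (fst p) * ap (?u p) (uv j) i) = (\<Sum>p\<in>?I. if p = (i, j) then ap f (uv (snd p)) (fst p) else 0)"
      by (intro sum.cong) auto
    also have "\<dots> = ap f (uv j) i" using ij by simp
    finally show "ap f (uv j) i = ap (\<Sum>p\<in>?I. scl (ap f (uv (snd p)) (fst p)) (?u p)) (uv j) i"
      by (simp add: ap_sum_op)
  qed
  also have "\<dots> \<in> scl.span (?u ` ?I)"
    by (intro scl.span_sum scl.span_scale scl.span_base imageI)
  finally show "f \<in> scl.span (?u ` ?I)" .
qed

lemma independent_finite: "scl.independent B \<Longrightarrow> B \<subseteq> bd n m \<Longrightarrow> finite B"
  using scl.independent_span_bound[of "(\<lambda>(i, j). colop (uv i) * emb (Matrix.mat 1 m (\<lambda>(a, b). if b = j then 1 else 0))) ` ({..<n} \<times> {..<m})" B]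
    bd_span[of n m] by auto

text \<open>
  Extend a basis \<open>A\<close> of the kernel to a basis \<open>B\<close> of the space; the
  map is injective on the span of \<open>B - A\<close>, since a vector there that lies in the
  kernel has two disjointly supported expansions.
\<close>

lemma rank_nullity:
  fixes T :: "'k::field lin_op \<Rightarrow> 'k lin_op"
  assumes T: "lin T" and V: "scl.subspace V" "V \<subseteq> bd n m"
  shows "scl.dim V = scl.dim {v \<in> V. T v = 0} + scl.dim (T ` V)"
proof -
  let ?K = "{v \<in> V. T v = 0}"
  obtain A where A: "A \<subseteq> ?K" "scl.independent A" "?K \<subseteq> scl.span A" by (rule scl.maximal_independent_subset)
  obtain B where B: "A \<subseteq> B" "B \<subseteq> V" "scl.independent B" "V \<subseteq> scl.span B"
    by (rule scl.maximal_independent_subset_extend[of A V]) (use A in auto)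
  let ?C = "B - A"
  have iC: "scl.independent ?C" using B(3) scl.independent_mono by blast
  have CV: "scl.span ?C \<subseteq> V" by (rule scl.span_minimal[OF _ V(1)]) (use B in auto)
  interpret T: module_hom scl scl T using T by (rule Vector_Spaces.linear.axioms(3))
  have "x = 0" if x: "x \<in> scl.span ?C" "T x = 0" for x
  proof -
    have xA: "x \<in> scl.span A" using x CV A(3) by auto
    have "scl.representation B x b = 0" for b
    proof (cases "b \<in> A")
      case True
      then have "scl.representation ?C x b = 0" using scl.representation_ne_zero[of ?C x b] by auto
      then show ?thesis using scl.representation_extend[OF B(3) x(1)] by simp
    next
      case False
      then have "scl.representation A x b = 0" using scl.representation_ne_zero[of A x b] by auto
      then show ?thesis using scl.representation_extend[OF B(3) xA B(1)] by simp
    qed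
    moreover have "x \<in> scl.span B" using x(1) CV B(4) by auto
    ultimately show ?thesis using scl.sum_nonzero_representation_eq[OF B(3), of x] by simp
  qed
  then have inj: "inj_on T (scl.span ?C)" by (simp add: T.inj_on_iff_eq_0[OF scl.subspace_span])
  have fB: "finite B" using independent_finite[OF B(3)] B(2) V(2) by blast
  have "T ` V \<subseteq> scl.span (T ` ?C)"
  proof -
    have "T ` B \<subseteq> insert 0 (T ` ?C)" using A(1) by auto
    then have "scl.span (T ` B) \<subseteq> scl.span (T ` ?C)" using scl.span_mono[of "T ` B" "insert 0 (T ` ?C)"] by simp
    moreover have "T ` V \<subseteq> scl.span (T ` B)" unfolding T.span_image using B(4) by (rule image_mono)
    ultimately show ?thesis by blast
  qed
  then have "scl.dim (T ` V) = card (T ` ?C)"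
    by (intro scl.dim_unique[OF _ _ T.independent_injective_image[OF iC inj] refl]) (use B(2) in auto)
  also have "\<dots> = card ?C" by (rule card_image) (rule inj_on_subset[OF inj], simp add: scl.span_superset)
  finally have 1: "scl.dim (T ` V) = card B - card A" using card_Diff_subset[of A B] B(1) fB finite_subset by auto
  have "scl.dim ?K = card A" by (rule scl.dim_unique[OF A(1,3,2) refl])
  moreover have "scl.dim V = card B" by (rule scl.dim_unique[OF B(2,4,3) refl])
  ultimately show ?thesis using 1 card_mono[OF fB B(1)] by simp
qed

lemma dim_0: "scl.dim {0 :: 'k::field lin_op} = 0"
  by (rule scl.dim_unique[OF _ _ scl.independent_empty]) auto

lemma dim_injective:
  assumes "lin T" "scl.subspace V" "V \<subseteq> bd n m" "\<And>v. v \<in> V \<Longrightarrow> T v = 0 \<Longrightarrow> v = 0"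
  shows "scl.dim V = scl.dim (T ` V)"
proof -
  have "{v \<in> V. T v = 0} = {0}" using assms(4) subspaceD(1)[OF assms(2)] lin_simps(3)[OF assms(1)] by auto
  then show ?thesis using rank_nullity[OF assms(1-3)] by (simp add: dim_0)
qed

lemma separating_functional:
  fixes u :: "'k::field lin_op"
  assumes N: "scl.subspace N" and u: "u \<notin> N"
  obtains \<phi> :: "'k lin_op \<Rightarrow> 'k" where "\<And>x y. \<phi> (x + y) = \<phi> x + \<phi> y" "\<And>c x. \<phi> (scl c x) = c * \<phi> x" "\<And>x. x \<in> N \<Longrightarrow> \<phi> x = 0" "\<phi> u = 1"
proof -
  obtain A where A: "A \<subseteq> N" "scl.independent A" "N \<subseteq> scl.span A" by (rule scl.maximal_independent_subset)
  have "scl.span A \<subseteq> N" by (rule scl.span_minimal[OF A(1) N])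
  then have uA: "u \<notin> scl.span A" using u by blast
  have "vector_space_pair (scl :: 'k \<Rightarrow> _) ((*) :: 'k \<Rightarrow> 'k \<Rightarrow> 'k)"
    by (rule vector_space_pair.intro[OF scl_vector_space vector_space_over_itself.vector_space_axioms])
  from vector_space_pair.linear_independent_extend[OF this scl.independent_insertI[OF uA A(2)], of "\<lambda>x. if x = u then 1 else 0"]
  obtain \<phi> :: "'k lin_op \<Rightarrow> 'k" where p: "Vector_Spaces.linear scl (*) \<phi>" "\<forall>x\<in>insert u A. \<phi> x = (if x = u then 1 else 0)" by blast
  have l: "\<phi> (x + y) = \<phi> x + \<phi> y" "\<phi> (scl c x) = c * \<phi> x" for x y c using p(1) by (auto simp: Vector_Spaces.linear_iff)
  have z: "\<phi> 0 = 0" using l(2)[of 0 0] by simp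
  have "scl.subspace {x. \<phi> x = 0}" by (rule subspaceI) (auto simp: l z)
  moreover have "A \<subseteq> {x. \<phi> x = 0}" using p(2) uA by (auto simp: scl.span_base)
  ultimately have "scl.span A \<subseteq> {x. \<phi> x = 0}" by (rule scl.span_minimal[rotated])
  then have "\<phi> x = 0" if "x \<in> N" for x using A(3) that by blast
  moreover have "\<phi> u = 1" using p(2) by simp
  ultimately show ?thesis by (rule that[OF l])
qed

lemma dim_columns: "scl.dim (bd r 1 :: 'k::field lin_op set) = r"
proof -
  let ?B = "(\<lambda>i. colop (uv i) :: 'k lin_op) ` {..<r}"
  have inj: "inj_on (\<lambda>i. colop (uv i) :: 'k lin_op) {..<r}"
    by (rule inj_onI) (auto simp: col_eq_iff uv_def fun_eq_iff split: if_splits)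
  have e: "ap (\<Sum>v\<in>?B. scl (u v) v) (uv 0) i = u (colop (uv i))" if "i < r" for u i
  proof -
    have "ap (\<Sum>v\<in>?B. scl (u v) v) (uv 0) i = (\<Sum>j<r. u (colop (uv j)) * uv j i)"
      by (simp add: sum.reindex[OF inj] ap_sum_op ap_col) (simp add: uv_def)
    then show ?thesis using that by (simp add: uv_def if_distrib[of "\<lambda>x. _ * x"] cong: if_cong)
  qed
  show ?thesis
  proof (rule scl.dim_unique[of ?B])
    show "?B \<subseteq> bd r 1" by (auto intro!: col_bd)
    show "bd r 1 \<subseteq> scl.span ?B"
    proof
      fix w :: "'k lin_op" assume w: "w \<in> bd r 1"
      have "w = (\<Sum>i<r. scl (ap w (uv 0) i) (colop (uv i)))"
      proof (rule bd_eqI[OF w])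
        show "(\<Sum>i<r. scl (ap w (uv 0) i) (colop (uv i))) \<in> bd r 1" by (rule bd_sum) (auto intro!: bd_closed(5) col_bd)
        fix i j :: nat assume "i < r" "j < 1"
        then show "ap w (uv j) i = ap (\<Sum>i<r. scl (ap w (uv 0) i) (colop (uv i))) (uv j) i"
          by (simp add: ap_sum_op ap_col) (simp add: uv_def if_distrib[of "\<lambda>x. _ * x"] cong: if_cong)
      qed
      also have "\<dots> \<in> scl.span ?B" by (intro scl.span_sum scl.span_scale scl.span_base imageI)
      finally show "w \<in> scl.span ?B" .
    qed
    show "scl.independent ?B"
    proof (rule scl.independent_if_scalars_zero)
      fix u and v :: "'k lin_op" assume z: "(\<Sum>v\<in>?B. scl (u v) v) = 0" and "v \<in> ?B"
      then obtain i where i: "i < r" "v = colop (uv i)" by auto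
      then show "u v = 0" using e[of i u] by (simp add: z)
    qed simp
    show "card ?B = r" by (simp add: card_image[OF inj])
  qed
qed

text \<open>
  With a basis \<open>y\<^sub>i\<close> of \<open>Y\<close>, the map \<open>z \<mapsto> (\<beta>
  z y\<^sub>i)\<^sub>i\<close> has the left kernel as its kernel. It is onto: a functional that
  vanishes on its image has as coefficients those of an element of \<open>Y\<close> in the right
  kernel.
\<close>

lemma pairing_dim:
  fixes \<beta> :: "'k::field lin_op \<Rightarrow> 'k lin_op \<Rightarrow> 'k"
  assumes l1: "\<And>x x' y. \<beta> (x + x') y = \<beta> x y + \<beta> x' y" "\<And>c x y. \<beta> (scl c x) y = c * \<beta> x y"
    and l2: "\<And>x y y'. \<beta> x (y + y') = \<beta> x y + \<beta> x y'" "\<And>c x y. \<beta> x (scl c y) = c * \<beta> x y"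
    and Z: "scl.subspace Z" "Z \<subseteq> bd n m" and Y: "scl.subspace Y" "Y \<subseteq> bd n' m'"
    and right: "\<And>y. y \<in> Y \<Longrightarrow> (\<And>z. z \<in> Z \<Longrightarrow> \<beta> z y = 0) \<Longrightarrow> y = 0"
  shows "scl.dim Z = scl.dim {z \<in> Z. \<forall>y\<in>Y. \<beta> z y = 0} + scl.dim Y"
proof -
  obtain A where A: "A \<subseteq> Y" "scl.independent A" "Y \<subseteq> scl.span A" by (rule scl.maximal_independent_subset)
  have fA: "finite A" using independent_finite[OF A(2)] A(1) Y(2) by blast
  then obtain a where a: "bij_betw a {..<card A} A" by (metis bij_betw_iff_card card_lessThan finite_lessThan)
  let ?r = "card A"
  let ?\<Phi> = "\<lambda>z. colop (\<lambda>i. if i < ?r then \<beta> z (a i) else 0)"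
  have lin: "lin ?\<Phi>" by (rule linI) (auto intro!: lin_op_eqI simp: ap_col l1 distrib_left distrib_right)
  have z0: "\<beta> z 0 = 0" for z using l2(2)[of z 0 0] by simp
  have "(\<forall>y\<in>Y. \<beta> z y = 0) \<longleftrightarrow> (\<forall>i<?r. \<beta> z (a i) = 0)" for z
  proof
    assume "\<forall>i<?r. \<beta> z (a i) = 0"
    then have "a ` {..<?r} \<subseteq> {y. \<beta> z y = 0}" by auto
    then have "A \<subseteq> {y. \<beta> z y = 0}" using bij_betw_imp_surj_on[OF a] by simp
    moreover have "scl.subspace {y. \<beta> z y = 0}" by (rule subspaceI) (auto simp: l2 z0)
    ultimately have "scl.span A \<subseteq> {y. \<beta> z y = 0}" by (rule scl.span_minimal)
    then show "\<forall>y\<in>Y. \<beta> z y = 0" using A(3) by auto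
  qed (use a A(1) in \<open>auto simp: bij_betw_def\<close>)
  moreover have "?\<Phi> z = 0 \<longleftrightarrow> (\<forall>i<?r. \<beta> z (a i) = 0)" for z
    unfolding col_zero[symmetric] col_eq_iff fun_eq_iff by auto
  ultimately have K: "{z \<in> Z. ?\<Phi> z = 0} = {z \<in> Z. \<forall>y\<in>Y. \<beta> z y = 0}" by auto
  have "w \<in> ?\<Phi> ` Z" if w: "w \<in> bd ?r 1" for w
  proof (rule ccontr)
    assume "w \<notin> ?\<Phi> ` Z"
    then obtain \<phi> :: "'k lin_op \<Rightarrow> 'k" where p: "\<And>x y. \<phi> (x + y) = \<phi> x + \<phi> y" "\<And>c x. \<phi> (scl c x) = c * \<phi> x" "\<And>x. x \<in> ?\<Phi> ` Z \<Longrightarrow> \<phi> x = 0" "\<phi> w = 1"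
      by (rule separating_functional[OF subspace_image[OF Z(1) lin]]) blast
    have p0: "\<phi> 0 = 0" using p(2)[of 0 0] by simp
    have ps: "\<phi> (\<Sum>i\<in>I. f i) = (\<Sum>i\<in>I. \<phi> (f i))" for f and I :: "nat set"
      by (induction I rule: infinite_finite_induct) (simp_all add: p p0)
    have pc: "\<phi> (colop v) = (\<Sum>i<?r. v i * \<phi> (colop (uv i)))" if v: "v \<in> vsp ?r" for v
    proof -
      have "colop v = (\<Sum>i<?r. scl (v i) (colop (uv i)))"
        by (rule lin_op_eqI, subst (1) vsp_expand[OF v]) (simp add: ap_sum_op ap_col sum_distrib_right mult.assoc)
      then show ?thesis by (simp add: ps p)
    qed
    let ?y = "\<Sum>i<?r. scl (\<phi> (colop (uv i))) (a i)"
    have bs: "\<beta> z (\<Sum>i\<in>I. f i) = (\<Sum>i\<in>I. \<beta> z (f i))" for f z and I :: "nat set"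
      by (induction I rule: infinite_finite_induct) (simp_all add: l2 z0)
    have yY: "?y \<in> Y" by (intro scl.subspace_sum[OF Y(1)] subspaceD(4)[OF Y(1)]) (use a A(1) in \<open>auto simp: bij_betw_def\<close>)
    have "\<beta> z ?y = 0" if z: "z \<in> Z" for z
    proof -
      have "\<beta> z ?y = \<phi> (?\<Phi> z)" by (subst pc) (auto simp: vsp_def bs l2 mult.commute intro!: sum.cong)
      then show ?thesis using p(3)[OF imageI[OF z]] by simp
    qed
    from right[OF yY this] have y0: "?y = 0" .
    have "\<phi> (colop (uv i)) = 0" if i: "i < ?r" for i
    proof -
      let ?ia = "the_inv_into {..<?r} a"
      have "(\<Sum>x\<in>A. scl (\<phi> (colop (uv (?ia x)))) x) = ?y"
        by (rule sum.reindex_bij_betw[OF a, symmetric, THEN trans]) (use a in \<open>auto simp: bij_betw_def the_inv_into_f_f intro!: sum.cong\<close>)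
      then have "\<phi> (colop (uv (?ia (a i)))) = 0"
        using scl.independentD[OF A(2) fA subset_refl, of "\<lambda>x. \<phi> (colop (uv (?ia x)))" "a i"] y0 a i by (auto simp: bij_betw_def)
      then show ?thesis using a i by (auto simp: bij_betw_def the_inv_into_f_f)
    qed
    then have "\<phi> (colop (ap w (uv 0))) = 0" by (subst pc[OF bd_vsp[OF w]]) simp
    then show False using p(4) by (simp add: col_of_bd[OF w])
  qed
  moreover have "?\<Phi> z \<in> bd ?r 1" for z by (rule col_bd) (simp add: vsp_def)
  ultimately have "?\<Phi> ` Z = bd ?r 1" by blast
  moreover have "scl.dim Y = ?r" by (rule scl.dim_unique[OF A(1,3,2) refl])
  ultimately show ?thesis using rank_nullity[OF lin Z] by (simp add: K dim_columns)
qed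

lemma section_ex:
  assumes f: "f \<in> bd n m" and s: "\<And>y. y \<in> bd n 1 \<Longrightarrow> \<exists>x\<in>bd m 1. f * x = (y :: 'k::field lin_op)"
  obtains g where "g \<in> bd m n" "f * g = en n"
proof -
  have "\<forall>i\<in>{..<n}. \<exists>x\<in>bd m 1. f * x = colop (uv i)" by (auto intro!: s col_bd)
  then obtain x where x: "\<And>i. i < n \<Longrightarrow> x i \<in> bd m 1" "\<And>i. i < n \<Longrightarrow> f * x i = colop (uv i)" by (metis lessThan_iff bchoice)
  let ?A = "Matrix.mat m n (\<lambda>(a, i). ap (x i) (uv 0) a)"
  have e: "ap (emb ?A) (uv i) = ap (x i) (uv 0)" if i: "i < n" for i
  proof (rule ext)
    fix a show "ap (emb ?A) (uv i) a = ap (x i) (uv 0) a"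
      using bd_vsp[OF x(1)[OF i], of "uv 0"] i ap_emb_uv[of ?A m n a i] bd_vsp[OF emb_bd[of ?A m n], of "uv i"]
      by (cases "a < m") (auto simp: vsp_def)
  qed
  have "f * emb ?A = en n"
  proof (rule bd_eqI[OF bd_closed(6)[OF f emb_bd[of ?A m n]] en_bd])
    fix i j :: nat assume ij: "i < n" "j < n"
    have "ap f (ap (x j) (uv 0)) = ap (colop (uv j)) (uv 0)" using x(2)[OF ij(2)] by (metis ap_simps(6))
    then show "ap (f * emb ?A) (uv j) i = ap (en n) (uv j) i" using ij by (simp add: e ap_col_uv ap_en)
  qed simp
  then show ?thesis using that[of "emb ?A"] emb_bd[of ?A m n] by simp
qed

text \<open>
  The columns of \<open>U\<close> form a basis of the image of \<open>E\<close>, and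
  \<open>V\<close> expresses the columns of \<open>E\<close> in this basis.
\<close>

lemma split_idempotent:
  "E \<in> bd n n \<Longrightarrow> E * E = (E :: 'k::field lin_op) \<Longrightarrow> \<exists>r. \<exists>U\<in>bd n r. \<exists>V\<in>bd r n. U * V = E \<and> V * U = en r"
proof -
  assume E: "E \<in> bd n n" "E * E = E"
  let ?W = "(\<lambda>x. E * x) ` bd n 1"
  have W: "scl.subspace ?W" by (rule subspace_image[OF subspace_bd lin_left])
  have Wb: "?W \<subseteq> bd n 1" using E by (auto intro: bd_closed)
  obtain B where B: "B \<subseteq> ?W" "scl.independent B" "?W \<subseteq> scl.span B" by (rule scl.maximal_independent_subset)
  have fB: "finite B" using independent_finite[OF B(2)] B(1) Wb by blast
  then obtain b where b: "bij_betw b {..<card B} B" by (metis bij_betw_iff_card card_lessThan finite_lessThan)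
  let ?r = "card B"
  have bW: "b i \<in> ?W" if "i < ?r" for i using b B(1) that by (auto simp: bij_betw_def)
  let ?A = "Matrix.mat n ?r (\<lambda>(a, i). ap (b i) (uv 0) a)"
  have U: "emb ?A \<in> bd n ?r" by (rule emb_bd) simp
  have col: "emb ?A * colop v = (\<Sum>i<?r. scl (v i) (b i))" if v: "v \<in> vsp ?r" for v
  proof (rule bd_eqI[of _ n 1])
    show "emb ?A * colop v \<in> bd n 1" by (rule bd_closed(6)[OF U col_bd[OF v]])
    show "(\<Sum>i<?r. scl (v i) (b i)) \<in> bd n 1" using bW Wb by (intro bd_sum bd_closed(5)) auto
    fix i j :: nat assume "i < n" "j < 1"
    then show "ap (emb ?A * colop v) (uv j) i = ap (\<Sum>i<?r. scl (v i) (b i)) (uv j) i"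
      by (simp add: ap_sum_op ap_emb ap_col) (simp add: uv_def mult.commute)
  qed
  have inj: "w = 0" if w: "w \<in> bd ?r 1" "emb ?A * w = 0" for w
  proof -
    let ?v = "ap w (uv 0)"
    have v: "w = colop ?v" by (simp add: col_of_bd[OF w(1)])
    let ?ib = "the_inv_into {..<?r} b"
    have "(\<Sum>i<?r. scl (?v i) (b i)) = 0" using col[OF bd_vsp[OF w(1)], of "uv 0"] w(2) v by simp
    moreover have "(\<Sum>x\<in>B. scl (?v (?ib x)) x) = (\<Sum>i<?r. scl (?v i) (b i))"
      by (rule sum.reindex_bij_betw[OF b, symmetric, THEN trans]) (use b in \<open>auto simp: bij_betw_def the_inv_into_f_f intro!: sum.cong\<close>)
    ultimately have "?v (?ib (b i)) = 0" if "i < ?r" for i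
      using scl.independentD[OF B(2) fB subset_refl, of "\<lambda>x. ?v (?ib x)" "b i"] b that by (auto simp: bij_betw_def)
    then have "?v i = 0" if "i < ?r" for i using b that by (auto simp: bij_betw_def the_inv_into_f_f)
    then have "?v = (\<lambda>i. 0)" using bd_vsp[OF w(1), of "uv 0"] unfolding vsp_def mem_Collect_eq by (metis not_le)
    then show ?thesis using v col_zero by metis
  qed
  have EU: "E * emb ?A = emb ?A"
  proof (rule bd_eqI[OF bd_closed(6)[OF E(1) U] U])
    fix i j :: nat assume ij: "i < n" "j < ?r"
    have "emb ?A * colop (uv j) = b j" by (subst col[OF uv_vsp[OF ij(2)]]) (use ij in \<open>simp add: uv_def if_distrib[of "\<lambda>c. scl c _"] cong: if_cong\<close>)
    moreover have "E * b j = b j" using bW[OF ij(2)] E(2) by (auto simp: mult.assoc[symmetric])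
    ultimately have "(E * emb ?A) * colop (uv j) = emb ?A * colop (uv j)" by (simp add: mult.assoc)
    then show "ap (E * emb ?A) (uv j) i = ap (emb ?A) (uv j) i" by (simp only: mult_col col_eq_iff)
  qed
  have "\<exists>x\<in>bd ?r 1. emb ?A * x = E * y" if y: "y \<in> bd n 1" for y
  proof -
    have "E * y \<in> scl.span B" using B(3) y by auto
    then obtain u where u: "E * y = (\<Sum>x\<in>B. scl (u x) x)" unfolding scl.span_finite[OF fB] by blast
    let ?v = "\<lambda>i. if i < ?r then u (b i) else 0"
    have v: "?v \<in> vsp ?r" by (simp add: vsp_def)
    have "E * y = (\<Sum>i<?r. scl (u (b i)) (b i))" unfolding u by (rule sum.reindex_bij_betw[OF b, symmetric])
    also have "\<dots> = emb ?A * colop ?v" by (subst col[OF v]) (auto intro!: sum.cong)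
    finally show ?thesis using col_bd[OF v] by auto
  qed
  then have "\<forall>i. \<exists>x\<in>bd ?r 1. i < n \<longrightarrow> emb ?A * x = E * colop (uv i)" by (metis bd_closed(1) col_bd uv_vsp)
  then obtain x where x: "\<And>i. x i \<in> bd ?r 1" "\<And>i. i < n \<Longrightarrow> emb ?A * x i = E * colop (uv i)" by metis
  let ?V = "emb (Matrix.mat ?r n (\<lambda>(a, i). ap (x i) (uv 0) a))"
  have V: "?V \<in> bd ?r n" by (rule emb_bd) simp
  have Vu: "?V * colop (uv i) = x i" if i: "i < n" for i
  proof (rule bd_eqI[OF bd_closed(6)[OF V col_bd[OF uv_vsp[OF i]]] x(1)])
    fix a j :: nat assume "a < ?r" "j < 1"
    then show "ap (?V * colop (uv i)) (uv j) a = ap (x i) (uv j) a"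
      using i by (simp add: ap_emb ap_col) (simp add: uv_def if_distrib[of "\<lambda>x. _ * x"] cong: if_cong)
  qed
  have UV: "emb ?A * ?V = E"
  proof (rule bd_eqI[OF bd_closed(6)[OF U V] E(1)])
    fix i j :: nat assume ij: "i < n" "j < n"
    have "(emb ?A * ?V) * colop (uv j) = E * colop (uv j)" by (simp add: mult.assoc Vu[OF ij(2)] x(2)[OF ij(2)])
    then show "ap (emb ?A * ?V) (uv j) i = ap E (uv j) i" by (simp only: mult_col col_eq_iff)
  qed
  have "?V * emb ?A = en ?r"
  proof (rule bd_eqI[OF bd_closed(6)[OF V U] en_bd])
    fix i j :: nat assume ij: "i < ?r" "j < ?r"
    let ?c = "colop (uv j) :: 'k lin_op"
    have c: "?c \<in> bd ?r 1" by (rule col_bd) (simp add: ij)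
    have "emb ?A * (?V * emb ?A * ?c - en ?r * ?c) = 0"
      by (simp add: right_diff_distrib bdD(1)[OF c] mult.assoc[symmetric] UV EU)
    from inj[OF bd_closed(3)[OF bd_closed(6)[OF bd_closed(6)[OF V U] c] bd_closed(6)[OF en_bd c]] this]
    have "?V * emb ?A * ?c = en ?r * ?c" by simp
    then show "ap (?V * emb ?A) (uv j) i = ap (en ?r) (uv j) i" by (simp only: mult_col col_eq_iff)
  qed
  then show ?thesis using U V UV by blast
qed

text \<open>
  Finitely many powers are linearly dependent; solve a dependence for its lowest power. Positive
  powers are used so that all of them lie in \<open>bd n n\<close>.
\<close>

lemma algebraic_operator:
  assumes F: "F \<in> bd n n"
  obtains a :: nat and u :: "nat \<Rightarrow> 'k::field" and N where "F ^ Suc a = (\<Sum>i\<in>{Suc a<..N}. scl (u i) (F ^ i))"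
proof -
  let ?T = "(\<lambda>(i, j). colop (uv i) * emb (Matrix.mat 1 n (\<lambda>(a, b). if b = j then 1 else 0))) ` ({..<n} \<times> {..<n}) :: 'k lin_op set"
  have pw: "F ^ Suc i \<in> bd n n" for i by (induction i) (use F in \<open>auto intro: bd_closed(6)\<close>)
  let ?S = "(\<lambda>i. F ^ Suc i) ` {..card ?T}"
  have fT: "finite ?T" by auto
  have sp: "?S \<subseteq> scl.span ?T" using pw bd_span[of n n] by blast
  show ?thesis
  proof (cases "inj_on (\<lambda>i. F ^ Suc i) {..card ?T}")
    case False
    then obtain a b where ab: "F ^ Suc a = F ^ Suc b" "a < b" unfolding inj_on_def by (metis linorder_neqE_nat)
    have "F ^ Suc a = (\<Sum>i\<in>{Suc a<..Suc b}. scl (if i = Suc b then 1 else 0) (F ^ i))"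
      using ab by (subst ab(1)) (simp add: if_distrib[of "\<lambda>c. scl c _"] cong: if_cong)
    then show ?thesis by (rule that)
  next
    case True
    have "\<not> scl.independent ?S" using scl.independent_span_bound[OF fT _ sp] card_image[OF True] by auto
    then obtain t u where t: "finite t" "t \<subseteq> ?S" "(\<Sum>v\<in>t. scl (u v) v) = 0" "\<exists>v\<in>t. u v \<noteq> 0" unfolding scl.dependent_explicit by blast
    define c where "c i = (if F ^ i \<in> t then u (F ^ i) else 0)" for i
    let ?M = "card ?T"
    have "(\<Sum>v\<in>t. scl (u v) v) = (\<Sum>v\<in>?S. scl (if v \<in> t then u v else 0) v)"
      by (rule sum.mono_neutral_cong_left) (use t in auto)
    also have "\<dots> = (\<Sum>i\<le>?M. scl (c (Suc i)) (F ^ Suc i))" unfolding c_def by (subst sum.reindex[OF True]) (simp add: o_def del: power_Suc)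
    finally have z: "(\<Sum>i\<le>?M. scl (c (Suc i)) (F ^ Suc i)) = 0" using t(3) by simp
    have "\<exists>i\<le>?M. c (Suc i) \<noteq> 0" using t(2,4) by (force simp: c_def)
    then obtain a where a: "a \<le> ?M" "c (Suc a) \<noteq> 0" and min: "\<And>i. i < a \<Longrightarrow> i \<le> ?M \<Longrightarrow> c (Suc i) = 0"
      using exists_least_iff[of "\<lambda>i. i \<le> ?M \<and> c (Suc i) \<noteq> 0"] by auto
    have "0 = (\<Sum>i\<in>{a..?M}. scl (c (Suc i)) (F ^ Suc i))"
      unfolding z[symmetric] by (rule sum.mono_neutral_right) (use min in force)+
    also have "\<dots> = scl (c (Suc a)) (F ^ Suc a) + (\<Sum>i\<in>{a<..?M}. scl (c (Suc i)) (F ^ Suc i))"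
      using a(1) by (simp add: sum.head)
    finally have "scl (c (Suc a)) (F ^ Suc a) = - (\<Sum>i\<in>{a<..?M}. scl (c (Suc i)) (F ^ Suc i))" by (simp add: eq_neg_iff_add_eq_0)
    then have "scl (inverse (c (Suc a))) (scl (c (Suc a)) (F ^ Suc a)) = scl (inverse (c (Suc a))) (- (\<Sum>i\<in>{a<..?M}. scl (c (Suc i)) (F ^ Suc i)))" by simp
    then have "F ^ Suc a = (\<Sum>i\<in>{a<..?M}. scl (- inverse (c (Suc a)) * c (Suc i)) (F ^ Suc i))"
      using a(2) by (simp add: scl.scale_sum_right sum_negf)
    also have "\<dots> = (\<Sum>i\<in>{Suc a<..Suc ?M}. scl (- inverse (c (Suc a)) * c i) (F ^ i))"
      by (rule sum.reindex_bij_witness[of _ "\<lambda>i. i - 1" Suc]) auto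
    finally show ?thesis by (rule that)
  qed
qed

section \<open>Endomorphisms of an indecomposable module\<close>

lemma image_summand:
  fixes X :: "('n::finite, 'k::field) rmod"
  assumes X: "is_mod Q X" and E: "E \<in> Hm Q X X" "E * E = E"
  obtains A U V where "is_mod Q A" "U \<in> Hm Q A X" "V \<in> Hm Q X A" "U * V = E" "V * U = idm A"
proof -
  obtain r U V where U: "U \<in> bd (mdim X) r" and V: "V \<in> bd r (mdim X)" and UV: "U * V = E" and VU: "V * U = en r"
    using split_idempotent[OF HmD(1)[OF E(1)] E(2)] by blast
  have EU: "E * U = U" using VU bdD(2)[OF U] by (simp add: UV[symmetric] mult.assoc)
  have VE: "V * E = V" using VU bdD(1)[OF V] by (simp add: UV[symmetric] mult.assoc[symmetric])
  have c: "E * rho X x = rho X x * E" if "x \<in> kQ Q" for x using HmD(2)[OF E(1) that] .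
  have Vr: "V * rho X x = V * rho X x * U * V" if "x \<in> kQ Q" for x
  proof -
    have "V * rho X x = V * (E * rho X x)" by (simp add: mult.assoc[symmetric] VE)
    also have "\<dots> = V * rho X x * U * V" by (simp add: c[OF that] UV mult.assoc)
    finally show ?thesis .
  qed
  obtain A where A: "is_mod Q A" "mdim A = r" "\<And>x. x \<in> kQ Q \<Longrightarrow> rho A x = V * rho X x * U"
  proof (rule mk_mod[of Q "\<lambda>x. V * rho X x * U" r])
    fix x y :: "('n, 'k) path_alg" and a assume x: "x \<in> kQ Q" and y: "y \<in> kQ Q"
    show "V * rho X x * U \<in> bd r r" by (rule bd_closed(6)[OF bd_closed(6)[OF V rho_bd[OF X x]] U])
    show "V * rho X (x + y) * U = V * rho X x * U + V * rho X y * U"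
      by (simp add: rho_simps(1)[OF X x y] distrib_left distrib_right)
    show "V * rho X (kQ_smult a x) * U = scl a (V * rho X x * U)"
      by (simp add: rho_simps(2)[OF X x] scl_mult_left scl_mult_right)
    have "V * rho X y * U * (V * rho X x * U) = V * rho X y * U * V * (rho X x * U)" by (simp only: mult.assoc)
    also have "\<dots> = V * rho X y * (rho X x * U)" by (simp only: Vr[OF y, symmetric])
    also have "\<dots> = V * rho X (kQ_mult x y) * U" by (simp only: rho_simps(3)[OF X x y] mult.assoc)
    finally show "V * rho X (kQ_mult x y) * U = V * rho X y * U * (V * rho X x * U)" by simp
  next
    show "V * rho X kQ_one * U = en r" by (simp add: rho_simps(4)[OF X] bdD(2)[OF V] VU)
  qed (blast intro: that)
  have "U * rho A x = rho X x * U" if x: "x \<in> kQ Q" for x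
  proof -
    have "U * rho A x = E * rho X x * U" by (simp add: A(3)[OF x] UV[symmetric] mult.assoc)
    then show ?thesis by (simp add: c[OF x] mult.assoc EU)
  qed
  then have "U \<in> Hm Q A X" using U A(2) by (simp add: Hm_def)
  moreover have "V \<in> Hm Q X A" using V A(2) Vr by (simp add: Hm_def A(3))
  ultimately show ?thesis using that[OF A(1) _ _ UV] VU A(2) by simp
qed

text \<open>
  An idempotent endomorphism and its complement split the module into their images.
\<close>

lemma indecomposable_idempotent:
  fixes X :: "('n::finite, 'k::field) rmod"
  assumes X: "indecomposable_mod Q X" and E: "E \<in> Hm Q X X" "E * E = E"
  shows "E = 0 \<or> E = idm X"
proof -
  have mX: "is_mod Q X" using X by (simp add: indecomposable_mod_def)
  let ?E = "idm X - E"
  have E': "?E \<in> Hm Q X X" "?E * ?E = ?E"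
    using E HmD(3,4)[OF E(1)] Hm_id[OF mX] by (auto intro: Hm_closed simp: algebra_simps)
  obtain A U V where A: "is_mod Q A" "U \<in> Hm Q A X" "V \<in> Hm Q X A" "U * V = E" "V * U = idm A" by (rule image_summand[OF mX E])
  obtain B S T where B: "is_mod Q B" "S \<in> Hm Q B X" "T \<in> Hm Q X B" "S * T = ?E" "T * S = idm B" by (rule image_summand[OF mX E'])
  note s = sum_mod_Hm[OF A(1) B(1)] and mS = is_mod_sum[OF A(1) B(1)]
  let ?f = "i1 A B * V + i2 A B * T" and ?g = "U * p1 A B + S * p2 A B"
  have f: "?f \<in> Hm Q X (sum_mod A B)" and g: "?g \<in> Hm Q (sum_mod A B) X"
    using s A(2,3) B(2,3) by (auto intro!: Hm_closed Hm_comp)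
  have VS: "V * S = 0" and TU: "T * U = 0"
  proof -
    have "V * S = (V * U) * (V * S) * (T * S)" using A(5) B(5) HmD(3)[OF A(3)] HmD(4)[OF B(2)] by (simp add: mult.assoc[symmetric]) (simp add: mult.assoc)
    also have "\<dots> = V * (U * V) * (S * T) * S" by (simp add: mult.assoc)
    also have "\<dots> = V * (E * ?E) * S" unfolding A(4) B(4) by (simp add: mult.assoc)
    also have "E * ?E = 0" using E(2) HmD(4)[OF E(1)] by (simp add: right_diff_distrib)
    finally show "V * S = 0" by simp
    have "T * U = (T * S) * (T * U) * (V * U)" using A(5) B(5) HmD(3)[OF B(3)] HmD(4)[OF A(2)] by (simp add: mult.assoc[symmetric]) (simp add: mult.assoc)
    also have "\<dots> = T * (S * T) * (U * V) * U" by (simp add: mult.assoc)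
    also have "\<dots> = T * (?E * E) * U" unfolding A(4) B(4) by (simp add: mult.assoc)
    also have "?E * E = 0" using E(2) HmD(3)[OF E(1)] by (simp add: left_diff_distrib)
    finally show "T * U = 0" by simp
  qed
  have gf: "?g * ?f = idm X"
    by (simp add: distrib_left distrib_right mult.assoc pr_in_assoc HmD(3)[OF A(3)] HmD(3)[OF B(3)] A(4) B(4))
  have fg: "?f * ?g = idm (sum_mod A B)"
  proof -
    have "?f * ?g = i1 A B * (V * U) * p1 A B + i1 A B * (V * S) * p2 A B + (i2 A B * (T * U) * p1 A B + i2 A B * (T * S) * p2 A B)"
      by (simp add: distrib_left distrib_right mult.assoc)
    also have "\<dots> = i1 A B * p1 A B + i2 A B * p2 A B"
      by (simp add: A(5) B(5) VS TU bdD(2)[OF blocks_bd(1)] bdD(2)[OF blocks_bd(2)])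
    finally show ?thesis by (simp add: pr_in sum_mod_def)
  qed
  note F = Hm_mod_hom[OF mX mS f] and G = Hm_mod_hom[OF mS mX g]
  let ?F = "mt (mdim (sum_mod A B)) (mdim X) ?f" and ?G = "mt (mdim X) (mdim (sum_mod A B)) ?g"
  have "emb (?G * ?F) = emb (1\<^sub>m (mdim X))" "emb (?F * ?G) = emb (1\<^sub>m (mdim (sum_mod A B)))"
    using gf fg by (simp_all only: emb_mult carrier_matD[OF mt_carrier] F(2) G(2) en_def[symmetric])
  then have "?G * ?F = 1\<^sub>m (mdim X)" "?F * ?G = 1\<^sub>m (mdim (sum_mod A B))"
    using emb_inj[OF mult_carrier_mat[OF mt_carrier mt_carrier] one_carrier_mat] by blast+
  then have "mod_iso Q X (sum_mod A B)" unfolding mod_iso_def using F(1) G(1) by blast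
  then have "mdim A = 0 \<or> mdim B = 0" using X A(1) B(1) by (auto simp: indecomposable_mod_def)
  then show ?thesis
  proof
    assume "mdim A = 0"
    then have "U = 0" using HmD(1)[OF A(2)] by simp
    then show ?thesis using A(4) by simp
  next
    assume "mdim B = 0"
    then have "S = 0" using HmD(1)[OF B(2)] by simp
    then show ?thesis using B(4) by simp
  qed
qed

text \<open>
  Fitting's lemma. The lowest power of \<open>F\<close> in a polynomial relation satisfies
  \<open>F\<^sup>m = F\<^sup>m F r\<close> with \<open>r\<close> a polynomial in
  \<open>F\<close>, hence \<open>F\<^sup>m = F\<^sup>2\<^sup>m r\<^sup>m\<close>, and
  \<open>F\<^sup>m r\<^sup>m\<close> is idempotent. If it is \<open>1\<close>, then
  \<open>F\<close> is invertible; if it is \<open>0\<close>, then \<open>F\<close> is nilpotent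
  and the geometric series inverts \<open>1 - F\<close>.
\<close>

lemma local_endomorphisms:
  fixes X :: "('n::finite, 'k::field) rmod"
  assumes X: "indecomposable_mod Q X" and F: "F \<in> Hm Q X X"
  shows "\<exists>G\<in>Hm Q X X. G * F = idm X \<or> G * (idm X - F) = idm X"
proof -
  have mX: "is_mod Q X" using X by (simp add: indecomposable_mod_def)
  note FE = HmD(3,4)[OF F]
  obtain a u N where rel: "F ^ Suc a = (\<Sum>i\<in>{Suc a<..N}. scl (u i) (F ^ i))" by (rule algebraic_operator[OF HmD(1)[OF F]])
  let ?A = "F ^ Suc a"
  define r where "r = (\<Sum>i\<in>{Suc a<..N}. scl (u i) (F ^ (i - Suc (Suc a))))"
  define R where "R = r ^ Suc a"
  have pF: "F ^ i * F = F * F ^ i" for i by (simp add: power_commutes)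
  have rF: "r * F = F * r" by (simp add: r_def sum_distrib_left sum_distrib_right scl_mult_left scl_mult_right pF)
  have rp: "r ^ i * F = F * r ^ i" for i by (rule power_commuting_commutes[OF rF])
  have rr: "r ^ i * F ^ j = F ^ j * r ^ i" for i j by (rule power_commuting_commutes[OF rp[symmetric], symmetric])
  have Fi: "?A * (F * F ^ (i - Suc (Suc a))) = F ^ i" if ia: "Suc a < i" for i
  proof -
    obtain d where "i = Suc (Suc a + d)" using less_imp_Suc_add[OF ia] by auto
    moreover have "F ^ a * (F * h) = F * (F ^ a * h)" for h by (simp add: mult.assoc[symmetric] pF)
    ultimately show ?thesis by (simp add: power_add mult.assoc)
  qed
  have AFr: "?A * (F * r) = ?A"
  proof -
    have "?A * (F * r) = (\<Sum>i\<in>{Suc a<..N}. scl (u i) (F ^ i))"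
      unfolding r_def by (auto simp: sum_distrib_left scl_mult_right Fi simp del: power_Suc intro!: sum.cong)
    then show ?thesis using rel by simp
  qed
  have Ak: "?A * (F ^ k * r ^ k) = ?A" for k
  proof (induction k)
    case (Suc k)
    have "?A * (F ^ Suc k * r ^ Suc k) = ?A * (F ^ k * (F * r ^ k) * r)" by (simp only: power_Suc2 mult.assoc)
    also have "\<dots> = ?A * (F ^ k * r ^ k) * (F * r)" by (simp only: rp[symmetric] mult.assoc)
    finally show ?case by (simp only: Suc AFr)
  qed simp
  have AAR: "?A * (?A * R) = ?A" using Ak[of "Suc a"] by (simp only: R_def)
  have RA: "R * ?A = ?A * R" by (simp only: R_def rr)
  let ?E = "?A * R"
  have closed: "F ^ i * h \<in> Hm Q X X" if "h \<in> Hm Q X X" for h i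
    by (induction i) (simp_all add: that mult.assoc Hm_comp[OF F])
  have rc: "r ^ i * h \<in> Hm Q X X" if h: "h \<in> Hm Q X X" for h i
  proof (induction i)
    case (Suc i)
    have "r ^ Suc i * h = (\<Sum>j\<in>{Suc a<..N}. scl (u j) (F ^ (j - Suc (Suc a)) * (r ^ i * h)))"
      by (simp add: mult.assoc) (subst (1) r_def, simp add: sum_distrib_right scl_mult_left)
    also have "\<dots> \<in> Hm Q X X" by (intro Hm_sum Hm_closed closed Suc)
    finally show ?case .
  qed (simp add: h)
  have A: "?A \<in> Hm Q X X" using closed[OF F, of a] by (simp only: power_Suc2)
  have E: "?E \<in> Hm Q X X" using rc[OF A, of "Suc a"] unfolding R_def[symmetric] RA .
  have "?E * ?E = ?A * (R * ?A) * R" by (simp only: mult.assoc)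
  also have "\<dots> = ?A * (?A * R) * R" by (simp only: RA)
  finally have "?E * ?E = ?E" by (simp only: AAR)
  from indecomposable_idempotent[OF X E this] show ?thesis
  proof
    assume "?E = 0"
    then have A0: "?A = 0" using AAR by simp
    let ?G = "(\<Sum>i<Suc a. F ^ i) * idm X"
    have tel: "(\<Sum>i<k. F ^ i) * (1 - F) = 1 - F ^ k" for k
    proof (induction k)
      case (Suc k)
      have "(\<Sum>i<Suc k. F ^ i) * (1 - F) = (\<Sum>i<k. F ^ i) * (1 - F) + F ^ k * (1 - F)" by (simp add: distrib_right)
      also have "\<dots> = 1 - F ^ k + (F ^ k - F * F ^ k)" by (simp only: Suc right_diff_distrib[of "F ^ k"] pF mult_1_right)
      finally show ?case by simp
    qed simp
    have "idm X - F = (1 - F) * idm X" using FE by (simp add: left_diff_distrib)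
    then have "?G * (idm X - F) = (\<Sum>i<Suc a. F ^ i) * (1 - F) * idm X"
      using FE by (simp add: mult.assoc right_diff_distrib left_diff_distrib)
    also have "\<dots> = idm X" unfolding tel A0 by simp
    finally have "?G * (idm X - F) = idm X" .
    moreover have "?G \<in> Hm Q X X" unfolding sum_distrib_right by (intro Hm_sum closed Hm_id mX)
    ultimately show ?thesis by blast
  next
    assume e: "?E = idm X"
    let ?G = "F ^ a * (R * idm X)"
    have "?G * F = F ^ a * (R * F)" using FE by (simp add: mult.assoc)
    also have "R * F = F * R" unfolding R_def by (rule rp)
    also have "F ^ a * (F * R) = ?E" by (simp only: power_Suc2 mult.assoc)
    finally have "?G * F = idm X" using e by simp
    moreover have "?G \<in> Hm Q X X" unfolding R_def by (intro closed rc Hm_id mX)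
    ultimately show ?thesis by blast
  qed
qed

section \<open>Dimensions of homomorphism spaces\<close>

text \<open>
  By Yoneda the space is the image of the vertex idempotent, whose rank is its trace.
\<close>

lemma dim_hom_from_proj:
  fixes M :: "('n::finite, 'k::field) rmod"
  assumes Q: "acyclic_quiver Q" and M: "is_mod Q M"
  shows "of_nat (scl.dim (Hm Q (proj_mod Q j) M)) = tdim j M"
proof -
  let ?E = "rho M (vtx j)" and ?n = "mdim M" and ?P = "proj_mod Q j :: ('n, 'k) rmod"
  let ?g = "colop (gen Q j) :: 'k lin_op"
  have "?E * ?E = rho M (kQ_mult (vtx j) (vtx j))" by (simp add: rho_simps(3)[OF M])
  then have EE: "?E * ?E = ?E" by (simp add: vtx_mult path_source_def)
  obtain r U V where U: "U \<in> bd ?n r" and V: "V \<in> bd r ?n" and UV: "U * V = ?E" and VU: "V * U = en r"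
    using split_idempotent[OF rho_bd[OF M vtx_closed] EE] by blast
  have "tdim j M = of_nat r" using trc_cyclic[OF U V] by (simp add: tdim_def UV VU trc_simps)
  moreover have "scl.dim (Hm Q ?P M) = r"
  proof -
    let ?T = "\<lambda>f. V * f * ?g"
    have T: "lin ?T" by (rule linI) (simp_all add: distrib_left distrib_right scl_mult_left scl_mult_right)
    have "f = 0" if f: "f \<in> Hm Q ?P M" and z: "?T f = 0" for f
    proof -
      have "U * V * (f * ?g) = 0" using z by (simp add: mult.assoc)
      moreover have "?E * (f * ?g) = f * (rho ?P (vtx j) * ?g)" using HmD(2)[OF f, of "vtx j"] by (simp add: mult.assoc[symmetric])
      ultimately have "f * ?g = 0" by (simp add: UV mult_col vtx_gen[OF Q])
      then have "ap f (gen Q j) = (\<lambda>i. 0)" by (simp add: mult_col col_zero[symmetric] col_eq_iff)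
      then show ?thesis by (intro proj_hom_eq[OF Q f Hm_closed(1)]) simp
    qed
    then have "scl.dim (Hm Q ?P M) = scl.dim (?T ` Hm Q ?P M)"
      by (intro dim_injective[OF T subspace_Hm, of _ _ _ "mdim M" "mdim ?P"]) (auto dest: HmD(1))
    also have "?T ` Hm Q ?P M = bd r 1"
    proof
      show "?T ` Hm Q ?P M \<subseteq> bd r 1" using V gen_vs by (auto intro!: bd_closed(6) col_bd dest!: HmD(1))
      show "bd r 1 \<subseteq> ?T ` Hm Q ?P M"
      proof
        fix w :: "'k lin_op" assume w: "w \<in> bd r 1"
        note Uw = bd_closed(6)[OF U w]
        have "?E * (U * w) = U * (V * U) * w" by (simp add: UV[symmetric] mult.assoc)
        also have "\<dots> = U * w" by (simp add: VU bdD(2)[OF U])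
        finally have e: "ap ?E (ap (U * w) (uv 0)) = ap (U * w) (uv 0)" by (metis ap_simps(6))
        obtain f where f: "f \<in> Hm Q ?P M" "ap f (gen Q j) = ap (U * w) (uv 0)"
          by (rule proj_hom_ex[OF Q M bd_vsp[OF Uw] e]) (blast intro: that)
        have "?T f = V * (U * w)" by (simp only: mult.assoc mult_col[of f] f(2) col_of_bd[OF Uw])
        also have "\<dots> = w" using VU bdD(1)[OF w] by (simp add: mult.assoc[symmetric])
        finally show "w \<in> ?T ` Hm Q ?P M" using f(1) by force
      qed
    qed
    finally show ?thesis by (simp add: dim_columns)
  qed
  ultimately show ?thesis by simp
qed

lemma additive_dim_hom:
  fixes L :: "('n::finite, 'k::field) rmod"
  shows "additive_on Q (\<lambda>M. int (scl.dim (Hm Q M L)))"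
proof -
  have z: "scl.dim (Hm Q M L) = 0" if "mdim M = 0" for M :: "('n, 'k) rmod"
  proof -
    have "Hm Q M L = {0}" using that by (auto dest!: HmD(1) intro: Hm_closed(1))
    then show ?thesis by (simp add: dim_0)
  qed
  have "scl.dim (Hm Q (sum_mod M N) L) = scl.dim (Hm Q M L) + scl.dim (Hm Q N L)" if M: "is_mod Q M" and N: "is_mod Q N" for M N :: "('n, 'k) rmod"
  proof -
    note s = sum_mod_Hm[OF M N]
    let ?S = "sum_mod M N"
    let ?K = "{f \<in> Hm Q ?S L. f * i1 M N = 0}"
    have SL: "Hm Q ?S L \<subseteq> bd (mdim L) (mdim ?S)" by (auto dest: HmD(1))
    have 1: "(\<lambda>f. f * i1 M N) ` Hm Q ?S L = Hm Q M L"
    proof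
      show "Hm Q M L \<subseteq> (\<lambda>f. f * i1 M N) ` Hm Q ?S L"
      proof
        fix g assume g: "g \<in> Hm Q M L"
        show "g \<in> (\<lambda>f. f * i1 M N) ` Hm Q ?S L"
          by (rule image_eqI[OF _ Hm_comp[OF g s(3)]]) (simp add: mult.assoc pr_in HmD(4)[OF g])
      qed
    qed (auto intro: Hm_comp s)
    have 2: "(\<lambda>f. f * i2 M N) ` ?K = Hm Q N L"
    proof
      show "Hm Q N L \<subseteq> (\<lambda>f. f * i2 M N) ` ?K"
      proof
        fix g assume g: "g \<in> Hm Q N L"
        show "g \<in> (\<lambda>f. f * i2 M N) ` ?K"
          by (rule image_eqI[of _ _ "g * p2 M N"]) (simp_all add: mult.assoc pr_in HmD(4)[OF g] Hm_comp[OF g s(4)])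
      qed
    qed (auto intro: Hm_comp s)
    have "scl.dim ?K = scl.dim ((\<lambda>f. f * i2 M N) ` ?K)"
    proof (rule dim_injective[OF lin_right subspace_kernel[OF subspace_Hm lin_right], of _ _ _ _ "mdim L" "mdim ?S"])
      fix f assume f: "f \<in> ?K" "f * i2 M N = 0"
      have "f = f * (i1 M N * p1 M N + i2 M N * p2 M N)" using f(1) HmD(4)[of f Q ?S L] by (simp add: pr_in sum_mod_def)
      also have "\<dots> = 0" using f by (simp add: distrib_left mult.assoc[symmetric])
      finally show "f = 0" .
    qed (use SL in auto)
    then show ?thesis using rank_nullity[OF lin_right[of "i1 M N"] subspace_Hm SL] by (simp only: 1 2)
  qed
  then show ?thesis by (simp add: additive_on_def z)
qed

lemma dim_hom_proj_proj:
  fixes Q :: "'n::finite quiver"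
  assumes Q: "acyclic_quiver Q"
  shows "scl.dim (Hm Q (proj_mod Q i) (proj_mod Q j :: ('n, 'k::field_char_0) rmod)) = npaths Q i j"
proof -
  have "of_nat (scl.dim (Hm Q (proj_mod Q i) (proj_mod Q j :: ('n, 'k) rmod))) = (of_nat (npaths Q i j) :: 'k)"
    by (simp add: dim_hom_from_proj[OF Q is_mod_proj[OF Q]] tdim_proj[OF Q])
  then show ?thesis by (simp only: of_nat_eq_iff)
qed

section \<open>Almost vanishing morphisms\<close>

text \<open>
  Maps into complexes with one term: a chain map to the module \<open>M\<close> in degree
  \<open>a\<close> is a homomorphism that kills the incoming boundaries, and it is
  null-homotopic if it factors through the outgoing differential. Thus the cohomology of the
  complex of homomorphisms from \<open>S\<close> to \<open>M\<close> consists of homotopy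
  classes of maps from \<open>S\<close> to shifts of \<open>M\<close>.
\<close>

lemma ob_at: "ob (stalk_at a M) n = (if n = a then M else zero_mod)" and D_at [simp]: "D (stalk_at a M) n = 0"
  by (simp_all add: stalk_at_def)

lemma proj_at:
  assumes "exproj Q P"
  shows "proj_cpx Q (stalk_at a P)"
proof -
  have P: "is_mod Q P" using assms by (simp add: exproj_def)
  have "bounded_cpx Q (stalk_at a P)"
  proof (rule cpxI)
    show "finite {n. cdim (stalk_at a P) n \<noteq> 0}" by (rule finite_subset[of _ "{a}"]) (auto simp: ob_at zero_mod_def)
  qed (auto simp: stalk_at_def is_mod_zero P Hm_closed)
  then show ?thesis using assms by (simp add: proj_cpx_def ob_at exproj_zero)
qed

lemma CM_at:
  assumes "h \<in> CM Q S (stalk_at a M)"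
  shows "n \<noteq> a \<Longrightarrow> h n = 0" "h a \<in> Hm Q (ob S a) M" "h a * D S (a - 1) = 0"
proof -
  show "h n = 0" if "n \<noteq> a" using CM_D(1)[OF assms, of n] that by (simp add: ob_at Hm_zero_right)
  show "h a \<in> Hm Q (ob S a) M" using CM_D(1)[OF assms, of a] by (simp add: ob_at)
  show "h a * D S (a - 1) = 0" using CM_D(2)[OF assms, of "a - 1"] by simp
qed

lemma CM_atI:
  assumes "f \<in> Hm Q (ob S a) M" "f * D S (a - 1) = 0"
  shows "(\<lambda>n. if n = a then f else 0) \<in> CM Q S (stalk_at a M)"
  using assms by (auto simp: CM_def ob_at Hm_zero_right dest: arg_cong[of _ a "\<lambda>m. D S (m - 1)"])

lemma null_at:
  assumes h: "h \<in> CM Q S (stalk_at a M)"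
  shows "null Q S (stalk_at a M) h \<longleftrightarrow> h a \<in> (\<lambda>b. b * D S a) ` Hm Q (ob S (a + 1)) M"
proof
  assume "null Q S (stalk_at a M) h"
  then obtain k where k: "\<And>n. k n \<in> Hm Q (ob S n) (ob (stalk_at a M) (n - 1))" "\<And>n. h n = D (stalk_at a M) (n - 1) * k n + k (n + 1) * D S n"
    by (auto simp: null_def)
  then show "h a \<in> (\<lambda>b. b * D S a) ` Hm Q (ob S (a + 1)) M" using k(1)[of "a + 1"] k(2)[of a] by (simp add: ob_at)
next
  assume "h a \<in> (\<lambda>b. b * D S a) ` Hm Q (ob S (a + 1)) M"
  then obtain b where b: "b \<in> Hm Q (ob S (a + 1)) M" "h a = b * D S a" by blast
  let ?k = "\<lambda>n. if n = a + 1 then b else 0"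
  have "?k n \<in> Hm Q (ob S n) (ob (stalk_at a M) (n - 1))" for n using b(1) by (auto simp: ob_at Hm_closed)
  moreover have "h n = D (stalk_at a M) (n - 1) * ?k n + ?k (n + 1) * D S n" for n
    using b(2) CM_at(1)[OF h, of n] by simp
  ultimately show "null Q S (stalk_at a M) h" unfolding null_def by (intro exI[of _ ?k] allI conjI)
qed

lemma bd_eq_cols:
  assumes "f \<in> bd n m" "g \<in> bd n m" "\<And>x. x \<in> bd m 1 \<Longrightarrow> f * x = g * x"
  shows "f = g"
proof (rule bd_eqI[OF assms(1,2)])
  fix i j assume "i < n" "j < m"
  then have "f * colop (uv j) = g * colop (uv j)" by (intro assms(3) col_bd) simp
  then show "ap f (uv j) i = ap g (uv j) i" by (simp add: mult_col col_eq_iff)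
qed

text \<open>
  Two consecutive maps of a triangle compose to zero; the homotopies are the structure maps of
  the cone.
\<close>

lemma null_cone_left:
  assumes X: "bounded_cpx Q X" and Y: "bounded_cpx Q Y" and f: "f \<in> CM Q X Y"
  shows "null Q X (cn X Y f) (\<lambda>n. cb X Y n * f n)"
  unfolding null_def
proof (intro exI[of _ "\<lambda>n. in1 (cdim X n) (cdim Y (n - 1))"] allI conjI)
  fix n
  show "in1 (cdim X n) (cdim Y (n - 1)) \<in> Hm Q (ob X n) (ob (cn X Y f) (n - 1))" using cone_Hm(1)[OF X Y, of "n - 1"] by simp
  have "D (cn X Y f) (n - 1) * in1 (cdim X n) (cdim Y (n - 1)) = cb X Y n * f n - ca X Y n * D X n"
    using D_cn[OF X Y f, of "n - 1"] HmD(4)[OF CM_D(1)[OF f, of n]] HmD(4)[OF cpxD(2)[OF X, of n]]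
    by (simp add: distrib_right left_diff_distrib mult.assoc pr_in)
  then show "cb X Y n * f n = D (cn X Y f) (n - 1) * in1 (cdim X n) (cdim Y (n - 1)) + in1 (cdim X (n + 1)) (cdim Y (n + 1 - 1)) * D X n"
    by simp
qed

lemma null_cone_right:
  assumes X: "bounded_cpx Q X" and Y: "bounded_cpx Q Y" and f: "f \<in> CM Q X Y"
  shows "null Q (ush (cn X Y f)) Y (\<lambda>n. f n * pr1 (cdim X n) (cdim Y (n - 1)))"
  unfolding null_def
proof (intro exI[of _ "\<lambda>n. - pr2 (cdim X n) (cdim Y (n - 1))"] allI conjI)
  fix n
  show "- pr2 (cdim X n) (cdim Y (n - 1)) \<in> Hm Q (ob (ush (cn X Y f)) n) (ob Y (n - 1))"
    using cone_Hm(4)[OF X Y, of "n - 1"] by (simp add: Hm_closed)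
  have "pr2 (cdim X (n + 1)) (cdim Y n) * D (cn X Y f) (n - 1) = f n * pr1 (cdim X n) (cdim Y (n - 1)) + D Y (n - 1) * pr2 (cdim X n) (cdim Y (n - 1))"
    using D_cn[OF X Y f, of "n - 1"] HmD(3)[OF CM_D(1)[OF f, of n]] HmD(3)[OF cpxD(3)[OF Y, of n]]
    by (simp add: distrib_left right_diff_distrib mult.assoc pr_in_assoc) (simp add: mult.assoc[symmetric])
  then show "f n * pr1 (cdim X n) (cdim Y (n - 1)) = D Y (n - 1) * - pr2 (cdim X n) (cdim Y (n - 1)) + - pr2 (cdim X (n + 1)) (cdim Y (n + 1 - 1)) * D (ush (cn X Y f)) n"
    by (simp add: D_ush)
qed

text \<open>
  A resolution in nonpositive degrees presents \<open>X\<close> as the cokernel of its last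
  differential.
\<close>

lemma resolution_factor:
  fixes X :: "('n::finite, 'k::field) rmod"
  assumes R: "bounded_cpx Q R" and X: "is_mod Q X" and e: "qis Q R (stalk X) e" and R0: "nonpos R"
    and t: "t \<in> Hm Q (ob R 0) X" "t * D R (- 1) = 0"
  obtains F where "F \<in> Hm Q X X" "F * e 0 = t"
proof -
  have e0: "e 0 \<in> Hm Q (ob R 0) X" using CM_D(1)[OF qis_CM[OF e], of 0] by (simp add: ob_stalk)
  have "\<exists>x\<in>bd (cdim R 0) 1. e 0 * x = y" if y: "y \<in> bd (mdim X) 1" for y
  proof -
    obtain x' y' where x: "x' \<in> bd (cdim R 0) 1" "y = e 0 * x' + D (stalk X) (0 - 1) * y'"
      by (rule qisD[OF e, of 0 0 y]) (use y in \<open>auto simp: bd_closed ob_stalk\<close>)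
    then show ?thesis by auto
  qed
  then obtain s where s: "s \<in> bd (cdim R 0) (mdim X)" "e 0 * s = idm X" by (rule section_ex[OF HmD(1)[OF e0]])
  have z: "t * x = 0" if x: "x \<in> bd (cdim R 0) 1" "e 0 * x = 0" for x
  proof -
    have "D R 0 = 0" using HmD(1)[OF cpxD(2)[OF R, of 0]] R0 by (simp add: nonpos_def)
    moreover obtain x' where "x = - (D R (- 1) * x')"
      by (rule qisD[OF e, of x "- 1" 0]) (use x calculation in \<open>auto simp: bd_closed\<close>)
    ultimately show ?thesis by (simp add: mult.assoc[symmetric] t(2))
  qed
  have Fb: "t * s \<in> bd (mdim X) (mdim X)" by (rule bd_closed(6)[OF HmD(1)[OF t(1)] s(1)])
  have Fe: "t * s * e 0 = t"
  proof (rule bd_eq_cols[OF bd_closed(6)[OF Fb HmD(1)[OF e0]] HmD(1)[OF t(1)]])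
    fix x :: "'k lin_op" assume x: "x \<in> bd (cdim R 0) 1"
    note ex = bd_closed(6)[OF HmD(1)[OF e0] x]
    have "e 0 * (s * (e 0 * x) - x) = 0" using bdD(1)[OF ex] by (simp add: right_diff_distrib mult.assoc[symmetric] s(2))
    from z[OF bd_closed(3)[OF bd_closed(6)[OF s(1) ex] x] this] show "t * s * e 0 * x = t * x"
      by (simp add: right_diff_distrib mult.assoc)
  qed
  have "t * s * rho X x = rho X x * (t * s)" if x: "x \<in> kQ Q" for x
  proof -
    have "t * s * rho X x = t * s * (rho X x * e 0) * s" using bdD(2)[OF rho_bd[OF X x]] by (simp add: mult.assoc s(2))
    also have "\<dots> = t * s * e 0 * rho (ob R 0) x * s" by (simp add: HmD(2)[OF e0 x, symmetric] mult.assoc)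
    also have "\<dots> = rho X x * (t * s)" unfolding Fe HmD(2)[OF t(1) x] by (simp only: mult.assoc)
    finally show ?thesis .
  qed
  then have "t * s \<in> Hm Q X X" using Fb by (simp add: Hm_def)
  then show ?thesis using that Fe by blast
qed

text \<open>
  The abstract property of the connecting morphism of an Auslander-Reiten triangle that is used;
  \<open>S\<close> stands for a resolution of \<open>\<tau>\<^sup>-\<^sup>1 X[-1]\<close>.
\<close>

locale almost_vanishing = acyclic Q for Q :: "'n::finite quiver" +
  fixes S :: "('n, 'k::field_char_0) cpx" and X :: "('n, 'k) rmod" and w :: "int \<Rightarrow> 'k lin_op"
  assumes S: "proj_cpx Q S" and X: "indecomposable_mod Q X" and w: "w \<in> CM Q S (stalk X)" and w_nz: "\<not> null Q S (stalk X) w"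
    and kills: "\<And>C p. proj_cpx Q C \<Longrightarrow> p \<in> CM Q C S \<Longrightarrow>
      (\<exists>s\<in>CM Q S C. null Q S S (\<lambda>n. p n * s n - idm (ob S n))) \<or> null Q C (stalk X) (\<lambda>n. w n * p n)"
begin

lemma mX: "is_mod Q X" using X by (simp add: indecomposable_mod_def)

lemma Sb: "bounded_cpx Q S" by (rule proj_cpxD(1)[OF S])

text \<open>
  The projection to \<open>S\<close> of the homotopy fibre \<open>K[-1]\<close> of
  \<open>h\<close> is killed by \<open>h\<close>. It is not a retraction, or else
  \<open>h\<close> would be null-homotopic; so \<open>w\<close> kills it and factors through
  \<open>h\<close>. The factor \<open>t\<close> is a component of the null-homotopy, up to sign.
\<close>

lemma factors:
  assumes W: "proj_cpx Q W" and h: "h \<in> CM Q S W" and nz: "\<not> null Q S W h"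
  obtains t where "t \<in> CM Q W (stalk X)" "null Q S (stalk X) (\<lambda>n. t n * h n - w n)"
proof -
  note Wb = proj_cpxD(1)[OF W]
  let ?K = "cn S W h" and ?p = "\<lambda>n. pr1 (cdim S n) (cdim W (n - 1))"
  have K: "proj_cpx Q (ush ?K)" by (rule proj_ush[OF proj_cn[OF S W h]])
  have p: "?p \<in> CM Q (ush ?K) S" using CM_ush[OF cp_CM[OF Sb Wb mts_emb(1)[OF Sb Wb h]]] by (simp add: ush_shift)
  have "\<not> (\<exists>s\<in>CM Q S (ush ?K). null Q S S (\<lambda>n. ?p n * s n - idm (ob S n)))"
  proof
    assume "\<exists>s\<in>CM Q S (ush ?K). null Q S S (\<lambda>n. ?p n * s n - idm (ob S n))"
    then obtain s where s: "s \<in> CM Q S (ush ?K)" "null Q S S (\<lambda>n. ?p n * s n - idm (ob S n))" by blast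
    have "null Q S W (\<lambda>n. h n * ?p n * s n)" by (rule null_right[OF null_cone_right[OF Sb Wb h] s(1)])
    moreover have "null Q S W (\<lambda>n. h n * (?p n * s n - idm (ob S n)))" by (rule null_left[OF h s(2)])
    ultimately have "null Q S W (\<lambda>n. h n * ?p n * s n - h n * (?p n * s n - idm (ob S n)))" by (rule null_diff)
    then show False using nz by (simp add: right_diff_distrib mult.assoc CM_idm(2)[OF h])
  qed
  then have "null Q (ush ?K) (stalk X) (\<lambda>n. w n * ?p n)" using kills[OF K p] by blast
  then obtain k where k: "\<And>n. k n \<in> Hm Q (ob (ush ?K) n) (ob (stalk X) (n - 1))" "\<And>n. w n * ?p n = k (n + 1) * - D ?K (n - 1)"
    unfolding null_def by (auto simp: D_ush)
  have k1: "k (n + 1) \<in> Hm Q (sum_mod (ob S (n + 1)) (ob W n)) (ob (stalk X) n)" for n using k(1)[of "n + 1"] by simp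
  let ?a = "\<lambda>n. in1 (cdim S n) (cdim W (n - 1)) :: 'k lin_op" and ?b = "\<lambda>n. in2 (cdim S n) (cdim W (n - 1)) :: 'k lin_op"
  have Db: "D ?K (n - 1) * ?b n = ?b (n + 1) * D W (n - 1)" for n
    using D_cn[OF Sb Wb h, of "n - 1"] HmD(4)[OF cpxD(3)[OF Wb, of n]]
    by (simp add: distrib_right left_diff_distrib mult.assoc pr_in)
  have Da: "D ?K (n - 1) * ?a n = ?b (n + 1) * h n - ?a (n + 1) * D S n" for n
    using D_cn[OF Sb Wb h, of "n - 1"] HmD(4)[OF CM_D(1)[OF h, of n]] HmD(4)[OF cpxD(2)[OF Sb, of n]]
    by (simp add: distrib_right left_diff_distrib mult.assoc pr_in)
  define t where "t n = - (k (n + 1) * ?b (n + 1))" for n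
  have tD: "t n * D W (n - 1) = 0" for n
  proof -
    have "t n * D W (n - 1) = w n * ?p n * ?b n" by (simp only: k(2) t_def mult.assoc mult_minus_left mult_minus_right Db)
    then show ?thesis by (simp add: mult.assoc pr_in)
  qed
  have "t n \<in> Hm Q (ob W n) (ob (stalk X) n)" for n
    unfolding t_def using Hm_comp[OF k1 cone_Hm(2)[OF Sb Wb, of n]] by (simp add: Hm_closed)
  then have "t \<in> CM Q W (stalk X)" using tD[of "n + 1" for n] by (simp add: CM_def)
  moreover have "null Q S (stalk X) (\<lambda>n. w n - t n * h n)"
    unfolding null_def
  proof (intro exI[of _ "\<lambda>n. k n * in1 (cdim S n) (cdim W (n - 1))"] allI conjI)
    fix n
    show "k n * ?a n \<in> Hm Q (ob S n) (ob (stalk X) (n - 1))"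
      using Hm_comp[OF k1[of "n - 1"] cone_Hm(1)[OF Sb Wb, of "n - 1"]] by simp
    have "w n = w n * ?p n * ?a n" using HmD(4)[OF CM_D(1)[OF w, of n]] by (simp add: mult.assoc pr_in)
    also have "\<dots> = t n * h n + k (n + 1) * ?a (n + 1) * D S n"
      by (simp only: k(2) t_def mult.assoc mult_minus_left mult_minus_right Da right_diff_distrib) simp
    finally show "w n - t n * h n = D (stalk X) (n - 1) * (k n * ?a n) + k (n + 1) * ?a (n + 1) * D S n" by simp
  qed
  ultimately show ?thesis by (intro that[of t] null_sym[of _ _ _ w])
qed

text \<open>
  If \<open>w\<close> does not factor through \<open>f\<close>, its image in the cone of
  \<open>f\<close> is a nonzero map out of \<open>S\<close>, and by \<open>factors\<close> some
  map \<open>t\<close> from the cone to \<open>X\<close> carries it back to \<open>w\<close>.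
  The composite of \<open>X\<close> into the cone with \<open>t\<close> is an endomorphism
  \<open>F\<close> of \<open>X\<close> with \<open>F f = 0\<close> and \<open>(1 - F) w =
  0\<close>; one of \<open>F\<close> and \<open>1 - F\<close> has a left inverse, so \<open>f =
  0\<close> or \<open>w = 0\<close>. To stay within complexes of projectives, \<open>X\<close>
  is replaced by a resolution \<open>R\<close>.
\<close>

lemma factors_from:
  assumes f: "f \<in> Hm Q (proj_mod Q j) X" "f \<noteq> 0"
  obtains h where "h \<in> CM Q S (stalk (proj_mod Q j))" "null Q S (stalk X) (\<lambda>n. st f n * h n - w n)"
proof -
  let ?P = "stalk (proj_mod Q j) :: ('n, 'k) cpx"
  have P: "proj_cpx Q ?P" by (rule perf_proj[OF perf_stalk Q])
  note Pb = proj_cpxD(1)[OF P] and Xb = bounded_stalk[OF mX]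
  obtain R g e where R: "perf Q R g" "qis Q R (stalk X) e" "nonpos R" using module_resolution[OF Q mX] by (auto simp: mod_resolution_def)
  note Rp = perf_proj[OF R(1) Q] note Rb = proj_cpxD(1)[OF Rp] and eC = qis_CM[OF R(2)]
  obtain f' where f': "f' \<in> CM Q ?P R" "null Q ?P (stalk X) (\<lambda>n. e n * f' n - st f n)" by (rule lift_ex[OF P Rb Xb R(2) CM_stalk[OF f(1)]])
  \<comment> \<open>Both \<open>f\<close> and \<open>w\<close> are lifted to the resolution of \<open>X\<close>.\<close>
  obtain w' where w': "w' \<in> CM Q S R" "null Q S (stalk X) (\<lambda>n. e n * w' n - w n)" by (rule lift_ex[OF S Rb Xb R(2) w])
  let ?q = "\<lambda>n. cb ?P R n"
  have q: "?q \<in> CM Q R (cn ?P R f')" by (rule cb_CM[OF Pb Rb f'(1)])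
  have "null Q S (cn ?P R f') (\<lambda>n. ?q n * w' n)"
  proof (rule ccontr)
    assume nn: "\<not> null Q S (cn ?P R f') (\<lambda>n. ?q n * w' n)"
    obtain t where t: "t \<in> CM Q (cn ?P R f') (stalk X)" "null Q S (stalk X) (\<lambda>n. t n * (?q n * w' n) - w n)"
      by (rule factors[OF proj_cn[OF P Rp f'(1)] CM_comp[OF q w'(1)] nn])
    note tq = CM_comp[OF t(1) q]
    have 0: "t 0 * ?q 0 \<in> Hm Q (ob R 0) X" using CM_D(1)[OF tq, of 0] by (simp add: ob_stalk)
    moreover have "t 0 * ?q 0 * D R (- 1) = 0" using CM_D(2)[OF tq, of "- 1"] by simp
    ultimately obtain F where F: "F \<in> Hm Q X X" "F * e 0 = t 0 * ?q 0" by (rule resolution_factor[OF Rb mX R(2,3)])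
    \<comment> \<open>Homotopic maps between modules are equal.\<close>
    have stalk0: "k 0 = 0" if "null Q ?P (stalk X) k" for k using that by (auto simp: null_def)
    have ef: "e 0 * f' 0 = f" using stalk0[OF f'(2)] by (simp add: st_def)
    have "t 0 * (?q 0 * f' 0) = 0" by (rule stalk0[OF null_left[OF t(1) null_cone_left[OF Pb Rb f'(1)]]])
    then have Ff: "F * f = 0" by (simp add: ef[symmetric] mult.assoc[symmetric] F(2))
    have wn: "w n = 0" if "n \<noteq> 0" for n using CM_D(1)[OF w, of n] that by (simp add: ob_stalk Hm_zero_right)
    have Fe: "st F n * e n = t n * ?q n" for n
      using F(2) CM_D(1)[OF tq, of n] by (cases "n = 0") (simp_all add: st_def ob_stalk Hm_zero_right)
    have "null Q S (stalk X) (\<lambda>n. st F n * (e n * w' n - w n))" by (rule null_left[OF CM_stalk[OF F(1)] w'(2)])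
    then have "null Q S (stalk X) (\<lambda>n. t n * (?q n * w' n) - st F n * w n)"
      by (simp add: right_diff_distrib mult.assoc[symmetric] Fe)
    then have wF: "null Q S (stalk X) (\<lambda>n. w n - st F n * w n)" by (rule null_trans[OF null_sym[OF t(2)]])
    obtain G where G: "G \<in> Hm Q X X" "G * F = idm X \<or> G * (idm X - F) = idm X" using local_endomorphisms[OF X F(1)] by blast
    from G(2) show False
    proof
      assume "G * F = idm X"
      then have "f = G * F * f" using HmD(3)[OF f(1)] by simp
      then show False using Ff f(2) by (simp add: mult.assoc)
    next
      assume GF: "G * (idm X - F) = idm X"
      have "null Q S (stalk X) (\<lambda>n. st G n * (w n - st F n * w n))" by (rule null_left[OF CM_stalk[OF G(1)] wF])
      moreover have "st G n * (w n - st F n * w n) = w n" for n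
      proof (cases "n = 0")
        case True
        have w0: "idm X * w 0 = w 0" using HmD(3)[OF CM_D(1)[OF w, of 0]] by (simp add: ob_stalk)
        have "G * (w 0 - F * w 0) = G * (idm X - F) * w 0" by (simp add: mult.assoc left_diff_distrib w0)
        then show ?thesis using True by (simp add: st_def GF w0)
      qed (simp add: wn)
      ultimately show False using w_nz by simp
    qed
  qed
  then obtain h where h: "h \<in> CM Q S ?P" "null Q S R (\<lambda>n. f' n * h n - w' n)" by (rule weak_kernel[OF Pb Rb Sb f'(1) w'(1)])
  have 1: "null Q S (stalk X) (\<lambda>n. st f n * h n - e n * (f' n * h n))"
    using null_right[OF null_sym[OF f'(2)] h(1)] by (simp add: left_diff_distrib mult.assoc)
  have 2: "null Q S (stalk X) (\<lambda>n. e n * (f' n * h n) - e n * w' n)"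
    using null_left[OF eC h(2)] by (simp add: right_diff_distrib)
  show ?thesis by (rule that[OF h(1) null_trans[OF 1 null_trans[OF 2 w'(2)]]])
qed

text \<open>
  The complex of homomorphisms from \<open>S\<close> to the projective at \<open>j\<close>, with
  its cocycles and its coboundaries.
\<close>

abbreviation L :: "'n \<Rightarrow> int \<Rightarrow> 'k lin_op set" where "L j n \<equiv> Hm Q (ob S n) (proj_mod Q j)"
abbreviation Z :: "'n \<Rightarrow> int \<Rightarrow> 'k lin_op set" where "Z j n \<equiv> {a \<in> L j n. a * D S (n - 1) = 0}"
abbreviation Bd :: "'n \<Rightarrow> int \<Rightarrow> 'k lin_op set" where "Bd j n \<equiv> (\<lambda>b. b * D S n) ` L j (n + 1)"

lemma Bd_Z: "Bd j n \<subseteq> Z j n"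
  using Hm_comp[OF _ cpxD(2)[OF Sb, of n]] cpxD(5)[OF Sb, of n] by (auto simp: mult.assoc)

lemma factors_at:
  assumes a: "a \<in> Z j n" "a \<notin> Bd j n"
  shows "n = 0" "\<exists>t\<in>Hm Q (proj_mod Q j) X. \<exists>k\<in>Hm Q (ob S 1) X. t * a - w 0 = k * D S 0"
proof -
  let ?h = "\<lambda>m. if m = n then a else 0"
  have h: "?h \<in> CM Q S (stalk_at n (proj_mod Q j))" by (rule CM_atI) (use a in auto)
  have "\<not> null Q S (stalk_at n (proj_mod Q j)) ?h" using a(2) by (simp add: null_at[OF h])
  then obtain t where t: "t \<in> CM Q (stalk_at n (proj_mod Q j)) (stalk X)" "null Q S (stalk X) (\<lambda>m. t m * ?h m - w m)"
    by (rule factors[OF proj_at[OF exproj_proj[OF Q]] h])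
  show n: "n = 0"
  proof (rule ccontr)
    assume "n \<noteq> 0"
    then have "t m = 0" for m using CM_D(1)[OF t(1), of m] by (cases "m = n") (auto simp: ob_stalk ob_at Hm_zero_left Hm_zero_right)
    then show False using null_minus[OF t(2)] w_nz by simp
  qed
  have "t 0 \<in> Hm Q (proj_mod Q j) X" using CM_D(1)[OF t(1), of 0] n by (simp add: ob_stalk ob_at)
  moreover have "(\<lambda>m. t m * ?h m - w m) \<in> CM Q S (stalk_at 0 X)" unfolding at_zero by (rule CM_closed(3)[OF CM_comp[OF t(1) h] w])
  from null_at[OF this] t(2) n have "t 0 * a - w 0 \<in> (\<lambda>b. b * D S 0) ` Hm Q (ob S 1) X" by (simp add: at_zero)
  ultimately show "\<exists>t\<in>Hm Q (proj_mod Q j) X. \<exists>k\<in>Hm Q (ob S 1) X. t * a - w 0 = k * D S 0" by blast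
qed

text \<open>
  The pairing \<open>\<langle>z, y\<rangle> = \<phi> (y z)\<close> between cocycles in degree
  \<open>0\<close> and homomorphisms \<open>y : P\<^sub>j \<rightarrow> X\<close>, where
  \<open>\<phi>\<close> vanishes on null-homotopic maps and takes the value \<open>1\<close> on
  \<open>w\<close>. Its left kernel consists of the coboundaries by \<open>factors_at\<close>,
  and its right kernel is zero by \<open>factors_from\<close>.
\<close>

lemma dim_cocycles: "scl.dim (Z j n) = scl.dim (Bd j n) + (if n = 0 then scl.dim (Hm Q (proj_mod Q j) X) else 0)"
proof (cases "n = 0")
  case False
  then have "Z j n = Bd j n" using factors_at(1)[of _ n j] Bd_Z[of n j] by blast
  then show ?thesis using False by simp
next
  case True
  let ?N = "(\<lambda>k. k * D S 0) ` Hm Q (ob S 1) X" and ?P = "proj_mod Q j :: ('n, 'k) rmod"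
  have wz: "w \<in> CM Q S (stalk_at 0 X)" using w by (simp add: at_zero)
  have "w 0 \<notin> ?N" using null_at[OF wz] w_nz by (simp add: at_zero)
  then obtain \<phi> :: "'k lin_op \<Rightarrow> 'k" where p: "\<And>x y. \<phi> (x + y) = \<phi> x + \<phi> y" "\<And>c x. \<phi> (scl c x) = c * \<phi> x" "\<And>x. x \<in> ?N \<Longrightarrow> \<phi> x = 0" "\<phi> (w 0) = 1"
    by (rule separating_functional[OF subspace_image[OF subspace_Hm lin_right]]) blast
  have p1: "\<phi> a = 1" if "a - w 0 \<in> ?N" for a using p(1)[of "a - w 0" "w 0"] p(3)[OF that] p(4) by simp
  have Zs: "scl.subspace (Z j 0)" "Z j 0 \<subseteq> bd (mdim ?P) (cdim S 0)"
    by (rule subspace_kernel[OF subspace_Hm lin_right]) (auto dest: HmD(1))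
  have YB: "Hm Q ?P X \<subseteq> bd (mdim X) (mdim ?P)" by (auto dest: HmD(1))
  have "scl.dim (Z j 0) = scl.dim {z \<in> Z j 0. \<forall>y\<in>Hm Q ?P X. \<phi> (y * z) = 0} + scl.dim (Hm Q ?P X)"
  proof (rule pairing_dim[where \<beta> = "\<lambda>z y. \<phi> (y * z)", OF _ _ _ _ Zs subspace_Hm YB])
    fix y assume y: "y \<in> Hm Q ?P X" and z: "\<And>z. z \<in> Z j 0 \<Longrightarrow> \<phi> (y * z) = 0"
    show "y = 0"
    proof (rule ccontr)
      assume "y \<noteq> 0"
      then obtain h where h: "h \<in> CM Q S (stalk ?P)" "null Q S (stalk X) (\<lambda>n. st y n * h n - w n)" by (rule factors_from[OF y])
      have hz: "h \<in> CM Q S (stalk_at 0 ?P)" using h(1) by (simp add: at_zero)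
      have "(\<lambda>n. st y n * h n - w n) \<in> CM Q S (stalk_at 0 X)"
        unfolding at_zero by (rule CM_closed(3)[OF CM_comp[OF CM_stalk[OF y] h(1)] w])
      from null_at[OF this] h(2) have "y * h 0 - w 0 \<in> ?N" by (simp add: at_zero st_def)
      from p1[OF this] z[of "h 0"] CM_at(2,3)[OF hz] show False by simp
    qed
  qed (simp_all add: p distrib_left distrib_right scl_mult_left scl_mult_right)
  also have "{z \<in> Z j 0. \<forall>y\<in>Hm Q ?P X. \<phi> (y * z) = 0} = Bd j 0"
  proof (intro equalityI subsetI)
    fix z assume "z \<in> {z \<in> Z j 0. \<forall>y\<in>Hm Q ?P X. \<phi> (y * z) = 0}"
    then have z: "z \<in> Z j 0" "\<And>y. y \<in> Hm Q ?P X \<Longrightarrow> \<phi> (y * z) = 0" by auto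
    show "z \<in> Bd j 0"
    proof (rule ccontr)
      assume "z \<notin> Bd j 0"
      from factors_at(2)[OF z(1) this] obtain t where "t \<in> Hm Q ?P X" "t * z - w 0 \<in> ?N" by blast
      then show False using p1[of "t * z"] z(2) by simp
    qed
  next
    fix z assume z: "z \<in> Bd j 0"
    then obtain b where b: "b \<in> L j 1" "z = b * D S 0" by auto
    have "\<phi> (y * z) = 0" if "y \<in> Hm Q ?P X" for y
      by (rule p(3)) (use Hm_comp[OF that b(1)] in \<open>auto simp: b(2) mult.assoc[symmetric]\<close>)
    then show "z \<in> {z \<in> Z j 0. \<forall>y\<in>Hm Q ?P X. \<phi> (y * z) = 0}" using z Bd_Z[of 0 j] by auto
  qed
  finally show ?thesis using True by simp
qed

text \<open>
  The Euler characteristic of a complex is that of its cohomology, which is concentrated in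
  degree \<open>0\<close>.
\<close>

lemma hom_euler: "euler (\<lambda>M. int (scl.dim (Hm Q M (proj_mod Q j :: ('n, 'k) rmod)))) S = int (scl.dim (Hm Q (proj_mod Q j) X))"
proof -
  let ?x = "int (scl.dim (Hm Q (proj_mod Q j) X))" and ?b = "\<lambda>n. int (scl.dim (Bd j n))" and ?A = "{n. cdim S n \<noteq> 0}"
  have fin: "finite ?A" by (rule cpx_finite[OF Sb])
  have Ln: "scl.dim (L j n) = scl.dim (Bd j n) + scl.dim (Bd j (n - 1)) + (if n = 0 then scl.dim (Hm Q (proj_mod Q j) X) else 0)" for n
  proof -
    have "scl.dim (L j n) = scl.dim (Z j n) + scl.dim (Bd j (n - 1))"
    proof -
      have "L j n \<subseteq> bd (mdim (proj_mod Q j :: ('n, 'k) rmod)) (cdim S n)" by (auto dest: HmD(1))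
      from rank_nullity[OF lin_right[of "D S (n - 1)"] subspace_Hm this] show ?thesis by simp
    qed
    then show ?thesis by (simp add: dim_cocycles)
  qed
  then have L: "int (scl.dim (L j n)) = ?b n + ?b (n - 1) + (if n = 0 then ?x else 0)" for n by simp
  have L0: "scl.dim (L j n) = 0" if "cdim S n = 0" for n
    using additive_zero[OF additive_dim_hom that] by simp
  have "scl.dim (Bd j n) = 0" if "cdim S n = 0" for n using Ln[of n] L0[OF that] by simp
  moreover have "scl.dim (Bd j n) = 0" if "cdim S (n + 1) = 0" for n using Ln[of "n + 1"] L0[OF that] by simp
  ultimately have b0: "?b n = 0" if "n \<notin> ?A \<or> n + 1 \<notin> ?A" for n using that by auto
  have x0: "?x = 0" if "0 \<notin> ?A" using Ln[of 0] L0[of 0] that by simp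
  have "euler (\<lambda>M. int (scl.dim (Hm Q M (proj_mod Q j :: ('n, 'k) rmod)))) S = (\<Sum>n\<in>?A. sgp n * (?b n + ?b (n - 1) + (if n = 0 then ?x else 0)))"
    unfolding euler_def L ..
  also have "\<dots> = (\<Sum>n\<in>?A. sgp n * ?b n) + (\<Sum>n\<in>?A. sgp n * ?b (n - 1)) + (\<Sum>n\<in>?A. if n = 0 then ?x else 0)"
    by (simp add: distrib_left sum.distrib if_distrib[of "\<lambda>c. _ * c"] cong: if_cong)
  also have "(\<Sum>n\<in>?A. if n = 0 then ?x else 0) = ?x" using x0 fin by auto
  also have "(\<Sum>n\<in>?A. sgp n * ?b (n - 1)) = (\<Sum>m\<in>(\<lambda>n. n - 1) ` ?A. sgp (m + 1) * ?b m)"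
    by (subst sum.reindex) (auto simp: inj_on_def)
  also have "\<dots> = (\<Sum>m\<in>?A. sgp (m + 1) * ?b m)"
    by (rule sum.mono_neutral_cong) (use fin b0 in \<open>force+\<close>)
  finally show ?thesis by (simp add: sum_negf)
qed

lemma almost_vanishing_class:
  assumes "perf Q S g"
  shows "(\<Sum>i\<in>UNIV. g i * int (npaths Q i j)) = int (scl.dim (Hm Q (proj_mod Q j) X))"
  using perf_euler[OF assms Q additive_dim_hom, of "proj_mod Q j"] hom_euler[of j] by (simp add: dim_hom_proj_proj[OF Q])

end

section \<open>Auslander-Reiten triangles\<close>

context acyclic
begin

text \<open>
  Consecutive morphisms of a distinguished triangle compose to zero. On the standard triangle
  this is an identity of matrices; it is carried over along the isomorphism of triangles, whose
  first component occurs shifted and has to be undone.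
\<close>

lemma triangle_kills:
  assumes tri: "distinguished (Db Q) X Y Z u v w" and C: "proj_cpx Q C" and r: "r \<in> CM Q C Y"
    and z: "acts Y Z v C r z" and x: "acts Z (shift X) w C z x"
  shows "null Q C (shift X) x"
proof -
  have b: "bounded_cpx Q X" "bounded_cpx Q Y" "bounded_cpx Q Z" and v: "v \<in> Mor (Db Q) Y Z" and w: "w \<in> Mor (Db Q) Z (shift X)"
    using tri by (simp_all add: distinguished_def Db_simps)
  obtain X' Y' Z' u' v' w' \<alpha> \<beta> \<gamma> where std: "(X', Y', Z', u', v', w') \<in> Std (Db Q)"
    and iso: "is_iso (Db Q) X X' \<alpha>" "is_iso (Db Q) Y Y' \<beta>" "is_iso (Db Q) Z Z' \<gamma>"
    and c1: "Cmp (Db Q) Y Z Z' \<gamma> v = Cmp (Db Q) Y Y' Z' v' \<beta>"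
    and c2: "Cmp (Db Q) Z (shift X) (shift X') (ShM (Db Q) X X' \<alpha>) w = Cmp (Db Q) Z Z' (shift X') w' \<gamma>"
    using tri by (auto simp: distinguished_def Db_simps(6))
  obtain f where X': "bounded_cpx Q X'" and Y': "bounded_cpx Q Y'" and f: "f \<in> chain_map Q X' Y'" and Z': "Z' = cone X' Y' f"
    and v': "v' = Db_map Q Y' Z' (cone_in X' Y')" and w': "w' = Db_map Q Z' (shift X') (cone_out X' Y')"
    using std by (auto simp: Db_def)
  have Zb: "bounded_cpx Q Z'" unfolding Z' by (rule bounded_cone[OF X' Y' f])
  note ci = cone_in_map[OF X' Y' f, folded Z'] and co = cone_out_map[OF X' Y' f, folded Z']
  have sb: "bounded_cpx Q (shift X)" "bounded_cpx Q (shift X')" using b(1) X' by (simp_all add: bounded_shift)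
  have \<alpha>: "\<alpha> \<in> Mor (Db Q) X X'" and \<beta>: "\<beta> \<in> Mor (Db Q) Y Y'" and \<gamma>: "\<gamma> \<in> Mor (Db Q) Z Z'" using iso by (auto simp: is_iso_def)
  have vM: "v' \<in> Mor (Db Q) Y' Z'" and wM: "w' \<in> Mor (Db Q) Z' (shift X')"
    unfolding v' w' by (rule Db_map_Mor[OF Y' Zb ci] Db_map_Mor[OF Zb sb(2) co])+
  note S\<alpha> = ShM_Db(1)[OF \<alpha> b(1) X']
  note zC = acts_CM[OF z] and xC = acts_CM[OF x]
  obtain b1 where b1: "b1 \<in> CM Q C Y'" "acts Y Y' \<beta> C r b1" using acts_ex[OF \<beta> b(2) Y' C r] by blast
  obtain g1 where g1: "g1 \<in> CM Q C Z'" "acts Z Z' \<gamma> C z g1" using acts_ex[OF \<gamma> b(3) Zb C zC] by blast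
  obtain a1 where a1: "a1 \<in> CM Q C (shift X')" "acts (shift X) (shift X') (ShM (Db Q) X X' \<alpha>) C x a1"
    using acts_ex[OF S\<alpha> sb C xC] by blast
  have "acts Y Z' (Cmp (Db Q) Y Y' Z' v' \<beta>) C r (\<lambda>n. cb X' Y' n * b1 n)"
    using Cmp_Db(2)[OF \<beta> vM b(2) Y' Zb C r b1(2)] Db_map_acts[OF Y' Zb ci C b1(1)] by (simp add: v' emb_cone_in)
  then have n1: "null Q C Z' (\<lambda>n. g1 n - cb X' Y' n * b1 n)"
    using acts_unique[OF Cmp_Db(1)[OF v \<gamma> b(2,3) Zb] b(2) Zb C r r Cmp_Db(2)[OF v \<gamma> b(2,3) Zb C r z g1(2)] _ null_refl] c1 by simp
  have "acts Z (shift X') (Cmp (Db Q) Z Z' (shift X') w' \<gamma>) C z (\<lambda>n. cp X' Y' n * g1 n)"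
    using Cmp_Db(2)[OF \<gamma> wM b(3) Zb sb(2) C zC g1(2)] Db_map_acts[OF Zb sb(2) co C g1(1)] by (simp add: w' emb_cone_out)
  then have n2: "null Q C (shift X') (\<lambda>n. a1 n - cp X' Y' n * g1 n)"
    using acts_unique[OF Cmp_Db(1)[OF w S\<alpha> b(3) sb] b(3) sb(2) C zC zC Cmp_Db(2)[OF w S\<alpha> b(3) sb C zC x a1(2)] _ null_refl] c2 by simp
  have "null Q C (shift X') (\<lambda>n. cp X' Y' n * (g1 n - cb X' Y' n * b1 n))"
    by (rule null_left[OF _ n1]) (use cp_CM[OF X' Y' f] in \<open>simp add: Z'\<close>)
  then have "null Q C (shift X') (\<lambda>n. cp X' Y' n * g1 n)" by (simp add: right_diff_distrib pr_in_assoc)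
  from null_add[OF n2 this] have a0: "null Q C (shift X') a1" by simp
  \<comment> \<open>The shifted isomorphism reflects vanishing: unshift and apply the inverse.\<close>
  obtain \<alpha>' where \<alpha>': "\<alpha>' \<in> Mor (Db Q) X' X" "Cmp (Db Q) X X' X \<alpha>' \<alpha> = Ide (Db Q) X" using iso(1) by (auto simp: is_iso_def)
  let ?C = "ush C" and ?x = "\<lambda>n. x (n - 1)"
  have C': "proj_cpx Q ?C" by (rule proj_ush[OF C])
  have x': "?x \<in> CM Q ?C X" using CM_ush[OF xC] by (simp add: ush_shift)
  obtain y where y: "y \<in> CM Q ?C X'" "acts X X' \<alpha> ?C ?x y" using acts_ex[OF \<alpha> b(1) X' C' x'] by blast
  have "acts (shift X) (shift X') (ShM (Db Q) X X' \<alpha>) C x (\<lambda>n. y (n + 1))"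
    using ShM_Db(2)[OF \<alpha> b(1) X' C' x' y(2)] by (simp add: shift_ush)
  from null_add[OF acts_unique[OF S\<alpha> sb C xC xC this a1(2) null_refl] a0] have "null Q C (shift X') (\<lambda>n. y (n + 1))" by simp
  from null_ush[OF this] have y0: "null Q ?C X' (\<lambda>n. y n - y n * 0)" by (simp add: ush_shift)
  obtain z' where z': "z' \<in> CM Q ?C X" "acts X' X \<alpha>' ?C y z'" using acts_ex[OF \<alpha>'(1) X' b(1) C' y(1)] by blast
  have "acts X' X \<alpha>' ?C (\<lambda>n. y n * 0) (\<lambda>n. z' n * 0)" by (rule acts_natural[OF z'(2) CM_closed(1)])
  from acts_unique[OF \<alpha>'(1) X' b(1) C' y(1) CM_comp[OF y(1) CM_closed(1)] z'(2) this y0] have z0: "null Q ?C X z'" by simp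
  have "acts X X (Ide (Db Q) X) ?C ?x z'"
    using Cmp_Db(2)[OF \<alpha> \<alpha>'(1) b(1) X' b(1) C' x' y(2) z'(2)] by (simp add: \<alpha>'(2))
  from acts_unique[OF Ide_Mor[OF b(1)] b(1) b(1) C' x' x' Ide_acts[OF b(1) C' x'] this null_refl]
  have "null Q ?C X (\<lambda>n. ?x n - z' n)" .
  from null_add[OF this z0] have "null Q ?C X ?x" by simp
  from null_shift[OF this] show ?thesis by (simp add: shift_ush)
qed

text \<open>
  A map \<open>p\<close> from a complex of projectives to \<open>S\<close> induces a morphism to
  \<open>Z\<close>. If this is a retraction, its section lifts to the resolutions; otherwise it
  factors through \<open>v\<close>, and \<open>w v = 0\<close>.
\<close>

lemma AR_almost_vanishing:
  fixes X :: "('n, 'k::field_char_0) rmod"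
  assumes AR: "AR_triangle (Db Q) (stalk X) Y Z u v w" and X: "indecomposable_mod Q X"
    and R: "proj_cpx Q R" and e: "qis Q R Z e"
  shows "\<exists>\<omega>. almost_vanishing Q (ush R) X \<omega>"
proof -
  have tri: "distinguished (Db Q) (stalk X) Y Z u v w" and wz: "w \<noteq> Zer (Db Q) Z (shift (stalk X))"
    and ret: "\<And>W f. bounded_cpx Q W \<Longrightarrow> f \<in> Mor (Db Q) W Z \<Longrightarrow> \<not> retraction (Db Q) W Z f \<Longrightarrow> \<exists>f'\<in>Mor (Db Q) W Y. Cmp (Db Q) W Y Z v f' = f"
    using AR by (auto simp: AR_triangle_def Db_simps(1,6))
  have b: "bounded_cpx Q (stalk X)" "bounded_cpx Q Y" "bounded_cpx Q Z" and v: "v \<in> Mor (Db Q) Y Z" and w: "w \<in> Mor (Db Q) Z (shift (stalk X))"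
    using tri by (simp_all add: distinguished_def Db_simps)
  note sb = bounded_shift[OF b(1)] and eC = qis_CM[OF e] and Rb = proj_cpxD(1)[OF R]
  obtain t where t: "t \<in> CM Q R (shift (stalk X))" "acts Z (shift (stalk X)) w R e t" using acts_ex[OF w b(3) sb R eC] by blast
  let ?\<omega> = "\<lambda>n. t (n - 1)"
  have \<omega>: "?\<omega> \<in> CM Q (ush R) (stalk X)" using CM_ush[OF t(1)] by (simp add: ush_shift)
  have nz: "\<not> null Q (ush R) (stalk X) ?\<omega>"
  proof
    assume "null Q (ush R) (stalk X) ?\<omega>"
    from null_shift[OF this] have t0: "null Q R (shift (stalk X)) (\<lambda>n. t n - 0)" by (simp add: shift_ush)
    note z = chain_zero_map[OF b(3) sb]
    have "acts Z (shift (stalk X)) w R e (\<lambda>n. 0)" by (rule acts_cong[OF t(2) null_refl t0 CM_closed(1)])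
    moreover have "acts Z (shift (stalk X)) (Zer (Db Q) Z (shift (stalk X))) R e (\<lambda>n. 0)"
      using Db_map_acts[OF b(3) sb z R eC] by (simp add: Db_simps(3) emb_chain_zero)
    moreover have "Zer (Db Q) Z (shift (stalk X)) \<in> Mor (Db Q) Z (shift (stalk X))" by (simp add: Db_simps(3) Db_map_Mor[OF b(3) sb z])
    ultimately have "w = Zer (Db Q) Z (shift (stalk X))" by (intro Mor_eqI[OF w _ b(3) sb R e])
    then show False using wz by simp
  qed
  have "(\<exists>s\<in>CM Q (ush R) C. null Q (ush R) (ush R) (\<lambda>n. p n * s n - idm (ob (ush R) n))) \<or> null Q C (stalk X) (\<lambda>n. ?\<omega> n * p n)"
    if C: "proj_cpx Q C" and p: "p \<in> CM Q C (ush R)" for C p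
  proof -
    \<comment> \<open>Shifting replaces maps to \<open>S\<close> by maps to the resolution \<open>R\<close> of \<open>Z\<close>, on which the triangle acts.\<close>
    let ?C = "shift C" and ?p = "\<lambda>n. p (n + 1)"
    have C': "proj_cpx Q ?C" by (rule proj_shift[OF C])
    note Cb = proj_cpxD(1)[OF C']
    have p': "?p \<in> CM Q ?C R" using CM_shift[OF p] by (simp add: shift_ush)
    note ep = CM_comp[OF eC p']
    note m = mts_emb[OF Cb b(3) ep]
    let ?f = "Db_map Q ?C Z (mts ?C Z (\<lambda>n. e n * ?p n))"
    have f: "?f \<in> Mor (Db Q) ?C Z" by (rule Db_map_Mor[OF Cb b(3) m(1)])
    have fa: "acts ?C Z ?f D' r (\<lambda>n. e n * ?p n * r n)" if "proj_cpx Q D'" "r \<in> CM Q D' ?C" for D' r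
      using Db_map_acts[OF Cb b(3) m(1) that] by (simp add: m(2))
    show ?thesis
    proof (cases "retraction (Db Q) ?C Z ?f")
      case True
      then obtain s where s: "s \<in> Mor (Db Q) Z ?C" "Cmp (Db Q) Z ?C Z ?f s = Ide (Db Q) Z" by (auto simp: retraction_def)
      obtain y where y: "y \<in> CM Q R ?C" "acts Z ?C s R e y" using acts_ex[OF s(1) b(3) Cb R eC] by blast
      have "acts Z Z (Ide (Db Q) Z) R e (\<lambda>n. e n * ?p n * y n)"
        using Cmp_Db(2)[OF s(1) f b(3) Cb b(3) R eC y(2) fa[OF R y(1)]] by (simp add: s(2))
      from acts_unique[OF Ide_Mor[OF b(3)] b(3) b(3) R eC eC this Ide_acts[OF b(3) R eC] null_refl]
      have "null Q R Z (\<lambda>n. e n * (?p n * y n - idm (ob R n)))" by (simp add: right_diff_distrib mult.assoc CM_idm(2)[OF eC])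
      from lift_unique[OF R Rb b(3) e CM_closed(3)[OF CM_comp[OF p' y(1)] CM_id[OF Rb]] this]
      have "null Q (ush R) (ush R) (\<lambda>n. p n * y (n - 1) - idm (ob (ush R) n))" by (auto dest: null_ush)
      moreover have "(\<lambda>n. y (n - 1)) \<in> CM Q (ush R) C" using CM_ush[OF y(1)] by (simp add: ush_shift)
      ultimately show ?thesis by (intro disjI1 bexI)
    next
      case False
      then obtain f' where f': "f' \<in> Mor (Db Q) ?C Y" "Cmp (Db Q) ?C Y Z v f' = ?f" using ret[OF Cb f] by blast
      note i = CM_id[OF Cb]
      obtain y where y: "y \<in> CM Q ?C Y" "acts ?C Y f' ?C (\<lambda>n. idm (ob ?C n)) y" using acts_ex[OF f'(1) Cb b(2) C' i] by blast
      obtain z where z: "z \<in> CM Q ?C Z" "acts Y Z v ?C y z" using acts_ex[OF v b(2,3) C' y(1)] by blast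
      obtain x where x: "x \<in> CM Q ?C (shift (stalk X))" "acts Z (shift (stalk X)) w ?C z x" using acts_ex[OF w b(3) sb C' z(1)] by blast
      have "acts ?C Z ?f ?C (\<lambda>n. idm (ob ?C n)) z" using Cmp_Db(2)[OF f'(1) v Cb b(2,3) C' i y(2) z(2)] by (simp add: f'(2))
      moreover have "acts ?C Z ?f ?C (\<lambda>n. idm (ob ?C n)) (\<lambda>n. e n * ?p n)" using fa[OF C' i] CM_idm(2)[OF ep] by simp
      ultimately have "null Q ?C Z (\<lambda>n. e n * ?p n - z n)" by (intro acts_unique[OF f Cb b(3) C' i i _ _ null_refl])
      from acts_unique[OF w b(3) sb C' ep z(1) acts_natural[OF t(2) p'] x(2) this]
      have "null Q ?C (shift (stalk X)) (\<lambda>n. t n * ?p n - x n)" .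
      from null_add[OF this triangle_kills[OF tri C' y(1) z(2) x(2)]] have "null Q ?C (shift (stalk X)) (\<lambda>n. t n * ?p n)" by simp
      from null_ush[OF this] show ?thesis by (simp add: ush_shift)
    qed
  qed
  then show ?thesis
    using proj_ush[OF R] X \<omega> nz by (intro exI[of _ ?\<omega>]) (simp add: almost_vanishing_def almost_vanishing_axioms_def acyclic_axioms)
qed

text \<open>
  The sign comes from \<open>S\<close> being a desuspension of the resolution of
  \<open>Z\<close>.
\<close>

lemma AR_g_vector:
  fixes X :: "('n, 'k::field_char_0) rmod"
  assumes AR: "AR_triangle (Db Q) (stalk X) Y Z u v w" and X: "indecomposable_mod Q X"
  shows "(\<Sum>i\<in>UNIV. g_vector Q Z $ i * int (npaths Q i j)) = - (dim_vector Q (stalk X) $ j)"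
proof -
  have Z: "bounded_cpx Q Z" using AR by (simp add: AR_triangle_def distinguished_def Db_simps)
  have mX: "is_mod Q X" using X by (simp add: indecomposable_mod_def)
  obtain R g e where R: "perf Q R g" "proj_cpx Q R" "qis Q R Z e" "\<And>l. euler (tdim l) R = (euler (tdim l) Z :: 'k)"
    by (rule resolve[OF Z]) (blast intro: that)
  obtain \<omega> where "almost_vanishing Q (ush R) X \<omega>" using AR_almost_vanishing[OF AR X R(2,3)] by blast
  then have "(\<Sum>i\<in>UNIV. - g i * int (npaths Q i j)) = int (scl.dim (Hm Q (proj_mod Q j) X))"
    by (rule almost_vanishing.almost_vanishing_class[OF _ perf_ush[OF R(1)]])
  moreover have "of_int (int (scl.dim (Hm Q (proj_mod Q j) X))) = (of_int (dim_vector Q (stalk X) $ j) :: 'k)"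
    using dim_hom_from_proj[OF Q mX, of j] dim_vector_stalk[OF mX, of j] by simp
  then have "int (scl.dim (Hm Q (proj_mod Q j) X)) = dim_vector Q (stalk X) $ j" by (simp only: of_int_eq_iff)
  ultimately show ?thesis by (simp add: g_vector_eq[OF Z R(1,3,4)] sum_negf)
qed

lemma euler_sum_objs: "\<forall>Y\<in>set Xs. bounded_cpx Q Y \<Longrightarrow>
    bounded_cpx Q (sum_objs (Db Q) Xs) \<and> euler (tdim l) (sum_objs (Db Q) Xs) = (\<Sum>Y\<leftarrow>Xs. euler (tdim l) Y)"
proof (induction Xs)
  case Nil
  show ?case by (simp add: sum_objs_def Db_simps bounded_zero) (simp add: euler_def zero_cpx_def zero_mod_def)
next
  case (Cons Y Xs)
  let ?T = "sum_objs (Db Q) Xs"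
  have Y: "bounded_cpx Q Y" and T: "bounded_cpx Q ?T" and e: "euler (tdim l) ?T = (\<Sum>Y\<leftarrow>Xs. euler (tdim l) Y)" using Cons by auto
  have ob: "ob (sum_cpx Y ?T) n = sum_mod (ob Y n) (ob ?T n)" for n by (simp add: sum_cpx_def)
  let ?A = "{n. cdim Y n \<noteq> 0} \<union> {n. cdim ?T n \<noteq> 0}"
  have A: "finite ?A" using cpx_finite[OF Y] cpx_finite[OF T] by simp
  have D: "D (sum_cpx Y ?T) n = i1 (ob Y (n + 1)) (ob ?T (n + 1)) * D Y n * p1 (ob Y n) (ob ?T n) +
      i2 (ob Y (n + 1)) (ob ?T (n + 1)) * D ?T n * p2 (ob Y n) (ob ?T n)" for n
    using Y T by (simp add: sum_cpx_def) (subst emb_four_block, auto simp: bounded_cpx_def mod_hom_def)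
  have "bounded_cpx Q (sum_cpx Y ?T)"
  proof (rule cpxI)
    fix n
    note s = sum_mod_Hm[OF cpxD(1)[OF Y, of n] cpxD(1)[OF T, of n]] sum_mod_Hm[OF cpxD(1)[OF Y, of "n + 1"] cpxD(1)[OF T, of "n + 1"]]
    show "is_mod Q (ob (sum_cpx Y ?T) n)" by (simp add: ob is_mod_sum cpxD(1) Y T)
    show "diff (sum_cpx Y ?T) n \<in> carrier_mat (cdim (sum_cpx Y ?T) (n + 1)) (cdim (sum_cpx Y ?T) n)"
      using Y T by (auto simp: sum_cpx_def sum_mod_def bounded_cpx_def mod_hom_def)
    show "D (sum_cpx Y ?T) n \<in> Hm Q (ob (sum_cpx Y ?T) n) (ob (sum_cpx Y ?T) (n + 1))"
      unfolding D ob using s cpxD(2)[OF Y, of n] cpxD(2)[OF T, of n] by (auto intro!: Hm_closed Hm_comp)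
    have "D Y (n + 1) * (D Y n * h) = 0" "D ?T (n + 1) * (D ?T n * h) = 0" for h
      using cpxD(4)[OF Y, of n] cpxD(4)[OF T, of n] by (simp_all add: mult.assoc[symmetric])
    then show "D (sum_cpx Y ?T) (n + 1) * D (sum_cpx Y ?T) n = 0"
      using HmD(3)[OF cpxD(2)[OF Y, of n]] HmD(3)[OF cpxD(2)[OF T, of n]]
      by (simp add: D distrib_left distrib_right mult.assoc pr_in_assoc en_assoc[OF cpxD(2)[OF Y, of n]] en_assoc[OF cpxD(2)[OF T, of n]])
  next
    show "finite {n. cdim (sum_cpx Y ?T) n \<noteq> 0}" by (rule finite_subset[OF _ A]) (auto simp: ob sum_mod_def)
  qed
  moreover have "euler (tdim l) (sum_cpx Y ?T) = euler (tdim l) Y + euler (tdim l) ?T"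
  proof -
    have "euler (tdim l) (sum_cpx Y ?T) = (\<Sum>n\<in>?A. sgp n * tdim l (ob (sum_cpx Y ?T) n))"
      by (rule euler_eq[OF additive_tdim[of Q] A]) (auto simp: ob sum_mod_def)
    also have "\<dots> = (\<Sum>n\<in>?A. sgp n * tdim l (ob Y n)) + (\<Sum>n\<in>?A. sgp n * tdim l (ob ?T n))"
      by (simp add: ob tdim_sum[OF cpxD(1)[OF Y] cpxD(1)[OF T]] distrib_left sum.distrib)
    finally show ?thesis using euler_eq[OF additive_tdim[of Q] A, of Y] euler_eq[OF additive_tdim[of Q] A, of ?T] by simp
  qed
  moreover have "sum_objs (Db Q) (Y # Xs) = sum_cpx Y ?T" by (simp add: sum_objs_def Db_simps)
  ultimately show ?case by (simp add: e)
qed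

text \<open>
  The transposed form of \<open>paths_inverse\<close>, based on last arrows.
\<close>

lemma paths_inverse_last:
  fixes h x :: "'n \<Rightarrow> int"
  assumes "\<And>j. (\<Sum>i\<in>UNIV. h i * int (npaths Q i j)) = x j"
  shows "h s = x s - (\<Sum>t\<in>UNIV. int (Q t s) * x t)"
proof -
  have "(\<Sum>t\<in>UNIV. int (Q t s) * x t) = (\<Sum>i\<in>UNIV. h i * (\<Sum>t\<in>UNIV. int (Q t s) * int (npaths Q i t)))"
    unfolding assms[symmetric] sum_distrib_left by (subst sum.swap) (simp add: ac_simps)
  moreover have "x s = (\<Sum>i\<in>UNIV. h i * int (npaths Q i s))" by (simp add: assms)
  moreover have "int (npaths Q i s) = (if s = i then 1 else 0) + (\<Sum>t\<in>UNIV. int (Q t s) * int (npaths Q i t))" for i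
    by (subst npaths_last[OF Q]) simp
  ultimately show ?thesis by (simp add: distrib_left sum.distrib if_distrib[of "\<lambda>c. _ * c"] cong: if_cong)
qed

theorem mesh_g_vectors:
  fixes X :: "('n, 'k::field_char_0) rmod"
  assumes X: "indecomposable_mod Q X" and mesh: "is_mesh (Db Q) (stalk X) Xs"
  shows "(\<Sum>Y\<leftarrow>Xs. g_vector Q Y) $ s = (\<Sum>t\<in>UNIV. (int (Q t s) - int (Q s t)) * dim_vector Q (stalk X) $ t)"
proof -
  note T = Db_triangles[where 'k = 'k]
  have mX: "is_mod Q X" using X by (simp add: indecomposable_mod_def)
  have Xs: "\<forall>Y\<in>set Xs. bounded_cpx Q Y" using mesh by (auto simp: is_mesh_def indecomposable_def Db_simps)
  obtain Z u v w where AR: "AR_triangle (Db Q) (stalk X) (sum_objs (Db Q) Xs) Z u v w" using mesh by (auto simp: is_mesh_def)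
  have tri: "distinguished (Db Q) (stalk X) (sum_objs (Db Q) Xs) Z u v w" using AR by (simp add: AR_triangle_def)
  have Z: "bounded_cpx Q Z" using tri by (simp add: distinguished_def Db_simps)
  let ?G = "\<Sum>Y\<leftarrow>Xs. g_vector Q Y" and ?gX = "g_vector Q (stalk X)" and ?gZ = "g_vector Q Z" and ?x = "dim_vector Q (stalk X)"
  let ?p = "\<lambda>g :: int ^ 'n. \<lambda>l. \<Sum>i\<in>UNIV. g $ i * int (npaths Q l i)"
  have padd: "?p (g + h) l = ?p g l + ?p h l" for g h l by (simp add: distrib_right sum.distrib)
  have "of_int (?p ?G l) = (of_int (?p ?gX l + ?p ?gZ l) :: 'k)" for l
  proof -
    have "of_int (?p ?G l) = (\<Sum>Y\<leftarrow>Xs. euler (tdim l) Y :: 'k)" using Xs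
    proof (induction Xs)
      case (Cons Y Ys)
      then have Y: "bounded_cpx Q Y" by simp
      show ?case unfolding list.map sum_list.Cons padd of_int_add g_vector_euler[OF Y] using Cons by simp
    qed simp
    also have "\<dots> = euler (tdim l) (stalk X) + euler (tdim l) Z"
      using chain_triangles.distinguished_euler[OF T tri, of l] euler_sum_objs[OF Xs, of l] by simp
    finally show ?thesis by (simp only: of_int_add g_vector_euler[OF Z] g_vector_euler[OF bounded_stalk[OF mX]])
  qed
  then have pG: "?p ?G l = ?p ?gX l + ?p ?gZ l" for l by (simp only: of_int_eq_iff)
  have pX: "?p ?gX l = ?x $ l" for l
  proof -
    have "of_int (?p ?gX l) = (of_int (?x $ l) :: 'k)"
      by (simp only: g_vector_euler[OF bounded_stalk[OF mX]] dim_vector_stalk[OF mX] euler_stalk[OF additive_tdim[of Q]])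
    then show ?thesis by (simp only: of_int_eq_iff)
  qed
  have "?G $ s = ?p ?G s - (\<Sum>t\<in>UNIV. int (Q s t) * ?p ?G t)" by (rule paths_inverse) simp
  also have "\<dots> = (?p ?gX s - (\<Sum>t\<in>UNIV. int (Q s t) * ?p ?gX t)) + (?p ?gZ s - (\<Sum>t\<in>UNIV. int (Q s t) * ?p ?gZ t))"
    by (simp add: pG distrib_left sum.distrib)
  also have "?p ?gZ s - (\<Sum>t\<in>UNIV. int (Q s t) * ?p ?gZ t) = ?gZ $ s" by (rule paths_inverse[symmetric]) simp
  also have "?gZ $ s = - ?x $ s - (\<Sum>t\<in>UNIV. int (Q t s) * - ?x $ t)"
    by (rule paths_inverse_last[of "\<lambda>i. ?gZ $ i" "\<lambda>j. - ?x $ j"]) (simp add: AR_g_vector[OF AR X])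
  finally show ?thesis by (simp add: pX left_diff_distrib sum_subtractf sum_negf)
qed

end

theorem corollary5p7:
  fixes \<omega> :: "int ^ ('n::finite) \<Rightarrow> int ^ 'n \<Rightarrow> int"
    and e :: "'n \<Rightarrow> int ^ 'n"
    and B :: "int ^ 'n ^ 'n"
    and Q :: "'n quiver"
    and s' :: "'n list"
    and i :: 'n
    and c :: "int ^ 'n"
    and X :: "('n, 'k :: {alg_closed_field, field_char_0}) rmod"
    and Xs :: "('n, 'k) cpx list"
  assumes "skew_form \<omega>"
    and "is_seed e"
    and "B = exchange_matrix \<omega> e"
    and "Q = quiver_of B"
    and "acyclic_quiver Q"
    and "s' \<in> tree_vertices"
    and "c = c_vector (- transpose B) s' i"
    and "positive_vector c"
    and "indecomposable_mod Q X"
    and "rigid_mod Q X"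
    and "c = dim_vector Q (stalk X)"
    and "is_mesh (Db Q) (stalk X) Xs"
  shows "normal_to e (\<Sum>Y\<leftarrow>Xs. g_vector Q Y) (c_hyperplane e B c)"
proof -
  interpret acyclic Q by unfold_locales (rule assms(5))
  have "int (Q t s) - int (Q s t) = B $ t $ s" for s t
  proof -
    have "\<omega> (e t) (e s) = - \<omega> (e s) (e t)" using assms(1) unfolding skew_form_def by blast
    then have skew: "B $ s $ t = - (B $ t $ s)" by (simp add: assms(3) exchange_matrix_def)
    have "int (nat x) - int (nat (- x)) = x" for x by simp
    then show ?thesis unfolding assms(4) quiver_of_def skew .
  qed
  then have "(\<Sum>Y\<leftarrow>Xs. g_vector Q Y) $ s = (c v* B) $ s" for s
    by (simp only: mesh_g_vectors[OF assms(9,12)] assms(11)[symmetric] vector_matrix_mult_def vec_lambda_beta)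
      (rule sum.cong[OF refl mult.commute])
  then have "(\<Sum>Y\<leftarrow>Xs. g_vector Q Y) = c v* B" by (simp add: Finite_Cartesian_Product.vec_eq_iff)
  then show ?thesis by (simp add: normal_to_def c_hyperplane_def)
qed

end
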